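(* Let $1<p<\infty$ and $m\in\mathbb N$. Let $T$ be a sublinear operator and $b\in L^1_{\rm loc}(\mathbb R^n)$. Suppose that for all $1<r<2<s<\infty$ both $T$ and $\mathcal M^{\#}_{T,s}$ are locally weak $L^r$-bounded and $$\varphi_{T,r}(\lambda_{m,n})+\varphi_{\mathcal M^{\#}_{T,s},r}(\lambda_{m,n})\le\psi(r',s),$$ where $\lambda_{m,n}\in(0,1)$ is the constant (depending only on $m,n$) of the sparse domination principle recalled in the context and $\psi:[1,\infty)^2\to[1,\infty)$ is non-decreasing in both variables. Let $\mu,\lambda\in A_p$ and define the Bloom weight $\nu:=(\mu/\lambda)^{\frac1{pm}}$. Then $$\|T_b^m\|_{L^p(\mu)\to L^p(\lambda)}\lesssim K_p(\mu,\lambda)\,C_{p,\psi}(\mu,\lambda)\,\|b\|_{\mathrm{BMO}_\nu}^m,$$ with implicit constant depending only on $p,n,m$, where one can take $$K_p(\mu,\lambda)=\big([\mu]_{A_p}[\lambda]_{A_p}\big)^{\frac{m+1}2\max(1,\frac1{p-1})}\qquad\text{for any }m\ge1,$$ and, if $m\ge2$, alternatively also $$K_p(\mu,\lambda)=[\mu]_{A_p}^{\frac m{p-1}}[\lambda]_{A_p}^{\max(1,\frac1{p-1})}+[\mu]_{A_p}^{\max(1,\frac1{p-1})}[\lambda]_{A_p}^m,$$ and where, for some constant $c_{p,n,m}\ge1$ depending only on $p,n,m$, $$C_{p,\psi}(\mu,\lambda):=\psi\Big(c_{p,n,m}\max([\mu]_{A_p},[\lambda]_{A_p})^{\frac1{p-1}},\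 c_{p,n,m}\max([\mu]_{A_p},[\lambda]_{A_p})\Big).$$
   Context: Cubes in $\mathbb R^n$ have sides parallel to the axes; $3Q$ is the cube concentric with $Q$ with three times its side length; $\langle h\rangle_Q:=\frac1{|Q|}\int_Qh$ and, for $h\ge0$, $\langle h\rangle_{t,Q}:=\langle h^t\rangle_Q^{1/t}$. Primes denote H\"older conjugates. A weight is a non-negative (a.e. positive) locally integrable function; $w\in A_p$ iff $[w]_{A_p}:=\sup_Q\langle w\rangle_{1,Q}\langle w^{-1}\rangle_{\frac1{p-1},Q}<\infty$. $\|b\|_{\mathrm{BMO}_\nu}:=\sup_Q\frac1{\nu(Q)}\int_Q|b-\langle b\rangle_Q|$ with $\nu(Q):=\int_Q\nu$. Sublinear means $|T(f+g)|\le|Tf|+|Tg|$ and $|T(cf)|=|c||Tf|$; $T$ is assumed to be defined on all functions to which it is applied. $T_b^mf(x):=T\big((b(x)-b(\cdot))^mf\big)(x)$, and $\|T_b^m\|_{L^p(\mu)\to L^p(\lambda)}$ is the best constant in $\|T_b^mf\|_{L^p(\lambda)}\le C\|f\|_{L^p(\mu)}$ for bounded compactly supported $f$. For $1\le s\le\infty$, $$\mathcal M^{\#}_{T,s}f(x):=\sup_{Q\ni x}\Big(\frac1{|Q|^2}\int_{Q\times Q}\big|T(f\chi_{\mathbb R^n\setminus3Q})(x')-T(f\chi_{\mathbb R^n\setminus3Q})(x'')\big|^s\,dx'\,dx''\Big)^{1/s}$$ (essential supremum if $s=\infty$). An operator $T$ is locally weak $L^r$-bounded ($r\in[1,\infty)$)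 if there is a non-increasing function $\varphi_{T,r}:(0,1)\to[0,\infty)$ such that for every cube $Q$ and $f\in L^r(Q)$, $|\{x\in Q:|T(f\chi_Q)(x)|>\varphi_{T,r}(\lambda)\langle|f|\rangle_{r,Q}\}|\le\lambda|Q|$ for all $\lambda\in(0,1)$. The constant $\lambda_{m,n}$: fix constants $C_{m,n}>1$ and $\lambda_{m,n}\in(0,1)$, depending only on $m,n$, for which the following sparse domination principle holds (such constants exist): whenever $1\le r<s\le\infty$ and $T$ is sublinear with $T$ and $\mathcal M^{\#}_{T,s}$ locally weak $L^r$-bounded, then for all bounded compactly supported $f,g$ and $b\in L^1_{\rm loc}(\mathbb R^n)$ there is a $\frac1{2\cdot3^n}$-sparse collection of cubes $\mathcal S$ with $$\int|T_b^mf||g|\le C_{m,n}\big(\varphi_{T,r}(\lambda_{m,n})+\varphi_{\mathcal M^{\#}_{T,s},r}(\lambda_{m,n})\big)\sum_{Q\in\mathcal S}\Big(\big\langle|b-\langle b\rangle_Q|^m|f|\big\rangle_{r,Q}\langle|g|\rangle_{s',Q}+\langle|f|\rangle_{r,Q}\big\langle|b-\langle b\rangle_Q|^m|g|\big\rangle_{s',Q}\Big)|Q|.$$ Here $\mathcal S$ is $\eta$-sparse if for every $Q\in\mathcal S$ there is $E_Q\subseteq Q$ with $|E_Q|\ge\eta|Q|$ and the $E_Q$ are pairwise disjoint. *)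

theory Defs
  imports "HOL-Analysis.Analysis" "HOL-Probability.Essential_Supremum"
begin

text \<open>
  Functions are \<open>'k\<close>-valued, where \<open>'k :: {real_normed_field, euclidean_space}\<close> stands for
  the real or the complex scalars.  Averages, norms and suprema of non-negative
  quantities are taken in \<^typ>\<open>ennreal\<close>, so that they always exist.
\<close>

definition epowr :: "ennreal \<Rightarrow> real \<Rightarrow> ennreal" where
  "epowr x a = (if x = \<infinity> then \<infinity> else ennreal (enn2real x powr a))"
  \<comment> \<open>only used with \<open>a > 0\<close>\<close>

section \<open>Cubes, averages and weights\<close>

definition cube :: "real^'n \<Rightarrow> real \<Rightarrow> (real^'n) set" where
  "cube c a = cbox (c - vec (a / 2)) (c + vec (a / 2))"
  \<comment> \<open>centre \<open>c\<close>, side length \<open>a\<close>; the concentric triple is \<open>cube c (3 * a)\<close>\<close>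

definition cubes :: "(real^'n) set set" where
  "cubes = {cube c a | c a. a > 0}"

definition restr :: "(real^'n) set \<Rightarrow> (real^'n \<Rightarrow> 'k::real_vector) \<Rightarrow> real^'n \<Rightarrow> 'k" where
  "restr A f = (\<lambda>x. indicator A x *\<^sub>R f x)"

definition mean :: "(real^'n) set \<Rightarrow> (real^'n \<Rightarrow> 'k::euclidean_space) \<Rightarrow> 'k" where
  "mean Q h = (LINT x:Q|lebesgue. h x) /\<^sub>R measure lebesgue Q"

text \<open>\<open>avg t Q h\<close> is \<open>\<langle>h\<rangle>\<close> with subscripts \<open>t, Q\<close>, for \<open>h \<ge> 0\<close>.\<close>

definition avg :: "real \<Rightarrow> (real^'n) set \<Rightarrow> (real^'n \<Rightarrow> real) \<Rightarrow> ennreal" where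
  "avg t Q h = epowr ((\<integral>\<^sup>+x\<in>Q. ennreal (h x powr t) \<partial>lebesgue) / emeasure lebesgue Q) (1 / t)"

definition locally_integrable :: "(real^'n \<Rightarrow> 'k::euclidean_space) \<Rightarrow> bool" where
  "locally_integrable f \<longleftrightarrow> (\<forall>K. compact K \<longrightarrow> f absolutely_integrable_on K)"

definition weight :: "(real^'n \<Rightarrow> real) \<Rightarrow> bool" where
  "weight w \<longleftrightarrow> locally_integrable w \<and> (\<forall>x. 0 \<le> w x) \<and> (AE x in lebesgue. 0 < w x)"

definition Ap_char :: "real \<Rightarrow> (real^'n \<Rightarrow> real) \<Rightarrow> ennreal" where
  "Ap_char p w = (SUP Q\<in>cubes. avg 1 Q w * avg (1 / (p - 1)) Q (\<lambda>x. inverse (w x)))"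

definition Ap :: "real \<Rightarrow> (real^'n \<Rightarrow> real) set" where
  "Ap p = {w. weight w \<and> Ap_char p w < \<infinity>}"

definition bmo_norm :: "(real^'n \<Rightarrow> real) \<Rightarrow> (real^'n \<Rightarrow> 'k::euclidean_space) \<Rightarrow> ennreal" where
  "bmo_norm \<nu> b = (SUP Q\<in>cubes.
     (\<integral>\<^sup>+x\<in>Q. ennreal (norm (b x - mean Q b)) \<partial>lebesgue) / (\<integral>\<^sup>+x\<in>Q. ennreal (\<nu> x) \<partial>lebesgue))"

definition bounded_compact_support :: "(real^'n \<Rightarrow> 'k::euclidean_space) \<Rightarrow> bool" where
  "bounded_compact_support f \<longleftrightarrow>
     f \<in> borel_measurable lebesgue \<and> bounded (range f) \<and> compact (closure {x. f x \<noteq> 0})"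

definition weighted_norm :: "real \<Rightarrow> (real^'n \<Rightarrow> real) \<Rightarrow> (real^'n \<Rightarrow> 'k::real_normed_vector) \<Rightarrow> ennreal" where
  "weighted_norm p w f = epowr (\<integral>\<^sup>+x. ennreal (norm (f x) powr p * w x) \<partial>lebesgue) (1 / p)"

section \<open>Sublinear operators and their commutators\<close>

text \<open>
  An operator comes with an explicit domain \<open>D\<close>, a set of functions closed under sums and scalar
  multiples.  Sublinearity holds pointwise, for all \<open>x\<close> and not just almost all: in the
  commutator below the argument of \<open>T\<close> changes with the evaluation point \<open>x\<close>.
\<close>

definition sublinear_operator ::
  "(real^'n \<Rightarrow> 'k) set \<Rightarrow> ((real^'n \<Rightarrow> 'k::{real_normed_field, euclidean_space}) \<Rightarrow> real^'n \<Rightarrow> 'k) \<Rightarrow> bool"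
where
  "sublinear_operator D T \<longleftrightarrow>
     (\<forall>f\<in>D. \<forall>g\<in>D. (\<lambda>x. f x + g x) \<in> D) \<and>
     (\<forall>c. \<forall>f\<in>D. (\<lambda>x. c * f x) \<in> D) \<and>
     (\<forall>f\<in>D. T f \<in> borel_measurable lebesgue) \<and>
     (\<forall>f\<in>D. \<forall>g\<in>D. \<forall>x. norm (T (\<lambda>y. f y + g y) x) \<le> norm (T f x) + norm (T g x)) \<and>
     (\<forall>c. \<forall>f\<in>D. \<forall>x. norm (T (\<lambda>y. c * f y) x) = norm c * norm (T f x))"

definition commutator ::
  "((real^'n \<Rightarrow> 'k) \<Rightarrow> real^'n \<Rightarrow> 'k) \<Rightarrow> (real^'n \<Rightarrow> 'k::{real_normed_field, euclidean_space})
    \<Rightarrow> nat \<Rightarrow> (real^'n \<Rightarrow> 'k) \<Rightarrow> real^'n \<Rightarrow> 'k"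
where
  "commutator T b m f x = T (\<lambda>y. (b x - b y) ^ m * f y) x"

text \<open>The best constant of an operator \<open>S\<close> acting on bounded compactly supported functions; it
  is \<open>\<infinity>\<close> if no finite constant works.\<close>

definition op_norm ::
  "real \<Rightarrow> (real^'n \<Rightarrow> real) \<Rightarrow> (real^'n \<Rightarrow> real)
    \<Rightarrow> ((real^'n \<Rightarrow> 'k::euclidean_space) \<Rightarrow> real^'n \<Rightarrow> 'k) \<Rightarrow> ennreal"
where
  "op_norm p \<mu> lam S = Inf {ennreal C | C. 0 \<le> C \<and>
     (\<forall>f. bounded_compact_support f \<longrightarrow>
        weighted_norm p lam (S f) \<le> ennreal C * weighted_norm p \<mu> f)}"

definition Lr_on :: "real \<Rightarrow> (real^'n) set \<Rightarrow> (real^'n \<Rightarrow> 'k::euclidean_space) set" where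
  "Lr_on r Q = {f. f \<in> borel_measurable (lebesgue_on Q) \<and>
                   (\<integral>\<^sup>+x\<in>Q. ennreal (norm (f x) powr r) \<partial>lebesgue) < \<infinity>}"

text \<open>The functions to which \<open>T\<close> is applied, in local weak bounds and in the commutator.\<close>

definition local_Lr :: "real \<Rightarrow> (real^'n \<Rightarrow> 'k::euclidean_space) set" where
  "local_Lr r = {restr Q f | Q f. Q \<in> cubes \<and> f \<in> Lr_on r Q}"

definition commutator_args ::
  "(real^'n \<Rightarrow> 'k::{real_normed_field, euclidean_space}) \<Rightarrow> nat \<Rightarrow> (real^'n \<Rightarrow> 'k) set" where
  "commutator_args b m = {(\<lambda>y. (b x - b y) ^ m * f y) | x f. bounded_compact_support f}"

text \<open>Local weak boundedness is a property of the modulus of an operator, so it is stated for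
  operators with values in \<^typ>\<open>ennreal\<close>.  The level sets are Lebesgue measurable in both
  applications: \<open>T f\<close> is measurable, and \<open>{x. sharp_maximal T s f x > t}\<close> is a union of closed
  cubes.\<close>

definition abs_op ::
  "((real^'n \<Rightarrow> 'k) \<Rightarrow> real^'n \<Rightarrow> 'k::real_normed_vector) \<Rightarrow> (real^'n \<Rightarrow> 'k) \<Rightarrow> real^'n \<Rightarrow> ennreal" where
  "abs_op T f x = ennreal (norm (T f x))"

definition locally_weak_bounded ::
  "real \<Rightarrow> (real \<Rightarrow> real) \<Rightarrow> ((real^'n \<Rightarrow> 'k::euclidean_space) \<Rightarrow> real^'n \<Rightarrow> ennreal) \<Rightarrow> bool"
where
  "locally_weak_bounded r \<phi> S \<longleftrightarrow>
     antimono_on {0<..<1} \<phi> \<and> (\<forall>t\<in>{0<..<1}. 0 \<le> \<phi> t) \<and>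
     (\<forall>Q\<in>cubes. \<forall>f\<in>Lr_on r Q. \<forall>t\<in>{0<..<1}.
        emeasure lebesgue {x\<in>Q. S (restr Q f) x > ennreal (\<phi> t) * avg r Q (\<lambda>y. norm (f y))}
          \<le> ennreal t * emeasure lebesgue Q)"

definition oscillation :: "ereal \<Rightarrow> (real^'n) set \<Rightarrow> (real^'n \<Rightarrow> 'k::euclidean_space) \<Rightarrow> ennreal" where
  "oscillation s Q g =
     (if s = \<infinity>
      then esssup (lebesgue_on Q \<Otimes>\<^sub>M lebesgue_on Q) (\<lambda>(x, y). ennreal (norm (g x - g y)))
      else epowr ((\<integral>\<^sup>+(x, y). ennreal (norm (g x - g y) powr real_of_ereal s)
                     \<partial>(lebesgue_on Q \<Otimes>\<^sub>M lebesgue_on Q)) / (emeasure lebesgue Q)\<^sup>2)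
                 (1 / real_of_ereal s))"

definition sharp_maximal ::
  "((real^'n \<Rightarrow> 'k) \<Rightarrow> real^'n \<Rightarrow> 'k::euclidean_space) \<Rightarrow> ereal \<Rightarrow> (real^'n \<Rightarrow> 'k) \<Rightarrow> real^'n \<Rightarrow> ennreal"
where
  "sharp_maximal T s f x =
     (SUP (c, a)\<in>{(c, a). a > 0 \<and> x \<in> cube c a}.
        oscillation s (cube c a) (T (restr (- cube c (3 * a)) f)))"

section \<open>The sparse domination principle\<close>

definition sparse :: "real \<Rightarrow> (real^'n) set set \<Rightarrow> bool" where
  "sparse \<eta> \<S> \<longleftrightarrow> \<S> \<subseteq> cubes \<and>
     (\<exists>E. (\<forall>Q\<in>\<S>. E Q \<subseteq> Q \<and> E Q \<in> sets lebesgue \<and>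
               emeasure lebesgue (E Q) \<ge> ennreal \<eta> * emeasure lebesgue Q) \<and>
          disjoint_family_on E \<S>)"

definition holder_conj :: "ereal \<Rightarrow> real" where
  "holder_conj s = (if s = \<infinity> then 1 else real_of_ereal s / (real_of_ereal s - 1))"

definition sparse_form ::
  "real \<Rightarrow> ereal \<Rightarrow> (real^'n \<Rightarrow> 'k::euclidean_space) \<Rightarrow> nat \<Rightarrow> (real^'n \<Rightarrow> 'k) \<Rightarrow> (real^'n \<Rightarrow> 'k)
    \<Rightarrow> (real^'n) set set \<Rightarrow> ennreal"
where
  "sparse_form r s b m f g \<S> =
     (\<integral>\<^sup>+Q. (avg r Q (\<lambda>x. norm (b x - mean Q b) ^ m * norm (f x))
              * avg (holder_conj s) Q (\<lambda>x. norm (g x))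
            + avg r Q (\<lambda>x. norm (f x))
              * avg (holder_conj s) Q (\<lambda>x. norm (b x - mean Q b) ^ m * norm (g x)))
           * emeasure lebesgue Q \<partial>count_space \<S>)"

text \<open>
  \<open>sparse_domination_constants TYPE('n) TYPE('k) m C l\<close>: sparse domination holds with the
  constants \<open>C\<close> and \<open>l\<close>, playing the roles of \<open>C\<close> and \<open>\<lambda>\<close> with subscripts \<open>m, n\<close>.
  The estimate carries no information if the sparse form is infinite.  This case is listed
  separately because \<open>0 * \<infinity> = 0\<close> in \<^typ>\<open>ennreal\<close> and the factor in front may vanish.
\<close>

definition sparse_domination_constants ::
  "'n::finite itself \<Rightarrow> 'k::{real_normed_field, euclidean_space} itself \<Rightarrow> nat \<Rightarrow> real \<Rightarrow> real \<Rightarrow> bool"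
where
  "sparse_domination_constants _ _ m C l \<longleftrightarrow> 1 < C \<and> 0 < l \<and> l < 1 \<and>
     (\<forall>r s D (T :: (real^'n \<Rightarrow> 'k) \<Rightarrow> real^'n \<Rightarrow> 'k) \<phi>T \<phi>M b f g.
        1 \<le> r \<and> ereal r < s \<and>
        sublinear_operator D T \<and> local_Lr r \<subseteq> D \<and> commutator_args b m \<subseteq> D \<and>
        locally_weak_bounded r \<phi>T (abs_op T) \<and>
        locally_weak_bounded r \<phi>M (sharp_maximal T s) \<and>
        bounded_compact_support f \<and> bounded_compact_support g \<and> locally_integrable b \<longrightarrow>
        (\<exists>\<S>. sparse (1 / (2 * 3 ^ CARD('n))) \<S> \<and>
           (sparse_form r s b m f g \<S> = \<infinity> \<or>
            (\<integral>\<^sup>+x. ennreal (norm (commutator T b m f x) * norm (g x)) \<partial>lebesgue)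
              \<le> ennreal (C * (\<phi>T l + \<phi>M l)) * sparse_form r s b m f g \<S>)))"

end

theory Submission
  imports Defs
begin

text \<open>
  By duality and the sparse domination principle it suffices to bound the sparse form on
  \<open>L\<^sup>p(\<mu>) \<times> L\<^bsup>p'\<^esup>(\<lambda>\<^bsup>1-p'\<^esup>)\<close>.  Cubes are enlarged to cells of \<open>2\<^sup>n\<close> shifted dyadic lattices.  Inside
  one lattice a stopping time argument enlarges the sparse family so that on each cell \<open>Q\<close> the
  function \<open>\<bar>b - \<langle>b\<rangle>\<^sub>Q\<bar>\<close> is dominated by the sum of the mean oscillations of \<open>b\<close> over the subcells
  containing the point, hence by \<open>\<parallel>b\<parallel>\<close> times \<open>\<Sum>\<^bsub>P \<subseteq> Q\<^esub> \<langle>\<nu>\<rangle>\<^sub>P 1\<^sub>P\<close>.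

  The exponents \<open>r'\<close> and \<open>s\<close> are taken proportional to \<open>max([\<mu>], [\<lambda>])\<^bsup>1/(p-1)\<^esup>\<close> and \<open>max([\<mu>], [\<lambda>])\<close>.
  The sharp reverse Hoelder inequality then lets one replace \<open>\<langle>f\<rangle>\<^bsub>r,Q\<^esub>\<close> and \<open>\<langle>g\<rangle>\<^bsub>s',Q\<^esub>\<close> by ordinary
  averages of functions with comparable norms.  For the first constant, the \<open>m\<close>-th power of the
  sum is unfolded into \<open>m\<close> nested sums; this gives \<open>m + 1\<close> applications of the sharp bound for
  sparse operators, each on one of the weights \<open>\<mu>\<^bsup>1-i/m\<^esup> \<lambda>\<^bsup>i/m\<^esup>\<close>, with a multiplication by \<open>\<nu>\<close>
  between two of them.  For the second constant, the power is bounded with the help of \<open>A\<^sub>p\<close>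
  maximal functions, and only one sparse operator, on \<open>L\<^sup>p(\<lambda>)\<close>, remains.  The second half of the form
  is the first half for \<open>p'\<close>, \<open>\<lambda>\<^bsup>1-p'\<^esup>\<close> and \<open>\<mu>\<^bsup>1-p'\<^esup>\<close>.
\<close>

section \<open>Powers and Hoelder's inequality in the extended non-negative reals\<close>

text \<open>The averages in the form have exponents above 1, so the inner sums cannot simply be
  integrated and replaced by averages, as for exponent 1. They are treated by duality in L^r(Q): the
  test function enters through a maximal function of its averages of exponent s/2, where s =
  r/(r-1), and this maximal function is bounded on L^s by an absolute constant. Every unfolding
  halves s once, which is the origin of the factor 2^m in the thresholds for the exponents; no
  implicit constant depends on them. The interpolated weights have the constants [\<mu>]^(1-i/m)
  [\<lambda>]^(i/m) for i = 0, ..., m, whose product is ([\<mu>][\<lambda>])^((m+1)/2). In the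
  second constant, m - 1 of the factors [\<mu>]^(1/(p-1)) come from comparing the dual measure of a
  cell with that of its sparse part, and the last one from Buckley's inequality. Several arguments
  divide an inequality by a power of one of its own terms, which must be finite; hence families are
  finite and functions bounded until a monotone limit is taken.\<close>

lemma epowr_ennreal: "0 \<le> x \<Longrightarrow> epowr (ennreal x) a = ennreal (x powr a)"
  by (simp add: epowr_def)

lemma epowr_top [simp]: "epowr top a = top"
  by (simp add: epowr_def)

lemma epowr_0 [simp]: "epowr 0 a = 0"
  by (simp add: epowr_def)

lemma epowr_1 [simp]: "epowr 1 a = 1"
  by (simp add: epowr_def)

lemma epowr_one [simp]: "epowr x 1 = x"
  by (cases x) (auto simp: epowr_ennreal)

lemma epowr_mono: "x \<le> y \<Longrightarrow> 0 \<le> a \<Longrightarrow> epowr x a \<le> epowr y a"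
  by (cases x; cases y) (auto simp: epowr_ennreal top_unique intro!: ennreal_leI powr_mono2)

lemma epowr_eq_0_iff [simp]: "epowr x a = 0 \<longleftrightarrow> x = 0"
  by (cases x) (auto simp: epowr_ennreal ennreal_eq_0_iff dest: order.antisym)

lemma epowr_eq_top_iff [simp]: "epowr x a = top \<longleftrightarrow> x = top"
  by (cases x) (auto simp: epowr_ennreal)

lemma epowr_less_top_iff [simp]: "epowr x a < top \<longleftrightarrow> x < top"
  by (simp add: less_top[symmetric])

lemma epowr_gt_0_iff [simp]: "0 < epowr x a \<longleftrightarrow> 0 < x"
  by (simp add: zero_less_iff_neq_zero)

text \<open>
  As \<open>0 powr a = 0\<close>, also \<open>epowr 0 a = 0\<close> and \<open>epowr \<infinity> a = \<infinity>\<close> for negative \<open>a\<close>.  This makes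
  \<open>epowr\<close> multiplicative without side conditions.
\<close>

lemma epowr_mult: "epowr (x * y) a = epowr x a * epowr y a"
proof (cases x; cases y)
  fix u v assume "x = ennreal u" "0 \<le> u" "y = ennreal v" "0 \<le> v"
  then show ?thesis by (simp add: epowr_ennreal powr_mult flip: ennreal_mult)
qed (auto simp: epowr_ennreal ennreal_top_mult ennreal_mult_top)

lemma epowr_inverse: "0 < x \<Longrightarrow> x < top \<Longrightarrow> epowr (inverse x) a = inverse (epowr x a)"
  by (cases x) (auto simp: epowr_ennreal inverse_ennreal inverse_powr)

lemma epowr_divide: "0 < y \<Longrightarrow> y < top \<Longrightarrow> epowr (x / y) a = epowr x a / epowr y a"
  by (simp add: divide_ennreal_def epowr_mult epowr_inverse)

lemma epowr_epowr: "epowr (epowr x a) b = epowr x (a * b)"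
  by (cases x) (auto simp: epowr_ennreal powr_powr)

text \<open>Holds at 0 and \<open>top\<close> as well, because \<open>epowr 0 0 = 0\<close> and
  \<open>epowr top 0 = top\<close> by the convention. The price is that the exponent 0 gives 1 only
  for positive finite arguments (\<open>epowr_exp_0\<close>), one reason for making weights positive
  and finite everywhere.\<close>

lemma epowr_add: "epowr x (a + b) = epowr x a * epowr x b"
  by (cases x) (auto simp: epowr_ennreal powr_add ennreal_mult')

lemma epowr_add1: "epowr x (1 + b) = x * epowr x b"
  by (simp add: epowr_add)

lemma epowr_nat: "1 \<le> n \<Longrightarrow> epowr x (real n) = x ^ n"
  by (cases x) (auto simp: epowr_ennreal powr_realpow' ennreal_power)

lemma epowr_less_mono: "x < y \<Longrightarrow> 0 < a \<Longrightarrow> epowr x a < epowr y a"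
  by (cases x; cases y) (auto simp: epowr_ennreal ennreal_less_iff intro!: powr_less_mono2)

lemma epowr_le_cancel: "epowr x a \<le> y \<Longrightarrow> 0 < a \<Longrightarrow> x \<le> epowr y (1 / a)"
  using epowr_mono[of "epowr x a" y "1 / a"] by (simp add: epowr_epowr)

lemma measurable_epowr [measurable (raw)]:
  assumes "f \<in> borel_measurable N"
  shows "(\<lambda>x. epowr (f x) a) \<in> borel_measurable N"
  unfolding epowr_def using assms by measurable

lemma epowr_SUP:
  assumes "0 < a" "I \<noteq> {}"
  shows "epowr (SUP i\<in>I. f i) a = (SUP i\<in>I. epowr (f i) a)"
proof (rule antisym)
  have "f i \<le> epowr (SUP i\<in>I. epowr (f i) a) (1 / a)" if "i \<in> I" for i
    by (rule epowr_le_cancel[OF SUP_upper[OF that] assms(1)])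
  then have "(SUP i\<in>I. f i) \<le> epowr (SUP i\<in>I. epowr (f i) a) (1 / a)"
    by (rule SUP_least)
  then show "epowr (SUP i\<in>I. f i) a \<le> (SUP i\<in>I. epowr (f i) a)"
    using epowr_mono[of _ _ a] assms by (fastforce simp: epowr_epowr)
  show "(SUP i\<in>I. epowr (f i) a) \<le> epowr (SUP i\<in>I. f i) a"
    using assms by (intro SUP_least epowr_mono SUP_upper) auto
qed

section \<open>Young's and Hoelder's inequalities, absorption and duality of norms\<close>

lemma epowr_young:
  assumes "0 < \<theta>" "\<theta> < 1"
  shows "epowr x \<theta> * epowr y (1 - \<theta>) \<le> ennreal \<theta> * x + ennreal (1 - \<theta>) * y"
proof (cases "x = 0 \<or> y = 0 \<or> x = top \<or> y = top")
  case True
  then show ?thesis using assms by (auto simp: ennreal_mult_top)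
next
  case False
  then obtain u v where uv: "x = ennreal u" "0 < u" "y = ennreal v" "0 < v"
    by (metis ennreal_cases ennreal_0 order_le_less)
  have "u powr \<theta> * v powr (1 - \<theta>) \<le> \<theta> * u + (1 - \<theta>) * v"
    using Youngs_inequality_0[of \<theta> "1 - \<theta>" u v] assms uv by simp
  then show ?thesis using uv assms
    by (simp add: epowr_ennreal ennreal_leI flip: ennreal_mult ennreal_plus)
qed

text \<open>Young's inequality is integrated after both integrals have been normalised to 1. If one
  integral is 0, the left side vanishes; if one is infinite and neither is 0, the right side is
  infinite.\<close>

theorem nn_integral_Holder:
  assumes [measurable]: "f \<in> borel_measurable N" "g \<in> borel_measurable N"
    and \<theta>: "0 < \<theta>" "\<theta> < 1"
  shows "(\<integral>\<^sup>+x. epowr (f x) \<theta> * epowr (g x) (1 - \<theta>) \<partial>N)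
           \<le> epowr (\<integral>\<^sup>+x. f x \<partial>N) \<theta> * epowr (\<integral>\<^sup>+x. g x \<partial>N) (1 - \<theta>)"
proof -
  define A where "A = (\<integral>\<^sup>+x. f x \<partial>N)"
  define B where "B = (\<integral>\<^sup>+x. g x \<partial>N)"
  consider "A = 0 \<or> B = 0" | "A \<noteq> 0" "B \<noteq> 0" "A = top \<or> B = top" | "0 < A" "0 < B" "A < top" "B < top"
    by (metis less_top not_gr_zero)
  then show ?thesis
  proof cases
    case 1
    then have "AE x in N. epowr (f x) \<theta> * epowr (g x) (1 - \<theta>) = 0"
      unfolding A_def B_def by (auto simp: nn_integral_0_iff_AE)
    then have "(\<integral>\<^sup>+x. epowr (f x) \<theta> * epowr (g x) (1 - \<theta>) \<partial>N) = 0"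
      by (subst nn_integral_0_iff_AE) measurable
    then show ?thesis by simp
  next
    case 2
    then show ?thesis by (auto simp: A_def[symmetric] B_def[symmetric])
  next
    case 3
    define K where "K = epowr A \<theta> * epowr B (1 - \<theta>)"
    have eq: "epowr (f x) \<theta> * epowr (g x) (1 - \<theta>) = K * (epowr (f x / A) \<theta> * epowr (g x / B) (1 - \<theta>))" for x
    proof -
      have "epowr (f x) \<theta> = epowr A \<theta> * epowr (f x / A) \<theta>"
        using 3 by (simp add: ennreal_times_divide mult.commute[of A] ennreal_mult_divide_eq flip: epowr_mult)
      moreover have "epowr (g x) (1 - \<theta>) = epowr B (1 - \<theta>) * epowr (g x / B) (1 - \<theta>)"
        using 3 by (simp add: ennreal_times_divide mult.commute[of B] ennreal_mult_divide_eq flip: epowr_mult)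
      ultimately show ?thesis unfolding K_def by (simp add: mult_ac)
    qed
    have "(\<integral>\<^sup>+x. epowr (f x) \<theta> * epowr (g x) (1 - \<theta>) \<partial>N)
        = K * (\<integral>\<^sup>+x. epowr (f x / A) \<theta> * epowr (g x / B) (1 - \<theta>) \<partial>N)"
      unfolding eq by (rule nn_integral_cmult) measurable
    also have "\<dots> \<le> K * (\<integral>\<^sup>+x. ennreal \<theta> * (f x / A) + ennreal (1 - \<theta>) * (g x / B) \<partial>N)"
      by (intro mult_left_mono nn_integral_mono epowr_young \<theta>) auto
    also have "(\<integral>\<^sup>+x. ennreal \<theta> * (f x / A) + ennreal (1 - \<theta>) * (g x / B) \<partial>N)
        = ennreal \<theta> * (A / A) + ennreal (1 - \<theta>) * (B / B)"
      by (simp add: nn_integral_add nn_integral_cmult nn_integral_divide A_def B_def)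
    also have "\<dots> = 1"
      using 3 \<theta> by (simp flip: ennreal_plus)
    finally show ?thesis by (simp add: K_def A_def B_def)
  qed
qed

lemma nn_integral_Holder_pq:
  assumes [measurable]: "f \<in> borel_measurable N" "g \<in> borel_measurable N"
    and pq: "1 < p" "1 < q" "1 / p + 1 / q = 1"
  shows "(\<integral>\<^sup>+x. f x * g x \<partial>N)
           \<le> epowr (\<integral>\<^sup>+x. epowr (f x) p \<partial>N) (1 / p) * epowr (\<integral>\<^sup>+x. epowr (g x) q \<partial>N) (1 / q)"
proof -
  have q: "1 - 1 / p = 1 / q" using pq by simp
  show ?thesis
    using nn_integral_Holder[of "\<lambda>x. epowr (f x) p" N "\<lambda>x. epowr (g x) q" "1 / p"] pq
    unfolding q by (simp add: epowr_epowr)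
qed

lemma sum_Holder:
  fixes f g :: "'a \<Rightarrow> ennreal"
  assumes "finite F" and pq: "1 < p" "1 < q" "1 / p + 1 / q = 1"
  shows "(\<Sum>x\<in>F. f x * g x) \<le> epowr (\<Sum>x\<in>F. epowr (f x) p) (1 / p) * epowr (\<Sum>x\<in>F. epowr (g x) q) (1 / q)"
  using nn_integral_Holder_pq[of f "count_space F" g p q] assms
  by (simp add: nn_integral_count_space_finite)

text \<open>An absorption argument: dividing by a power of I is legitimate only because I is finite.
  The finiteness claims scattered over the later proofs serve this step.\<close>

lemma ennreal_self_improve:
  assumes "I < top" "I \<le> K * epowr I \<theta>" "0 < \<theta>" "\<theta> < 1"
  shows "epowr I (1 - \<theta>) \<le> K"
proof (cases "I = 0")
  case False
  have "I = epowr I (1 - \<theta>) * epowr I \<theta>"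
    by (simp flip: epowr_add)
  then have "epowr I \<theta> * epowr I (1 - \<theta>) \<le> epowr I \<theta> * K"
    using assms by (simp add: mult.commute)
  then show ?thesis
    by (subst (asm) ennreal_mult_le_mult_iff) (use False assms in auto)
qed auto

text \<open>The extremal test function, X to the power r - 1, is inserted into the dual hypothesis,
  and the power of the norm that it produces is absorbed.\<close>

lemma epowr_norm_dual:
  assumes [measurable]: "X \<in> borel_measurable N"
    and r: "1 < r" and fin: "(\<integral>\<^sup>+x. epowr (X x) r \<partial>N) < top"
    and dual: "\<And>h. h \<in> borel_measurable N \<Longrightarrow> (\<integral>\<^sup>+x. epowr (h x) (r / (r - 1)) \<partial>N) < top \<Longrightarrow>
      (\<integral>\<^sup>+x. X x * h x \<partial>N) \<le> K * epowr (\<integral>\<^sup>+x. epowr (h x) (r / (r - 1)) \<partial>N) (1 - 1 / r)"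
  shows "epowr (\<integral>\<^sup>+x. epowr (X x) r \<partial>N) (1 / r) \<le> K"
proof -
  let ?I = "\<integral>\<^sup>+x. epowr (X x) r \<partial>N"
  have "X x * epowr (X x) (r - 1) = epowr (X x) r" for x
    by (simp flip: epowr_add1)
  moreover have "epowr (epowr (X x) (r - 1)) (r / (r - 1)) = epowr (X x) r" for x
    using r by (simp add: epowr_epowr)
  ultimately have "?I \<le> K * epowr ?I (1 - 1 / r)"
    using dual[of "\<lambda>x. epowr (X x) (r - 1)"] fin by simp
  from ennreal_self_improve[OF fin this] show ?thesis using r by simp
qed

section \<open>Averages\<close>

text \<open>The measure is a parameter because averages are taken both with respect to
  \<open>lebesgue\<close> and with respect to densities of weights.\<close>

definition ave :: "'a measure \<Rightarrow> 'a set \<Rightarrow> ('a \<Rightarrow> ennreal) \<Rightarrow> ennreal" where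
  "ave N P f = (\<integral>\<^sup>+x\<in>P. f x \<partial>N) / emeasure N P"

definition rave :: "real \<Rightarrow> 'a measure \<Rightarrow> 'a set \<Rightarrow> ('a \<Rightarrow> ennreal) \<Rightarrow> ennreal" where
  "rave r N P f = epowr (ave N P (\<lambda>x. epowr (f x) r)) (1 / r)"

lemma ave_mono: "(\<And>x. x \<in> P \<Longrightarrow> f x \<le> g x) \<Longrightarrow> ave N P f \<le> ave N P g"
  unfolding ave_def by (intro divide_right_mono_ennreal nn_integral_mono) (auto split: split_indicator)

lemma ave_mono_AE: "(AE x in N. x \<in> P \<longrightarrow> f x \<le> g x) \<Longrightarrow> ave N P f \<le> ave N P g"
  unfolding ave_def
  by (intro divide_right_mono_ennreal nn_integral_mono_AE) (auto split: split_indicator)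

lemma rave_mono_AE: "0 < r \<Longrightarrow> (AE x in N. x \<in> P \<longrightarrow> f x \<le> g x) \<Longrightarrow> rave r N P f \<le> rave r N P g"
  unfolding rave_def
  by (intro epowr_mono ave_mono_AE) (auto intro!: epowr_mono elim!: eventually_mono)

lemma rave_mono: "0 < r \<Longrightarrow> (\<And>x. x \<in> P \<Longrightarrow> f x \<le> g x) \<Longrightarrow> rave r N P f \<le> rave r N P g"
  by (rule rave_mono_AE) auto

lemma rave_1 [simp]: "rave 1 N P f = ave N P f"
  by (simp add: rave_def)

lemma ave_cmult:
  assumes [measurable]: "f \<in> borel_measurable N" "P \<in> sets N"
  shows "ave N P (\<lambda>x. c * f x) = c * ave N P f"
proof -
  have "(\<integral>\<^sup>+x\<in>P. c * f x \<partial>N) = c * (\<integral>\<^sup>+x\<in>P. f x \<partial>N)"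
    by (simp add: mult.assoc nn_integral_cmult)
  then show ?thesis by (simp add: ave_def ennreal_times_divide)
qed

lemma rave_cmult:
  assumes [measurable]: "f \<in> borel_measurable N" "P \<in> sets N" and "0 < r"
  shows "rave r N P (\<lambda>x. c * f x) = c * rave r N P f"
  using assms(3) by (simp add: rave_def epowr_mult ave_cmult epowr_epowr)

text \<open>Positive finite measure is what allows a division by \<open>emeasure N P\<close> to be
  undone by multiplication.\<close>

locale finite_pos_set =
  fixes N :: "'a measure" and P
  assumes sets_P [measurable]: "P \<in> sets N" and pos: "0 < emeasure N P" and fin: "emeasure N P < top"
begin

lemma ave_mult_emeasure: "ave N P f * emeasure N P = (\<integral>\<^sup>+x\<in>P. f x \<partial>N)"
  using pos fin by (simp add: ave_def ennreal_divide_times ennreal_times_divide ennreal_mult_divide_eq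
      flip: mult_divide_eq_ennreal)

lemma ave_const: "ave N P (\<lambda>x. c) = c"
  using pos fin
  by (simp add: ave_def nn_integral_cmult_indicator ennreal_mult_divide_eq)

lemma ave_Holder:
  assumes [measurable]: "f \<in> borel_measurable N" "g \<in> borel_measurable N"
    and \<theta>: "0 < \<theta>" "\<theta> < 1"
  shows "ave N P (\<lambda>x. epowr (f x) \<theta> * epowr (g x) (1 - \<theta>)) \<le> epowr (ave N P f) \<theta> * epowr (ave N P g) (1 - \<theta>)"
proof -
  have i: "epowr (f x * indicator P x) \<theta> * epowr (g x * indicator P x) (1 - \<theta>) =
     epowr (f x) \<theta> * epowr (g x) (1 - \<theta>) * indicator P x" for x
    by (simp split: split_indicator)
  have e: "emeasure N P = epowr (emeasure N P) \<theta> * epowr (emeasure N P) (1 - \<theta>)"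
    by (simp flip: epowr_add)
  have n: "0 < epowr (emeasure N P) \<theta>" "epowr (emeasure N P) \<theta> < top"
     "0 < epowr (emeasure N P) (1 - \<theta>)" "epowr (emeasure N P) (1 - \<theta>) < top"
    using pos fin by auto
  have "ave N P (\<lambda>x. epowr (f x) \<theta> * epowr (g x) (1 - \<theta>)) \<le>
    (epowr (\<integral>\<^sup>+x\<in>P. f x \<partial>N) \<theta> * epowr (\<integral>\<^sup>+x\<in>P. g x \<partial>N) (1 - \<theta>)) / emeasure N P"
    unfolding ave_def
    using nn_integral_Holder[of "\<lambda>x. f x * indicator P x" N "\<lambda>x. g x * indicator P x" \<theta>] \<theta>
    by (intro divide_right_mono_ennreal) (simp add: i)
  also have "\<dots> = epowr (ave N P f) \<theta> * epowr (ave N P g) (1 - \<theta>)"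
    unfolding ave_def epowr_divide[OF pos fin]
    by (subst e) (use n in \<open>simp add: divide_ennreal_def ennreal_inverse_mult mult_ac\<close>)
  finally show ?thesis .
qed

lemma ave_Holder_pq:
  assumes [measurable]: "f \<in> borel_measurable N" "g \<in> borel_measurable N"
    and pq: "1 < p" "1 < q" "1 / p + 1 / q = 1"
  shows "ave N P (\<lambda>x. f x * g x) \<le> rave p N P f * rave q N P g"
proof -
  have q: "1 - 1 / p = 1 / q" using pq by simp
  show ?thesis
    using ave_Holder[of "\<lambda>x. epowr (f x) p" "\<lambda>x. epowr (g x) q" "1 / p"] pq
    unfolding q by (simp add: epowr_epowr rave_def)
qed

lemma ave_Jensen:
  assumes [measurable]: "f \<in> borel_measurable N" and \<theta>: "0 < \<theta>" "\<theta> \<le> 1"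
  shows "ave N P (\<lambda>x. epowr (f x) \<theta>) \<le> epowr (ave N P f) \<theta>"
proof (cases "\<theta> = 1")
  case False
  then show ?thesis
    using ave_Holder[of f "\<lambda>_. 1" \<theta>] \<theta> by (simp add: ave_const)
qed simp

lemma rave_mono_exponent:
  assumes [measurable]: "f \<in> borel_measurable N" and "0 < r" "r \<le> s"
  shows "rave r N P f \<le> rave s N P f"
proof -
  have "ave N P (\<lambda>x. epowr (f x) r) \<le> epowr (ave N P (\<lambda>x. epowr (f x) s)) (r / s)"
    using ave_Jensen[of "\<lambda>x. epowr (f x) s" "r / s"] assms by (simp add: epowr_epowr)
  then have "rave r N P f \<le> epowr (epowr (ave N P (\<lambda>x. epowr (f x) s)) (r / s)) (1 / r)"
    unfolding rave_def using assms by (intro epowr_mono) auto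
  then show ?thesis using assms by (simp add: epowr_epowr rave_def)
qed

end

section \<open>Maximal functions of finite nested families\<close>

definition nested :: "'a set set \<Rightarrow> bool" where
  "nested F \<longleftrightarrow> (\<forall>P\<in>F. \<forall>Q\<in>F. P \<inter> Q = {} \<or> P \<subseteq> Q \<or> Q \<subseteq> P)"

lemma nestedD: "nested F \<Longrightarrow> P \<in> F \<Longrightarrow> Q \<in> F \<Longrightarrow> x \<in> P \<Longrightarrow> x \<in> Q \<Longrightarrow> P \<subseteq> Q \<or> Q \<subseteq> P"
  unfolding nested_def by blast

lemma nested_subset: "nested F \<Longrightarrow> G \<subseteq> F \<Longrightarrow> nested G"
  unfolding nested_def by blast

definition mf :: "('a set \<Rightarrow> ennreal) \<Rightarrow> 'a set set \<Rightarrow> 'a \<Rightarrow> ennreal" where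
  "mf v F x = (SUP P\<in>{P\<in>F. x \<in> P}. v P)"

definition anc :: "('a set \<Rightarrow> ennreal) \<Rightarrow> 'a set set \<Rightarrow> 'a set \<Rightarrow> ennreal" where
  "anc v F P = (SUP P'\<in>{P'\<in>F. P \<subset> P'}. v P')"

lemma mf_upper: "P \<in> F \<Longrightarrow> x \<in> P \<Longrightarrow> v P \<le> mf v F x"
  unfolding mf_def by (rule SUP_upper) auto

lemma mf_least: "(\<And>P. P \<in> F \<Longrightarrow> x \<in> P \<Longrightarrow> v P \<le> c) \<Longrightarrow> mf v F x \<le> c"
  unfolding mf_def by (rule SUP_least) auto

text \<open>Here the index set no longer depends on the point, which gives measurability for
  countable families.\<close>

lemma mf_alt: "mf v F x = (SUP P\<in>F. v P * indicator P x)"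
proof (rule antisym)
  show "mf v F x \<le> (SUP P\<in>F. v P * indicator P x)"
    by (rule mf_least) (rule SUP_upper2, auto)
  show "(SUP P\<in>F. v P * indicator P x) \<le> mf v F x"
    by (rule SUP_least) (auto split: split_indicator intro: mf_upper)
qed

lemma measurable_mf:
  assumes "countable F" "F \<subseteq> sets N"
  shows "mf v F \<in> borel_measurable N"
proof -
  have "(\<lambda>x. SUP P\<in>F. v P * indicator P x) \<in> borel_measurable N"
    using assms by (intro borel_measurable_SUP) auto
  then show ?thesis by (simp add: mf_alt[abs_def])
qed

lemma epowr_mf:
  assumes "0 < a" shows "epowr (mf v F x) a = mf (\<lambda>P. epowr (v P) a) F x"
proof (cases "{P\<in>F. x \<in> P} = {}")
  case True
  then show ?thesis by (simp only: mf_def True) (simp add: bot_ennreal)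
next
  case False
  then show ?thesis unfolding mf_def by (rule epowr_SUP[OF assms])
qed

lemma nn_integral_split:
  assumes [measurable]: "f \<in> borel_measurable N" "P \<in> sets N"
  shows "(\<integral>\<^sup>+x. f x \<partial>N) = (\<integral>\<^sup>+x\<in>-P. f x \<partial>N) + (\<integral>\<^sup>+x\<in>P. f x \<partial>N)"
proof -
  have m: "(\<lambda>x. f x * indicator (- P) x) \<in> borel_measurable N"
    by (rule measurable_cong[THEN iffD1, of _ "\<lambda>x. f x * indicator (space N - P) x"])
      (auto split: split_indicator)
  have "(\<integral>\<^sup>+x. f x \<partial>N) = (\<integral>\<^sup>+x. f x * indicator (-P) x + f x * indicator P x \<partial>N)"
    by (rule nn_integral_cong) (auto split: split_indicator)
  also have "\<dots> = (\<integral>\<^sup>+x\<in>-P. f x \<partial>N) + (\<integral>\<^sup>+x\<in>P. f x \<partial>N)"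
    using m by (intro nn_integral_add) auto
  finally show ?thesis .
qed

text \<open>
  Integral inequalities for the maximal function are proved by adding the sets of the family one
  by one, larger sets first: a new set \<open>P\<close> only changes the value on \<open>P\<close>, from the constant
  \<open>anc v F P\<close> to \<open>v P\<close>.
\<close>

lemma nested_mf_induct:
  fixes \<Phi> \<Psi> :: "'a \<Rightarrow> ennreal \<Rightarrow> ennreal"
  assumes F: "finite F" "nested F" "F \<subseteq> sets N"
    and meas: "\<And>g. g \<in> borel_measurable N \<Longrightarrow> (\<lambda>x. \<Phi> x (g x)) \<in> borel_measurable N"
      "\<And>g. g \<in> borel_measurable N \<Longrightarrow> (\<lambda>x. \<Psi> x (g x)) \<in> borel_measurable N"
    and base: "(\<integral>\<^sup>+x. \<Phi> x 0 \<partial>N) \<le> (\<integral>\<^sup>+x. \<Psi> x 0 \<partial>N)"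
    and step: "\<And>P X Y. P \<in> F \<Longrightarrow> anc v F P < v P \<Longrightarrow>
       X + (\<integral>\<^sup>+x\<in>P. \<Phi> x (anc v F P) \<partial>N) \<le> Y + (\<integral>\<^sup>+x\<in>P. \<Psi> x (anc v F P) \<partial>N) \<Longrightarrow>
       X + (\<integral>\<^sup>+x\<in>P. \<Phi> x (v P) \<partial>N) \<le> Y + (\<integral>\<^sup>+x\<in>P. \<Psi> x (v P) \<partial>N)"
  shows "(\<integral>\<^sup>+x. \<Phi> x (mf v F x) \<partial>N) \<le> (\<integral>\<^sup>+x. \<Psi> x (mf v F x) \<partial>N)"
proof -
  have "(\<integral>\<^sup>+x. \<Phi> x (mf v G x) \<partial>N) \<le> (\<integral>\<^sup>+x. \<Psi> x (mf v G x) \<partial>N)"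
    if "G \<subseteq> F" "\<And>P P'. P \<in> G \<Longrightarrow> P' \<in> F \<Longrightarrow> P \<subset> P' \<Longrightarrow> P' \<in> G" for G
    using finite_subset[OF that(1) F(1)] that
  proof (induction G rule: finite_psubset_induct)
    case (psubset G)
    show ?case
    proof (cases "G = {}")
      case True
      then show ?thesis using base by (simp add: mf_def bot_ennreal)
    next
      case False
      \<comment> \<open>G is closed under passing to larger sets of F. Removing a minimal member
        keeps this property and makes P the last set to be added.\<close>
      obtain P where P: "P \<in> G" "\<And>R. R \<in> G \<Longrightarrow> R \<subseteq> P \<Longrightarrow> R = P"
        using finite_has_minimal[OF psubset.hyps False] by metis
      define H where "H = G - {P}"
      have PF: "P \<in> F" and [measurable]: "P \<in> sets N" using P psubset.prems F by auto
      have up: "R \<in> G" if "x \<in> P" "R \<in> F" "P \<subset> R" for x R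
        using psubset.prems(2)[OF P(1) that(2,3)] .
      \<comment> \<open>By nestedness and minimality, the members of H through a point of P are
        exactly the strict supersets of P in F, so the old maximal function is constant on
        P.\<close>
      have eqA: "{R\<in>H. x \<in> R} = {P'\<in>F. P \<subset> P'}" if "x \<in> P" for x
      proof -
        have "P \<subset> R" if "R \<in> H" "x \<in> R" for R
          using nestedD[OF F(2), of P R x] P that \<open>x \<in> P\<close> psubset.prems(1) PF
          unfolding H_def by blast
        then show ?thesis
          using that psubset.prems(1) up unfolding H_def by auto
      qed
      have mH: "mf v H x = anc v F P" if "x \<in> P" for x
        using eqA[OF that] by (simp add: mf_def anc_def)
      have eqG: "{R\<in>G. x \<in> R} = insert P {R\<in>H. x \<in> R}" if "x \<in> P" for x
        using that P(1) by (auto simp: H_def)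
      have mG: "mf v G x = max (anc v F P) (v P)" if "x \<in> P" for x
        using mH[OF that] unfolding mf_def eqG[OF that] by (simp add: max.commute sup_max)
      have mG': "mf v G x = mf v H x" if "x \<notin> P" for x
      proof -
        have "{R\<in>G. x \<in> R} = {R\<in>H. x \<in> R}" using that by (auto simp: H_def)
        then show ?thesis by (simp add: mf_def)
      qed
      have mm: "mf v G \<in> borel_measurable N" "mf v H \<in> borel_measurable N"
        using psubset.prems F psubset.hyps unfolding H_def
        by (intro measurable_mf; auto intro: countable_finite)+
      have IH: "(\<integral>\<^sup>+x. \<Phi> x (mf v H x) \<partial>N) \<le> (\<integral>\<^sup>+x. \<Psi> x (mf v H x) \<partial>N)"
      proof (rule psubset.IH)
        show "H \<subset> G" using P by (auto simp: H_def)
        show "H \<subseteq> F" using psubset.prems by (auto simp: H_def)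
        fix R R' assume "R \<in> H" "R' \<in> F" "R \<subset> R'"
        then show "R' \<in> H" using psubset.prems(2)[of R R'] P(2)[of R] by (auto simp: H_def)
      qed
      have spH: "(\<integral>\<^sup>+x. \<Theta> x (mf v H x) \<partial>N) = (\<integral>\<^sup>+x\<in>-P. \<Theta> x (mf v H x) \<partial>N) + (\<integral>\<^sup>+x\<in>P. \<Theta> x (anc v F P) \<partial>N)"
        if "\<forall>g\<in>borel_measurable N. (\<lambda>x. \<Theta> x (g x)) \<in> borel_measurable N" for \<Theta> :: "'a \<Rightarrow> ennreal \<Rightarrow> ennreal"
        using nn_integral_split[OF bspec[OF that mm(2)], of P]
        by (auto intro!: nn_integral_cong arg_cong2[where f="(+)"] simp: mH split: split_indicator)
      have spG: "(\<integral>\<^sup>+x. \<Theta> x (mf v G x) \<partial>N) = (\<integral>\<^sup>+x\<in>-P. \<Theta> x (mf v H x) \<partial>N) +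
          (\<integral>\<^sup>+x\<in>P. \<Theta> x (max (anc v F P) (v P)) \<partial>N)"
        if "\<forall>g\<in>borel_measurable N. (\<lambda>x. \<Theta> x (g x)) \<in> borel_measurable N" for \<Theta> :: "'a \<Rightarrow> ennreal \<Rightarrow> ennreal"
        using nn_integral_split[OF bspec[OF that mm(1)], of P]
        by (auto intro!: nn_integral_cong arg_cong2[where f="(+)"] simp: mG mG' split: split_indicator)
      have meas': "\<forall>g\<in>borel_measurable N. (\<lambda>x. \<Phi> x (g x)) \<in> borel_measurable N"
        "\<forall>g\<in>borel_measurable N. (\<lambda>x. \<Psi> x (g x)) \<in> borel_measurable N"
        using meas by auto
      show ?thesis
      proof (cases "anc v F P < v P")
        case True
        \<comment> \<open>X and Y of the hypothesis \<open>step\<close> are the integrals over the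
          complement of P, where nothing changes.\<close>
        then have "max (anc v F P) (v P) = v P" by simp
        then show ?thesis
          using step[OF PF True IH[unfolded spH[of \<Phi>, OF meas'(1)] spH[of \<Psi>, OF meas'(2)]]]
          by (simp add: spG[of \<Phi>, OF meas'(1)] spG[of \<Psi>, OF meas'(2)])
      next
        case False
        then have "max (anc v F P) (v P) = anc v F P" by simp
        then show ?thesis
          using IH[unfolded spH[of \<Phi>, OF meas'(1)] spH[of \<Psi>, OF meas'(2)]]
          by (simp add: spG[of \<Phi>, OF meas'(1)] spG[of \<Psi>, OF meas'(2)])
      qed
    qed
  qed
  then show ?thesis by blast
qed

text \<open>X and Y may be infinite, so nothing is subtracted from them: only the real increments u'
  - u and v' - v are compared.\<close>

lemma ennreal_increment:
  assumes "X + ennreal u \<le> Y + ennreal v" "0 \<le> u" "u \<le> u'" "0 \<le> v" "u' - u \<le> v' - v"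
  shows "X + ennreal u' \<le> Y + ennreal v'"
proof -
  have "X + ennreal u' = (X + ennreal u) + ennreal (u' - u)"
    using assms by (simp add: add.assoc flip: ennreal_plus)
  also have "\<dots> \<le> (Y + ennreal v) + ennreal (v' - v)"
    by (intro add_mono ennreal_leI assms)
  also have "\<dots> = Y + ennreal v'"
    using assms by (simp add: add.assoc flip: ennreal_plus)
  finally show ?thesis .
qed

text \<open>Young's inequality for \<open>a * b powr (q - 1)\<close> with the exponents q and q / (q
  - 1), rearranged. It compares the jumps of the q-th and of the (q-1)-st power when a maximal
  function rises from b to a.\<close>

lemma powr_diff_le:
  assumes "1 < q" "0 \<le> b" "b \<le> (a::real)"
  shows "a powr q - b powr q \<le> q / (q - 1) * a * (a powr (q - 1) - b powr (q - 1))"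
proof -
  have "a * b powr (q - 1) \<le> a powr q / q + (b powr (q - 1)) powr (q / (q - 1)) / (q / (q - 1))"
    using assms by (intro Youngs_inequality) (auto simp: field_simps)
  also have "(b powr (q - 1)) powr (q / (q - 1)) = b powr q"
    using assms by (simp add: powr_powr)
  finally have "q * (a * b powr (q - 1)) \<le> a powr q + (q - 1) * b powr q"
    using assms by (simp add: field_simps)
  moreover have e: "a powr q = a * a powr (q - 1)"
    using assms by (cases "a = 0") (auto simp: powr_mult_base)
  moreover have "(a powr q - b powr q) * (q - 1) = q * a powr q - (a powr q + (q - 1) * b powr q)"
    by (simp add: algebra_simps)
  moreover have "q * a * (a powr (q - 1) - b powr (q - 1)) = q * a powr q - q * (a * b powr (q - 1))"
    unfolding e by (simp add: algebra_simps)
  ultimately have "(a powr q - b powr q) * (q - 1) \<le> q * a * (a powr (q - 1) - b powr (q - 1))"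
    by linarith
  then have "a powr q - b powr q \<le> q * a * (a powr (q - 1) - b powr (q - 1)) / (q - 1)"
    using assms by (simp add: pos_le_divide_eq)
  then show ?thesis by simp
qed

section \<open>Doob's maximal inequality with respect to an arbitrary measure\<close>

context
  fixes N :: "'a measure" and F :: "'a set set"
  assumes F: "finite F" "nested F" and F_pos: "\<And>P. P \<in> F \<Longrightarrow> finite_pos_set N P"
begin

lemma F_sets: "F \<subseteq> sets N"
  using F_pos finite_pos_set.sets_P by blast

text \<open>When the maximal function rises on P from b to \<open>a = ave N P h\<close>, the left
  side grows by (a^q - b^q) N(P). The right side grows by q / (q-1) (a^(q-1) - b^(q-1)) a N(P),
  since the integral of h over P is a N(P). The two are compared by
  \<open>powr_diff_le\<close>.\<close>

lemma Doob_aux: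
  assumes [measurable]: "h \<in> borel_measurable N" and q: "1 < q"
  defines "m \<equiv> mf (\<lambda>P. ave N P h) F"
  shows "(\<integral>\<^sup>+x. epowr (m x) q \<partial>N) \<le> (\<integral>\<^sup>+x. ennreal (q / (q - 1)) * h x * epowr (m x) (q - 1) \<partial>N)"
  unfolding m_def
proof (rule nested_mf_induct[OF F F_sets])
  fix P X Y assume P: "P \<in> F" and less: "anc (\<lambda>P. ave N P h) F P < ave N P h"
  interpret finite_pos_set N P by (rule F_pos[OF P])
  define H where "H = (\<integral>\<^sup>+x\<in>P. h x \<partial>N)"
  have i1: "(\<integral>\<^sup>+x\<in>P. epowr c q \<partial>N) = epowr c q * emeasure N P" for c
    by (simp add: nn_integral_cmult_indicator)
  have i2: "(\<integral>\<^sup>+x\<in>P. ennreal (q / (q - 1)) * h x * epowr c (q - 1) \<partial>N)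
      = ennreal (q / (q - 1)) * epowr c (q - 1) * H" for c
  proof -
    have "ennreal (q / (q - 1)) * h x * epowr c (q - 1) * indicator P x
       = (ennreal (q / (q - 1)) * epowr c (q - 1)) * (h x * indicator P x)" for x
      by (simp add: mult_ac)
    then show ?thesis by (simp add: nn_integral_cmult H_def)
  qed
  have H: "H = ave N P h * emeasure N P" by (simp add: H_def ave_mult_emeasure)
  let ?b = "anc (\<lambda>P. ave N P h) F P"
  assume IH: "X + (\<integral>\<^sup>+x\<in>P. epowr ?b q \<partial>N) \<le> Y + (\<integral>\<^sup>+x\<in>P. ennreal (q / (q - 1)) * h x * epowr ?b (q - 1) \<partial>N)"
  show "X + (\<integral>\<^sup>+x\<in>P. epowr (ave N P h) q \<partial>N)
      \<le> Y + (\<integral>\<^sup>+x\<in>P. ennreal (q / (q - 1)) * h x * epowr (ave N P h) (q - 1) \<partial>N)"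
  proof (cases "ave N P h = top")
    case True
    then show ?thesis unfolding i1 i2 H using pos q
      by (auto simp: ennreal_top_mult ennreal_mult_top)
  next
    case False
    then obtain a b n where r: "ave N P h = ennreal a" "0 \<le> a" "?b = ennreal b" "0 \<le> b"
        "emeasure N P = ennreal n" "0 < n"
      using less pos fin by (cases "ave N P h"; cases "?b"; cases "emeasure N P") auto
    have ba: "b \<le> a" using less r by (simp add: ennreal_less_iff)
    have e1: "epowr (ennreal c) q * ennreal n = ennreal (n * c powr q)" if "0 \<le> c" for c
      using that r by (simp add: epowr_ennreal mult.commute flip: ennreal_mult)
    have e2: "ennreal (q / (q - 1)) * epowr (ennreal c) (q - 1) * (ennreal a * ennreal n)
        = ennreal (q / (q - 1) * c powr (q - 1) * a * n)" if "0 \<le> c" for c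
      using that r q by (simp add: epowr_ennreal mult.assoc flip: ennreal_mult)
    have "n * a powr q - n * b powr q \<le> n * (q / (q - 1) * a * (a powr (q - 1) - b powr (q - 1)))"
      using powr_diff_le[OF q r(4) ba] r(6) by (metis less_imp_le mult_left_mono right_diff_distrib')
    then have d: "n * a powr q - n * b powr q
       \<le> q / (q - 1) * a powr (q - 1) * a * n - q / (q - 1) * b powr (q - 1) * a * n"
      by (simp add: algebra_simps)
    have d1: "n * b powr q \<le> n * a powr q"
      using r ba q by (intro mult_left_mono powr_mono2) auto
    have d2: "0 \<le> n * b powr q" "0 \<le> q / (q - 1) * b powr (q - 1) * a * n"
      using r q by auto
    show ?thesis
      using ennreal_increment[OF IH[unfolded i1 i2 H r(1,3,5) e1[OF r(4)] e2[OF r(4)]] d2(1) d1 d2(2) d]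
      unfolding i1 i2 H r(1,5) e1[OF r(2)] e2[OF r(2)] .
  qed
qed (use q in simp_all)

text \<open>Hoelder in \<open>Doob_aux\<close>, followed by absorption. The constant does not see
  the measure, so maximal functions with respect to weighted measures cost nothing in terms of the
  weight.\<close>

lemma Doob:
  assumes [measurable]: "h \<in> borel_measurable N" and q: "1 < q"
  shows "(\<integral>\<^sup>+x. epowr (mf (\<lambda>P. ave N P h) F x) q \<partial>N)
     \<le> ennreal ((q / (q - 1)) powr q) * (\<integral>\<^sup>+x. epowr (h x) q \<partial>N)"
proof (cases "(\<integral>\<^sup>+x. epowr (h x) q \<partial>N) = top")
  case True
  then show ?thesis using q by (simp add: ennreal_mult_top)
next
  case False
  let ?m = "mf (\<lambda>P. ave N P h) F" and ?I = "\<integral>\<^sup>+x. epowr (mf (\<lambda>P. ave N P h) F x) q \<partial>N"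
  have [measurable]: "?m \<in> borel_measurable N"
    by (rule measurable_mf[OF countable_finite[OF F(1)] F_sets])
  have finq: "ave N P (\<lambda>x. epowr (h x) q) < top" if "P \<in> F" for P
  proof -
    interpret finite_pos_set N P by (rule F_pos[OF that])
    have "(\<integral>\<^sup>+x\<in>P. epowr (h x) q \<partial>N) \<le> (\<integral>\<^sup>+x. epowr (h x) q \<partial>N)"
      by (intro nn_integral_mono) (auto split: split_indicator)
    then show ?thesis using False pos
      by (auto simp: ave_def less_top[symmetric] ennreal_divide_eq_top_iff top_unique)
  qed
  have fin2: "epowr (ave N P h) q < top" if "P \<in> F" for P
  proof -
    interpret finite_pos_set N P by (rule F_pos[OF that])
    have "ave N P h \<le> rave q N P h"
      using rave_mono_exponent[of h 1 q] q by simp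
    also have "\<dots> < top" using finq[OF that] by (simp add: rave_def)
    finally show ?thesis by simp
  qed
  have "?I \<le> (\<integral>\<^sup>+x. (\<Sum>P\<in>F. epowr (ave N P h) q * indicator P x) \<partial>N)"
  proof (rule nn_integral_mono)
    fix x
    show "epowr (?m x) q \<le> (\<Sum>P\<in>F. epowr (ave N P h) q * indicator P x)"
      using q F(1) unfolding epowr_mf[OF order_less_trans[OF zero_less_one q]]
      by (intro mf_least order_trans[OF _ member_le_sum[of _ F]]) auto
  qed
  also have "\<dots> = (\<Sum>P\<in>F. epowr (ave N P h) q * emeasure N P)"
    using F_sets by (subst nn_integral_sum) (auto intro!: sum.cong nn_integral_cmult_indicator)
  also have "\<dots> < top"
    using finite_pos_set.fin[OF F_pos] fin2 by (subst ennreal_sum_less_top[OF F(1)]) (simp add: ennreal_mult_less_top)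
  \<comment> \<open>The crude bound by a sum over the finite family F serves only to make the
    absorption below legitimate.\<close>
  finally have Ifin: "?I < top" .
  have "?I \<le> (\<integral>\<^sup>+x. ennreal (q / (q - 1)) * (h x * epowr (?m x) (q - 1)) \<partial>N)"
    using Doob_aux[of h q] q by (simp add: mult.assoc)
  also have "\<dots> = ennreal (q / (q - 1)) * (\<integral>\<^sup>+x. h x * epowr (?m x) (q - 1) \<partial>N)"
    by (rule nn_integral_cmult) measurable
  also have "\<dots> \<le> ennreal (q / (q - 1)) *
     (epowr (\<integral>\<^sup>+x. epowr (h x) q \<partial>N) (1 / q) * epowr ?I (1 / (q / (q - 1))))"
  proof (intro mult_left_mono)
    have "1 / q + 1 / (q / (q - 1)) = 1" "1 < q / (q - 1)" "(q - 1) * (q / (q - 1)) = q"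
      using q by (simp_all add: field_simps)
    then show "(\<integral>\<^sup>+x. h x * epowr (?m x) (q - 1) \<partial>N)
        \<le> epowr (\<integral>\<^sup>+x. epowr (h x) q \<partial>N) (1 / q) * epowr ?I (1 / (q / (q - 1)))"
      using nn_integral_Holder_pq[of h N "\<lambda>x. epowr (?m x) (q - 1)" q "q / (q - 1)"] q
      by (simp add: epowr_epowr)
  qed simp
  also have "1 / (q / (q - 1)) = 1 - 1 / q" using q by (simp add: field_simps)
  finally have "epowr ?I (1 - (1 - 1 / q)) \<le> ennreal (q / (q - 1)) * epowr (\<integral>\<^sup>+x. epowr (h x) q \<partial>N) (1 / q)"
    using q by (intro ennreal_self_improve Ifin) (auto simp: mult_ac)
  then have "epowr ?I (1 / q) \<le> ennreal (q / (q - 1)) * epowr (\<integral>\<^sup>+x. epowr (h x) q \<partial>N) (1 / q)"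
    by simp
  from epowr_mono[OF this, of q] show ?thesis
    using q by (simp add: epowr_epowr epowr_mult epowr_ennreal)
qed

lemma Doob_rave:
  assumes [measurable]: "h \<in> borel_measurable N" and s: "0 < s" "s < t"
  shows "(\<integral>\<^sup>+x. epowr (mf (\<lambda>P. rave s N P h) F x) t \<partial>N)
     \<le> ennreal ((t / (t - s)) powr (t / s)) * (\<integral>\<^sup>+x. epowr (h x) t \<partial>N)"
proof -
  have "epowr (mf (\<lambda>P. rave s N P h) F x) t = epowr (mf (\<lambda>P. ave N P (\<lambda>x. epowr (h x) s)) F x) (t / s)" for x
    using s by (simp add: epowr_mf rave_def epowr_epowr)
  moreover have "t / s / (t / s - 1) = t / (t - s)" using s by (simp add: field_simps)
  ultimately show ?thesis
    using Doob[of "\<lambda>x. epowr (h x) s" "t / s"] s by (simp add: epowr_epowr)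
qed

end

text \<open>On \<open>E P\<close> the number \<open>v P\<close> is at most the maximal function; the
  factor 2 is the overlap of the sets \<open>E P\<close>.\<close>

lemma sum_sparse_le_mf:
  assumes F: "finite F" and E: "\<And>P. P \<in> F \<Longrightarrow> E P \<in> sets N" "\<And>P. P \<in> F \<Longrightarrow> E P \<subseteq> P"
    and overlap: "\<And>x. (\<Sum>P\<in>F. indicator (E P) x) \<le> (2::ennreal)"
    and mf: "mf v F \<in> borel_measurable N"
  shows "(\<Sum>P\<in>F. v P * emeasure N (E P)) \<le> 2 * (\<integral>\<^sup>+x. mf v F x \<partial>N)"
proof -
  have "(\<Sum>P\<in>F. v P * emeasure N (E P)) = (\<Sum>P\<in>F. \<integral>\<^sup>+x. v P * indicator (E P) x \<partial>N)"
    using E by (intro sum.cong) (auto simp: nn_integral_cmult_indicator)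
  also have "\<dots> = (\<integral>\<^sup>+x. (\<Sum>P\<in>F. v P * indicator (E P) x) \<partial>N)"
    using E by (subst nn_integral_sum) auto
  also have "\<dots> \<le> (\<integral>\<^sup>+x. 2 * mf v F x \<partial>N)"
  proof (rule nn_integral_mono)
    fix x
    have "(\<Sum>P\<in>F. v P * indicator (E P) x) \<le> (\<Sum>P\<in>F. mf v F x * indicator (E P) x)"
      using E by (intro sum_mono) (auto split: split_indicator intro!: mf_upper)
    also have "\<dots> \<le> mf v F x * 2"
      unfolding sum_distrib_left[symmetric] by (intro mult_left_mono overlap) auto
    finally show "(\<Sum>P\<in>F. v P * indicator (E P) x) \<le> 2 * mf v F x" by (simp add: mult.commute)
  qed
  also have "\<dots> = 2 * (\<integral>\<^sup>+x. mf v F x \<partial>N)"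
    by (rule nn_integral_cmult[OF mf])
  finally show ?thesis .
qed

declare emeasure_completion [simp del]

section \<open>Dyadic lattices\<close>

text \<open>An abstract lattice. \<open>parent\<close> speaks only of cells inside a larger cell, so
  two cells need not have a common ancestor; d bounds the ratio of the measures of a next larger
  cell and the cell. \<open>finite_between\<close> yields maximal cells, and \<open>small\<close>
  provides the covers for the differentiation argument.\<close>

locale dyadic =
  fixes D :: "'a::euclidean_space set set" and d :: real
  assumes d_ge_1: "1 \<le> d"
    and countable_D: "countable D" and nested_D: "nested D"
    and D_pos: "P \<in> D \<Longrightarrow> finite_pos_set lebesgue P"
    and parent: "P \<in> D \<Longrightarrow> Q \<in> D \<Longrightarrow> P \<subset> Q \<Longrightarrow>
       \<exists>P'\<in>D. P \<subset> P' \<and> P' \<subseteq> Q \<and> emeasure lebesgue P' \<le> ennreal d * emeasure lebesgue P"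
    and finite_between: "P \<in> D \<Longrightarrow> Q \<in> D \<Longrightarrow> finite {R\<in>D. P \<subseteq> R \<and> R \<subseteq> Q}"
    and small: "open U \<Longrightarrow> Q \<in> D \<Longrightarrow> x \<in> U \<Longrightarrow> x \<in> Q \<Longrightarrow> \<exists>P\<in>D. x \<in> P \<and> P \<subseteq> U \<and> P \<subseteq> Q"
begin

lemma D_sets: "P \<in> D \<Longrightarrow> P \<in> sets lebesgue"
  using D_pos finite_pos_set.sets_P by blast

lemma D_nonempty: "P \<in> D \<Longrightarrow> P \<noteq> {}"
  using finite_pos_set.pos[OF D_pos] by force

definition maxi :: "'a set set \<Rightarrow> 'a set set" where
  "maxi C = {P\<in>C. \<forall>R\<in>C. P \<subseteq> R \<longrightarrow> R = P}"

lemma maxi_subset: "maxi C \<subseteq> C"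
  by (auto simp: maxi_def)

lemma exists_maxi:
  assumes C: "C \<subseteq> {P\<in>D. P \<subseteq> Q}" and Q: "Q \<in> D" and P: "P \<in> C"
  shows "\<exists>R\<in>maxi C. P \<subseteq> R"
proof -
  have "finite {R\<in>C. P \<subseteq> R}"
    by (rule finite_subset[OF _ finite_between[of P Q]]) (use assms in blast)+
  from finite_has_maximal[OF this] P obtain R where R: "R \<in> C" "P \<subseteq> R"
      "\<forall>R'\<in>{R\<in>C. P \<subseteq> R}. R \<subseteq> R' \<longrightarrow> R = R'"
    by auto
  then have "R \<in> maxi C" by (auto simp: maxi_def)
  then show ?thesis using R by auto
qed

lemma maxi_disjoint:
  assumes "C \<subseteq> D" "P \<in> maxi C" "R \<in> maxi C" "P \<noteq> R"
  shows "P \<inter> R = {}"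
proof -
  have "P \<in> D" "R \<in> D" "\<not> P \<subseteq> R" "\<not> R \<subseteq> P"
    using assms by (auto simp: maxi_def)
  then show ?thesis
    using nested_D unfolding nested_def by blast
qed

lemma disjoint_maxi: "C \<subseteq> D \<Longrightarrow> disjoint_family_on (\<lambda>P. P) (maxi C)"
  using maxi_disjoint by (auto simp: disjoint_family_on_def)

lemma countable_maxi: "C \<subseteq> D \<Longrightarrow> countable (maxi C)"
  by (rule countable_subset[OF order_trans[OF maxi_subset] countable_D])

lemma UN_maxi_sets: "C \<subseteq> D \<Longrightarrow> \<Union>(maxi C) \<in> sets lebesgue"
  using countable_maxi[of C] by (intro sets.countable_Union) (auto simp: maxi_def intro!: D_sets)

lemma emeasure_UN_maxi:
  assumes C: "C \<subseteq> D" and sets: "sets N = sets lebesgue"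
  shows "emeasure N (\<Union>(maxi C)) = (\<integral>\<^sup>+P. emeasure N P \<partial>count_space (maxi C))"
proof -
  have "P \<in> sets N" if "P \<in> maxi C" for P
    using that C D_sets maxi_subset unfolding sets by blast
  then show ?thesis
    using emeasure_UN_countable[of "maxi C" "\<lambda>P. P" N] disjoint_maxi[OF C] countable_maxi[OF C] by simp
qed

text \<open>
  If all averages over cubes meeting
  \<open>A \<subseteq> {h \<ge> c'}\<close> were at most \<open>c < c'\<close>, then covering \<open>A\<close> by disjoint cubes inside an open
  superset of almost the same measure would give \<open>c' |A| \<le> \<integral>\<^sub>A h \<le> c |A|\<close>.
\<close>

lemma dyadic_differentiation_level:
  fixes c c' :: real
  assumes [measurable]: "h \<in> borel_measurable lebesgue" and Q: "Q \<in> D" and c: "0 \<le> c" "c < c'"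
  shows "AE x in lebesgue. x \<in> Q \<longrightarrow> ennreal c' \<le> h x \<longrightarrow> (\<exists>P\<in>D. x \<in> P \<and> P \<subseteq> Q \<and> ennreal c < ave lebesgue P h)"
proof -
  let ?B = "\<Union>{P\<in>D. P \<subseteq> Q \<and> ennreal c < ave lebesgue P h}"
  define A where "A = {x\<in>Q. ennreal c' \<le> h x} - ?B"
  interpret Q: finite_pos_set lebesgue Q by (rule D_pos[OF Q])
  have [measurable]: "?B \<in> sets lebesgue"
    by (intro sets.countable_Union countable_subset[OF _ countable_D]) (auto intro: D_sets)
  have [measurable]: "A \<in> sets lebesgue"
  proof -
    have "{x\<in>Q. ennreal c' \<le> h x} = Q \<inter> {x\<in>space lebesgue. ennreal c' \<le> h x}" by auto
    also have "\<dots> \<in> sets lebesgue" by measurable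
    finally show ?thesis by (simp add: A_def)
  qed
  have AQ: "A \<subseteq> Q" by (auto simp: A_def)
  have Afin: "emeasure lebesgue A < top"
    using emeasure_mono[OF AQ, of lebesgue] Q.fin by (auto simp: order_le_less_trans)
  have main: "ennreal c' * emeasure lebesgue A \<le> ennreal c * emeasure lebesgue A + ennreal c * ennreal e"
    if e: "0 < e" for e
  proof -
    obtain U where U: "open U" "A \<subseteq> U" "U - A \<in> lmeasurable" "emeasure lebesgue (U - A) < ennreal e"
      using sets_lebesgue_outer_open[OF \<open>A \<in> sets lebesgue\<close> e] by metis
    \<comment> \<open>Each cell of this family meets A, which avoids \<open>?B\<close>, so the
      average of h over it is at most c. Its maximal cells are disjoint, and by \<open>small\<close>
      they cover A.\<close>
    let ?C = "{P\<in>D. P \<subseteq> Q \<and> P \<subseteq> U \<and> P \<inter> A \<noteq> {}}"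
    let ?N = "density lebesgue h"
    have C: "?C \<subseteq> D" "?C \<subseteq> {P\<in>D. P \<subseteq> Q}" by auto
    have cover: "A \<subseteq> \<Union>(maxi ?C)"
    proof
      fix x assume x: "x \<in> A"
      then obtain P where "P \<in> D" "x \<in> P" "P \<subseteq> U" "P \<subseteq> Q"
        using small[OF U(1) Q, of x] U(2) AQ by auto
      then show "x \<in> \<Union>(maxi ?C)" using exists_maxi[OF C(2) Q, of P] x by blast
    qed
    have "ennreal c' * emeasure lebesgue A = (\<integral>\<^sup>+x\<in>A. ennreal c' \<partial>lebesgue)"
      by (simp add: nn_integral_cmult_indicator)
    also have "\<dots> \<le> (\<integral>\<^sup>+x\<in>A. h x \<partial>lebesgue)"
      by (intro nn_integral_mono) (auto simp: A_def split: split_indicator)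
    also have "\<dots> = emeasure ?N A"
      by (simp add: emeasure_density)
    also have "\<dots> \<le> emeasure ?N (\<Union>(maxi ?C))"
      using UN_maxi_sets[OF C(1)] by (intro emeasure_mono cover) simp
    also have "\<dots> = (\<integral>\<^sup>+P. emeasure ?N P \<partial>count_space (maxi ?C))"
      by (rule emeasure_UN_maxi[OF C(1)]) simp
    also have "\<dots> \<le> (\<integral>\<^sup>+P. ennreal c * emeasure lebesgue P \<partial>count_space (maxi ?C))"
    proof (rule nn_integral_mono)
      fix P assume "P \<in> space (count_space (maxi ?C))"
      then have P: "P \<in> D" "P \<subseteq> Q" "P \<inter> A \<noteq> {}" by (auto simp: maxi_def)
      interpret finite_pos_set lebesgue P by (rule D_pos[OF P(1)])
      have "ave lebesgue P h \<le> ennreal c" using P by (auto simp: A_def not_less)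
      then have "ave lebesgue P h * emeasure lebesgue P \<le> ennreal c * emeasure lebesgue P"
        by (intro mult_right_mono) auto
      then show "emeasure ?N P \<le> ennreal c * emeasure lebesgue P"
        by (simp add: ave_mult_emeasure emeasure_density)
    qed
    also have "\<dots> = ennreal c * emeasure lebesgue (\<Union>(maxi ?C))"
      by (subst emeasure_UN_maxi[OF C(1)]) (auto intro: nn_integral_cmult)
    also have "\<dots> \<le> ennreal c * emeasure lebesgue U"
      using U(1) by (intro mult_left_mono emeasure_mono) (auto simp: maxi_def)
    also have "emeasure lebesgue U \<le> emeasure lebesgue A + emeasure lebesgue (U - A)"
    proof -
      have "U = A \<union> (U - A)" using U(2) by auto
      then show ?thesis using emeasure_subadditive[of A lebesgue "U - A"] U(3) by auto
    qed
    also have "\<dots> \<le> emeasure lebesgue A + ennreal e" using U(4) by (intro add_mono) auto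
    finally show ?thesis using c by (simp add: distrib_left mult_left_mono)
  qed
  have "emeasure lebesgue A = 0"
  proof (rule ccontr)
    assume "emeasure lebesgue A \<noteq> 0"
    then obtain a where a: "emeasure lebesgue A = ennreal a" "0 < a"
      using Afin by (cases "emeasure lebesgue A") auto
    \<comment> \<open>Makes c * e smaller than (c' - c) * a, which contradicts \<open>main\<close>;
      the summand 1 in the denominator covers c = 0.\<close>
    define e where "e = (c' - c) * a / (2 * (c + 1))"
    have e: "0 < e" using c a by (auto simp: e_def)
    have "ennreal (c' * a) \<le> ennreal (c * a + c * e)"
      using main[OF e] a c e by (simp add: ennreal_mult)
    then have "c' * a \<le> c * a + c * e" using a c e by (subst (asm) ennreal_le_iff) auto
    moreover have "c * e < (c' - c) * a"
    proof -
      have "c * e \<le> (c + 1) * e" using e by simp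
      also have "\<dots> = (c' - c) * a / 2" using c by (simp add: e_def field_simps)
      also have "\<dots> < (c' - c) * a" using c a by simp
      finally show ?thesis .
    qed
    ultimately show False by (simp add: algebra_simps)
  qed
  then have "A \<in> null_sets lebesgue" by auto
  then show ?thesis
    by (rule AE_I'[where N = A]) (auto simp: A_def)
qed

text \<open>One half of Lebesgue's differentiation theorem, with a supremum in place of a limit. In
  this form it holds for every nonnegative measurable function, integrable or not.\<close>

lemma dyadic_differentiation:
  assumes [measurable]: "h \<in> borel_measurable lebesgue" and Q: "Q \<in> D"
  shows "AE x in lebesgue. x \<in> Q \<longrightarrow> h x \<le> mf (\<lambda>P. ave lebesgue P h) {P\<in>D. P \<subseteq> Q} x"
proof -
  have 1: "AE x in lebesgue. 0 \<le> fst z \<longrightarrow> fst z < snd z \<longrightarrow> x \<in> Q \<longrightarrow> ennreal (snd z) \<le> h x \<longrightarrow>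
     (\<exists>P\<in>D. x \<in> P \<and> P \<subseteq> Q \<and> ennreal (fst z) < ave lebesgue P h)" for z
    using dyadic_differentiation_level[of h Q "fst z" "snd z"] Q
    by (cases "0 \<le> fst z \<and> fst z < snd z") auto
  \<comment> \<open>Two rationals fit between the maximal function and h wherever the claim fails,
    so countably many null sets contain the exceptional set.\<close>
  have cnt: "countable (\<rat> \<times> \<rat> :: (real \<times> real) set)" by (simp add: countable_rat)
  have "AE x in lebesgue. \<forall>z\<in>\<rat> \<times> \<rat>. 0 \<le> fst z \<longrightarrow> fst z < snd z \<longrightarrow> x \<in> Q \<longrightarrow> ennreal (snd z) \<le> h x \<longrightarrow>
     (\<exists>P\<in>D. x \<in> P \<and> P \<subseteq> Q \<and> ennreal (fst z) < ave lebesgue P h)"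
    by (intro iffD2[OF AE_ball_countable[OF cnt]] ballI 1)
  then show ?thesis
  proof (rule eventually_mono)
    fix x
    assume elim: "\<forall>z\<in>\<rat> \<times> \<rat>. 0 \<le> fst z \<longrightarrow> fst z < snd z \<longrightarrow> x \<in> Q \<longrightarrow> ennreal (snd z) \<le> h x \<longrightarrow>
      (\<exists>P\<in>D. x \<in> P \<and> P \<subseteq> Q \<and> ennreal (fst z) < ave lebesgue P h)"
    show "x \<in> Q \<longrightarrow> h x \<le> mf (\<lambda>P. ave lebesgue P h) {P\<in>D. P \<subseteq> Q} x"
    proof (intro impI, rule ccontr)
      let ?m = "mf (\<lambda>P. ave lebesgue P h) {P\<in>D. P \<subseteq> Q} x"
      assume x: "x \<in> Q" and "\<not> h x \<le> ?m"
      then have less: "?m < h x" by simp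
      then obtain c where c: "?m = ennreal c" "0 \<le> c"
        by (cases ?m) (auto simp: less_top[symmetric])
      obtain c' where c': "c < c'" "ennreal c' \<le> h x"
      proof (cases "h x")
        case (real r)
        then show ?thesis using less c that[of r] by (auto simp: ennreal_less_iff)
      next
        case top
        then show ?thesis using that[of "c + 1"] by auto
      qed
      obtain q' where q': "q' \<in> \<rat>" "c < q'" "q' < c'" using Rats_dense_in_real[OF c'(1)] by auto
      obtain q where q: "q \<in> \<rat>" "c < q" "q < q'" using Rats_dense_in_real[OF q'(2)] by auto
      have "ennreal q' \<le> h x" using q' c'(2) by (meson ennreal_leI less_imp_le order_trans)
      then obtain P where P: "P \<in> D" "x \<in> P" "P \<subseteq> Q" "ennreal q < ave lebesgue P h"
        using bspec[OF elim, of "(q, q')"] q q' x c(2) by auto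
      then have "ave lebesgue P h \<le> ?m" by (intro mf_upper) auto
      then have "ennreal q < ennreal c" using P(4) c by simp
      then show False using q c(2) by (simp add: ennreal_less_iff)
    qed
  qed
qed

end

section \<open>A sharp reverse Hoelder inequality\<close>

text \<open>The function d \<epsilon> t^(1+\<epsilon>) - a t^\<epsilon> is nondecreasing on [b, a],
  because a \<le> d b \<le> d t there. This is the jump inequality for a maximal function that rises
  at most by the factor d in one step.\<close>

lemma powr_diff_le':
  assumes "0 < \<epsilon>" "0 < b" "b \<le> a" "a \<le> d * b" "1 \<le> (d::real)"
  shows "a * (a powr \<epsilon> - b powr \<epsilon>) \<le> d * \<epsilon> * (a powr (1 + \<epsilon>) - b powr (1 + \<epsilon>))"
proof -
  define g where "g t = d * \<epsilon> * t powr (1 + \<epsilon>) - a * t powr \<epsilon>" for t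
  have "g b \<le> g a"
  proof (rule DERIV_nonneg_imp_nondecreasing[OF assms(3)])
    fix t assume t: "b \<le> t" "t \<le> a"
    then have t0: "0 < t" using assms by auto
    have "(g has_real_derivative d * \<epsilon> * ((1 + \<epsilon>) * t powr \<epsilon>) - a * (\<epsilon> * t powr (\<epsilon> - 1))) (at t)"
      unfolding g_def using t0 by (auto intro!: derivative_eq_intros simp: powr_diff)
    moreover have "a * (\<epsilon> * t powr (\<epsilon> - 1)) \<le> d * \<epsilon> * ((1 + \<epsilon>) * t powr \<epsilon>)"
    proof -
      have "a \<le> d * t" using t assms by (meson mult_left_mono order_trans zero_le_one)
      also have "d * t \<le> d * ((1 + \<epsilon>) * t)" using t0 assms by (intro mult_left_mono) auto
      finally have "a * (\<epsilon> * t powr (\<epsilon> - 1)) \<le> d * ((1 + \<epsilon>) * t) * (\<epsilon> * t powr (\<epsilon> - 1))"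
        using assms by (intro mult_right_mono) auto
      also have "t * t powr (\<epsilon> - 1) = t powr \<epsilon>" using t0 by (simp add: powr_diff)
      then have "d * ((1 + \<epsilon>) * t) * (\<epsilon> * t powr (\<epsilon> - 1)) = d * \<epsilon> * ((1 + \<epsilon>) * t powr \<epsilon>)"
        by (simp add: mult_ac)
      finally show ?thesis .
    qed
    ultimately show "\<exists>y. (g has_real_derivative y) (at t) \<and> 0 \<le> y" by auto
  qed
  moreover have "a * (a powr \<epsilon> - b powr \<epsilon>) = a * a powr \<epsilon> - a * b powr \<epsilon>" by (simp add: algebra_simps)
  ultimately show ?thesis by (simp add: g_def algebra_simps)
qed

lemma epowr_exp_0: "0 < x \<Longrightarrow> x < top \<Longrightarrow> epowr x 0 = 1"
  by (cases x) (auto simp: epowr_ennreal)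

lemma epowr_antimono: "0 < x \<Longrightarrow> x \<le> y \<Longrightarrow> y < top \<Longrightarrow> a \<le> 0 \<Longrightarrow> epowr y a \<le> epowr x a"
  by (cases x; cases y) (auto simp: epowr_ennreal intro!: ennreal_leI powr_mono2')

lemma nn_integral_set_const:
  "P \<in> sets N \<Longrightarrow> (\<integral>\<^sup>+x\<in>P. c \<partial>N) = c * emeasure N P"
  by (simp add: nn_integral_cmult_indicator)

lemma nn_integral_set_cmult:
  assumes [measurable]: "f \<in> borel_measurable N" "P \<in> sets N"
  shows "(\<integral>\<^sup>+x\<in>P. c * f x \<partial>N) = c * (\<integral>\<^sup>+x\<in>P. f x \<partial>N)"
  by (simp add: mult.assoc nn_integral_cmult)

lemma nn_integral_set_add:
  assumes [measurable]: "f \<in> borel_measurable N" "g \<in> borel_measurable N" "P \<in> sets N"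
  shows "(\<integral>\<^sup>+x\<in>P. f x + g x \<partial>N) = (\<integral>\<^sup>+x\<in>P. f x \<partial>N) + (\<integral>\<^sup>+x\<in>P. g x \<partial>N)"
  by (simp add: distrib_right nn_integral_add)

lemma nn_integral_set_mono:
  "(\<And>x. x \<in> P \<Longrightarrow> f x \<le> g x) \<Longrightarrow> (\<integral>\<^sup>+x\<in>P. f x \<partial>N) \<le> (\<integral>\<^sup>+x\<in>P. g x \<partial>N)"
  by (intro nn_integral_mono) (auto split: split_indicator)

context dyadic
begin

text \<open>Let m be the maximal function, J the integral of s m^\<epsilon>, M that of
  m^(1+\<epsilon>) and S that of s over Q. Bounded jumps of m give J \<le> t0^\<epsilon> S + d
  \<epsilon> M, and M \<le> (2 / \<beta>) J because s exceeds \<beta> times its average on half of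
  each cell. The size of \<epsilon> makes d \<epsilon> (2 / \<beta>) at most 1/2, so J can be
  absorbed.\<close>

lemma reverse_Holder_finite:
  fixes s :: "'a \<Rightarrow> ennreal" and G Q
  defines "v \<equiv> \<lambda>P. ave lebesgue P s"
  assumes [measurable]: "s \<in> borel_measurable lebesgue"
    and fin_s: "\<And>P. P \<in> D \<Longrightarrow> 0 < v P \<and> v P < top"
    and half: "\<And>P. P \<in> D \<Longrightarrow> emeasure lebesgue P \<le> 2 * emeasure lebesgue {x\<in>P. ennreal \<beta> * v P < s x}"
    and \<beta>: "0 < \<beta>" and \<epsilon>: "0 < \<epsilon>" "\<epsilon> \<le> \<beta> / (4 * d)"
    and G: "finite G" "G \<subseteq> {P\<in>D. P \<subseteq> Q}" "Q \<in> G"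
      "\<And>P P'. P \<in> G \<Longrightarrow> P' \<in> D \<Longrightarrow> P \<subseteq> P' \<Longrightarrow> P' \<subseteq> Q \<Longrightarrow> P' \<in> G"
  shows "(\<integral>\<^sup>+x\<in>Q. s x * epowr (mf v G x) \<epsilon> \<partial>lebesgue) \<le> 2 * (epowr (v Q) \<epsilon> * (\<integral>\<^sup>+x\<in>Q. s x \<partial>lebesgue))"
proof -
  define t0 where "t0 = v Q"
  have QD: "Q \<in> D" and GD: "G \<subseteq> D" using G by auto
  interpret Q: finite_pos_set lebesgue Q by (rule D_pos[OF QD])
  have [measurable]: "Q \<in> sets lebesgue" by (rule Q.sets_P)
  have nG: "nested G" "G \<subseteq> sets lebesgue"
    using nested_subset[OF nested_D GD] GD D_sets by auto
  have [measurable]: "mf v G \<in> borel_measurable lebesgue"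
    by (rule measurable_mf[OF countable_finite[OF G(1)] nG(2)])
  define u where "u x = ennreal (1 / \<beta>) * s x" for x
  have [measurable]: "u \<in> borel_measurable lebesgue" unfolding u_def by measurable
  have t0: "0 < t0" "t0 < top" using fin_s[OF QD] by (auto simp: t0_def)
  have m_ge: "t0 \<le> mf v G x" if "x \<in> Q" for x
    unfolding t0_def by (rule mf_upper[OF G(3) that])
  \<comment> \<open>Cutting m off at t0 from below changes nothing on Q, but both inductions then
    start from the value t0, so that adding Q itself is no jump (\<open>Q_step\<close>).\<close>
  have max_m: "max (mf v G x) t0 = mf v G x" if "x \<in> Q" for x
    using m_ge[OF that] by (simp add: max_absorb1)
  let ?S = "\<integral>\<^sup>+x\<in>Q. s x \<partial>lebesgue"
  \<comment> \<open>The next larger cell P' stays in G by the closure of G, so the value before the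
    jump is at least \<open>v P'\<close>; comparing measures gives \<open>v P\<close> at most d
    times \<open>v P'\<close>.\<close>
  have anc_facts: "t0 \<le> anc v G P \<and> v P \<le> ennreal d * anc v G P" if P: "P \<in> G" "P \<noteq> Q" for P
  proof
    have PQ: "P \<subset> Q" "P \<in> D" using P G by auto
    show "t0 \<le> anc v G P" unfolding anc_def t0_def using PQ G by (intro SUP_upper) auto
    obtain P' where P': "P' \<in> D" "P \<subset> P'" "P' \<subseteq> Q" "emeasure lebesgue P' \<le> ennreal d * emeasure lebesgue P"
      using parent[OF PQ(2) QD PQ(1)] by auto
    interpret P: finite_pos_set lebesgue P by (rule D_pos[OF PQ(2)])
    interpret P': finite_pos_set lebesgue P' by (rule D_pos[OF P'(1)])
    have "v P * emeasure lebesgue P' \<le> v P * (ennreal d * emeasure lebesgue P)"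
      by (intro mult_left_mono P') auto
    also have "\<dots> = ennreal d * (\<integral>\<^sup>+x\<in>P. s x \<partial>lebesgue)"
      unfolding v_def P.ave_mult_emeasure[symmetric] by (simp add: mult_ac)
    also have "\<dots> \<le> ennreal d * (\<integral>\<^sup>+x\<in>P'. s x \<partial>lebesgue)"
      using P'(2) by (intro mult_left_mono nn_integral_mono) (auto split: split_indicator)
    also have "\<dots> = ennreal d * v P' * emeasure lebesgue P'"
      unfolding v_def P'.ave_mult_emeasure[symmetric] by (simp add: mult_ac)
    finally have "emeasure lebesgue P' * v P \<le> emeasure lebesgue P' * (ennreal d * v P')"
      by (simp add: mult_ac)
    then have "v P \<le> ennreal d * v P'"
      by (subst (asm) ennreal_mult_le_mult_iff) (use P'.pos P'.fin in auto)
    also have "v P' \<le> anc v G P"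
      unfolding anc_def using P' G(4)[OF P(1) P'(1) _ P'(3)] by (intro SUP_upper) auto
    finally show "v P \<le> ennreal d * anc v G P" by (simp add: mult_left_mono)
  qed
  have reals: "\<exists>a b n. v P = ennreal a \<and> anc v G P = ennreal b \<and> emeasure lebesgue P = ennreal n \<and>
      0 < b \<and> b < a \<and> a \<le> d * b \<and> 0 < n \<and> t0 \<le> ennreal b"
    if P: "P \<in> G" "P \<noteq> Q" and less: "anc v G P < v P" for P
  proof -
    have PD: "P \<in> D" using P GD by auto
    interpret P: finite_pos_set lebesgue P by (rule D_pos[OF PD])
    obtain a b n where r: "v P = ennreal a" "anc v G P = ennreal b" "emeasure lebesgue P = ennreal n" "0 \<le> a" "0 \<le> b" "0 \<le> n"
      using less fin_s[OF PD] P.fin by (cases "v P"; cases "anc v G P"; cases "emeasure lebesgue P") auto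
    have "0 < n" using P.pos r by auto
    moreover have tb: "t0 \<le> ennreal b" using anc_facts[OF P] r by simp
    moreover have "0 < b"
      using order_less_le_trans[OF t0(1) tb] by auto
    moreover have "b < a" using less r by (simp add: ennreal_less_iff)
    moreover have "ennreal a \<le> ennreal d * ennreal b" using anc_facts[OF P] r by simp
    then have "a \<le> d * b"
      using r d_ge_1 by (simp flip: ennreal_mult)
    ultimately show ?thesis using r by blast
  qed
  have Q_step: "max (v P) t0 = max (anc v G P) t0" if "P \<in> G" "P = Q" for P
  proof -
    have "{P' \<in> G. Q \<subset> P'} = {}" using G by auto
    then have "anc v G Q = 0" by (simp only: anc_def) (simp add: bot_ennreal)
    then show ?thesis using that by (simp add: t0_def)
  qed
  \<comment> \<open>A jump from b to a on P, with n the measure of P, adds a n (a^\<epsilon> -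
    b^\<epsilon>) on the left and d \<epsilon> n (a^(1+\<epsilon>) - b^(1+\<epsilon>)) on the
    right.\<close>
  have I1: "(\<integral>\<^sup>+x. indicator Q x * (s x * epowr (max (mf v G x) t0) \<epsilon>) \<partial>lebesgue)
     \<le> (\<integral>\<^sup>+x. indicator Q x * (s x * epowr t0 \<epsilon> + ennreal (d * \<epsilon>) * epowr (max (mf v G x) t0) (1 + \<epsilon>)) \<partial>lebesgue)"
  proof (rule nested_mf_induct[OF G(1) nG])
    fix P X Y assume P: "P \<in> G" and less: "anc v G P < v P"
    assume IH: "X + (\<integral>\<^sup>+x\<in>P. indicator Q x * (s x * epowr (max (anc v G P) t0) \<epsilon>) \<partial>lebesgue)
      \<le> Y + (\<integral>\<^sup>+x\<in>P. indicator Q x * (s x * epowr t0 \<epsilon> + ennreal (d * \<epsilon>) * epowr (max (anc v G P) t0) (1 + \<epsilon>)) \<partial>lebesgue)"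
    show "X + (\<integral>\<^sup>+x\<in>P. indicator Q x * (s x * epowr (max (v P) t0) \<epsilon>) \<partial>lebesgue)
      \<le> Y + (\<integral>\<^sup>+x\<in>P. indicator Q x * (s x * epowr t0 \<epsilon> + ennreal (d * \<epsilon>) * epowr (max (v P) t0) (1 + \<epsilon>)) \<partial>lebesgue)"
    proof (cases "P = Q")
      case True
      then show ?thesis using IH Q_step[OF P] by simp
    next
      case False
      obtain a b n where r: "v P = ennreal a" "anc v G P = ennreal b" "emeasure lebesgue P = ennreal n"
        "0 < b" "b < a" "a \<le> d * b" "0 < n" "t0 \<le> ennreal b"
        using reals[OF P False less] by blast
      have PD: "P \<in> D" "P \<subseteq> Q" using P G by auto
      interpret P: finite_pos_set lebesgue P by (rule D_pos[OF PD(1)])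
      have S: "(\<integral>\<^sup>+x\<in>P. s x \<partial>lebesgue) = ennreal (a * n)"
        using P.ave_mult_emeasure[of s] r unfolding v_def by (simp add: ennreal_mult)
      have "epowr t0 \<epsilon> < top" using t0 by simp
      then obtain e where e: "epowr t0 \<epsilon> = ennreal e" "0 \<le> e" by (metis ennreal_cases less_irrefl)
      have L: "(\<integral>\<^sup>+x\<in>P. indicator Q x * (s x * epowr (max (ennreal c) t0) \<epsilon>) \<partial>lebesgue) = ennreal (a * n * c powr \<epsilon>)"
        if "b \<le> c" for c
      proof -
        have "max (ennreal c) t0 = ennreal c"
          using r(8) that by (meson ennreal_leI max_absorb1 order_trans)
        then have "indicator Q x * (s x * epowr (max (ennreal c) t0) \<epsilon>) * indicator P x
            = ennreal (c powr \<epsilon>) * s x * indicator P x" for x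
          using PD(2) that r by (auto split: split_indicator simp: mult.commute epowr_ennreal)
        then have "(\<integral>\<^sup>+x\<in>P. indicator Q x * (s x * epowr (max (ennreal c) t0) \<epsilon>) \<partial>lebesgue)
            = ennreal (c powr \<epsilon>) * ennreal (a * n)"
          by (simp only: nn_integral_set_cmult[OF assms(2) P.sets_P] S)
        then show ?thesis by (simp add: ennreal_mult'' mult.commute)
      qed
      have R: "(\<integral>\<^sup>+x\<in>P. indicator Q x * (s x * epowr t0 \<epsilon> + ennreal (d * \<epsilon>) * epowr (max (ennreal c) t0) (1 + \<epsilon>)) \<partial>lebesgue)
         = ennreal (a * n * e + d * \<epsilon> * n * c powr (1 + \<epsilon>))"
        if "b \<le> c" for c
      proof -
        have "max (ennreal c) t0 = ennreal c"
          using r(8) that by (meson ennreal_leI max_absorb1 order_trans)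
        then have "indicator Q x * (s x * epowr t0 \<epsilon> + ennreal (d * \<epsilon>) * epowr (max (ennreal c) t0) (1 + \<epsilon>)) * indicator P x
            = (ennreal e * s x + ennreal (d * \<epsilon> * c powr (1 + \<epsilon>))) * indicator P x" for x
          using PD(2) that r e d_ge_1 \<epsilon>(1)
          by (auto split: split_indicator simp: mult.commute epowr_ennreal ennreal_mult')
        then have "(\<integral>\<^sup>+x\<in>P. indicator Q x * (s x * epowr t0 \<epsilon> + ennreal (d * \<epsilon>) * epowr (max (ennreal c) t0) (1 + \<epsilon>)) \<partial>lebesgue)
            = ennreal e * ennreal (a * n) + ennreal (d * \<epsilon> * c powr (1 + \<epsilon>)) * ennreal n"
          by (simp add: nn_integral_set_add nn_integral_set_cmult nn_integral_set_const S r(3))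
        then show ?thesis using r e d_ge_1 \<epsilon>(1) by (simp add: mult_ac flip: ennreal_mult ennreal_plus)
      qed
      have "n * (a * (a powr \<epsilon> - b powr \<epsilon>)) \<le> n * (d * \<epsilon> * (a powr (1 + \<epsilon>) - b powr (1 + \<epsilon>)))"
        using powr_diff_le'[of \<epsilon> b a d] r \<epsilon> d_ge_1 by (intro mult_left_mono) auto
      then have d: "a * n * a powr \<epsilon> - a * n * b powr \<epsilon>
          \<le> (a * n * e + d * \<epsilon> * n * a powr (1 + \<epsilon>)) - (a * n * e + d * \<epsilon> * n * b powr (1 + \<epsilon>))"
        by (simp add: algebra_simps)
      have m: "a * n * b powr \<epsilon> \<le> a * n * a powr \<epsilon>"
        using r \<epsilon>(1) by (intro mult_left_mono powr_mono2) auto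
      have z: "0 \<le> a * n * b powr \<epsilon>" "0 \<le> a * n * e + d * \<epsilon> * n * b powr (1 + \<epsilon>)"
        using r \<epsilon>(1) d_ge_1 e by auto
      show ?thesis
        using ennreal_increment[OF IH[unfolded r(1,2) L[OF order_refl] R[OF order_refl]] z(1) m z(2) d]
        unfolding r(1) L[OF less_imp_le[OF r(5)]] R[OF less_imp_le[OF r(5)]] .
    qed
  qed (auto simp: max_def not_le intro!: nn_integral_mono mult_left_mono add_increasing2)
  \<comment> \<open>Where s exceeds \<beta> a, the function u = s / \<beta> exceeds a, and the
    minimum makes the full jump. This happens on at least half of P, hence the factor 2.\<close>
  have I2: "(\<integral>\<^sup>+x. indicator Q x * epowr (max (mf v G x) t0) (1 + \<epsilon>) \<partial>lebesgue)
     \<le> (\<integral>\<^sup>+x. 2 * (indicator Q x * epowr (min (max (mf v G x) t0) (u x)) (1 + \<epsilon>)) \<partial>lebesgue)"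
  proof (rule nested_mf_induct[OF G(1) nG])
    define H where "H P c = {x\<in>P. ennreal \<beta> * c < s x}" for P c
    have H_sets [measurable]: "H P c \<in> sets lebesgue" if "P \<in> sets lebesgue" for P c
    proof -
      have "H P c = P \<inter> {x\<in>space lebesgue. ennreal \<beta> * c < s x}" by (auto simp: H_def)
      also have "\<dots> \<in> sets lebesgue" using that by measurable
      finally show ?thesis .
    qed
    have u_ge: "c \<le> u x" if "x \<in> H P c" for x c P
    proof -
      have "ennreal (1 / \<beta>) * (ennreal \<beta> * c) \<le> u x"
        unfolding u_def using that by (intro mult_left_mono) (auto simp: H_def)
      then show ?thesis using \<beta> by (simp add: mult.assoc[symmetric] flip: ennreal_mult)
    qed
    show "(\<integral>\<^sup>+x. indicator Q x * epowr (max 0 t0) (1 + \<epsilon>) \<partial>lebesgue)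
      \<le> (\<integral>\<^sup>+x. 2 * (indicator Q x * epowr (min (max 0 t0) (u x)) (1 + \<epsilon>)) \<partial>lebesgue)"
    proof -
      have "(\<integral>\<^sup>+x. indicator Q x * epowr (max 0 t0) (1 + \<epsilon>) \<partial>lebesgue) = epowr t0 (1 + \<epsilon>) * emeasure lebesgue Q"
        by (simp add: mult.commute[of "indicator Q _"] nn_integral_set_const)
      also have "\<dots> \<le> epowr t0 (1 + \<epsilon>) * (2 * emeasure lebesgue (H Q t0))"
        unfolding H_def t0_def by (intro mult_left_mono half QD) auto
      also have "\<dots> = (\<integral>\<^sup>+x\<in>H Q t0. 2 * epowr t0 (1 + \<epsilon>) \<partial>lebesgue)"
        using nn_integral_set_const[OF H_sets[OF Q.sets_P, of t0], of "2 * epowr t0 (1 + \<epsilon>)"] by (simp only: mult_ac)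
      also have "\<dots> \<le> (\<integral>\<^sup>+x. 2 * (indicator Q x * epowr (min (max 0 t0) (u x)) (1 + \<epsilon>)) \<partial>lebesgue)"
        using u_ge[of _ Q t0]
        by (intro nn_integral_mono) (auto split: split_indicator simp: min_absorb1 H_def)
      finally show ?thesis .
    qed
    fix P X Y assume P: "P \<in> G" and less: "anc v G P < v P"
    assume IH: "X + (\<integral>\<^sup>+x\<in>P. indicator Q x * epowr (max (anc v G P) t0) (1 + \<epsilon>) \<partial>lebesgue)
      \<le> Y + (\<integral>\<^sup>+x\<in>P. 2 * (indicator Q x * epowr (min (max (anc v G P) t0) (u x)) (1 + \<epsilon>)) \<partial>lebesgue)"
    show "X + (\<integral>\<^sup>+x\<in>P. indicator Q x * epowr (max (v P) t0) (1 + \<epsilon>) \<partial>lebesgue)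
      \<le> Y + (\<integral>\<^sup>+x\<in>P. 2 * (indicator Q x * epowr (min (max (v P) t0) (u x)) (1 + \<epsilon>)) \<partial>lebesgue)"
    proof (cases "P = Q")
      case True
      then show ?thesis using IH Q_step[OF P] by simp
    next
      case False
      obtain a b n where r: "v P = ennreal a" "anc v G P = ennreal b" "emeasure lebesgue P = ennreal n"
        "0 < b" "b < a" "a \<le> d * b" "0 < n" "t0 \<le> ennreal b"
        using reals[OF P False less] by blast
      have PD: "P \<in> D" "P \<subseteq> Q" using P G by auto
      interpret P: finite_pos_set lebesgue P by (rule D_pos[OF PD(1)])
      have [measurable]: "P \<in> sets lebesgue" by (rule P.sets_P)
      define \<Delta> where "\<Delta> = ennreal (a powr (1 + \<epsilon>) - b powr (1 + \<epsilon>))"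
      have ab: "epowr (ennreal a) (1 + \<epsilon>) = epowr (ennreal b) (1 + \<epsilon>) + \<Delta>"
        using r \<epsilon>(1) unfolding \<Delta>_def
        by (auto simp: epowr_ennreal powr_mono2 simp flip: ennreal_plus)
      have mx: "max (ennreal a) t0 = ennreal a" "max (ennreal b) t0 = ennreal b"
        using r by (meson ennreal_leI less_imp_le max_absorb1 order_trans)+
      have iPQ: "indicator Q x * K * indicator P x = K * indicator P x"
        "2 * (indicator Q x * K) * indicator P x = 2 * K * indicator P x" for x and K :: ennreal
        using PD(2) by (auto split: split_indicator)
      have "\<Delta> * emeasure lebesgue P \<le> \<Delta> * (2 * emeasure lebesgue (H P (ennreal a)))"
        unfolding H_def r(1)[symmetric] by (intro mult_left_mono half PD) auto
      also have "\<dots> = (\<integral>\<^sup>+x\<in>P. 2 * \<Delta> * indicator (H P (ennreal a)) x \<partial>lebesgue)"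
      proof -
        have "2 * \<Delta> * indicator (H P (ennreal a)) x * indicator P x = 2 * \<Delta> * indicator (H P (ennreal a)) x" for x
          by (auto simp: H_def split: split_indicator)
        then show ?thesis
          using nn_integral_set_const[OF H_sets[OF P.sets_P, of "ennreal a"], of "2 * \<Delta>"] by (simp only: mult_ac)
      qed
      finally have d: "\<Delta> * emeasure lebesgue P \<le> (\<integral>\<^sup>+x\<in>P. 2 * \<Delta> * indicator (H P (ennreal a)) x \<partial>lebesgue)" .
      have pt: "2 * epowr (min (ennreal b) (u x)) (1 + \<epsilon>) + 2 * \<Delta> * indicator (H P (ennreal a)) x
         \<le> 2 * epowr (min (ennreal a) (u x)) (1 + \<epsilon>)" for x
      proof (cases "x \<in> H P (ennreal a)")
        case True
        have "ennreal b \<le> ennreal a" using r by (intro ennreal_leI) auto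
        then have "min (ennreal b) (u x) = ennreal b" "min (ennreal a) (u x) = ennreal a"
          using u_ge[OF True] by (auto simp: min_absorb1)
        then show ?thesis using True by (simp add: ab distrib_left)
      next
        case False
        have "ennreal b \<le> ennreal a" using r by (intro ennreal_leI) auto
        then show ?thesis using False \<epsilon>(1) by (auto intro!: mult_left_mono epowr_mono min.mono)
      qed
      have "X + (\<integral>\<^sup>+x\<in>P. indicator Q x * epowr (max (v P) t0) (1 + \<epsilon>) \<partial>lebesgue)
         = X + (\<integral>\<^sup>+x\<in>P. indicator Q x * epowr (max (anc v G P) t0) (1 + \<epsilon>) \<partial>lebesgue) + \<Delta> * emeasure lebesgue P"
        unfolding r(1,2) mx iPQ ab nn_integral_set_const[OF P.sets_P] by (simp add: distrib_right add.assoc)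
      also have "\<dots> \<le> Y + (\<integral>\<^sup>+x\<in>P. 2 * (indicator Q x * epowr (min (max (anc v G P) t0) (u x)) (1 + \<epsilon>)) \<partial>lebesgue)
        + (\<integral>\<^sup>+x\<in>P. 2 * \<Delta> * indicator (H P (ennreal a)) x \<partial>lebesgue)"
        by (intro add_mono IH d)
      also have "\<dots> = Y + (\<integral>\<^sup>+x\<in>P. 2 * epowr (min (ennreal b) (u x)) (1 + \<epsilon>) + 2 * \<Delta> * indicator (H P (ennreal a)) x \<partial>lebesgue)"
        unfolding r(1,2) mx iPQ by (subst nn_integral_set_add) (auto simp: add.assoc)
      also have "\<dots> \<le> Y + (\<integral>\<^sup>+x\<in>P. 2 * epowr (min (ennreal a) (u x)) (1 + \<epsilon>) \<partial>lebesgue)"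
        by (intro add_left_mono nn_integral_set_mono pt)
      finally show ?thesis unfolding r(1) mx iPQ .
    qed
  qed auto
  let ?J = "\<integral>\<^sup>+x\<in>Q. s x * epowr (mf v G x) \<epsilon> \<partial>lebesgue"
  let ?M = "\<integral>\<^sup>+x\<in>Q. epowr (mf v G x) (1 + \<epsilon>) \<partial>lebesgue"
  have S_fin: "?S < top"
    using fin_s[OF QD] Q.fin unfolding Q.ave_mult_emeasure[symmetric] v_def
    by (auto simp: ennreal_mult_less_top)
  have J1: "?J \<le> epowr t0 \<epsilon> * ?S + ennreal (d * \<epsilon>) * ?M"
  proof -
    have "?J = (\<integral>\<^sup>+x. indicator Q x * (s x * epowr (max (mf v G x) t0) \<epsilon>) \<partial>lebesgue)"
      by (intro nn_integral_cong) (auto split: split_indicator simp: max_m)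
    also note I1
    also have "(\<integral>\<^sup>+x. indicator Q x * (s x * epowr t0 \<epsilon> + ennreal (d * \<epsilon>) * epowr (max (mf v G x) t0) (1 + \<epsilon>)) \<partial>lebesgue)
      = (\<integral>\<^sup>+x\<in>Q. epowr t0 \<epsilon> * s x + ennreal (d * \<epsilon>) * epowr (mf v G x) (1 + \<epsilon>) \<partial>lebesgue)"
      by (intro nn_integral_cong) (auto split: split_indicator simp: max_m mult.commute)
    also have "\<dots> = epowr t0 \<epsilon> * ?S + ennreal (d * \<epsilon>) * ?M"
      by (simp add: nn_integral_set_add nn_integral_set_cmult)
    finally show ?thesis .
  qed
  have M1: "?M \<le> ennreal (2 / \<beta>) * ?J"
  proof -
    have "?M = (\<integral>\<^sup>+x. indicator Q x * epowr (max (mf v G x) t0) (1 + \<epsilon>) \<partial>lebesgue)"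
      by (intro nn_integral_cong) (auto split: split_indicator simp: max_m)
    also note I2
    also have "(\<integral>\<^sup>+x. 2 * (indicator Q x * epowr (min (max (mf v G x) t0) (u x)) (1 + \<epsilon>)) \<partial>lebesgue)
       \<le> (\<integral>\<^sup>+x\<in>Q. ennreal (2 / \<beta>) * (s x * epowr (mf v G x) \<epsilon>) \<partial>lebesgue)"
    proof (rule nn_integral_mono)
      fix x
      have "2 * epowr (min (mf v G x) (u x)) (1 + \<epsilon>) \<le> ennreal (2 / \<beta>) * (s x * epowr (mf v G x) \<epsilon>)"
      proof -
        have "epowr (min (mf v G x) (u x)) (1 + \<epsilon>) \<le> u x * epowr (mf v G x) \<epsilon>"
          unfolding epowr_add1 using \<epsilon>(1) by (intro mult_mono epowr_mono) auto
        then have "2 * epowr (min (mf v G x) (u x)) (1 + \<epsilon>) \<le> 2 * (u x * epowr (mf v G x) \<epsilon>)"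
          by (intro mult_left_mono) auto
        also have "\<dots> = (2 * ennreal (1 / \<beta>)) * (s x * epowr (mf v G x) \<epsilon>)"
          by (simp add: u_def mult_ac)
        also have "2 * ennreal (1 / \<beta>) = ennreal (2 / \<beta>)"
          using \<beta> by (simp flip: ennreal_mult ennreal_numeral)
        finally show ?thesis .
      qed
      then show "2 * (indicator Q x * epowr (min (max (mf v G x) t0) (u x)) (1 + \<epsilon>))
         \<le> ennreal (2 / \<beta>) * (s x * epowr (mf v G x) \<epsilon>) * indicator Q x"
        by (auto split: split_indicator simp: max_m)
    qed
    also have "\<dots> = ennreal (2 / \<beta>) * ?J" by (simp add: nn_integral_set_cmult)
    finally show ?thesis .
  qed
  have "finite (v ` G)" "v ` G \<noteq> {}" using G by auto
  define c where "c = (SUP P\<in>G. v P)"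
  have c: "c < top"
    using fin_s GD \<open>finite (v ` G)\<close> \<open>v ` G \<noteq> {}\<close> unfolding c_def by (subst cSup_eq_Max) auto
  have J_fin: "?J < top"
  proof -
    have "?J \<le> (\<integral>\<^sup>+x\<in>Q. epowr c \<epsilon> * s x \<partial>lebesgue)"
      using \<epsilon>(1) unfolding c_def
      by (intro nn_integral_set_mono, subst mult.commute)
        (auto intro!: mult_right_mono epowr_mono mf_least SUP_upper)
    also have "\<dots> < top" using c S_fin by (simp add: nn_integral_set_cmult ennreal_mult_less_top)
    finally show ?thesis .
  qed
  have "?J \<le> epowr t0 \<epsilon> * ?S + ennreal (d * \<epsilon>) * (ennreal (2 / \<beta>) * ?J)"
    by (intro order_trans[OF J1] add_left_mono mult_left_mono M1) auto
  also have "ennreal (d * \<epsilon>) * (ennreal (2 / \<beta>) * ?J) \<le> ennreal (1 / 2) * ?J"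
  proof -
    have "ennreal (d * \<epsilon>) * (ennreal (2 / \<beta>) * ?J) = ennreal (d * \<epsilon> * (2 / \<beta>)) * ?J"
      using \<beta> \<epsilon> d_ge_1 by (subst mult.assoc[symmetric], subst ennreal_mult[symmetric]) auto
    also have "\<dots> \<le> ennreal (1 / 2) * ?J"
    proof (intro mult_right_mono ennreal_leI)
      have "d * \<epsilon> \<le> \<beta> / 4" using \<epsilon>(2) d_ge_1 by (simp add: field_simps)
      then show "d * \<epsilon> * (2 / \<beta>) \<le> 1 / 2" using \<beta> by (simp add: field_simps)
    qed simp
    finally show ?thesis .
  qed
  finally have "?J \<le> epowr t0 \<epsilon> * ?S + ennreal (1 / 2) * ?J" by (simp add: add_left_mono)
  moreover obtain j where j: "?J = ennreal j" "0 \<le> j" using J_fin by (cases ?J) auto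
  moreover have "epowr t0 \<epsilon> * ?S < top" using t0 S_fin by (simp add: ennreal_mult_less_top)
  then obtain k where k: "epowr t0 \<epsilon> * ?S = ennreal k" "0 \<le> k"
    by (cases "epowr t0 \<epsilon> * ?S") auto
  ultimately have "ennreal j \<le> ennreal k + ennreal (1 / 2) * ennreal j" by simp
  also have "ennreal (1 / 2) * ennreal j = ennreal (j / 2)"
    using j(2) by (simp flip: ennreal_mult del: ennreal_half)
  also have "ennreal k + ennreal (j / 2) = ennreal (k + j / 2)" using j(2) k(2) by simp
  finally have "ennreal j \<le> ennreal (k + j / 2)" .
  then have "j \<le> 2 * k" using j k by (subst (asm) ennreal_le_iff) auto
  then have "ennreal j \<le> ennreal (2 * k)" by (rule ennreal_leI)
  then show ?thesis using j k by (simp add: t0_def ennreal_mult)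
qed

end

context dyadic
begin

text \<open>The i-th family consists of all cells that lie between Q and one of the cells with
  number at most i in an enumeration. Such families are finite and closed upwards, as
  \<open>reverse_Holder_finite\<close> demands.\<close>

lemma exhaustion:
  assumes Q: "Q \<in> D"
  obtains G where "\<forall>i::nat. finite (G i)" "\<forall>i. G i \<subseteq> {P\<in>D. P \<subseteq> Q}" "\<forall>i. Q \<in> G i"
    "\<forall>i. \<forall>P\<in>G i. \<forall>P'\<in>D. P \<subseteq> P' \<longrightarrow> P' \<subseteq> Q \<longrightarrow> P' \<in> G i"
    "incseq G" "(\<Union>i. G i) = {P\<in>D. P \<subseteq> Q}"
proof -
  let ?S = "{P\<in>D. P \<subseteq> Q}"
  define p where "p = from_nat_into ?S"
  have cS: "countable ?S" by (rule countable_subset[OF _ countable_D]) auto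
  have pS: "p i \<in> ?S" for i
    unfolding p_def using Q by (intro from_nat_into) auto
  define G where "G i = (\<Union>j\<le>i. {R\<in>D. p j \<subseteq> R \<and> R \<subseteq> Q})" for i
  show ?thesis
  proof
    show "\<forall>i. finite (G i)"
      unfolding G_def using finite_between[OF _ Q] pS by auto
    show "\<forall>i. G i \<subseteq> ?S" by (auto simp: G_def)
    show "\<forall>i. Q \<in> G i" using Q pS by (auto simp: G_def)
    show "\<forall>i. \<forall>P\<in>G i. \<forall>P'\<in>D. P \<subseteq> P' \<longrightarrow> P' \<subseteq> Q \<longrightarrow> P' \<in> G i"
      unfolding G_def by blast
    show "incseq G" unfolding incseq_def G_def by fastforce
    have "P \<in> (\<Union>i. G i)" if P: "P \<in> ?S" for P
    proof -
      obtain i where "p i = P"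
        using from_nat_into_surj[OF cS P] by (auto simp: p_def)
      then have "P \<in> G i" using P by (auto simp: G_def)
      then show ?thesis by blast
    qed
    then show "(\<Union>i. G i) = ?S" by (auto simp: G_def)
  qed
qed

lemma mf_UN_incseq: "mf v (\<Union>i. G i) x = (SUP i. mf v (G i) x)"
proof (rule antisym)
  show "mf v (\<Union>i. G i) x \<le> (SUP i. mf v (G i) x)"
    by (rule mf_least) (auto intro!: SUP_upper2 mf_upper)
  show "(SUP i. mf v (G i) x) \<le> mf v (\<Union>i. G i) x"
    by (intro SUP_least mf_least mf_upper) auto
qed

text \<open>By \<open>dyadic_differentiation\<close> s is at most the maximal function m almost
  everywhere, so s^(1+\<epsilon>) \<le> s m^\<epsilon>; the finite families exhaust m
  monotonically.\<close>

theorem reverse_Holder: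
  assumes [measurable]: "s \<in> borel_measurable lebesgue"
    and fin_s: "\<And>P. P \<in> D \<Longrightarrow> 0 < ave lebesgue P s \<and> ave lebesgue P s < top"
    and half: "\<And>P. P \<in> D \<Longrightarrow>
      emeasure lebesgue P \<le> 2 * emeasure lebesgue {x\<in>P. ennreal \<beta> * ave lebesgue P s < s x}"
    and \<beta>: "0 < \<beta>" and \<epsilon>: "0 < \<epsilon>" "\<epsilon> \<le> \<beta> / (4 * d)" and Q: "Q \<in> D"
  shows "ave lebesgue Q (\<lambda>x. epowr (s x) (1 + \<epsilon>)) \<le> 2 * epowr (ave lebesgue Q s) (1 + \<epsilon>)"
proof -
  let ?v = "\<lambda>P. ave lebesgue P s"
  interpret Q: finite_pos_set lebesgue Q by (rule D_pos[OF Q])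
  obtain G where G': "\<forall>i::nat. finite (G i)" "\<forall>i. G i \<subseteq> {P\<in>D. P \<subseteq> Q}" "\<forall>i. Q \<in> G i"
    "\<forall>i. \<forall>P\<in>G i. \<forall>P'\<in>D. P \<subseteq> P' \<longrightarrow> P' \<subseteq> Q \<longrightarrow> P' \<in> G i"
    "incseq G" "(\<Union>i. G i) = {P\<in>D. P \<subseteq> Q}"
    using exhaustion[OF Q] .
  have G: "\<And>i. finite (G i)" "\<And>i. G i \<subseteq> {P\<in>D. P \<subseteq> Q}" "\<And>i. Q \<in> G i"
    "\<And>i P P'. P \<in> G i \<Longrightarrow> P' \<in> D \<Longrightarrow> P \<subseteq> P' \<Longrightarrow> P' \<subseteq> Q \<Longrightarrow> P' \<in> G i"
    "incseq G" "(\<Union>i. G i) = {P\<in>D. P \<subseteq> Q}"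
    using G' by blast+
  have Gs: "G i \<subseteq> sets lebesgue" for i using G(2)[of i] D_sets by auto
  have [measurable]: "mf ?v (G i) \<in> borel_measurable lebesgue" for i
    by (rule measurable_mf[OF countable_finite[OF G(1)] Gs])
  have mono: "mf ?v (G i) x \<le> mf ?v (G j) x" if "i \<le> j" for i j x
    using incseqD[OF G(5) that] by (intro mf_least mf_upper) auto
  have inc: "incseq (\<lambda>i x. s x * epowr (mf ?v (G i) x) \<epsilon> * indicator Q x)"
    using \<epsilon>(1) by (intro incseq_SucI le_funI mult_right_mono mult_left_mono epowr_mono mono) auto
  have "(\<integral>\<^sup>+x\<in>Q. epowr (s x) (1 + \<epsilon>) \<partial>lebesgue)
      \<le> (\<integral>\<^sup>+x. (SUP i. s x * epowr (mf ?v (G i) x) \<epsilon> * indicator Q x) \<partial>lebesgue)"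
  proof (rule nn_integral_mono_AE)
    have "AE x in lebesgue. x \<in> Q \<longrightarrow> s x \<le> (SUP i. mf ?v (G i) x)"
      using dyadic_differentiation[of s Q] Q unfolding G(6)[symmetric] mf_UN_incseq by simp
    then show "AE x in lebesgue. epowr (s x) (1 + \<epsilon>) * indicator Q x
       \<le> (SUP i. s x * epowr (mf ?v (G i) x) \<epsilon> * indicator Q x)"
    proof (rule eventually_mono)
      fix x assume x: "x \<in> Q \<longrightarrow> s x \<le> (SUP i. mf ?v (G i) x)"
      show "epowr (s x) (1 + \<epsilon>) * indicator Q x \<le> (SUP i. s x * epowr (mf ?v (G i) x) \<epsilon> * indicator Q x)"
      proof (cases "x \<in> Q")
        case True
        then have "s x * epowr (s x) \<epsilon> \<le> s x * epowr (SUP i. mf ?v (G i) x) \<epsilon>"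
          using x \<epsilon>(1) by (intro mult_left_mono epowr_mono) auto
        also have "\<dots> = (SUP i. s x * epowr (mf ?v (G i) x) \<epsilon>)"
          using \<epsilon>(1) by (simp add: epowr_SUP SUP_mult_left_ennreal)
        finally show ?thesis using True by (simp add: epowr_add1)
      qed simp
    qed
  qed
  also have "\<dots> = (SUP i. \<integral>\<^sup>+x\<in>Q. s x * epowr (mf ?v (G i) x) \<epsilon> \<partial>lebesgue)"
    by (rule nn_integral_monotone_convergence_SUP[OF inc]) measurable
  also have "\<dots> \<le> 2 * (epowr (?v Q) \<epsilon> * (\<integral>\<^sup>+x\<in>Q. s x \<partial>lebesgue))"
    by (intro SUP_least reverse_Holder_finite[OF assms(1) fin_s half \<beta> \<epsilon> G(1,2,3,4)])
  also have "\<dots> = 2 * epowr (?v Q) (1 + \<epsilon>) * emeasure lebesgue Q"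
    unfolding Q.ave_mult_emeasure[symmetric] by (simp add: epowr_add1 mult_ac)
  finally show ?thesis
    unfolding ave_def[of _ _ "\<lambda>x. epowr (s x) (1 + \<epsilon>)"]
    using divide_right_mono_ennreal[of _ _ "emeasure lebesgue Q"] Q.pos Q.fin
    by (metis ennreal_mult_divide_eq less_top not_gr_zero)
qed

end

section \<open>Dyadic \<open>A\<^sub>p\<close> weights\<close>

text \<open>Positivity and finiteness at every point, not only almost everywhere, let powers of
  either sign be cancelled pointwise.\<close>

definition pos_weight :: "('a::euclidean_space \<Rightarrow> ennreal) \<Rightarrow> bool" where
  "pos_weight w \<longleftrightarrow> w \<in> borel_measurable lebesgue \<and> (\<forall>x. 0 < w x \<and> w x < top)"

lemma pos_weight_measurable [measurable_dest]: "pos_weight w \<Longrightarrow> w \<in> borel_measurable lebesgue"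
  by (simp add: pos_weight_def)

lemma pos_weight_epowr: "pos_weight w \<Longrightarrow> pos_weight (\<lambda>x. epowr (w x) a)"
  by (auto simp: pos_weight_def)

definition dual_weight :: "real \<Rightarrow> ('a \<Rightarrow> ennreal) \<Rightarrow> 'a \<Rightarrow> ennreal" where
  "dual_weight p w = (\<lambda>x. epowr (w x) (- (1 / (p - 1))))"

lemma pos_weight_dual: "pos_weight w \<Longrightarrow> pos_weight (dual_weight p w)"
  unfolding dual_weight_def by (rule pos_weight_epowr)

lemma dual_dual_weight: "1 < p \<Longrightarrow> dual_weight (p / (p - 1)) (dual_weight p w) = w"
proof -
  assume p: "1 < p"
  have e: "p / (p - 1) - 1 = 1 / (p - 1)" using p by (simp add: field_simps)
  have "- (1 / (p - 1)) * - (1 / (p / (p - 1) - 1)) = 1" unfolding e using p by (simp add: field_simps)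
  then show ?thesis by (simp only: dual_weight_def epowr_epowr epowr_one)
qed

lemma dual_weight_mult: "1 < p \<Longrightarrow> pos_weight w \<Longrightarrow> epowr (dual_weight p w x) (p - 1) * w x = 1"
proof -
  assume p: "1 < p" and w: "pos_weight w"
  have "epowr (dual_weight p w x) (p - 1) * w x = epowr (w x) (-1) * epowr (w x) 1"
    using p by (simp add: dual_weight_def epowr_epowr)
  also have "\<dots> = 1"
    unfolding epowr_add[symmetric] using w by (simp add: epowr_exp_0 pos_weight_def)
  finally show ?thesis .
qed

context dyadic
begin

text \<open>A is any upper bound, at least 1, for the characteristic over the cells; so one number
  can serve all lattices.\<close>

definition Apd :: "real \<Rightarrow> ('a \<Rightarrow> ennreal) \<Rightarrow> real \<Rightarrow> bool" where
  "Apd p w A \<longleftrightarrow> pos_weight w \<and> 1 \<le> A \<and>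
     (\<forall>P\<in>D. ave lebesgue P w * epowr (ave lebesgue P (dual_weight p w)) (p - 1) \<le> ennreal A)"

lemma Apd_pos: "Apd p w A \<Longrightarrow> pos_weight w" by (simp add: Apd_def)

lemma ave_pos:
  assumes "pos_weight w" "P \<in> D" shows "0 < ave lebesgue P w"
proof -
  interpret P: finite_pos_set lebesgue P by (rule D_pos[OF assms(2)])
  have [measurable]: "w \<in> borel_measurable lebesgue" using assms(1) by measurable
  have "(\<integral>\<^sup>+x\<in>P. w x \<partial>lebesgue) \<noteq> 0"
  proof
    assume "(\<integral>\<^sup>+x\<in>P. w x \<partial>lebesgue) = 0"
    then have "AE x in lebesgue. w x * indicator P x = 0"
      by (subst (asm) nn_integral_0_iff_AE) auto
    moreover have "w x \<noteq> 0" for x using assms(1) by (metis pos_weight_def less_irrefl)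
    ultimately have "AE x in lebesgue. x \<notin> P" by (simp add: indicator_eq_0_iff)
    then have "emeasure lebesgue P = 0"
      by (subst (asm) AE_iff_measurable[of P]) auto
    then show False using P.pos by simp
  qed
  then show ?thesis using P.fin P.pos by (auto simp: ave_def ennreal_zero_less_divide zero_less_iff_neq_zero)
qed

lemma Apd_ave:
  assumes A: "Apd p w A" and p: "1 < p" and P: "P \<in> D"
  shows "0 < ave lebesgue P w \<and> ave lebesgue P w < top"
    "0 < ave lebesgue P (dual_weight p w) \<and> ave lebesgue P (dual_weight p w) < top"
proof -
  have "0 < ave lebesgue P w" "0 < ave lebesgue P (dual_weight p w)"
    using ave_pos[OF _ P] pos_weight_dual Apd_pos[OF A] by auto
  moreover have "ave lebesgue P w * epowr (ave lebesgue P (dual_weight p w)) (p - 1) < top"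
    using A P unfolding Apd_def by (meson ennreal_less_top order_le_less_trans)
  ultimately show "0 < ave lebesgue P w \<and> ave lebesgue P w < top"
    "0 < ave lebesgue P (dual_weight p w) \<and> ave lebesgue P (dual_weight p w) < top"
    by (auto simp: ennreal_mult_less_top)
qed

lemma Apd_dual:
  assumes A: "Apd p w A" and p: "1 < p"
  shows "Apd (p / (p - 1)) (dual_weight p w) (A powr (1 / (p - 1)))"
  unfolding Apd_def
proof (intro conjI ballI)
  show "pos_weight (dual_weight p w)" using A by (simp add: Apd_pos pos_weight_dual)
  show "1 \<le> A powr (1 / (p - 1))" using A p by (intro ge_one_powr_ge_zero) (auto simp: Apd_def)
  fix P assume P: "P \<in> D"
  have e: "p / (p - 1) - 1 = 1 / (p - 1)" using p by (simp add: field_simps)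
  have "epowr (ave lebesgue P w * epowr (ave lebesgue P (dual_weight p w)) (p - 1)) (1 / (p - 1)) \<le> epowr (ennreal A) (1 / (p - 1))"
    using A P p by (intro epowr_mono) (auto simp: Apd_def)
  then show "ave lebesgue P (dual_weight p w) *
      epowr (ave lebesgue P (dual_weight (p / (p - 1)) (dual_weight p w))) (p / (p - 1) - 1) \<le> ennreal (A powr (1 / (p - 1)))"
    using A p by (simp add: dual_dual_weight e epowr_mult epowr_epowr epowr_ennreal Apd_def mult.commute)
qed

text \<open>Outside the set w is at most \<beta> times its average, so the dual weight is large
  there. The A_p condition bounds the average of the dual weight and permits this on at most half of
  P; \<beta> is chosen to give exactly 1/2.\<close>

lemma Apd_half:
  assumes A: "Apd p w A" and p: "1 < p" and P: "P \<in> D"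
  shows "emeasure lebesgue P \<le> 2 * emeasure lebesgue {x\<in>P. ennreal (1 / (2 powr (p - 1) * A)) * ave lebesgue P w < w x}"
proof -
  interpret P: finite_pos_set lebesgue P by (rule D_pos[OF P])
  have w: "pos_weight w" by (rule Apd_pos[OF A])
  have [measurable]: "w \<in> borel_measurable lebesgue" "dual_weight p w \<in> borel_measurable lebesgue"
    using w pos_weight_dual[OF w] by measurable
  define \<beta> where "\<beta> = 1 / (2 powr (p - 1) * A)"
  have A1: "1 \<le> A" using A by (simp add: Apd_def)
  have \<beta>: "0 < \<beta>" using A1 by (simp add: \<beta>_def)
  obtain a z where r: "ave lebesgue P w = ennreal a" "0 < a" "ave lebesgue P (dual_weight p w) = ennreal z" "0 < z"
    using Apd_ave[OF A p P] by (cases "ave lebesgue P w"; cases "ave lebesgue P (dual_weight p w)") auto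
  obtain n where n: "emeasure lebesgue P = ennreal n" "0 < n"
    using P.pos P.fin by (cases "emeasure lebesgue P") auto
  define H where "H = {x\<in>P. ennreal \<beta> * ave lebesgue P w < w x}"
  have "H = P \<inter> {x\<in>space lebesgue. ennreal \<beta> * ave lebesgue P w < w x}" by (auto simp: H_def)
  also have "\<dots> \<in> sets lebesgue" by measurable
  finally have [measurable]: "H \<in> sets lebesgue" .
  have split: "emeasure lebesgue P = emeasure lebesgue H + emeasure lebesgue (P - H)"
    by (subst plus_emeasure) (auto simp: H_def intro!: arg_cong[where f="emeasure lebesgue"])
  then obtain h k where hk: "emeasure lebesgue H = ennreal h" "emeasure lebesgue (P - H) = ennreal k" "0 \<le> h" "0 \<le> k"
    using n by (cases "emeasure lebesgue H"; cases "emeasure lebesgue (P - H)") auto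
  then have nhk: "n = h + k" using split n by (simp flip: ennreal_plus)
  have "ennreal ((\<beta> * a) powr (- (1 / (p - 1)))) * ennreal k = (\<integral>\<^sup>+x\<in>P - H. epowr (ennreal (\<beta> * a)) (- (1 / (p - 1))) \<partial>lebesgue)"
    using r \<beta> hk nn_integral_set_const[of "P - H" lebesgue "epowr (ennreal (\<beta> * a)) (- (1 / (p - 1)))"]
    by (simp add: epowr_ennreal)
  also have "\<dots> \<le> (\<integral>\<^sup>+x\<in>P. dual_weight p w x \<partial>lebesgue)"
  proof (rule nn_integral_mono)
    fix x
    have "epowr (ennreal (\<beta> * a)) (- (1 / (p - 1))) \<le> dual_weight p w x" if "x \<in> P - H"
      unfolding dual_weight_def
      using that w r \<beta> p by (intro epowr_antimono) (auto simp: H_def pos_weight_def not_less ennreal_mult ennreal_mult_less_top)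
    then show "epowr (ennreal (\<beta> * a)) (- (1 / (p - 1))) * indicator (P - H) x \<le> dual_weight p w x * indicator P x"
      by (auto split: split_indicator)
  qed
  also have "\<dots> = ennreal z * ennreal n" using r n P.ave_mult_emeasure[of "dual_weight p w"] by simp
  finally have 1: "(\<beta> * a) powr (- (1 / (p - 1))) * k \<le> z * n"
    using r n hk by (simp flip: ennreal_mult add: ennreal_le_iff)
  have "ennreal (a * z powr (p - 1)) \<le> ennreal A"
    using A P r by (auto simp: Apd_def epowr_ennreal ennreal_mult)
  then have "a * z powr (p - 1) \<le> A" using A1 by (simp add: ennreal_le_iff)
  then have "(a * z powr (p - 1)) powr (1 / (p - 1)) \<le> A powr (1 / (p - 1))"
    using r p by (intro powr_mono2) auto
  then have 2: "a powr (1 / (p - 1)) * z \<le> A powr (1 / (p - 1))"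
    using r p by (simp add: powr_mult powr_powr)
  have b: "\<beta> powr (1 / (p - 1)) = 1 / (2 * A powr (1 / (p - 1)))"
    using p A1 by (simp add: \<beta>_def powr_divide powr_mult powr_powr)
  have "k \<le> z * n * (\<beta> * a) powr (1 / (p - 1))"
    using 1 r \<beta> by (simp add: powr_minus field_simps)
  also have "\<dots> = n * (a powr (1 / (p - 1)) * z) * \<beta> powr (1 / (p - 1))"
    using r \<beta> by (simp add: powr_mult mult_ac)
  also have "\<dots> \<le> n * A powr (1 / (p - 1)) * \<beta> powr (1 / (p - 1))"
    using 2 n by (intro mult_right_mono mult_left_mono) auto
  also have "\<dots> = n / 2" using A1 by (simp add: b)
  finally have "n \<le> 2 * h" using nhk by simp
  then have "ennreal n \<le> 2 * ennreal h"
    using hk by (metis ennreal_leI ennreal_mult' ennreal_numeral zero_le_numeral)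
  then show ?thesis using n hk by (simp add: H_def \<beta>_def)
qed

text \<open>The largest \<epsilon> that \<open>reverse_Holder\<close> permits with the \<beta> of
  \<open>Apd_half\<close>. Being inversely proportional to A, it makes the thresholds for the
  exponents linear in the constants of the weights to which it is applied.\<close>

definition rh_exp :: "real \<Rightarrow> real \<Rightarrow> real" where
  "rh_exp p A = 1 / (4 * d * 2 powr (p - 1) * A)"

lemma Apd_reverse_Holder:
  assumes A: "Apd p w A" and p: "1 < p" and \<kappa>: "1 \<le> \<kappa>" "\<kappa> \<le> 1 + rh_exp p A" and Q: "Q \<in> D"
  shows "ave lebesgue Q (\<lambda>x. epowr (w x) \<kappa>) \<le> 2 * epowr (ave lebesgue Q w) \<kappa>"
proof (cases "\<kappa> = 1")
  case True
  have "1 * ave lebesgue Q w \<le> 2 * ave lebesgue Q w"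
    by (intro mult_right_mono) (auto intro: order_trans[of 1 "2::ennreal"])
  then show ?thesis using True by simp
next
  case False
  have "1 \<le> A" using A by (simp add: Apd_def)
  moreover have "w \<in> borel_measurable lebesgue" using Apd_pos[OF A] by measurable
  ultimately show ?thesis
    using reverse_Holder[of w "1 / (2 powr (p - 1) * A)" "\<kappa> - 1" Q] False \<kappa> Q d_ge_1
      Apd_ave(1)[OF A p] Apd_half[OF A p]
    by (simp add: rh_exp_def mult_ac)
qed

end

section \<open>Weighted norms, weighted averages and the regularisation of functions\<close>

definition wnorm :: "real \<Rightarrow> ('a::euclidean_space \<Rightarrow> ennreal) \<Rightarrow> ('a \<Rightarrow> ennreal) \<Rightarrow> ennreal" where
  "wnorm p w f = epowr (\<integral>\<^sup>+x. epowr (f x) p * w x \<partial>lebesgue) (1 / p)"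

lemma wnorm_cong_le:
  assumes "0 < p" "(\<integral>\<^sup>+x. epowr (f x) p * w x \<partial>lebesgue) \<le> ennreal (c powr p) * (\<integral>\<^sup>+x. epowr (g x) p * v x \<partial>lebesgue)" "0 \<le> c"
  shows "wnorm p w f \<le> ennreal c * wnorm p v g"
proof -
  have "wnorm p w f \<le> epowr (ennreal (c powr p) * (\<integral>\<^sup>+x. epowr (g x) p * v x \<partial>lebesgue)) (1 / p)"
    unfolding wnorm_def using assms by (intro epowr_mono) auto
  also have "\<dots> = ennreal c * wnorm p v g"
    using assms by (simp add: wnorm_def epowr_mult epowr_ennreal powr_powr)
  finally show ?thesis .
qed

abbreviation wdens :: "('a::euclidean_space \<Rightarrow> ennreal) \<Rightarrow> 'a measure" where
  "wdens w \<equiv> density lebesgue w"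

lemma nn_integral_wdens:
  "pos_weight w \<Longrightarrow> f \<in> borel_measurable lebesgue \<Longrightarrow> (\<integral>\<^sup>+x. f x \<partial>wdens w) = (\<integral>\<^sup>+x. f x * w x \<partial>lebesgue)"
  by (subst nn_integral_density) (auto simp: pos_weight_def mult.commute)

lemma pos_weight_epowr_add:
  "pos_weight w \<Longrightarrow> epowr (w x) a * epowr (w x) b = epowr (w x) (a + b)"
  by (simp add: epowr_add)

lemma pos_weight_epowr_0: "pos_weight w \<Longrightarrow> epowr (w x) 0 = 1"
  by (simp add: pos_weight_def epowr_exp_0)

text \<open>The quotient f / s; the power -1 keeps the unconditional laws of \<open>epowr\<close>
  available.\<close>

definition over :: "('a \<Rightarrow> ennreal) \<Rightarrow> ('a \<Rightarrow> ennreal) \<Rightarrow> 'a \<Rightarrow> ennreal" where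
  "over f s = (\<lambda>x. f x * epowr (s x) (-1))"

lemma over_mult: "pos_weight s \<Longrightarrow> over f s x * s x = f x"
  using pos_weight_epowr_add[of s x "-1" 1] by (simp add: over_def mult.assoc pos_weight_epowr_0)

lemma measurable_over [measurable (raw)]:
  "f \<in> borel_measurable N \<Longrightarrow> s \<in> borel_measurable N \<Longrightarrow> over f s \<in> borel_measurable N"
  unfolding over_def by (intro borel_measurable_times_ennreal measurable_epowr)

lemma over_epowr: "pos_weight s \<Longrightarrow> epowr (over f s x) p * s x = epowr (f x) p * epowr (s x) (1 - p)"
proof -
  assume s: "pos_weight s"
  have "epowr (over f s x) p * s x = epowr (f x) p * (epowr (s x) (- p) * epowr (s x) 1)"
    by (simp add: over_def epowr_mult epowr_epowr mult.assoc)
  then show ?thesis unfolding epowr_add[symmetric] by simp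
qed

lemma dual_weight_1p: "1 < p \<Longrightarrow> epowr (dual_weight p w x) (1 - p) = w x"
proof -
  assume p: "1 < p"
  have "- (1 / (p - 1)) * (1 - p) = 1" using p by (simp add: field_simps)
  then show ?thesis by (simp only: dual_weight_def epowr_epowr epowr_one)
qed

text \<open>Division by the dual weight is an isometry from L^p(w) onto the L^p space of the dual
  weight, on which Doob's inequality is applied.\<close>

lemma over_dual_epowr:
  "1 < p \<Longrightarrow> pos_weight w \<Longrightarrow> epowr (over f (dual_weight p w) x) p * dual_weight p w x = epowr (f x) p * w x"
  by (simp add: over_epowr pos_weight_dual dual_weight_1p)

context dyadic
begin

lemma wdens_pos:
  assumes w: "pos_weight w" and fin: "ave lebesgue P w < top" and P: "P \<in> D"
  shows "finite_pos_set (wdens w) P"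
proof
  interpret P: finite_pos_set lebesgue P by (rule D_pos[OF P])
  have [measurable]: "w \<in> borel_measurable lebesgue" using w by measurable
  show "P \<in> sets (wdens w)" by simp
  have "emeasure (wdens w) P = ave lebesgue P w * emeasure lebesgue P"
    by (simp add: emeasure_density P.ave_mult_emeasure)
  then show "0 < emeasure (wdens w) P" "emeasure (wdens w) P < top"
    using ave_pos[OF w P] P.pos P.fin fin by (auto simp: ennreal_mult_less_top ennreal_zero_less_mult_iff)
qed

lemma ave_wdens:
  assumes w: "pos_weight w" and fin: "ave lebesgue P w < top" and P: "P \<in> D"
    and [measurable]: "f \<in> borel_measurable lebesgue"
  shows "ave (wdens w) P f * ave lebesgue P w = ave lebesgue P (\<lambda>x. f x * w x)"
proof -
  interpret P: finite_pos_set lebesgue P by (rule D_pos[OF P])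
  have [measurable]: "w \<in> borel_measurable lebesgue" using w by measurable
  have e: "emeasure (wdens w) P = ave lebesgue P w * emeasure lebesgue P"
    by (simp add: emeasure_density P.ave_mult_emeasure)
  let ?I = "\<integral>\<^sup>+x\<in>P. f x * w x \<partial>lebesgue"
  have i: "(\<integral>\<^sup>+x\<in>P. f x \<partial>wdens w) = ?I"
    by (subst nn_integral_density) (auto intro!: nn_integral_cong simp: mult_ac)
  have pos: "0 < ave lebesgue P w" by (rule ave_pos[OF w P])
  have "ave (wdens w) P f * ave lebesgue P w = ?I * (inverse (ave lebesgue P w) * ave lebesgue P w) * inverse (emeasure lebesgue P)"
    unfolding ave_def[of "wdens w"] i e divide_ennreal_def
    using P.pos P.fin pos fin by (subst ennreal_inverse_mult) (auto simp: mult_ac)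
  also have "inverse (ave lebesgue P w) * ave lebesgue P w = 1"
    using pos fin by (metis divide_ennreal_def ennreal_divide_self mult.commute not_gr_zero)
  finally show ?thesis by (simp add: ave_def divide_ennreal_def)
qed

text \<open>
  Passing from \<open>f\<close> to \<open>reg p q w F f\<close> costs a constant in \<open>L\<^sup>p(w)\<close>, and averages of \<open>f\<close> with an
  exponent close to 1 (in terms of the \<open>A\<^sub>p\<close> constant) become ordinary averages.
\<close>

definition reg :: "real \<Rightarrow> real \<Rightarrow> ('a \<Rightarrow> ennreal) \<Rightarrow> 'a set set \<Rightarrow> ('a \<Rightarrow> ennreal) \<Rightarrow> 'a \<Rightarrow> ennreal" where
  "reg p q w F f = (\<lambda>x. mf (\<lambda>P. rave q (wdens (dual_weight p w)) P (over f (dual_weight p w))) F x * dual_weight p w x)"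

context
  fixes p A :: real and w :: "'a \<Rightarrow> ennreal" and F
  assumes p: "1 < p" and A: "Apd p w A" and F: "finite F" "F \<subseteq> D"
begin

abbreviation "\<sigma> \<equiv> dual_weight p w"

lemma w_pos: "pos_weight w" "pos_weight \<sigma>"
  using Apd_pos[OF A] by (auto intro: pos_weight_dual)

lemma w_meas [measurable]: "w \<in> borel_measurable lebesgue" "\<sigma> \<in> borel_measurable lebesgue"
  using w_pos by measurable

lemma F_nested: "nested F" "F \<subseteq> sets lebesgue"
  using nested_subset[OF nested_D F(2)] F(2) D_sets by auto

lemma F_pos: "P \<in> F \<Longrightarrow> finite_pos_set (wdens \<sigma>) P" "P \<in> F \<Longrightarrow> finite_pos_set (wdens w) P"
  using wdens_pos w_pos Apd_ave[OF A p] F by blast+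

lemma mf_measurable [measurable]: "mf v F \<in> borel_measurable lebesgue"
  by (rule measurable_mf[OF countable_finite[OF F(1)] F_nested(2)])

lemma reg_measurable: "reg p q w F f \<in> borel_measurable lebesgue"
  unfolding reg_def by measurable

lemma Doob_dual:
  assumes [measurable]: "f \<in> borel_measurable lebesgue" and q: "0 < q" "q < p"
  shows "(\<integral>\<^sup>+x. epowr (mf (\<lambda>P. rave q (wdens \<sigma>) P (over f \<sigma>)) F x) p * \<sigma> x \<partial>lebesgue)
     \<le> ennreal ((p / (p - q)) powr (p / q)) * (\<integral>\<^sup>+x. epowr (f x) p * w x \<partial>lebesgue)"
proof -
  have "(\<integral>\<^sup>+x. epowr (mf (\<lambda>P. rave q (wdens \<sigma>) P (over f \<sigma>)) F x) p \<partial>wdens \<sigma>)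
     \<le> ennreal ((p / (p - q)) powr (p / q)) * (\<integral>\<^sup>+x. epowr (over f \<sigma> x) p \<partial>wdens \<sigma>)"
    by (rule Doob_rave[OF F(1) F_nested(1) F_pos(1) _ q]) auto
  then show ?thesis
    by (simp add: nn_integral_wdens w_pos over_dual_epowr p)
qed

text \<open>As \<sigma>^p w = \<sigma>, the norm on the left is that of the \<sigma>-maximal
  function of f / \<sigma> in L^p(\<sigma>). The constant is Doob's and does not contain A.\<close>

lemma reg_norm:
  assumes [measurable]: "f \<in> borel_measurable lebesgue" and q: "0 < q" "q < p"
  shows "wnorm p w (reg p q w F f) \<le> ennreal ((p / (p - q)) powr (1 / q)) * wnorm p w f"
proof (rule wnorm_cong_le)
  have e: "epowr (reg p q w F f x) p * w x =
      epowr (mf (\<lambda>P. rave q (wdens \<sigma>) P (over f \<sigma>)) F x) p * \<sigma> x" for x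
  proof -
    have "epowr (\<sigma> x) p * w x = \<sigma> x * (epowr (\<sigma> x) (p - 1) * w x)"
      using epowr_add[of "\<sigma> x" 1 "p - 1"] by (simp add: mult.assoc)
    then show ?thesis
      unfolding reg_def epowr_mult by (simp add: mult.assoc dual_weight_mult[OF p w_pos(1)])
  qed
  have c: "((p / (p - q)) powr (1 / q)) powr p = (p / (p - q)) powr (p / q)"
    by (simp add: powr_powr)
  show "(\<integral>\<^sup>+x. epowr (reg p q w F f x) p * w x \<partial>lebesgue)
    \<le> ennreal (((p / (p - q)) powr (1 / q)) powr p) * (\<integral>\<^sup>+x. epowr (f x) p * w x \<partial>lebesgue)"
    unfolding e c by (rule Doob_dual[OF assms])
qed (use p in auto)

lemma reg_ave:
  assumes P: "P \<in> F"
  shows "rave q (wdens \<sigma>) P (over f \<sigma>) * ave lebesgue P \<sigma> \<le> ave lebesgue P (reg p q w F f)"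
proof -
  have "rave q (wdens \<sigma>) P (over f \<sigma>) * ave lebesgue P \<sigma> = ave lebesgue P (\<lambda>x. rave q (wdens \<sigma>) P (over f \<sigma>) * \<sigma> x)"
    using P F_nested by (subst ave_cmult) auto
  also have "\<dots> \<le> ave lebesgue P (reg p q w F f)"
    unfolding reg_def by (intro ave_mono mult_right_mono mf_upper P) auto
  finally show ?thesis .
qed

text \<open>f^r is split as ((f/\<sigma>)^q \<sigma>)^\<theta> (\<sigma>^\<kappa>)^(1-\<theta>) with
  \<theta> = r/q; the exponent \<kappa> = r (q-1) / (q-r) is forced by \<theta> + \<kappa>
  (1-\<theta>) = r. Hoelder is followed by the reverse Hoelder inequality for \<sigma>, which
  satisfies the condition for p / (p-1) with the constant A^(1/(p-1)).\<close>

lemma rave_le_over: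
  assumes [measurable]: "f \<in> borel_measurable lebesgue"
    and r: "1 \<le> r" "r < q" and \<kappa>: "r * (q - 1) / (q - r) \<le> 1 + rh_exp (p / (p - 1)) (A powr (1 / (p - 1)))"
    and P: "P \<in> D"
  shows "rave r lebesgue P f \<le> 2 * (rave q (wdens \<sigma>) P (over f \<sigma>) * ave lebesgue P \<sigma>)"
proof -
  define \<kappa> where "\<kappa> = r * (q - 1) / (q - r)"
  define \<theta> where "\<theta> = r / q"
  have \<theta>: "0 < \<theta>" "\<theta> < 1" using r by (auto simp: \<theta>_def)
  have q1: "1 < q" using r by simp
  have \<kappa>1: "1 \<le> \<kappa>" using r by (simp add: \<kappa>_def field_simps)
  have ex: "\<theta> + \<kappa> * (1 - \<theta>) = r"
  proof -
    have "\<kappa> * (1 - \<theta>) = r * (q - 1) / q" unfolding \<kappa>_def \<theta>_def using r by (simp add: field_simps)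
    then show ?thesis using r by (simp add: \<theta>_def field_simps)
  qed
  have p': "1 < p / (p - 1)" using p by simp
  interpret P: finite_pos_set lebesgue P by (rule D_pos[OF P])
  note fin = Apd_ave(2)[OF A p P]
  have e: "epowr (f x) r = epowr (epowr (over f \<sigma> x) q * \<sigma> x) \<theta> * epowr (epowr (\<sigma> x) \<kappa>) (1 - \<theta>)" for x
  proof -
    have "epowr (epowr (over f \<sigma> x) q * \<sigma> x) \<theta> * epowr (epowr (\<sigma> x) \<kappa>) (1 - \<theta>)
      = epowr (over f \<sigma> x) r * epowr (\<sigma> x) (\<theta> + \<kappa> * (1 - \<theta>))"
      using q1 by (simp add: epowr_mult epowr_epowr epowr_add \<theta>_def mult.assoc)
    also have "\<dots> = epowr (f x) r"
      unfolding ex epowr_mult[symmetric] by (simp add: over_mult w_pos)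
    finally show ?thesis by simp
  qed
  have "ave lebesgue P (\<lambda>x. epowr (f x) r) \<le>
     epowr (ave lebesgue P (\<lambda>x. epowr (over f \<sigma> x) q * \<sigma> x)) \<theta> * epowr (ave lebesgue P (\<lambda>x. epowr (\<sigma> x) \<kappa>)) (1 - \<theta>)"
    unfolding e by (rule P.ave_Holder[OF _ _ \<theta>]) measurable
  also have "\<dots> \<le> epowr (ave (wdens \<sigma>) P (\<lambda>x. epowr (over f \<sigma> x) q) * ave lebesgue P \<sigma>) \<theta> *
      epowr (2 * epowr (ave lebesgue P \<sigma>) \<kappa>) (1 - \<theta>)"
  proof (intro mult_mono epowr_mono)
    show "ave lebesgue P (\<lambda>x. epowr (over f \<sigma> x) q * \<sigma> x) \<le> ave (wdens \<sigma>) P (\<lambda>x. epowr (over f \<sigma> x) q) * ave lebesgue P \<sigma>"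
      by (subst ave_wdens[OF w_pos(2) _ P]) (use fin in auto)
    show "ave lebesgue P (\<lambda>x. epowr (\<sigma> x) \<kappa>) \<le> 2 * epowr (ave lebesgue P \<sigma>) \<kappa>"
      by (rule Apd_reverse_Holder[OF Apd_dual[OF A p] p' \<kappa>1 _ P]) (use \<kappa> in \<open>simp add: \<kappa>_def\<close>)
  qed (use \<theta> in auto)
  also have "\<dots> = epowr 2 (1 - \<theta>) * (epowr (ave (wdens \<sigma>) P (\<lambda>x. epowr (over f \<sigma> x) q)) \<theta>
     * epowr (ave lebesgue P \<sigma>) r)"
    by (subst ex[symmetric]) (simp add: epowr_mult epowr_epowr epowr_add mult_ac)
  finally have "rave r lebesgue P f \<le> epowr (epowr 2 (1 - \<theta>) * (epowr (ave (wdens \<sigma>) P (\<lambda>x. epowr (over f \<sigma> x) q)) \<theta>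
     * epowr (ave lebesgue P \<sigma>) r)) (1 / r)"
    unfolding rave_def using r by (intro epowr_mono) auto
  also have "\<dots> = epowr 2 ((1 - \<theta>) / r) * (rave q (wdens \<sigma>) P (over f \<sigma>) * ave lebesgue P \<sigma>)"
    using r by (simp add: epowr_mult epowr_epowr rave_def \<theta>_def)
  also have "epowr 2 ((1 - \<theta>) / r) \<le> (2::ennreal)"
  proof -
    have "(1 - \<theta>) / r \<le> 1" using \<theta> r by (simp add: field_simps)
    then have "(2::real) powr ((1 - \<theta>) / r) \<le> 2 powr 1" by (intro powr_mono) auto
    then show ?thesis using epowr_ennreal[of 2 "(1 - \<theta>) / r"] ennreal_leI by fastforce
  qed
  finally show ?thesis by (simp add: mult_right_mono)
qed

lemma rave_le_reg:
  assumes "f \<in> borel_measurable lebesgue"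
    and "1 \<le> r" "r < q" "r * (q - 1) / (q - r) \<le> 1 + rh_exp (p / (p - 1)) (A powr (1 / (p - 1)))"
    and P: "P \<in> F"
  shows "rave r lebesgue P f \<le> 2 * ave lebesgue P (reg p q w F f)"
proof -
  have "rave r lebesgue P f \<le> 2 * (rave q (wdens \<sigma>) P (over f \<sigma>) * ave lebesgue P \<sigma>)"
    using rave_le_over assms F by blast
  also have "\<dots> \<le> 2 * ave lebesgue P (reg p q w F f)"
    by (intro mult_left_mono reg_ave P) auto
  finally show ?thesis .
qed

end

end

section \<open>Sparse operators and the maximal function on \<open>A\<^sub>p\<close>-weighted spaces\<close>

lemma ennreal_mult3:
  "0 \<le> a \<Longrightarrow> 0 \<le> b \<Longrightarrow> 0 \<le> c \<Longrightarrow> ennreal (a * b * c) = ennreal a * ennreal b * ennreal c"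
  by (simp add: ennreal_mult)

text \<open>n, S, W are the Lebesgue, dual and w-measures of a cell, and e, Se, We those of its
  sparse part. The A_p condition uses up (S/n)^(p-1); what remains of S has the exponent 2 - p \<le>
  0, so S may be lowered to Se. This is where p \<ge> 2 enters. Then n is raised to e / \<eta>, and
  e is bounded by Hoelder.\<close>

lemma sparse_weights_real:
  fixes p :: real
  assumes p: "2 \<le> p" and pos: "0 < n" "0 < e" "0 < S" "0 < W" "0 < Se" "0 < We" "0 < \<eta>"
    and A: "W / n * (S / n) powr (p - 1) \<le> A" and e: "e \<le> We powr (1 / p) * Se powr (1 - 1 / p)"
    and \<eta>: "\<eta> * n \<le> e" and S: "Se \<le> S"
  shows "S / n * (W / n) * n \<le> A * \<eta> powr (1 - p) * (Se powr (1 / p) * We powr (1 - 1 / p))"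
proof -
  have A0: "0 \<le> A" using A pos by (meson divide_nonneg_pos less_imp_le mult_nonneg_nonneg order_trans powr_ge_zero)
  have "(S / n) powr (p - 1) * (S / n) powr (2 - p) = S / n"
    using pos by (simp flip: powr_add)
  then have "S / n * (W / n) * n = (W / n * (S / n) powr (p - 1)) * ((S / n) powr (2 - p) * n)"
    by (simp add: mult_ac)
  also have "\<dots> \<le> A * ((S / n) powr (2 - p) * n)"
    using A pos by (intro mult_right_mono) auto
  also have "(S / n) powr (2 - p) * n = S powr (2 - p) * n powr (p - 1)"
  proof -
    have "n powr (2 - p) * n powr (p - 1) = n" using pos by (simp flip: powr_add)
    then show ?thesis using pos by (simp add: powr_divide field_simps)
  qed
  also have "A * (S powr (2 - p) * n powr (p - 1)) \<le> A * (Se powr (2 - p) * (e / \<eta>) powr (p - 1))"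
    using pos p S \<eta> A0 by (intro mult_left_mono mult_mono powr_mono2' powr_mono2) (auto simp: field_simps)
  also have "\<dots> \<le> A * (Se powr (2 - p) * ((We powr (1 / p) * Se powr (1 - 1 / p)) / \<eta>) powr (p - 1))"
    using pos p e A0 by (intro mult_left_mono powr_mono2 divide_right_mono) auto
  also have "\<dots> = A * \<eta> powr (1 - p) * ((Se powr (2 - p) * Se powr ((1 - 1 / p) * (p - 1))) * We powr ((1 / p) * (p - 1)))"
  proof -
    have "\<eta> powr (1 - p) = 1 / \<eta> powr (p - 1)"
      using powr_minus_divide[of \<eta> "p - 1"] by simp
    then show ?thesis using pos by (simp add: powr_divide powr_mult powr_powr)
  qed
  also have "Se powr (2 - p) * Se powr ((1 - 1 / p) * (p - 1)) = Se powr (1 / p)"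
  proof -
    have "2 - p + (1 - 1 / p) * (p - 1) = 1 / p" using p by (simp add: field_simps)
    then show ?thesis using pos by (simp flip: powr_add)
  qed
  also have "1 / p * (p - 1) = 1 - 1 / p" using p by (simp add: field_simps)
  finally show ?thesis .
qed

text \<open>2 is the overlap of the sparse parts, p / (p - 1) and p are the Doob constants for f and
  for g, and \<eta>^(1-p) comes from \<open>sparse_weights_real\<close>.\<close>

definition cbil :: "real \<Rightarrow> real \<Rightarrow> real" where
  "cbil p \<eta> = 2 * \<eta> powr (1 - p) * (p / (p - 1)) * p"

definition cform :: "real \<Rightarrow> real \<Rightarrow> real" where
  "cform p \<eta> = cbil p \<eta> + cbil (p / (p - 1)) \<eta>"

definition Ap_exp :: "real \<Rightarrow> real" where "Ap_exp p = max 1 (1 / (p - 1))"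

lemma cbil_nonneg: "1 < p \<Longrightarrow> 0 \<le> cbil p \<eta>"
  by (simp add: cbil_def)

lemma cform_nonneg: "1 < p \<Longrightarrow> 0 \<le> cform p \<eta>"
  by (simp add: cform_def cbil_nonneg)

context dyadic
begin

text \<open>
  The sets \<open>E P\<close> may overlap twice, because the stopping families below are sparse only in this
  sense.
\<close>

definition sparse_sets :: "real \<Rightarrow> 'a set set \<Rightarrow> ('a set \<Rightarrow> 'a set) \<Rightarrow> bool" where
  "sparse_sets \<eta> F E \<longleftrightarrow> finite F \<and> F \<subseteq> D \<and> 0 < \<eta> \<and> \<eta> \<le> 1 \<and>
     (\<forall>P\<in>F. E P \<in> sets lebesgue \<and> E P \<subseteq> P \<and> ennreal \<eta> * emeasure lebesgue P \<le> emeasure lebesgue (E P)) \<and>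
     (\<forall>x. (\<Sum>P\<in>F. indicator (E P) x) \<le> (2::ennreal))"

lemma emeasure_le_weights:
  assumes p: "1 < p" and w: "pos_weight w" and [measurable]: "E \<in> sets lebesgue"
  shows "emeasure lebesgue E \<le> epowr (emeasure (wdens w) E) (1 / p) * epowr (emeasure (wdens (dual_weight p w)) E) (1 - 1 / p)"
proof -
  have [measurable]: "w \<in> borel_measurable lebesgue" "dual_weight p w \<in> borel_measurable lebesgue"
    using w pos_weight_dual by measurable
  have "1 / p + - (1 / (p - 1)) * (1 - 1 / p) = 0" using p by (simp add: field_simps)
  then have "epowr (w x) (1 / p) * epowr (dual_weight p w x) (1 - 1 / p) = 1" for x
    unfolding dual_weight_def epowr_epowr epowr_add[symmetric] by (simp add: pos_weight_epowr_0 w)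
  then have e: "epowr (w x * indicator E x) (1 / p) * epowr (dual_weight p w x * indicator E x) (1 - 1 / p) = indicator E x" for x
    by (simp split: split_indicator)
  have "emeasure lebesgue E = (\<integral>\<^sup>+x. indicator E x \<partial>lebesgue)" by simp
  also have "\<dots> = (\<integral>\<^sup>+x. epowr (w x * indicator E x) (1 / p) * epowr (dual_weight p w x * indicator E x) (1 - 1 / p) \<partial>lebesgue)"
    by (simp only: e)
  also have "\<dots> \<le> epowr (\<integral>\<^sup>+x. w x * indicator E x \<partial>lebesgue) (1 / p) *
       epowr (\<integral>\<^sup>+x. dual_weight p w x * indicator E x \<partial>lebesgue) (1 - 1 / p)"
    by (rule nn_integral_Holder) (use p in auto)
  finally show ?thesis by (simp add: emeasure_density)
qed

lemma wdens_finite_real: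
  assumes "pos_weight w" "ave lebesgue P w < top" "P \<in> D" "E \<in> sets lebesgue" "E \<subseteq> P" "0 < emeasure lebesgue E"
  shows "\<exists>S n Se e. ave lebesgue P w = ennreal (S / n) \<and> emeasure lebesgue P = ennreal n \<and> emeasure (wdens w) E = ennreal Se \<and>
     emeasure lebesgue E = ennreal e \<and> 0 < S \<and> 0 < n \<and> 0 < Se \<and> 0 < e \<and> Se \<le> S \<and> emeasure (wdens w) P = ennreal S"
proof -
  interpret P: finite_pos_set lebesgue P by (rule D_pos[OF assms(3)])
  interpret W: finite_pos_set "wdens w" P by (rule wdens_pos[OF assms(1-3)])
  have [measurable]: "w \<in> borel_measurable lebesgue" using assms(1) by measurable
  have le: "emeasure (wdens w) E \<le> emeasure (wdens w) P" "emeasure lebesgue E \<le> emeasure lebesgue P"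
    using assms(4,5) by (auto intro!: emeasure_mono)
  have pos: "0 < emeasure (wdens w) E"
  proof (rule ccontr)
    assume "\<not> 0 < emeasure (wdens w) E"
    then have "(\<integral>\<^sup>+x. w x * indicator E x \<partial>lebesgue) = 0"
      using assms(4) by (simp add: emeasure_density)
    then have "AE x in lebesgue. w x * indicator E x = 0"
      using assms(4) by (subst (asm) nn_integral_0_iff_AE) auto
    moreover have "w x \<noteq> 0" for x using assms(1) by (metis pos_weight_def less_irrefl)
    ultimately have "AE x in lebesgue. x \<notin> E" by (simp add: indicator_eq_0_iff)
    then have "emeasure lebesgue E = 0"
      using assms(4) by (subst (asm) AE_iff_measurable[of E]) auto
    then show False using assms(6) by simp
  qed
  obtain S where S: "emeasure (wdens w) P = ennreal S" "0 < S"
    using W.pos W.fin by (cases "emeasure (wdens w) P") auto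
  obtain n where n: "emeasure lebesgue P = ennreal n" "0 < n"
    using P.pos P.fin by (cases "emeasure lebesgue P") auto
  have "emeasure (wdens w) E < top" using le(1) W.fin by (rule order_le_less_trans)
  then obtain Se where Se: "emeasure (wdens w) E = ennreal Se" "0 < Se"
    using pos by (cases "emeasure (wdens w) E") auto
  have "emeasure lebesgue E < top" using le(2) P.fin by (rule order_le_less_trans)
  then obtain e where e: "emeasure lebesgue E = ennreal e" "0 < e"
    using assms(6) by (cases "emeasure lebesgue E") auto
  have "ave lebesgue P w = emeasure (wdens w) P / emeasure lebesgue P"
    by (simp add: emeasure_density ave_def)
  then have "ave lebesgue P w = ennreal (S / n)" using S n by (simp add: divide_ennreal)
  moreover have "Se \<le> S" using le(1) S Se by (simp add: ennreal_le_iff)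
  ultimately show ?thesis using S n Se e by blast
qed

text \<open>The averages of f and g are rewritten as weighted averages with respect to \<sigma> and
  w. The remaining factor, the two weight averages times |P|, is at most a multiple of A \<sigma>(E
  P)^(1/p) w(E P)^(1/p'). Hoelder for sums then leaves two maximal functions integrated over the
  sparse parts.\<close>

lemma sparse_bilinear_ge2:
  assumes p: "2 \<le> p" and A: "Apd p w A" and sp: "sparse_sets \<eta> F E"
    and [measurable]: "f \<in> borel_measurable lebesgue" "g \<in> borel_measurable lebesgue"
  shows "(\<Sum>P\<in>F. ave lebesgue P f * ave lebesgue P g * emeasure lebesgue P)
    \<le> ennreal (cbil p \<eta> * A) * (wnorm p w f * wnorm (p / (p - 1)) (dual_weight p w) g)"
proof -
  define \<sigma> where "\<sigma> = dual_weight p w"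
  define p' where "p' = p / (p - 1)"
  have p1: "1 < p" using p by simp
  have p': "1 < p'" "1 / p + 1 / p' = 1" "1 - 1 / p = 1 / p'" using p by (auto simp: p'_def field_simps)
  have F: "finite F" "F \<subseteq> D" and \<eta>: "0 < \<eta>" "\<eta> \<le> 1" and E: "\<And>P. P \<in> F \<Longrightarrow> E P \<in> sets lebesgue"
    "\<And>P. P \<in> F \<Longrightarrow> E P \<subseteq> P" "\<And>P. P \<in> F \<Longrightarrow> ennreal \<eta> * emeasure lebesgue P \<le> emeasure lebesgue (E P)"
    "\<And>x. (\<Sum>P\<in>F. indicator (E P) x) \<le> (2::ennreal)"
    using sp by (auto simp: sparse_sets_def)
  have w: "pos_weight w" "pos_weight \<sigma>" using Apd_pos[OF A] by (auto simp: \<sigma>_def intro: pos_weight_dual)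
  have [measurable]: "w \<in> borel_measurable lebesgue" "\<sigma> \<in> borel_measurable lebesgue" using w by measurable
  have A1: "1 \<le> A" using A by (simp add: Apd_def)
  note fin = Apd_ave[OF A p1, folded \<sigma>_def]
  define a where "a P = ave (wdens \<sigma>) P (over f \<sigma>)" for P
  define b where "b P = ave (wdens w) P (over g w)" for P
  have fa: "ave lebesgue P f = a P * ave lebesgue P \<sigma>" if "P \<in> F" for P
    unfolding a_def using that F fin by (subst ave_wdens) (auto simp: w over_mult)
  have gb: "ave lebesgue P g = b P * ave lebesgue P w" if "P \<in> F" for P
    unfolding b_def using that F fin by (subst ave_wdens) (auto simp: w over_mult)
  define K where "K = ennreal (A * \<eta> powr (1 - p))"
  have key: "ave lebesgue P \<sigma> * ave lebesgue P w * emeasure lebesgue P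
     \<le> K * (epowr (emeasure (wdens \<sigma>) (E P)) (1 / p) * epowr (emeasure (wdens w) (E P)) (1 / p'))" if P: "P \<in> F" for P
  proof -
    have PD: "P \<in> D" using P F by auto
    interpret P: finite_pos_set lebesgue P by (rule D_pos[OF PD])
    have "0 < ennreal \<eta> * emeasure lebesgue P" using \<eta> P.pos by (simp add: ennreal_zero_less_mult_iff)
    then have Epos: "0 < emeasure lebesgue (E P)" using E(3)[OF P] by (rule order_less_le_trans)
    obtain S n Se e where 1: "ave lebesgue P \<sigma> = ennreal (S / n)" "emeasure lebesgue P = ennreal n" "emeasure (wdens \<sigma>) (E P) = ennreal Se"
     "emeasure lebesgue (E P) = ennreal e" "0 < S" "0 < n" "0 < Se" "0 < e" "Se \<le> S"
      using wdens_finite_real[OF w(2) _ PD E(1)[OF P] E(2)[OF P] Epos] fin(2)[OF PD] by blast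
    obtain W n' We e' where 2: "ave lebesgue P w = ennreal (W / n')" "emeasure lebesgue P = ennreal n'" "emeasure (wdens w) (E P) = ennreal We"
     "emeasure lebesgue (E P) = ennreal e'" "0 < W" "0 < n'" "0 < We" "0 < e'" "We \<le> W"
      using wdens_finite_real[OF w(1) _ PD E(1)[OF P] E(2)[OF P] Epos] fin(1)[OF PD] by blast
    have [simp]: "n' = n" "e' = e" using 1 2 by auto
    have "ave lebesgue P w * epowr (ave lebesgue P \<sigma>) (p - 1) \<le> ennreal A"
      using A PD by (auto simp: Apd_def \<sigma>_def)
    then have "W / n * (S / n) powr (p - 1) \<le> A"
      using 1 2 A1 by (simp add: epowr_ennreal ennreal_le_iff flip: ennreal_mult)
    moreover have "ennreal e \<le> ennreal (We powr (1 / p) * Se powr (1 - 1 / p))"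
      using emeasure_le_weights[OF p1 w(1) E(1)[OF P]] 1 2 by (simp add: epowr_ennreal ennreal_mult \<sigma>_def)
    then have "e \<le> We powr (1 / p) * Se powr (1 - 1 / p)" by (subst (asm) ennreal_le_iff) auto
    moreover have "\<eta> * n \<le> e" using E(3)[OF P] 1 \<eta> by (simp add: ennreal_le_iff flip: ennreal_mult)
    ultimately have "S / n * (W / n) * n \<le> A * \<eta> powr (1 - p) * (Se powr (1 / p) * We powr (1 - 1 / p))"
      using 1 2 \<eta> by (intro sparse_weights_real[OF p, where e=e]) auto
    then have "ennreal (S / n * (W / n) * n) \<le> ennreal (A * \<eta> powr (1 - p) * (Se powr (1 / p) * We powr (1 - 1 / p)))"
      by (rule ennreal_leI)
    moreover have "ennreal (S / n) * ennreal (W / n) * ennreal n = ennreal (S / n * (W / n) * n)"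
      by (rule ennreal_mult3[symmetric]) (use 1 2 in auto)
    moreover have "K * (epowr (ennreal Se) (1 / p) * epowr (ennreal We) (1 / p'))
       = ennreal (A * \<eta> powr (1 - p) * (Se powr (1 / p) * We powr (1 - 1 / p)))"
      using 1 2 A1 by (simp add: K_def epowr_ennreal p'(3) ennreal_mult)
    ultimately show ?thesis unfolding 1(1,2,3) 2(1,3) \<open>n' = n\<close> by (simp only:)
  qed
  have "(\<Sum>P\<in>F. ave lebesgue P f * ave lebesgue P g * emeasure lebesgue P)
     \<le> (\<Sum>P\<in>F. K * ((a P * epowr (emeasure (wdens \<sigma>) (E P)) (1 / p)) * (b P * epowr (emeasure (wdens w) (E P)) (1 / p'))))"
  proof (rule sum_mono)
    fix P assume P: "P \<in> F"
    have "ave lebesgue P f * ave lebesgue P g * emeasure lebesgue P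
      = a P * b P * (ave lebesgue P \<sigma> * ave lebesgue P w * emeasure lebesgue P)"
      by (simp add: fa gb P mult_ac)
    also have "\<dots> \<le> a P * b P * (K * (epowr (emeasure (wdens \<sigma>) (E P)) (1 / p) * epowr (emeasure (wdens w) (E P)) (1 / p')))"
      by (intro mult_left_mono key P) auto
    finally show "ave lebesgue P f * ave lebesgue P g * emeasure lebesgue P \<le>
      K * ((a P * epowr (emeasure (wdens \<sigma>) (E P)) (1 / p)) * (b P * epowr (emeasure (wdens w) (E P)) (1 / p')))"
      by (simp add: mult_ac)
  qed
  also have "\<dots> = K * (\<Sum>P\<in>F. (a P * epowr (emeasure (wdens \<sigma>) (E P)) (1 / p)) * (b P * epowr (emeasure (wdens w) (E P)) (1 / p')))"
    by (simp add: sum_distrib_left)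
  also have "\<dots> \<le> K * (epowr (\<Sum>P\<in>F. epowr (a P * epowr (emeasure (wdens \<sigma>) (E P)) (1 / p)) p) (1 / p) *
      epowr (\<Sum>P\<in>F. epowr (b P * epowr (emeasure (wdens w) (E P)) (1 / p')) p') (1 / p'))"
    by (intro mult_left_mono sum_Holder F p1 p') auto
  also have "\<dots> = K * (epowr (\<Sum>P\<in>F. epowr (a P) p * emeasure (wdens \<sigma>) (E P)) (1 / p) *
      epowr (\<Sum>P\<in>F. epowr (b P) p' * emeasure (wdens w) (E P)) (1 / p'))"
    using p1 p' by (simp add: epowr_mult epowr_epowr)
  also have "\<dots> \<le> K * ((ennreal (2 powr (1 / p) * (p / (p - 1))) * wnorm p w f) *
     (ennreal (2 powr (1 / p') * p) * wnorm p' \<sigma> g))"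
  proof (intro mult_left_mono mult_mono)
    have e1: "epowr (mf v F x) p = mf (\<lambda>P. epowr (v P) p) F x" "epowr (mf v F x) p' = mf (\<lambda>P. epowr (v P) p') F x" for v x
      using p1 p' by (auto intro!: epowr_mf)
    have wn: "epowr (2 * (ennreal (c powr r) * I)) (1 / r) = ennreal (2 powr (1 / r) * c) * epowr I (1 / r)"
      if "1 < r" "0 \<le> c" for c r I
    proof -
      have "epowr (2::ennreal) (1 / r) = ennreal (2 powr (1 / r))" using epowr_ennreal[of 2 "1 / r"] by simp
      then show ?thesis using that by (simp add: epowr_mult epowr_ennreal powr_powr ennreal_mult mult.assoc)
    qed
    have "(\<Sum>P\<in>F. epowr (a P) p * emeasure (wdens \<sigma>) (E P)) \<le> 2 * (\<integral>\<^sup>+x. epowr (mf a F x) p \<partial>wdens \<sigma>)"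
      using E F_nested[OF p1 A F] unfolding e1
      by (intro sum_sparse_le_mf F measurable_mf) (auto intro: countable_finite F)
    also have "\<dots> = 2 * (\<integral>\<^sup>+x. epowr (mf a F x) p * \<sigma> x \<partial>lebesgue)"
      using mf_measurable[OF p1 A F] by (subst nn_integral_wdens[OF w(2)]) auto
    also have "\<dots> \<le> 2 * (ennreal ((p / (p - 1)) powr p) * (\<integral>\<^sup>+x. epowr (f x) p * w x \<partial>lebesgue))"
      using Doob_dual[OF p1 A F, of f 1] p1 by (intro mult_left_mono) (auto simp: a_def[abs_def] \<sigma>_def)
    finally show "epowr (\<Sum>P\<in>F. epowr (a P) p * emeasure (wdens \<sigma>) (E P)) (1 / p) \<le> ennreal (2 powr (1 / p) * (p / (p - 1))) * wnorm p w f"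
      unfolding wnorm_def using p1 by (subst wn[symmetric]) (auto intro!: epowr_mono)
    have p'p: "p' / (p' - 1) = p" using p1 by (simp add: p'_def field_simps)
    have A': "Apd p' \<sigma> (A powr (1 / (p - 1)))" unfolding p'_def \<sigma>_def by (rule Apd_dual[OF A p1])
    have dd: "dual_weight p' \<sigma> = w" unfolding p'_def \<sigma>_def by (rule dual_dual_weight[OF p1])
    have "(\<Sum>P\<in>F. epowr (b P) p' * emeasure (wdens w) (E P)) \<le> 2 * (\<integral>\<^sup>+x. epowr (mf b F x) p' \<partial>wdens w)"
      using E F_nested[OF p1 A F] unfolding e1
      by (intro sum_sparse_le_mf F measurable_mf) (auto intro: countable_finite F)
    also have "\<dots> = 2 * (\<integral>\<^sup>+x. epowr (mf b F x) p' * w x \<partial>lebesgue)"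
      using mf_measurable[OF p1 A F] by (subst nn_integral_wdens[OF w(1)]) auto
    also have "\<dots> \<le> 2 * (ennreal (p powr p') * (\<integral>\<^sup>+x. epowr (g x) p' * \<sigma> x \<partial>lebesgue))"
      using Doob_dual[OF p'(1) A' F, of g 1] p' by (intro mult_left_mono) (auto simp: b_def[abs_def] dd p'p)
    finally show "epowr (\<Sum>P\<in>F. epowr (b P) p' * emeasure (wdens w) (E P)) (1 / p') \<le> ennreal (2 powr (1 / p') * p) * wnorm p' \<sigma> g"
      unfolding wnorm_def using p' p1 by (subst wn[symmetric]) (auto intro!: epowr_mono)
  qed auto
  also have "\<dots> = ennreal (cbil p \<eta> * A) * (wnorm p w f * wnorm p' \<sigma> g)"
  proof -
    have "(2::real) powr (1 / p) * 2 powr (1 / p') = 2" using p'(2) by (simp flip: powr_add)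
    then have "A * \<eta> powr (1 - p) * (2 powr (1 / p) * (p / (p - 1))) * (2 powr (1 / p') * p) = cbil p \<eta> * A"
      unfolding cbil_def by (simp add: mult_ac)
    moreover have "K * ((ennreal (2 powr (1 / p) * (p / (p - 1))) * wnorm p w f) * (ennreal (2 powr (1 / p') * p) * wnorm p' \<sigma> g))
       = ennreal (A * \<eta> powr (1 - p) * (2 powr (1 / p) * (p / (p - 1))) * (2 powr (1 / p') * p)) * (wnorm p w f * wnorm p' \<sigma> g)"
      unfolding K_def using p1 A1 by (subst ennreal_mult3) (auto simp only: mult_ac, auto)
    ultimately show ?thesis by simp
  qed
  finally show ?thesis by (simp add: p'_def \<sigma>_def)
qed

text \<open>For p < 2 the pairs f, w and g, \<open>dual_weight p w\<close> exchange their roles: the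
  conjugate exponent is above 2, and the dual constant A^(1/(p-1)) produces the other branch of the
  maximum in \<open>Ap_exp\<close>.\<close>

theorem sparse_bilinear:
  assumes p: "1 < p" and A: "Apd p w A" and sp: "sparse_sets \<eta> F E"
    and [measurable]: "f \<in> borel_measurable lebesgue" "g \<in> borel_measurable lebesgue"
  shows "(\<Sum>P\<in>F. ave lebesgue P f * ave lebesgue P g * emeasure lebesgue P)
    \<le> ennreal (cform p \<eta> * A powr Ap_exp p) * (wnorm p w f * wnorm (p / (p - 1)) (dual_weight p w) g)"
proof (cases "2 \<le> p")
  case True
  have A1: "1 \<le> A" using A by (simp add: Apd_def)
  have "Ap_exp p = 1" using True by (simp add: Ap_exp_def)
  then have "cbil p \<eta> * A \<le> cform p \<eta> * A powr Ap_exp p"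
    using cbil_nonneg[of p \<eta>] cbil_nonneg[of "p / (p - 1)" \<eta>] p A1 unfolding cform_def
    by (auto intro!: mult_right_mono)
  then show ?thesis
    by (intro order_trans[OF sparse_bilinear_ge2[OF True A sp assms(4,5)]] mult_right_mono ennreal_leI) auto
next
  case False
  define p' where "p' = p / (p - 1)"
  have p': "2 \<le> p'" "1 < p'" "p' / (p' - 1) = p" using p False by (auto simp: p'_def field_simps)
  have A1: "1 \<le> A" using A by (simp add: Apd_def)
  have A': "Apd p' (dual_weight p w) (A powr (1 / (p - 1)))" unfolding p'_def by (rule Apd_dual[OF A p])
  have dd: "dual_weight p' (dual_weight p w) = w" unfolding p'_def by (rule dual_dual_weight[OF p])
  have "Ap_exp p = 1 / (p - 1)" using False p by (simp add: Ap_exp_def max_def field_simps)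
  then have c: "cbil p' \<eta> * A powr (1 / (p - 1)) \<le> cform p \<eta> * A powr Ap_exp p"
    using cbil_nonneg[of p \<eta>] cbil_nonneg[of "p / (p - 1)" \<eta>] p A1 unfolding cform_def p'_def
    by (auto intro!: mult_right_mono)
  have "(\<Sum>P\<in>F. ave lebesgue P f * ave lebesgue P g * emeasure lebesgue P)
     = (\<Sum>P\<in>F. ave lebesgue P g * ave lebesgue P f * emeasure lebesgue P)" by (simp add: mult_ac)
  also have "\<dots> \<le> ennreal (cbil p' \<eta> * A powr (1 / (p - 1))) * (wnorm p' (dual_weight p w) g * wnorm p w f)"
    using sparse_bilinear_ge2[OF p'(1) A' sp assms(5,4)] by (simp add: dd p'(3))
  also have "\<dots> \<le> ennreal (cform p \<eta> * A powr Ap_exp p) * (wnorm p' (dual_weight p w) g * wnorm p w f)"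
    by (intro mult_right_mono ennreal_leI c) auto
  finally show ?thesis by (simp add: p'_def mult_ac)
qed

section \<open>The sharp strong bound for sparse operators\<close>

definition sparse_op :: "'a set set \<Rightarrow> ('a \<Rightarrow> ennreal) \<Rightarrow> 'a \<Rightarrow> ennreal" where
  "sparse_op F f x = (\<Sum>P\<in>F. ave lebesgue P f * indicator P x)"

lemma ave_le_wnorm:
  assumes p: "1 < p" and w: "pos_weight w" and P: "P \<in> D" and [measurable]: "f \<in> borel_measurable lebesgue"
  shows "(\<integral>\<^sup>+x\<in>P. f x \<partial>lebesgue) \<le> wnorm p w f * epowr (\<integral>\<^sup>+x\<in>P. dual_weight p w x \<partial>lebesgue) (1 - 1 / p)"
proof -
  have [measurable]: "w \<in> borel_measurable lebesgue" "dual_weight p w \<in> borel_measurable lebesgue" "P \<in> sets lebesgue"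
    using w pos_weight_dual D_sets[OF P] by measurable
  have "1 / p + - (1 / (p - 1)) * (1 - 1 / p) = 0" using p by (simp add: field_simps)
  then have 1: "epowr (w x) (1 / p) * epowr (dual_weight p w x) (1 - 1 / p) = 1" for x
    unfolding dual_weight_def epowr_epowr epowr_add[symmetric] by (simp add: pos_weight_epowr_0 w)
  have e: "f x * indicator P x = epowr (epowr (f x) p * w x) (1 / p) * epowr (dual_weight p w x * indicator P x) (1 - 1 / p)" for x
    using 1[of x] p by (auto simp: epowr_mult epowr_epowr mult.assoc split: split_indicator)
  show ?thesis
    unfolding e wnorm_def by (rule nn_integral_Holder) (use p in auto)
qed

text \<open>The dual form of \<open>sparse_bilinear\<close>, tested with g = h w. The finite norm of
  f makes the averages and hence the norm on the left finite, as \<open>epowr_norm_dual\<close>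
  requires.\<close>

theorem sparse_op_bound:
  assumes p: "1 < p" and A: "Apd p w A" and sp: "sparse_sets \<eta> F E"
    and [measurable]: "f \<in> borel_measurable lebesgue" and fin_f: "wnorm p w f < top"
  shows "wnorm p w (sparse_op F f) \<le> ennreal (cform p \<eta> * A powr Ap_exp p) * wnorm p w f"
proof -
  let ?N = "wdens w"
  have F: "finite F" "F \<subseteq> D" using sp by (auto simp: sparse_sets_def)
  have w: "pos_weight w" using Apd_pos[OF A] .
  have [measurable]: "w \<in> borel_measurable lebesgue" "dual_weight p w \<in> borel_measurable lebesgue"
    using w pos_weight_dual by measurable
  have Fs: "P \<in> sets lebesgue" if "P \<in> F" for P using that F D_sets by auto
  have [measurable]: "sparse_op F f \<in> borel_measurable lebesgue"
    unfolding sparse_op_def[abs_def] using Fs by (auto intro!: borel_measurable_sum)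
  have eq: "(\<integral>\<^sup>+x. epowr (sparse_op F f x) p \<partial>?N) = (\<integral>\<^sup>+x. epowr (sparse_op F f x) p * w x \<partial>lebesgue)"
    by (rule nn_integral_wdens[OF w]) measurable
  have afin: "ave lebesgue P f < top" if P: "P \<in> F" for P
  proof -
    have PD: "P \<in> D" using P F by auto
    interpret P: finite_pos_set lebesgue P by (rule D_pos[OF PD])
    have "(\<integral>\<^sup>+x\<in>P. dual_weight p w x \<partial>lebesgue) < top"
      using Apd_ave(2)[OF A p PD] P.fin unfolding P.ave_mult_emeasure[symmetric] by (simp add: ennreal_mult_less_top)
    then have "(\<integral>\<^sup>+x\<in>P. f x \<partial>lebesgue) < top"
      using fin_f by (intro order_le_less_trans[OF ave_le_wnorm[OF p w PD]]) (auto simp: ennreal_mult_less_top)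
    then show ?thesis using P.pos by (auto simp: ave_def less_top[symmetric] ennreal_divide_eq_top_iff)
  qed
  define c where "c = (\<Sum>P\<in>F. ave lebesgue P f)"
  have c: "c < top" unfolding c_def using afin F by simp
  have le_c: "sparse_op F f x \<le> c * indicator (\<Union>F) x" for x
  proof (cases "x \<in> \<Union>F")
    case True
    then show ?thesis unfolding sparse_op_def c_def by (auto intro!: sum_mono split: split_indicator)
  next
    case False
    then have "sparse_op F f x = 0" unfolding sparse_op_def by (auto intro!: sum.neutral)
    then show ?thesis by simp
  qed
  have "(\<integral>\<^sup>+x. epowr (sparse_op F f x) p * w x \<partial>lebesgue) \<le> (\<integral>\<^sup>+x. (\<Sum>P\<in>F. epowr c p * (w x * indicator P x)) \<partial>lebesgue)"
  proof (rule nn_integral_mono)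
    fix x
    have "epowr (sparse_op F f x) p * w x \<le> epowr (c * indicator (\<Union>F) x) p * w x"
      using p by (intro mult_right_mono epowr_mono le_c) auto
    also have "\<dots> = epowr c p * (w x * indicator (\<Union>F) x)"
      by (auto split: split_indicator)
    also have "\<dots> \<le> epowr c p * (\<Sum>P\<in>F. w x * indicator P x)"
    proof (intro mult_left_mono)
      show "w x * indicator (\<Union>F) x \<le> (\<Sum>P\<in>F. w x * indicator P x)"
      proof (cases "x \<in> \<Union>F")
        case True
        then obtain P where "P \<in> F" "x \<in> P" by auto
        then show ?thesis using member_le_sum[of P F "\<lambda>P. w x * indicator P x"] F True by auto
      qed simp
    qed simp
    finally show "epowr (sparse_op F f x) p * w x \<le> (\<Sum>P\<in>F. epowr c p * (w x * indicator P x))"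
      by (simp add: sum_distrib_left)
  qed
  also have "\<dots> = (\<Sum>P\<in>F. epowr c p * (\<integral>\<^sup>+x\<in>P. w x \<partial>lebesgue))"
    using Fs by (subst nn_integral_sum) (auto intro!: sum.cong nn_integral_cmult)
  also have "\<dots> < top"
  proof (subst ennreal_sum_less_top[OF F(1)], intro ballI)
    fix P assume "P \<in> F"
    then have PD: "P \<in> D" using F by auto
    interpret P: finite_pos_set lebesgue P by (rule D_pos[OF PD])
    show "epowr c p * (\<integral>\<^sup>+x\<in>P. w x \<partial>lebesgue) < top"
      using Apd_ave(1)[OF A p PD] P.fin c unfolding P.ave_mult_emeasure[symmetric] by (simp add: ennreal_mult_less_top)
  qed
  finally have fin: "(\<integral>\<^sup>+x. epowr (sparse_op F f x) p \<partial>?N) < top" unfolding eq .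
  have "epowr (\<integral>\<^sup>+x. epowr (sparse_op F f x) p \<partial>?N) (1 / p) \<le> ennreal (cform p \<eta> * A powr Ap_exp p) * wnorm p w f"
  proof (rule epowr_norm_dual[OF _ p fin])
    fix h :: "'a \<Rightarrow> ennreal" assume "h \<in> borel_measurable ?N"
    then have [measurable]: "h \<in> borel_measurable lebesgue" by simp
    have "(\<integral>\<^sup>+x. sparse_op F f x * h x \<partial>?N) = (\<integral>\<^sup>+x. sparse_op F f x * h x * w x \<partial>lebesgue)"
      by (rule nn_integral_wdens[OF w]) measurable
    also have "\<dots> = (\<integral>\<^sup>+x. (\<Sum>P\<in>F. ave lebesgue P f * (h x * w x * indicator P x)) \<partial>lebesgue)"
      unfolding sparse_op_def sum_distrib_right by (intro nn_integral_cong sum.cong) (auto simp: mult_ac)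
    also have "\<dots> = (\<Sum>P\<in>F. ave lebesgue P f * (\<integral>\<^sup>+x\<in>P. h x * w x \<partial>lebesgue))"
      using Fs by (subst nn_integral_sum) (auto intro!: sum.cong nn_integral_cmult)
    also have "\<dots> = (\<Sum>P\<in>F. ave lebesgue P f * ave lebesgue P (\<lambda>x. h x * w x) * emeasure lebesgue P)"
      using F D_pos by (intro sum.cong) (auto simp: mult.assoc finite_pos_set.ave_mult_emeasure[OF D_pos])
    also have "\<dots> \<le> ennreal (cform p \<eta> * A powr Ap_exp p) * (wnorm p w f * wnorm (p / (p - 1)) (dual_weight p w) (\<lambda>x. h x * w x))"
      by (rule sparse_bilinear[OF p A sp]) measurable
    also have "wnorm (p / (p - 1)) (dual_weight p w) (\<lambda>x. h x * w x) = epowr (\<integral>\<^sup>+x. epowr (h x) (p / (p - 1)) \<partial>?N) (1 - 1 / p)"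
    proof -
      have ex: "p / (p - 1) + - (1 / (p - 1)) = 1" using p by (simp flip: diff_divide_distrib)
      have "epowr (w x) (p / (p - 1)) * dual_weight p w x = w x" for x
        unfolding dual_weight_def epowr_add[symmetric] ex by simp
      then have "(\<integral>\<^sup>+x. epowr (h x * w x) (p / (p - 1)) * dual_weight p w x \<partial>lebesgue) = (\<integral>\<^sup>+x. epowr (h x) (p / (p - 1)) * w x \<partial>lebesgue)"
        by (simp add: epowr_mult mult.assoc)
      also have "\<dots> = (\<integral>\<^sup>+x. epowr (h x) (p / (p - 1)) \<partial>?N)"
        by (rule nn_integral_wdens[OF w, symmetric]) measurable
      finally have i: "(\<integral>\<^sup>+x. epowr (h x * w x) (p / (p - 1)) * dual_weight p w x \<partial>lebesgue) = (\<integral>\<^sup>+x. epowr (h x) (p / (p - 1)) \<partial>?N)" .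
      have "1 / (p / (p - 1)) = 1 - 1 / p" using p by (simp add: field_simps)
      then show ?thesis unfolding wnorm_def i by (simp only:)
    qed
    finally show "(\<integral>\<^sup>+x. sparse_op F f x * h x \<partial>?N) \<le> ennreal (cform p \<eta> * A powr Ap_exp p) * wnorm p w f *
        epowr (\<integral>\<^sup>+x. epowr (h x) (p / (p - 1)) \<partial>?N) (1 - 1 / p)" by (simp add: mult.assoc)
  qed simp
  then show ?thesis unfolding eq wnorm_def .
qed

end

section \<open>Sparse domination of mean oscillations\<close>

lemma norm_mean_diff_le:
  fixes b :: "(real^'n) \<Rightarrow> 'k::euclidean_space"
  assumes P: "finite_pos_set lebesgue P" and b: "set_integrable lebesgue P b"
  shows "ennreal (norm (mean P b - c)) \<le> ave lebesgue P (\<lambda>x. ennreal (norm (b x - c)))"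
proof -
  interpret finite_pos_set lebesgue P by (rule P)
  obtain n where n: "emeasure lebesgue P = ennreal n" "0 < n"
    using pos fin by (cases "emeasure lebesgue P") auto
  have m: "measure lebesgue P = n" using n by (simp add: measure_def)
  have c: "set_integrable lebesgue P (\<lambda>x. c)"
    using fin by (simp add: set_integrable_def less_top)
  have i: "set_integrable lebesgue P (\<lambda>x. b x - c)"
    using b c by (rule set_integral_diff)
  have "(LINT x:P|lebesgue. b x - c) = (LINT x:P|lebesgue. b x) - n *\<^sub>R c"
    using set_integral_diff(2)[OF b c] fin m by (simp add: set_lebesgue_integral_def less_top)
  then have e: "mean P b - c = (LINT x:P|lebesgue. b x - c) /\<^sub>R n"
    using n by (simp add: mean_def m scaleR_diff_right)
  have "ennreal (norm (LINT x:P|lebesgue. b x - c)) \<le> (\<integral>\<^sup>+x\<in>P. ennreal (norm (b x - c)) \<partial>lebesgue)"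
  proof -
    have "ennreal (norm (LINT x:P|lebesgue. b x - c)) \<le> (\<integral>\<^sup>+x. ennreal (norm (indicator P x *\<^sub>R (b x - c))) \<partial>lebesgue)"
      unfolding set_lebesgue_integral_def
      using i[unfolded set_integrable_def] by (rule integral_norm_bound_ennreal)
    also have "\<dots> = (\<integral>\<^sup>+x\<in>P. ennreal (norm (b x - c)) \<partial>lebesgue)"
      by (intro nn_integral_cong) (auto split: split_indicator)
    finally show ?thesis .
  qed
  then have "ennreal (norm (LINT x:P|lebesgue. b x - c)) / ennreal n \<le> ave lebesgue P (\<lambda>x. ennreal (norm (b x - c)))"
    unfolding ave_def n by (rule divide_right_mono_ennreal)
  then show ?thesis
    unfolding e using n by (simp add: divide_ennreal divide_inverse mult.commute)
qed

lemma sum_indicator_disjoint_le: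
  assumes "finite F" "disjoint_family_on A F"
  shows "(\<Sum>P\<in>F. indicator (A P) x) \<le> (1::ennreal)"
proof -
  have "(\<Sum>P\<in>F. indicator (A P) x) = (indicator (\<Union>(A ` F)) x :: ennreal)"
    by (rule indicator_UN_disjoint[OF assms, symmetric])
  then show ?thesis by (simp split: split_indicator)
qed

lemma nn_integral_count_space_le_countable:
  fixes f :: "'a \<Rightarrow> ennreal"
  assumes A: "countable A" and le: "\<And>F. finite F \<Longrightarrow> F \<subseteq> A \<Longrightarrow> (\<Sum>x\<in>F. f x) \<le> K"
  shows "(\<integral>\<^sup>+x. f x \<partial>count_space A) \<le> K"
proof (cases "finite A")
  case True
  then show ?thesis using le[of A] by (simp add: nn_integral_count_space_finite)
next
  case False
  note bij = bij_betw_from_nat_into[OF A False]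
  have "(\<integral>\<^sup>+x. f x \<partial>count_space A) = (\<Sum>i. f (from_nat_into A i))"
    by (simp add: nn_integral_bij_count_space[OF bij, symmetric] nn_integral_count_space_nat)
  also have "\<dots> = (SUP n. \<Sum>i<n. f (from_nat_into A i))"
    by (rule suminf_eq_SUP)
  also have "\<dots> \<le> K"
  proof (rule SUP_least)
    fix n
    have "inj_on (from_nat_into A) {..<n}"
      using bij by (auto simp: bij_betw_def intro: inj_on_subset)
    then have "(\<Sum>i<n. f (from_nat_into A i)) = (\<Sum>x\<in>from_nat_into A ` {..<n}. f x)"
      by (simp add: sum.reindex)
    also have "\<dots> \<le> K"
      using bij by (intro le) (auto simp: bij_betw_def)
    finally show "(\<Sum>i<n. f (from_nat_into A i)) \<le> K" .
  qed
  finally show ?thesis .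
qed

section \<open>The stopping family for the mean oscillations of b\<close>

locale dyadic_osc = dyadic D d for D :: "(real^'n) set set" and d +
  fixes S :: "(real^'n) set set" and b :: "real^'n \<Rightarrow> 'k::euclidean_space"
  assumes S: "finite S" "S \<subseteq> D"
    and b_int: "\<And>P. P \<in> D \<Longrightarrow> set_integrable lebesgue P b"
    and b_meas [measurable]: "b \<in> borel_measurable lebesgue"
begin

definition dev :: "(real^'n) set \<Rightarrow> real^'n \<Rightarrow> ennreal" where
  "dev R x = ennreal (norm (b x - mean R b))"

definition osc :: "(real^'n) set \<Rightarrow> ennreal" where
  "osc R = ave lebesgue R (dev R)"

text \<open>With the factor 4 these cells fill at most a quarter of R
  (\<open>bstop_measure\<close>), which leaves enough of R for sparseness.\<close>

definition bstop :: "(real^'n) set \<Rightarrow> (real^'n) set set" where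
  "bstop R = {P\<in>D. P \<subset> R \<and> ennreal 4 * osc R < ave lebesgue P (dev R)}"

text \<open>The given cells also stop, so that S becomes part of one tree and every cell of S below
  R lies under a child of R.\<close>

definition sstop :: "(real^'n) set \<Rightarrow> (real^'n) set set" where
  "sstop R = bstop R \<union> {P\<in>S. P \<subset> R}"

definition ch :: "(real^'n) set \<Rightarrow> (real^'n) set set" where
  "ch R = maxi (sstop R)"

inductive_set St :: "(real^'n) set set" where
  base: "Q \<in> S \<Longrightarrow> Q \<in> St"
| step: "R \<in> St \<Longrightarrow> P \<in> ch R \<Longrightarrow> P \<in> St"

lemma dev_meas [measurable]: "dev R \<in> borel_measurable lebesgue"
  unfolding dev_def by measurable

lemma sstop_D: "sstop R \<subseteq> {P\<in>D. P \<subset> R}"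
  using S by (auto simp: sstop_def bstop_def)

lemma ch_D: "P \<in> ch R \<Longrightarrow> P \<in> D \<and> P \<subset> R"
  using sstop_D maxi_subset unfolding ch_def by blast

lemma St_sub: "P \<in> St \<Longrightarrow> P \<in> D \<and> (\<exists>Q\<in>S. P \<subseteq> Q)"
  by (induction rule: St.induct) (use S ch_D in blast)+

lemma St_D: "P \<in> St \<Longrightarrow> P \<in> D" using St_sub by blast

lemma in_ch: "P \<in> sstop R \<Longrightarrow> R \<in> D \<Longrightarrow> \<exists>C\<in>ch R. P \<subseteq> C"
  unfolding ch_def using sstop_D by (intro exists_maxi) auto

lemma ch_max: "P \<in> ch R \<Longrightarrow> C \<in> ch R \<Longrightarrow> P \<subseteq> C \<Longrightarrow> P = C"
  by (auto simp: ch_def maxi_def)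

lemma nested_St: "P \<in> D \<Longrightarrow> R \<in> D \<Longrightarrow> T \<in> D \<Longrightarrow> T \<subseteq> P \<Longrightarrow> T \<subseteq> R \<Longrightarrow> P \<subseteq> R \<or> R \<subseteq> P"
  using D_nonempty nestedD[OF nested_D] by (metis ex_in_conv subsetD)

lemma finite_above: "R \<in> D \<Longrightarrow> finite {T\<in>D. R \<subseteq> T \<and> (\<exists>Q\<in>S. T \<subseteq> Q)}"
proof -
  assume R: "R \<in> D"
  have "{T\<in>D. R \<subseteq> T \<and> (\<exists>Q\<in>S. T \<subseteq> Q)} = (\<Union>Q\<in>S. {T\<in>D. R \<subseteq> T \<and> T \<subseteq> Q})" by auto
  then show ?thesis using S finite_between[OF R] by auto
qed

text \<open>\<open>St\<close> is generated from each member of S separately, so it has to be shown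
  that the trees fit together. If R is a child of R', then P is compared with R': if P lies strictly
  inside R', a child of R' contains P and hence strictly contains R, against maximality; the other
  two cases are direct. The induction is on the number of cells above R, finite because only cells
  inside members of S count.\<close>

lemma St_child: "R \<in> St \<Longrightarrow> P \<in> St \<Longrightarrow> R \<subset> P \<Longrightarrow> \<exists>C\<in>ch P. R \<subseteq> C"
proof (induction "card {T\<in>D. R \<subseteq> T \<and> (\<exists>Q\<in>S. T \<subseteq> Q)}" arbitrary: R P rule: less_induct)
  case less
  have RD: "R \<in> D" and PD: "P \<in> D" using less.prems St_D by auto
  have IH: "\<exists>C\<in>ch Y. X \<subseteq> C" if "X \<in> St" "Y \<in> St" "X \<subset> Y" "R \<subset> X" for X Y
  proof (rule less.hyps[OF _ that(1-3)])
    have "R \<in> {T\<in>D. R \<subseteq> T \<and> (\<exists>Q\<in>S. T \<subseteq> Q)}" using St_sub[OF less.prems(1)] by auto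
    moreover have "R \<notin> {T\<in>D. X \<subseteq> T \<and> (\<exists>Q\<in>S. T \<subseteq> Q)}" using that by auto
    moreover have "{T\<in>D. X \<subseteq> T \<and> (\<exists>Q\<in>S. T \<subseteq> Q)} \<subseteq> {T\<in>D. R \<subseteq> T \<and> (\<exists>Q\<in>S. T \<subseteq> Q)}" using that by auto
    ultimately show "card {T\<in>D. X \<subseteq> T \<and> (\<exists>Q\<in>S. T \<subseteq> Q)} < card {T\<in>D. R \<subseteq> T \<and> (\<exists>Q\<in>S. T \<subseteq> Q)}"
      by (intro psubset_card_mono finite_above RD) blast
  qed
  from less.prems(1) show ?case
  proof (cases rule: St.cases)
    case base
    then have "R \<in> sstop P" using less.prems by (auto simp: sstop_def)
    then show ?thesis by (rule in_ch[OF _ PD])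
  next
    case (step R')
    have R': "R' \<in> D" "R \<subset> R'" using St_D[OF step(1)] ch_D[OF step(2)] by auto
    consider "R' \<subset> P" | "R' = P" | "P \<subset> R'"
      using nested_St[OF R'(1) PD RD] R' less.prems by blast
    then show ?thesis
    proof cases
      case 1
      then show ?thesis using IH[OF step(1) less.prems(2) 1 R'(2)] R'(2) by blast
    next
      case 2
      then show ?thesis using step(2) by auto
    next
      case 3
      then obtain C where "C \<in> ch R'" "P \<subseteq> C" using IH[OF less.prems(2) step(1) 3] less.prems(3) by blast
      then have "R = C" using ch_max[OF step(2)] less.prems(3) by blast
      then show ?thesis using \<open>P \<subseteq> C\<close> less.prems(3) by blast
    qed
  qed
qed

lemma osc_fin: "R \<in> D \<Longrightarrow> osc R < top"
proof -
  assume R: "R \<in> D"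
  interpret finite_pos_set lebesgue R by (rule D_pos[OF R])
  have c: "set_integrable lebesgue R (\<lambda>x. mean R b)"
    using fin by (simp add: set_integrable_def less_top)
  have "integrable lebesgue (\<lambda>x. indicator R x *\<^sub>R (b x - mean R b))"
    using set_integral_diff(1)[OF b_int[OF R] c] by (simp add: set_integrable_def)
  then have "(\<integral>\<^sup>+x. ennreal (norm (indicator R x *\<^sub>R (b x - mean R b))) \<partial>lebesgue) < top"
    by (simp add: integrable_iff_bounded)
  also have "(\<integral>\<^sup>+x. ennreal (norm (indicator R x *\<^sub>R (b x - mean R b))) \<partial>lebesgue) = (\<integral>\<^sup>+x\<in>R. dev R x \<partial>lebesgue)"
    by (intro nn_integral_cong) (auto simp: dev_def split: split_indicator)
  finally show ?thesis using pos by (auto simp: osc_def ave_def less_top[symmetric] ennreal_divide_eq_top_iff)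
qed

text \<open>The weak type bound for the disjoint maximal cells. If the oscillation is 0 it cannot be
  cancelled, but then no cell is selected at all.\<close>

lemma bstop_measure:
  assumes R: "R \<in> D"
  shows "4 * emeasure lebesgue (\<Union>(maxi (bstop R))) \<le> emeasure lebesgue R"
proof -
  interpret R: finite_pos_set lebesgue R by (rule D_pos[OF R])
  have C: "bstop R \<subseteq> D" by (auto simp: bstop_def)
  have sub: "\<Union>(maxi (bstop R)) \<subseteq> R" by (auto simp: bstop_def maxi_def)
  let ?N = "density lebesgue (dev R)"
  have "ennreal 4 * osc R * emeasure lebesgue (\<Union>(maxi (bstop R))) = (\<integral>\<^sup>+P. ennreal 4 * osc R * emeasure lebesgue P \<partial>count_space (maxi (bstop R)))"
    by (subst emeasure_UN_maxi[OF C]) (auto intro!: nn_integral_cmult[symmetric])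
  also have "\<dots> \<le> (\<integral>\<^sup>+P. emeasure ?N P \<partial>count_space (maxi (bstop R)))"
  proof (rule nn_integral_mono)
    fix P assume "P \<in> space (count_space (maxi (bstop R)))"
    then have P: "P \<in> D" "ennreal 4 * osc R < ave lebesgue P (dev R)" by (auto simp: maxi_def bstop_def)
    interpret P: finite_pos_set lebesgue P by (rule D_pos[OF P(1)])
    have "ennreal 4 * osc R * emeasure lebesgue P \<le> ave lebesgue P (dev R) * emeasure lebesgue P"
      using P(2) by (intro mult_right_mono) auto
    then show "ennreal 4 * osc R * emeasure lebesgue P \<le> emeasure ?N P"
      by (simp add: P.ave_mult_emeasure emeasure_density)
  qed
  also have "\<dots> = emeasure ?N (\<Union>(maxi (bstop R)))"
    by (rule emeasure_UN_maxi[OF C, symmetric]) simp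
  also have "\<dots> \<le> emeasure ?N R" using sub by (intro emeasure_mono) auto
  also have "\<dots> = osc R * emeasure lebesgue R"
    by (simp add: emeasure_density osc_def R.ave_mult_emeasure)
  finally have main: "osc R * (4 * emeasure lebesgue (\<Union>(maxi (bstop R)))) \<le> osc R * emeasure lebesgue R"
    by (simp add: mult_ac)
  show ?thesis
  proof (cases "osc R = 0")
    case True
    have "bstop R = {}"
    proof -
      have "ave lebesgue P (dev R) = 0" if P: "P \<in> D" "P \<subset> R" for P
      proof -
        have "(\<integral>\<^sup>+x\<in>P. dev R x \<partial>lebesgue) \<le> (\<integral>\<^sup>+x\<in>R. dev R x \<partial>lebesgue)"
          using P by (intro nn_integral_mono) (auto split: split_indicator)
        also have "\<dots> = 0" using True R.ave_mult_emeasure[of "dev R"] by (simp add: osc_def)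
        finally show ?thesis by (simp add: ave_def)
      qed
      then show ?thesis by (auto simp: bstop_def)
    qed
    then show ?thesis by (simp add: maxi_def)
  next
    case False
    then show ?thesis using main osc_fin[OF R] by (subst (asm) ennreal_mult_le_mult_iff) auto
  qed
qed

text \<open>The next larger cell P' inside R is either R or, by the maximality of P, not a stopping
  cell. In both cases the mean deviation over P' is at most 4 \<open>osc R\<close>; passing from P'
  to P costs the factor d.\<close>

lemma child_mean:
  assumes R: "R \<in> D" and P: "P \<in> ch R"
  shows "ennreal (norm (mean P b - mean R b)) \<le> ennreal (4 * d) * osc R"
proof -
  have PD: "P \<in> D" "P \<subset> R" using ch_D[OF P] by auto
  obtain P' where P': "P' \<in> D" "P \<subset> P'" "P' \<subseteq> R" "emeasure lebesgue P' \<le> ennreal d * emeasure lebesgue P"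
    using parent[OF PD(1) R PD(2)] by auto
  interpret P: finite_pos_set lebesgue P by (rule D_pos[OF PD(1)])
  interpret P': finite_pos_set lebesgue P' by (rule D_pos[OF P'(1)])
  have 1: "ave lebesgue P' (dev R) \<le> ennreal 4 * osc R"
  proof (cases "P' = R")
    case True
    have "1 * osc R \<le> ennreal 4 * osc R" by (intro mult_right_mono) auto
    then show ?thesis using True by (simp add: osc_def)
  next
    case False
    have "P' \<notin> sstop R" using P P'(2) unfolding ch_def maxi_def by auto
    then show ?thesis using False P' by (auto simp: sstop_def bstop_def not_less)
  qed
  have "ennreal (norm (mean P b - mean R b)) * emeasure lebesgue P \<le> ave lebesgue P (dev R) * emeasure lebesgue P"
    unfolding dev_def by (intro mult_right_mono norm_mean_diff_le D_pos PD b_int) auto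
  also have "\<dots> \<le> (\<integral>\<^sup>+x\<in>P'. dev R x \<partial>lebesgue)"
    unfolding P.ave_mult_emeasure using P'(2) by (intro nn_integral_mono) (auto split: split_indicator)
  also have "\<dots> \<le> ennreal 4 * osc R * (ennreal d * emeasure lebesgue P)"
    unfolding P'.ave_mult_emeasure[symmetric] by (intro mult_mono 1 P') auto
  finally have "emeasure lebesgue P * ennreal (norm (mean P b - mean R b)) \<le> emeasure lebesgue P * (ennreal (4 * d) * osc R)"
    using d_ge_1 by (simp add: mult_ac ennreal_mult)
  then show ?thesis using P.pos P.fin by (subst (asm) ennreal_mult_le_mult_iff) auto
qed

text \<open>At a point outside the stopping cells all averages of the deviation are at most 4
  \<open>osc R\<close>, and almost everywhere they dominate the deviation. Countably many cells need
  only one null set.\<close>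

lemma AE_not_stopped:
  "AE x in lebesgue. \<forall>R\<in>D. x \<in> R \<longrightarrow> x \<notin> \<Union>(bstop R) \<longrightarrow> dev R x \<le> ennreal 4 * osc R"
proof (intro iffD2[OF AE_ball_countable[OF countable_D]] ballI)
  fix R assume R: "R \<in> D"
  have "AE x in lebesgue. x \<in> R \<longrightarrow> dev R x \<le> mf (\<lambda>P. ave lebesgue P (dev R)) {P\<in>D. P \<subseteq> R} x"
    by (rule dyadic_differentiation[OF _ R]) measurable
  then show "AE x in lebesgue. x \<in> R \<longrightarrow> x \<notin> \<Union>(bstop R) \<longrightarrow> dev R x \<le> ennreal 4 * osc R"
  proof (rule eventually_mono, intro impI)
    fix x assume h: "x \<in> R \<longrightarrow> dev R x \<le> mf (\<lambda>P. ave lebesgue P (dev R)) {P\<in>D. P \<subseteq> R} x"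
      and x: "x \<in> R" "x \<notin> \<Union>(bstop R)"
    have "mf (\<lambda>P. ave lebesgue P (dev R)) {P\<in>D. P \<subseteq> R} x \<le> ennreal 4 * osc R"
    proof (rule mf_least)
      fix P assume P: "P \<in> {P\<in>D. P \<subseteq> R}" "x \<in> P"
      show "ave lebesgue P (dev R) \<le> ennreal 4 * osc R"
      proof (cases "P = R")
        case True
        have "1 * osc R \<le> ennreal 4 * osc R" by (intro mult_right_mono) auto
        then show ?thesis using True by (simp add: osc_def)
      next
        case False
        then have "P \<subset> R" using P by auto
        then show ?thesis using P x by (auto simp: bstop_def not_less)
      qed
    qed
    then show "dev R x \<le> ennreal 4 * osc R" using h x by auto
  qed
qed

text \<open>Telescoping down the stopping cells that contain x: each step costs
  \<open>child_mean\<close>, and the last cell, in no child of which x lies, is covered by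
  \<open>good\<close>. The descent ends because the chain is finite.\<close>

lemma pointwise_bound:
  assumes good: "\<forall>R\<in>D. x \<in> R \<longrightarrow> x \<notin> \<Union>(bstop R) \<longrightarrow> dev R x \<le> ennreal 4 * osc R"
    and fin: "finite {P\<in>St. x \<in> P}" and Q: "Q \<in> St" "x \<in> Q"
  shows "dev Q x \<le> ennreal (4 * d) * (\<Sum>P\<in>{P\<in>St. P \<subseteq> Q \<and> x \<in> P}. osc P)"
  using Q
proof (induction "card {P\<in>St. P \<subseteq> Q \<and> x \<in> P}" arbitrary: Q rule: less_induct)
  case less
  have QD: "Q \<in> D" using less.prems St_D by auto
  have f: "finite {P\<in>St. P \<subseteq> R \<and> x \<in> P}" for R by (rule finite_subset[OF _ fin]) auto
  show ?case
  proof (cases "x \<in> \<Union>(ch Q)")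
    case False
    have "x \<notin> \<Union>(bstop Q)"
      using in_ch[OF _ QD] False unfolding sstop_def by blast
    then have "dev Q x \<le> ennreal 4 * osc Q" using good QD less.prems by auto
    also have "\<dots> \<le> ennreal (4 * d) * (\<Sum>P\<in>{P\<in>St. P \<subseteq> Q \<and> x \<in> P}. osc P)"
      using d_ge_1 less.prems by (intro mult_mono ennreal_leI member_le_sum f) auto
    finally show ?thesis .
  next
    case True
    then obtain P where P: "P \<in> ch Q" "x \<in> P" by auto
    have PD: "P \<in> D" "P \<subset> Q" using ch_D[OF P(1)] by auto
    have PS: "P \<in> St" by (rule St.step[OF less.prems(1) P(1)])
    let ?A = "\<lambda>R. {P\<in>St. P \<subseteq> R \<and> x \<in> P}"
    have sub: "insert Q (?A P) \<subseteq> ?A Q" "Q \<notin> ?A P" using PD less.prems by auto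
    have "card (?A P) < card (?A Q)"
      using sub by (intro psubset_card_mono f) auto
    from less.hyps[OF this PS P(2)] have IH: "dev P x \<le> ennreal (4 * d) * (\<Sum>P\<in>?A P. osc P)" .
    have "norm (b x - mean Q b) \<le> norm (b x - mean P b) + norm (mean P b - mean Q b)"
      using norm_triangle_ineq[of "b x - mean P b" "mean P b - mean Q b"] by simp
    then have "dev Q x \<le> dev P x + ennreal (norm (mean P b - mean Q b))"
      unfolding dev_def by (simp add: ennreal_leI flip: ennreal_plus)
    also have "\<dots> \<le> ennreal (4 * d) * (\<Sum>P\<in>?A P. osc P) + ennreal (4 * d) * osc Q"
      by (intro add_mono IH child_mean QD P)
    also have "\<dots> = ennreal (4 * d) * (\<Sum>P\<in>insert Q (?A P). osc P)"
      using sub f by (subst sum.insert) (auto simp: distrib_left add.commute)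
    also have "\<dots> \<le> ennreal (4 * d) * (\<Sum>P\<in>?A Q. osc P)"
      by (intro mult_left_mono sum_mono2 f sub) auto
    finally show ?thesis .
  qed
qed

context
  fixes E :: "(real^'n) set \<Rightarrow> (real^'n) set" and \<eta> :: real
  assumes \<eta>: "0 < \<eta>" "\<eta> \<le> 1"
    and E: "\<And>Q. Q \<in> S \<Longrightarrow> E Q \<in> sets lebesgue" "\<And>Q. Q \<in> S \<Longrightarrow> E Q \<subseteq> Q"
      "\<And>Q. Q \<in> S \<Longrightarrow> ennreal \<eta> * emeasure lebesgue Q \<le> emeasure lebesgue (E Q)"
    and E_disj: "disjoint_family_on E S"
begin

text \<open>
  A set \<open>E Q\<close> with \<open>Q \<in> S\<close> is also given to the stopping parent of \<open>Q\<close>, whose own part \<open>EA\<close> may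
  be small when its children in \<open>S\<close> cover most of it.
\<close>

definition EA :: "(real^'n) set \<Rightarrow> (real^'n) set" where "EA P = P - \<Union>(ch P)"
definition EB :: "(real^'n) set \<Rightarrow> (real^'n) set" where "EB P = (\<Union>Q\<in>ch P \<inter> S. E Q)"
definition ES :: "(real^'n) set \<Rightarrow> (real^'n) set" where "ES P = EA P \<union> EB P"

lemma EA_sets [measurable]: "P \<in> D \<Longrightarrow> EA P \<in> sets lebesgue"
  unfolding EA_def ch_def using sstop_D by (intro sets.Diff D_sets UN_maxi_sets) auto

lemma EB_sets [measurable]: "EB P \<in> sets lebesgue"
  unfolding EB_def using S E by (intro sets.finite_UN) auto

lemma EA_disj: "disjoint_family_on EA St"
  unfolding disjoint_family_on_def
proof (intro ballI impI)
  fix P R assume PR: "P \<in> St" "R \<in> St" "P \<noteq> R"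
  show "EA P \<inter> EA R = {}"
  proof (rule ccontr)
    assume "EA P \<inter> EA R \<noteq> {}"
    then obtain x where x: "x \<in> EA P" "x \<in> EA R" by auto
    then have "P \<subset> R \<or> R \<subset> P"
      using nestedD[OF nested_D, of P R x] PR St_D unfolding EA_def by auto
    then show False
      using St_child[of P R] St_child[of R P] PR x unfolding EA_def by blast
  qed
qed

text \<open>Of two different parents the smaller would lie in a child of the larger. That child
  would strictly contain Q, which is itself a child of the larger parent.\<close>

lemma ch_unique: "Q \<in> ch P \<Longrightarrow> Q \<in> ch R \<Longrightarrow> P \<in> St \<Longrightarrow> R \<in> St \<Longrightarrow> P = R"
proof (rule ccontr)
  assume h: "Q \<in> ch P" "Q \<in> ch R" "P \<in> St" "R \<in> St" "P \<noteq> R"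
  have *: False if q: "Q \<in> ch P" "Q \<in> ch R" "P \<in> St" "R \<in> St" "R \<subset> P" for P R
  proof -
    obtain C where C: "C \<in> ch P" "R \<subseteq> C" using St_child[OF q(4,3,5)] by auto
    have "Q \<subset> R" using ch_D[OF q(2)] by auto
    then show False using ch_max[OF q(1) C(1)] C(2) by blast
  qed
  have "Q \<subset> P" "Q \<subset> R" "Q \<in> D" using ch_D h by auto
  then have "P \<subset> R \<or> R \<subset> P"
    using nested_St[of P R Q] h St_D by blast
  then show False using *[OF h(1,2,3,4)] *[OF h(2,1,4,3)] by blast
qed

lemma EB_disj: "disjoint_family_on EB St"
  unfolding disjoint_family_on_def
proof (intro ballI impI)
  fix P R assume PR: "P \<in> St" "R \<in> St" "P \<noteq> R"
  show "EB P \<inter> EB R = {}"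
  proof (rule ccontr)
    assume "EB P \<inter> EB R \<noteq> {}"
    then obtain x Q Q' where x: "Q \<in> ch P" "Q \<in> S" "x \<in> E Q" "Q' \<in> ch R" "Q' \<in> S" "x \<in> E Q'"
      unfolding EB_def by auto
    then have "Q = Q'" using E_disj unfolding disjoint_family_on_def by blast
    then show False using ch_unique x PR by blast
  qed
qed

text \<open>P is covered by \<open>EA P\<close>, the cells of \<open>bstop\<close>, which fill at
  most a quarter of P, and the children in S. Of the last a proportion \<eta> is recovered in
  \<open>EB P\<close>; hence 3/4 \<eta>. The overlap is at most 2 since the families
  \<open>EA\<close> and \<open>EB\<close> are each disjoint.\<close>

lemma sparse_St:
  assumes F: "finite F" "F \<subseteq> St"
  shows "sparse_sets (3 / 4 * \<eta>) F ES"
  unfolding sparse_sets_def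
proof (intro conjI ballI allI)
  show "F \<subseteq> D" using F St_D by auto
  show "0 < 3 / 4 * \<eta>" "3 / 4 * \<eta> \<le> 1" using \<eta> by auto
  fix x
  have "(\<Sum>P\<in>F. indicator (ES P) x) \<le> (\<Sum>P\<in>F. indicator (EA P) x + indicator (EB P) x :: ennreal)"
    unfolding ES_def by (intro sum_mono) (auto split: split_indicator)
  also have "\<dots> \<le> 1 + 1"
    unfolding sum.distrib
    by (intro add_mono sum_indicator_disjoint_le F disjoint_family_on_mono[OF F(2)] EA_disj EB_disj)
  finally show "(\<Sum>P\<in>F. indicator (ES P) x) \<le> (2::ennreal)" by simp
next
  fix P assume "P \<in> F"
  then have PSt: "P \<in> St" and PD: "P \<in> D" using F St_D by auto
  interpret P: finite_pos_set lebesgue P by (rule D_pos[OF PD])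
  show "ES P \<in> sets lebesgue" unfolding ES_def using EA_sets[OF PD] EB_sets by (rule sets.Un)
  show "ES P \<subseteq> P"
    unfolding ES_def EA_def EB_def using E(2) ch_D by blast
  have EBs: "EB P \<subseteq> \<Union>(ch P)" unfolding EB_def using E(2) by blast
  have chs: "\<Union>(ch P) \<subseteq> \<Union>(maxi (bstop P)) \<union> \<Union>(ch P \<inter> S)"
  proof
    fix x assume "x \<in> \<Union>(ch P)"
    then obtain C where C: "C \<in> ch P" "x \<in> C" by auto
    then have "C \<in> S \<or> C \<in> bstop P" unfolding ch_def maxi_def sstop_def by auto
    then show "x \<in> \<Union>(maxi (bstop P)) \<union> \<Union>(ch P \<inter> S)"
    proof
      assume "C \<in> bstop P"
      then obtain C' where "C' \<in> maxi (bstop P)" "C \<subseteq> C'"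
        using exists_maxi[of "bstop P" P C] PD unfolding bstop_def by auto
      then show ?thesis using C by auto
    qed (use C in auto)
  qed
  have finS: "finite (ch P \<inter> S)" using S by auto
  have B: "ennreal \<eta> * emeasure lebesgue (\<Union>(ch P \<inter> S)) \<le> emeasure lebesgue (EB P)"
  proof -
    have "emeasure lebesgue (\<Union>(ch P \<inter> S)) \<le> (\<Sum>Q\<in>ch P \<inter> S. emeasure lebesgue Q)"
      using emeasure_subadditive_finite[OF finS, of "\<lambda>Q. Q" lebesgue] S D_sets by auto
    then have "ennreal \<eta> * emeasure lebesgue (\<Union>(ch P \<inter> S)) \<le> (\<Sum>Q\<in>ch P \<inter> S. ennreal \<eta> * emeasure lebesgue Q)"
      unfolding sum_distrib_left[symmetric] by (rule mult_left_mono) simp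
    also have "\<dots> \<le> (\<Sum>Q\<in>ch P \<inter> S. emeasure lebesgue (E Q))"
      by (intro sum_mono E) auto
    also have "\<dots> = emeasure lebesgue (EB P)"
      unfolding EB_def using E(1) finS disjoint_family_on_mono[OF _ E_disj, of "ch P \<inter> S"]
      by (intro sum_emeasure) auto
    finally show ?thesis .
  qed
  have bm: "\<Union>(maxi (bstop P)) \<in> sets lebesgue" "\<Union>(ch P) \<in> sets lebesgue" "\<Union>(ch P \<inter> S) \<in> sets lebesgue"
    using sstop_D S D_sets finS
    by (auto simp: ch_def bstop_def intro!: UN_maxi_sets sets.finite_Union)
  have P1: "emeasure lebesgue P \<le> emeasure lebesgue (EA P) + (emeasure lebesgue (\<Union>(maxi (bstop P))) + emeasure lebesgue (\<Union>(ch P \<inter> S)))"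
  proof -
    have "emeasure lebesgue P \<le> emeasure lebesgue (EA P \<union> (\<Union>(maxi (bstop P)) \<union> \<Union>(ch P \<inter> S)))"
      using chs EA_sets[OF PD] bm by (intro emeasure_mono) (auto simp: EA_def)
    also have "\<dots> \<le> emeasure lebesgue (EA P) + emeasure lebesgue (\<Union>(maxi (bstop P)) \<union> \<Union>(ch P \<inter> S))"
      using EA_sets[OF PD] bm by (intro emeasure_subadditive) auto
    also have "\<dots> \<le> emeasure lebesgue (EA P) + (emeasure lebesgue (\<Union>(maxi (bstop P))) + emeasure lebesgue (\<Union>(ch P \<inter> S)))"
      using bm by (intro add_left_mono emeasure_subadditive) auto
    finally show ?thesis .
  qed
  have P2: "emeasure lebesgue (ES P) = emeasure lebesgue (EA P) + emeasure lebesgue (EB P)"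
    unfolding ES_def using EBs EA_sets[OF PD] by (intro plus_emeasure[symmetric]) (auto simp: EA_def)
  have sub: "EA P \<subseteq> P" "EB P \<subseteq> P" "\<Union>(ch P \<inter> S) \<subseteq> P" "\<Union>(maxi (bstop P)) \<subseteq> P"
    using ch_D EBs unfolding EA_def maxi_def bstop_def by blast+
  have finm: "emeasure lebesgue X < top" if "X \<subseteq> P" for X
    using emeasure_mono[OF that, of lebesgue] P.fin P.sets_P by (auto intro: order_le_less_trans)
  obtain n where n: "emeasure lebesgue P = ennreal n" "0 \<le> n" using P.fin by (cases "emeasure lebesgue P") auto
  obtain eA where eA: "emeasure lebesgue (EA P) = ennreal eA" "0 \<le> eA"
    using finm[OF sub(1)] by (cases "emeasure lebesgue (EA P)") auto
  obtain eB where eB: "emeasure lebesgue (EB P) = ennreal eB" "0 \<le> eB"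
    using finm[OF sub(2)] by (cases "emeasure lebesgue (EB P)") auto
  obtain eS where eS: "emeasure lebesgue (\<Union>(ch P \<inter> S)) = ennreal eS" "0 \<le> eS"
    using finm[OF sub(3)] by (cases "emeasure lebesgue (\<Union>(ch P \<inter> S))") auto
  obtain eb where eb: "emeasure lebesgue (\<Union>(maxi (bstop P))) = ennreal eb" "0 \<le> eb"
    using finm[OF sub(4)] by (cases "emeasure lebesgue (\<Union>(maxi (bstop P)))") auto
  have 1: "n \<le> eA + (eb + eS)"
    using P1 n eA eb eS by (simp flip: ennreal_plus)
  have "ennreal (4 * eb) \<le> ennreal n" using bstop_measure[OF PD] eb n by (simp add: ennreal_mult)
  then have 2: "4 * eb \<le> n" using n by (simp add: ennreal_le_iff)
  have "ennreal (\<eta> * eS) \<le> ennreal eB" using B eS eB \<eta> by (simp add: ennreal_mult)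
  then have 3: "\<eta> * eS \<le> eB" using eB by (simp add: ennreal_le_iff)
  have "3 / 4 * n \<le> eA + eS" using 1 2 by linarith
  then have "3 / 4 * \<eta> * n \<le> \<eta> * (eA + eS)" using \<eta> by (simp add: mult_left_mono mult.left_commute)
  also have "\<dots> \<le> eA + eB"
    using 3 mult_right_mono[OF \<eta>(2) eA(2)] by (simp add: distrib_left)
  finally have "ennreal (3 / 4 * \<eta> * n) \<le> ennreal (eA + eB)" by (rule ennreal_leI)
  then show "ennreal (3 / 4 * \<eta>) * emeasure lebesgue P \<le> emeasure lebesgue (ES P)"
  proof -
    have "ennreal (3 / 4 * \<eta>) * ennreal n = ennreal (3 / 4 * \<eta> * n)"
      using \<eta> n by (intro ennreal_mult[symmetric]) auto
    then show ?thesis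
      using \<open>ennreal (3 / 4 * \<eta> * n) \<le> ennreal (eA + eB)\<close>
      by (simp only: P2 n(1) eA(1) eB(1) ennreal_plus[OF eA(2) eB(2)])
  qed
qed (use F in auto)

text \<open>A Borel-Cantelli argument: sparseness bounds the sum of the measures of all stopping
  cells by a multiple of the measure of the union of S, which is finite.\<close>

lemma AE_finite_St: "AE x in lebesgue. finite {P\<in>St. x \<in> P}"
proof -
  have cSt: "countable St" by (rule countable_subset[OF _ countable_D]) (use St_D in auto)
  define K where "K = ennreal (2 / (3 / 4 * \<eta>)) * emeasure lebesgue (\<Union>S)"
  have US: "\<Union>S \<in> sets lebesgue" using S D_sets by (intro sets.finite_Union) auto
  have "emeasure lebesgue (\<Union>S) \<le> (\<Sum>Q\<in>S. emeasure lebesgue Q)"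
    using emeasure_subadditive_finite[OF S(1), of "\<lambda>Q. Q" lebesgue] S(2) D_sets by auto
  also have "\<dots> < top"
    using S finite_pos_set.fin[OF D_pos] by (subst ennreal_sum_less_top) auto
  finally have K: "K < top" by (simp add: K_def ennreal_mult_less_top)
  have fin_le: "(\<Sum>P\<in>F. emeasure lebesgue P) \<le> K" if F: "finite F" "F \<subseteq> St" for F
  proof -
    have sp: "ennreal (3 / 4 * \<eta>) * emeasure lebesgue P \<le> emeasure lebesgue (ES P)" "ES P \<in> sets lebesgue" "ES P \<subseteq> P"
      if "P \<in> F" for P using sparse_St[OF F] that by (auto simp: sparse_sets_def)
    have ov: "(\<Sum>P\<in>F. indicator (ES P) x) \<le> (2::ennreal)" for x
      using sparse_St[OF F] by (auto simp: sparse_sets_def)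
    have "ennreal (3 / 4 * \<eta>) * (\<Sum>P\<in>F. emeasure lebesgue P) \<le> (\<Sum>P\<in>F. emeasure lebesgue (ES P))"
      unfolding sum_distrib_left by (intro sum_mono sp)
    also have "\<dots> = (\<integral>\<^sup>+x. (\<Sum>P\<in>F. indicator (ES P) x) \<partial>lebesgue)"
      using sp by (subst nn_integral_sum) auto
    also have "\<dots> \<le> (\<integral>\<^sup>+x. 2 * indicator (\<Union>S) x \<partial>lebesgue)"
    proof (rule nn_integral_mono)
      fix x
      show "(\<Sum>P\<in>F. indicator (ES P) x) \<le> 2 * (indicator (\<Union>S) x :: ennreal)"
      proof (cases "x \<in> \<Union>S")
        case False
        then have "x \<notin> ES P" if "P \<in> F" for P using that sp(3) St_sub F(2) by blast
        then have "(\<Sum>P\<in>F. indicator (ES P) x) = (0::ennreal)" by (intro sum.neutral) auto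
        then show ?thesis by simp
      qed (use ov in auto)
    qed
    also have "\<dots> = 2 * emeasure lebesgue (\<Union>S)"
      using US by (simp add: nn_integral_cmult_indicator)
    finally have "ennreal (1 / (3 / 4 * \<eta>)) * (ennreal (3 / 4 * \<eta>) * (\<Sum>P\<in>F. emeasure lebesgue P))
       \<le> ennreal (1 / (3 / 4 * \<eta>)) * (ennreal 2 * emeasure lebesgue (\<Union>S))"
      by (intro mult_left_mono) auto
    also have "ennreal (1 / (3 / 4 * \<eta>)) * (ennreal (3 / 4 * \<eta>) * (\<Sum>P\<in>F. emeasure lebesgue P)) = (\<Sum>P\<in>F. emeasure lebesgue P)"
      using \<eta> by (subst mult.assoc[symmetric], subst ennreal_mult[symmetric]) auto
    also have "ennreal (1 / (3 / 4 * \<eta>)) * (ennreal 2 * emeasure lebesgue (\<Union>S)) = K"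
      using \<eta> unfolding K_def by (subst mult.assoc[symmetric], subst ennreal_mult[symmetric]) auto
    finally show ?thesis .
  qed
  have "(\<integral>\<^sup>+P. emeasure lebesgue P \<partial>count_space St) \<le> K"
    by (rule nn_integral_count_space_le_countable[OF cSt fin_le])
  also have "(\<integral>\<^sup>+P. emeasure lebesgue P \<partial>count_space St) = (\<integral>\<^sup>+P. (\<integral>\<^sup>+x. indicator P x \<partial>lebesgue) \<partial>count_space St)"
    using St_D D_sets by (intro nn_integral_cong) auto
  also have "\<dots> = (\<integral>\<^sup>+x. (\<integral>\<^sup>+P. indicator P x \<partial>count_space St) \<partial>lebesgue)"
    using St_D D_sets by (intro nn_integral_count_space_nn_integral[symmetric] cSt) auto
  finally have "(\<integral>\<^sup>+x. (\<integral>\<^sup>+P. indicator P x \<partial>count_space St) \<partial>lebesgue) \<noteq> top"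
    using K by (simp add: less_top order_le_less_trans)
  moreover have "(\<lambda>x. \<integral>\<^sup>+P. indicator P x \<partial>count_space St) \<in> borel_measurable lebesgue"
  proof (cases "finite St")
    case True
    then show ?thesis
      using St_D D_sets by (auto simp: nn_integral_count_space_finite intro!: borel_measurable_sum)
  next
    case False
    note bij = bij_betw_from_nat_into[OF cSt False]
    have "from_nat_into St i \<in> sets lebesgue" for i
      using bij_betwE[OF bij] St_D D_sets by auto
    then show ?thesis
      by (simp add: nn_integral_bij_count_space[OF bij, symmetric] nn_integral_count_space_nat)
  qed
  ultimately have "AE x in lebesgue. (\<integral>\<^sup>+P. indicator P x \<partial>count_space St) \<noteq> \<infinity>"
    by (intro nn_integral_PInf_AE) auto
  then show ?thesis
  proof (rule eventually_mono)
    fix x assume "(\<integral>\<^sup>+P. indicator P x \<partial>count_space St) \<noteq> \<infinity>"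
    moreover have "(\<integral>\<^sup>+P. indicator P x \<partial>count_space St) = (\<integral>\<^sup>+P. indicator {P\<in>St. x \<in> P} P \<partial>count_space St)"
      by (intro nn_integral_cong) (auto split: split_indicator)
    moreover have "\<dots> = emeasure (count_space St) {P\<in>St. x \<in> P}"
      by (rule nn_integral_indicator) auto
    ultimately show "finite {P\<in>St. x \<in> P}"
      by (auto simp: emeasure_count_space split: if_splits)
  qed
qed

theorem oscillation_sparse:
  "AE x in lebesgue. \<forall>Q\<in>S. x \<in> Q \<longrightarrow> finite {P\<in>St. x \<in> P} \<and>
     dev Q x \<le> ennreal (4 * d) * (\<Sum>P\<in>{P\<in>St. P \<subseteq> Q \<and> x \<in> P}. osc P)"
proof -
  have "AE x in lebesgue. finite {P\<in>St. x \<in> P} \<and> (\<forall>R\<in>D. x \<in> R \<longrightarrow> x \<notin> \<Union>(bstop R) \<longrightarrow> dev R x \<le> ennreal 4 * osc R)"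
    by (intro AE_conjI AE_finite_St AE_not_stopped)
  then show ?thesis
  proof (rule eventually_mono, intro ballI impI conjI)
    fix x Q assume x: "finite {P\<in>St. x \<in> P} \<and> (\<forall>R\<in>D. x \<in> R \<longrightarrow> x \<notin> \<Union>(bstop R) \<longrightarrow> dev R x \<le> ennreal 4 * osc R)"
      and Q: "Q \<in> S" "x \<in> Q"
    then show "finite {P\<in>St. x \<in> P}" by blast
    show "dev Q x \<le> ennreal (4 * d) * (\<Sum>P\<in>{P\<in>St. P \<subseteq> Q \<and> x \<in> P}. osc P)"
      using x Q by (intro pointwise_bound) (auto intro: St.base)
  qed
qed

end

end

section \<open>Duality for local averages, and powers of sums along chains\<close>

lemma epowr_mult_indicator: "epowr (f * indicator Q x) a = epowr f a * indicator Q x"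
  by (simp split: split_indicator)

lemma rave_dual:
  assumes Q: "finite_pos_set N Q" and r: "1 < r"
    and [measurable]: "X \<in> borel_measurable N"
    and X_fin: "(\<integral>\<^sup>+x\<in>Q. epowr (X x) r \<partial>N) < top"
    and dual: "\<And>h. h \<in> borel_measurable N \<Longrightarrow> (\<integral>\<^sup>+x. epowr (h x) (r / (r - 1)) \<partial>N) < top \<Longrightarrow>
      (\<integral>\<^sup>+x\<in>Q. X x * h x \<partial>N) \<le> K * (epowr (\<integral>\<^sup>+x\<in>Q. epowr (Y x) r \<partial>N) (1 / r) *
         epowr (\<integral>\<^sup>+x. epowr (h x) (r / (r - 1)) \<partial>N) (1 - 1 / r))"
  shows "rave r N Q X \<le> K * rave r N Q Y"
proof -
  interpret finite_pos_set N Q by (rule Q)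
  have "epowr (\<integral>\<^sup>+x. epowr (X x * indicator Q x) r \<partial>N) (1 / r) \<le> K * epowr (\<integral>\<^sup>+x\<in>Q. epowr (Y x) r \<partial>N) (1 / r)"
  proof (rule epowr_norm_dual[OF _ r])
    show "(\<integral>\<^sup>+x. epowr (X x * indicator Q x) r \<partial>N) < top"
      using X_fin by (simp add: epowr_mult_indicator)
    fix h :: "'a \<Rightarrow> ennreal" assume h: "h \<in> borel_measurable N" "(\<integral>\<^sup>+x. epowr (h x) (r / (r - 1)) \<partial>N) < top"
    have "(\<integral>\<^sup>+x. X x * indicator Q x * h x \<partial>N) = (\<integral>\<^sup>+x\<in>Q. X x * h x \<partial>N)"
      by (intro nn_integral_cong) (simp add: mult_ac)
    then show "(\<integral>\<^sup>+x. X x * indicator Q x * h x \<partial>N) \<le> K * epowr (\<integral>\<^sup>+x\<in>Q. epowr (Y x) r \<partial>N) (1 / r) *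
        epowr (\<integral>\<^sup>+x. epowr (h x) (r / (r - 1)) \<partial>N) (1 - 1 / r)"
      using dual[OF h] by (simp add: mult.assoc)
  qed measurable
  then have "epowr (\<integral>\<^sup>+x\<in>Q. epowr (X x) r \<partial>N) (1 / r) / epowr (emeasure N Q) (1 / r)
     \<le> K * epowr (\<integral>\<^sup>+x\<in>Q. epowr (Y x) r \<partial>N) (1 / r) / epowr (emeasure N Q) (1 / r)"
    by (intro divide_right_mono_ennreal) (simp add: epowr_mult_indicator)
  then show ?thesis
    unfolding rave_def ave_def epowr_divide[OF pos fin] by (simp add: ennreal_times_divide)
qed

text \<open>The mean value estimate for the power j + 1, with the difference moved to the other
  side.\<close>

lemma ennreal_add_power_le:
  fixes s a :: ennreal
  shows "(s + a) ^ Suc j \<le> s ^ Suc j + of_nat (Suc j) * (a * (s + a) ^ j)"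
proof (induction j)
  case (Suc j)
  have "(s + a) ^ Suc (Suc j) = s * (s + a) ^ Suc j + a * (s + a) ^ Suc j"
    by (simp add: distrib_right)
  also have "\<dots> \<le> s * (s ^ Suc j + of_nat (Suc j) * (a * (s + a) ^ j)) + a * (s + a) ^ Suc j"
    by (intro add_right_mono mult_left_mono Suc.IH) auto
  also have "\<dots> = s ^ Suc (Suc j) + (of_nat (Suc j) * (a * (s * (s + a) ^ j)) + a * (s + a) ^ Suc j)"
    by (simp only: distrib_left power_Suc add.assoc mult_ac)
  also have "\<dots> \<le> s ^ Suc (Suc j) + (of_nat (Suc j) * (a * (s + a) ^ Suc j) + a * (s + a) ^ Suc j)"
    unfolding power_Suc[of "s + a" j]
    by (intro add_left_mono add_right_mono mult_left_mono mult_right_mono) auto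
  also have "of_nat (Suc j) * (a * (s + a) ^ Suc j) + a * (s + a) ^ Suc j = of_nat (Suc (Suc j)) * (a * (s + a) ^ Suc j)"
    unfolding of_nat_Suc[of "Suc j"] by (simp only: distrib_right mult_1 add.commute)
  finally show ?case .
qed simp

text \<open>Partial summation: adding the largest set M raises the sum by \<open>a M\<close> and its
  power by at most (j + 1) \<open>a M\<close> times the j-th power of the new sum, which runs over
  exactly the sets inside M.\<close>

lemma chain_sum_power:
  fixes a :: "'a set \<Rightarrow> ennreal"
  assumes "finite C" "\<And>P R. P \<in> C \<Longrightarrow> R \<in> C \<Longrightarrow> P \<subseteq> R \<or> R \<subseteq> P"
  shows "(\<Sum>P\<in>C. a P) ^ Suc j \<le> of_nat (Suc j) * (\<Sum>P\<in>C. a P * (\<Sum>R\<in>{R\<in>C. R \<subseteq> P}. a R) ^ j)"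
  using assms
proof (induction C rule: finite_psubset_induct)
  case (psubset C)
  show ?case
  proof (cases "C = {}")
    case False
    obtain M where M: "M \<in> C" "\<And>R. R \<in> C \<Longrightarrow> M \<subseteq> R \<Longrightarrow> M = R"
      using finite_has_maximal[OF psubset.hyps False] by metis
    define C' where "C' = C - {M}"
    have C: "C = insert M C'" "M \<notin> C'" "finite C'" using M psubset.hyps by (auto simp: C'_def)
    have sub: "R \<subseteq> M" if "R \<in> C" for R using psubset.prems[OF M(1) that] M(2)[OF that] by auto
    have 1: "{R\<in>C. R \<subseteq> M} = C" using sub by auto
    have 2: "{R\<in>C. R \<subseteq> P} = {R\<in>C'. R \<subseteq> P}" if "P \<in> C'" for P
      using that M(2)[of P] C by auto
    have IH: "(\<Sum>P\<in>C'. a P) ^ Suc j \<le> of_nat (Suc j) * (\<Sum>P\<in>C'. a P * (\<Sum>R\<in>{R\<in>C'. R \<subseteq> P}. a R) ^ j)"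
      using psubset.prems M(1) by (intro psubset.IH) (auto simp: C'_def)
    have s: "(\<Sum>P\<in>C. a P) = (\<Sum>P\<in>C'. a P) + a M" using C by (simp add: add.commute)
    have "(\<Sum>P\<in>C. a P) ^ Suc j \<le> (\<Sum>P\<in>C'. a P) ^ Suc j + of_nat (Suc j) * (a M * (\<Sum>P\<in>C. a P) ^ j)"
      unfolding s by (rule ennreal_add_power_le)
    also have "\<dots> \<le> of_nat (Suc j) * (\<Sum>P\<in>C'. a P * (\<Sum>R\<in>{R\<in>C'. R \<subseteq> P}. a R) ^ j) + of_nat (Suc j) * (a M * (\<Sum>P\<in>C. a P) ^ j)"
      by (intro add_right_mono IH)
    also have "\<dots> = of_nat (Suc j) * (\<Sum>P\<in>C. a P * (\<Sum>R\<in>{R\<in>C. R \<subseteq> P}. a R) ^ j)"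
    proof -
      have "(\<Sum>P\<in>C. a P * (\<Sum>R\<in>{R\<in>C. R \<subseteq> P}. a R) ^ j) = a M * (\<Sum>P\<in>C. a P) ^ j + (\<Sum>P\<in>C'. a P * (\<Sum>R\<in>{R\<in>C. R \<subseteq> P}. a R) ^ j)"
        using C 1 by (metis (no_types, lifting) sum.insert)
      also have "(\<Sum>P\<in>C'. a P * (\<Sum>R\<in>{R\<in>C. R \<subseteq> P}. a R) ^ j) = (\<Sum>P\<in>C'. a P * (\<Sum>R\<in>{R\<in>C'. R \<subseteq> P}. a R) ^ j)"
        by (intro sum.cong) (auto simp: 2)
      finally show ?thesis by (simp only: distrib_left add.commute)
    qed
    finally show ?thesis .
  qed simp
qed

definition local_sum :: "('a set \<Rightarrow> ennreal) \<Rightarrow> 'a set set \<Rightarrow> 'a set \<Rightarrow> 'a \<Rightarrow> ennreal" where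
  "local_sum a F Q x = (\<Sum>P\<in>{P\<in>F. P \<subseteq> Q}. a P * indicator P x)"

lemma local_sum_alt: "finite F \<Longrightarrow> local_sum a F Q x = (\<Sum>P\<in>{P\<in>F. P \<subseteq> Q \<and> x \<in> P}. a P)"
  unfolding local_sum_def by (rule sum.mono_neutral_cong_right) (auto split: split_indicator)

lemma local_sum_power:
  assumes F: "finite F" "nested F"
  shows "local_sum a F Q x ^ Suc j \<le> of_nat (Suc j) * (\<Sum>P\<in>{P\<in>F. P \<subseteq> Q}. a P * indicator P x * local_sum a F P x ^ j)"
proof -
  let ?C = "{P\<in>F. P \<subseteq> Q \<and> x \<in> P}"
  have "local_sum a F Q x ^ Suc j \<le> of_nat (Suc j) * (\<Sum>P\<in>?C. a P * (\<Sum>R\<in>{R\<in>?C. R \<subseteq> P}. a R) ^ j)"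
    unfolding local_sum_alt[OF F(1)] by (rule chain_sum_power) (use F nestedD[OF F(2)] in auto)
  also have "(\<Sum>P\<in>?C. a P * (\<Sum>R\<in>{R\<in>?C. R \<subseteq> P}. a R) ^ j) = (\<Sum>P\<in>?C. a P * local_sum a F P x ^ j)"
  proof (rule sum.cong[OF refl])
    fix P assume P: "P \<in> ?C"
    have "{R\<in>?C. R \<subseteq> P} = {R\<in>F. R \<subseteq> P \<and> x \<in> R}" using P by auto
    then show "a P * (\<Sum>R\<in>{R\<in>?C. R \<subseteq> P}. a R) ^ j = a P * local_sum a F P x ^ j" by (simp add: local_sum_alt[OF F(1)])
  qed
  also have "\<dots> = (\<Sum>P\<in>{P\<in>F. P \<subseteq> Q}. a P * indicator P x * local_sum a F P x ^ j)"
    using F(1) by (intro sum.mono_neutral_cong_left) (auto split: split_indicator)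
  finally show ?thesis .
qed

section \<open>Maximal functions: a dual estimate, Buckley's inequality, dual measures of sparse
  parts\<close>

context dyadic
begin

text \<open>With r' = r / (r - 1), averages of h of exponent r'/2 have a maximal function for which
  Doob's inequality with the power r' has the constant 4, whatever r is; since r' > 2 its root is at
  most 2. This uniformity keeps the final constants independent of the chosen exponents.\<close>

lemma mf_dual:
  assumes G: "finite G" "G \<subseteq> D" and Q: "Q \<in> D" and r: "1 < r" "2 < r / (r - 1)"
    and [measurable]: "h \<in> borel_measurable lebesgue" "Y \<in> borel_measurable lebesgue"
  shows "(\<integral>\<^sup>+x\<in>Q. Y x * mf (\<lambda>P. rave (r / (r - 1) / 2) lebesgue P h) G x \<partial>lebesgue)
    \<le> 2 * (epowr (\<integral>\<^sup>+x\<in>Q. epowr (Y x) r \<partial>lebesgue) (1 / r) * epowr (\<integral>\<^sup>+x. epowr (h x) (r / (r - 1)) \<partial>lebesgue) (1 - 1 / r))"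
proof -
  define r' where "r' = r / (r - 1)"
  have r': "2 < r'" "1 / r + 1 / r' = 1" "1 - 1 / r = 1 / r'" using r by (auto simp: r'_def field_simps)
  have Gn: "nested G" "G \<subseteq> sets lebesgue" using nested_subset[OF nested_D G(2)] G D_sets by auto
  have [measurable]: "Q \<in> sets lebesgue" by (rule D_sets[OF Q])
  let ?m = "mf (\<lambda>P. rave (r' / 2) lebesgue P h) G"
  have [measurable]: "?m \<in> borel_measurable lebesgue"
    by (rule measurable_mf[OF countable_finite[OF G(1)] Gn(2)])
  have "r' / (r' - r' / 2) = 2" "r' / (r' / 2) = 2" using r' by (auto simp: field_simps)
  then have D: "(\<integral>\<^sup>+x. epowr (?m x) r' \<partial>lebesgue) \<le> 4 * (\<integral>\<^sup>+x. epowr (h x) r' \<partial>lebesgue)"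
    using Doob_rave[OF G(1) Gn(1), of lebesgue h "r' / 2" r'] D_pos G(2) r' by auto
  have "(\<integral>\<^sup>+x\<in>Q. Y x * ?m x \<partial>lebesgue) = (\<integral>\<^sup>+x. (Y x * indicator Q x) * ?m x \<partial>lebesgue)"
    by (intro nn_integral_cong) (simp add: mult_ac)
  also have "\<dots> \<le> epowr (\<integral>\<^sup>+x. epowr (Y x * indicator Q x) r \<partial>lebesgue) (1 / r) * epowr (\<integral>\<^sup>+x. epowr (?m x) r' \<partial>lebesgue) (1 / r')"
    by (rule nn_integral_Holder_pq) (use r r' in auto)
  also have "\<dots> \<le> epowr (\<integral>\<^sup>+x\<in>Q. epowr (Y x) r \<partial>lebesgue) (1 / r) * (2 * epowr (\<integral>\<^sup>+x. epowr (h x) r' \<partial>lebesgue) (1 / r'))"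
  proof (intro mult_mono)
    have "epowr (\<integral>\<^sup>+x. epowr (?m x) r' \<partial>lebesgue) (1 / r') \<le> epowr (4 * (\<integral>\<^sup>+x. epowr (h x) r' \<partial>lebesgue)) (1 / r')"
      using r' by (intro epowr_mono D) auto
    also have "\<dots> = epowr 4 (1 / r') * epowr (\<integral>\<^sup>+x. epowr (h x) r' \<partial>lebesgue) (1 / r')" by (rule epowr_mult)
    also have "epowr 4 (1 / r') \<le> (2::ennreal)"
    proof -
      have "(4::real) powr (1 / r') \<le> 4 powr (1 / 2)" using r' by (intro powr_mono) auto
      also have "\<dots> = 2" by (simp add: powr_half_sqrt)
      finally show ?thesis using epowr_ennreal[of 4 "1 / r'"] ennreal_leI by fastforce
    qed
    finally show "epowr (\<integral>\<^sup>+x. epowr (?m x) r' \<partial>lebesgue) (1 / r') \<le> 2 * epowr (\<integral>\<^sup>+x. epowr (h x) r' \<partial>lebesgue) (1 / r')"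
      by (simp add: mult_right_mono)
  qed (auto simp: epowr_mult_indicator)
  finally show ?thesis by (simp add: r'_def[symmetric] r'(3) mult_ac)
qed

text \<open>
  By Lerner's argument:
  \<open>(M f)\<^bsup>p-1\<^esup> \<le> A M\<^sub>w (M\<^sub>\<sigma> (f / \<sigma>)\<^bsup>p-1\<^esup> / w)\<close>.
\<close>

theorem Buckley:
  assumes p: "1 < p" and A: "Apd p w A" and F: "finite F" "F \<subseteq> D"
    and [measurable]: "f \<in> borel_measurable lebesgue"
  shows "wnorm p w (mf (\<lambda>P. ave lebesgue P f) F)
    \<le> ennreal (p powr (1 / (p - 1)) * (p / (p - 1)) * A powr (1 / (p - 1))) * wnorm p w f"
proof -
  define \<sigma> where "\<sigma> = dual_weight p w"
  define p' where "p' = p / (p - 1)"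
  have p': "1 < p'" "p' / (p' - 1) = p" "(p - 1) * p' = p" using p by (auto simp: p'_def field_simps)
  have w: "pos_weight w" "pos_weight \<sigma>" using Apd_pos[OF A] by (auto simp: \<sigma>_def intro: pos_weight_dual)
  have [measurable]: "w \<in> borel_measurable lebesgue" "\<sigma> \<in> borel_measurable lebesgue" using w by measurable
  have A1: "1 \<le> A" using A by (simp add: Apd_def)
  note fin = Apd_ave[OF A p, folded \<sigma>_def]
  have [measurable]: "mf v F \<in> borel_measurable lebesgue" for v by (rule mf_measurable[OF p A F])
  define m where "m = mf (\<lambda>P. rave 1 (wdens \<sigma>) P (over f \<sigma>)) F"
  have [measurable]: "m \<in> borel_measurable lebesgue" unfolding m_def by measurable
  define H where "H = over (\<lambda>x. epowr (m x) (p - 1)) w"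
  have [measurable]: "H \<in> borel_measurable lebesgue" unfolding H_def by measurable
  \<comment> \<open>On P the function m is at least \<open>?a\<close>. Averaging the (p-1)-st power
    of this over P brings in the w-average of H, and the product of the two weight averages is at
    most A.\<close>
  have pt: "epowr (ave lebesgue P f) (p - 1) \<le> ennreal A * ave (wdens w) P H" if P: "P \<in> F" for P
  proof -
    have PD: "P \<in> D" using P F by auto
    interpret P: finite_pos_set lebesgue P by (rule D_pos[OF PD])
    let ?a = "ave (wdens \<sigma>) P (over f \<sigma>)"
    have fa: "ave lebesgue P f = ?a * ave lebesgue P \<sigma>"
      using fin PD by (subst ave_wdens) (auto simp: w over_mult)
    have "epowr ?a (p - 1) \<le> ave lebesgue P (\<lambda>x. epowr (m x) (p - 1))"
      by (subst P.ave_const[of "epowr ?a (p - 1)", symmetric], intro ave_mono epowr_mono)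
        (use p P mf_upper[OF P] in \<open>auto simp: m_def\<close>)
    also have "\<dots> = ave (wdens w) P H * ave lebesgue P w"
      unfolding H_def using fin PD by (subst ave_wdens) (auto simp: w over_mult)
    finally have 1: "epowr ?a (p - 1) \<le> ave (wdens w) P H * ave lebesgue P w" .
    have "epowr (ave lebesgue P f) (p - 1) = epowr ?a (p - 1) * epowr (ave lebesgue P \<sigma>) (p - 1)"
      unfolding fa by (rule epowr_mult)
    also have "\<dots> \<le> ave (wdens w) P H * ave lebesgue P w * epowr (ave lebesgue P \<sigma>) (p - 1)"
      by (intro mult_right_mono 1) auto
    also have "\<dots> = ave (wdens w) P H * (ave lebesgue P w * epowr (ave lebesgue P \<sigma>) (p - 1))"
      by (simp add: mult.assoc)
    also have "\<dots> \<le> ave (wdens w) P H * ennreal A"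
      using A PD by (intro mult_left_mono) (auto simp: Apd_def \<sigma>_def)
    finally show ?thesis by (simp add: mult.commute)
  qed
  have pt2: "epowr (mf (\<lambda>P. ave lebesgue P f) F x) p \<le> ennreal (A powr p') * epowr (mf (\<lambda>P. rave 1 (wdens w) P H) F x) p'" for x
  proof -
    have "epowr (mf (\<lambda>P. ave lebesgue P f) F x) (p - 1) \<le> ennreal A * mf (\<lambda>P. rave 1 (wdens w) P H) F x"
    proof (subst epowr_mf)
      show "mf (\<lambda>P. epowr (ave lebesgue P f) (p - 1)) F x \<le> ennreal A * mf (\<lambda>P. rave 1 (wdens w) P H) F x"
      proof (rule mf_least)
        fix P assume P: "P \<in> F" "x \<in> P"
        have "ennreal A * ave (wdens w) P H \<le> ennreal A * mf (\<lambda>P. rave 1 (wdens w) P H) F x"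
          using mf_upper[OF P, of "\<lambda>P. rave 1 (wdens w) P H"] by (intro mult_left_mono) auto
        then show "epowr (ave lebesgue P f) (p - 1) \<le> ennreal A * mf (\<lambda>P. rave 1 (wdens w) P H) F x"
          using pt[OF P(1)] by (rule order_trans[rotated])
      qed
    qed (use p in simp)
    then have "epowr (epowr (mf (\<lambda>P. ave lebesgue P f) F x) (p - 1)) p' \<le> epowr (ennreal A * mf (\<lambda>P. rave 1 (wdens w) P H) F x) p'"
      using p' by (intro epowr_mono) auto
    then show ?thesis using A1 by (simp add: epowr_epowr p'(3) epowr_mult epowr_ennreal)
  qed
  have "(\<integral>\<^sup>+x. epowr (mf (\<lambda>P. ave lebesgue P f) F x) p * w x \<partial>lebesgue)
     \<le> (\<integral>\<^sup>+x. ennreal (A powr p') * (epowr (mf (\<lambda>P. rave 1 (wdens w) P H) F x) p' * w x) \<partial>lebesgue)"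
    unfolding mult.assoc[symmetric] by (intro nn_integral_mono mult_right_mono pt2) auto
  also have "\<dots> = ennreal (A powr p') * (\<integral>\<^sup>+x. epowr (mf (\<lambda>P. rave 1 (wdens w) P H) F x) p' * w x \<partial>lebesgue)"
    by (rule nn_integral_cmult) measurable
  also have "\<dots> \<le> ennreal (A powr p') * (ennreal (p powr p') * (\<integral>\<^sup>+x. epowr (m x) p * \<sigma> x \<partial>lebesgue))"
  proof (intro mult_left_mono)
    have A': "Apd p' \<sigma> (A powr (1 / (p - 1)))" unfolding p'_def \<sigma>_def by (rule Apd_dual[OF A p])
    have dd: "dual_weight p' \<sigma> = w" unfolding p'_def \<sigma>_def by (rule dual_dual_weight[OF p])
    have "(\<integral>\<^sup>+x. epowr (mf (\<lambda>P. rave 1 (wdens w) P H) F x) p' * w x \<partial>lebesgue)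
       \<le> ennreal (p powr p') * (\<integral>\<^sup>+x. epowr (epowr (m x) (p - 1)) p' * \<sigma> x \<partial>lebesgue)"
      using Doob_dual[OF p'(1) A' F, of "\<lambda>x. epowr (m x) (p - 1)" 1] p' unfolding dd H_def by simp
    then show "(\<integral>\<^sup>+x. epowr (mf (\<lambda>P. rave 1 (wdens w) P H) F x) p' * w x \<partial>lebesgue)
       \<le> ennreal (p powr p') * (\<integral>\<^sup>+x. epowr (m x) p * \<sigma> x \<partial>lebesgue)"
      by (simp add: epowr_epowr p'(3))
  qed simp
  also have "\<dots> \<le> ennreal (A powr p') * (ennreal (p powr p') * (ennreal ((p / (p - 1)) powr p) * (\<integral>\<^sup>+x. epowr (f x) p * w x \<partial>lebesgue)))"
    using Doob_dual[OF p A F, of f 1] p unfolding m_def \<sigma>_def by (intro mult_left_mono) auto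
  also have "\<dots> = ennreal ((p powr (1 / (p - 1)) * (p / (p - 1)) * A powr (1 / (p - 1))) powr p) * (\<integral>\<^sup>+x. epowr (f x) p * w x \<partial>lebesgue)"
  proof -
    have "1 / (p - 1) * p = p'" by (simp add: p'_def)
    then have "(p powr (1 / (p - 1)) * (p / (p - 1)) * A powr (1 / (p - 1))) powr p = A powr p' * (p powr p' * (p / (p - 1)) powr p)"
      using p A1 by (simp add: powr_mult powr_powr powr_divide mult_ac)
    then show ?thesis by (simp add: ennreal_mult mult.assoc)
  qed
  finally show ?thesis by (rule wnorm_cong_le[rotated]) (use p in auto)
qed

text \<open>Hoelder on E gives |E| \<le> w(P)^(1/p) \<sigma>(E)^(1/p'), with \<sigma> the dual
  weight. The A_p condition on P bounds w(P)^(1/(p-1)) \<sigma>(P) by A^(1/(p-1)) |P|^(p'), which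
  removes w.\<close>

lemma dual_measure_le:
  assumes p: "1 < p" and A: "Apd p w A" and P: "P \<in> D" and E: "E \<in> sets lebesgue" "E \<subseteq> P"
    and \<eta>: "0 < \<eta>" "ennreal \<eta> * emeasure lebesgue P \<le> emeasure lebesgue E"
  shows "emeasure (wdens (dual_weight p w)) P
    \<le> ennreal (\<eta> powr (- (p / (p - 1))) * A powr (1 / (p - 1))) * emeasure (wdens (dual_weight p w)) E"
proof -
  define p' where "p' = p / (p - 1)"
  have p': "1 < p'" "(1 - 1 / p) * p' = 1" "1 / p * p' = 1 / (p - 1)" using p by (auto simp: p'_def field_simps)
  interpret P: finite_pos_set lebesgue P by (rule D_pos[OF P])
  have w: "pos_weight w" "pos_weight (dual_weight p w)" using Apd_pos[OF A] by (auto intro: pos_weight_dual)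
  have "0 < ennreal \<eta> * emeasure lebesgue P" using \<eta> P.pos by (simp add: ennreal_zero_less_mult_iff)
  then have Epos: "0 < emeasure lebesgue E" using \<eta>(2) by (rule order_less_le_trans)
  note fin = Apd_ave[OF A p P]
  have A1: "1 \<le> A" using A by (simp add: Apd_def)
  obtain S n Se e where 1: "ave lebesgue P (dual_weight p w) = ennreal (S / n)" "emeasure lebesgue P = ennreal n"
     "emeasure (wdens (dual_weight p w)) E = ennreal Se"
     "emeasure lebesgue E = ennreal e" "0 < S" "0 < n" "0 < Se" "0 < e" "Se \<le> S" "emeasure (wdens (dual_weight p w)) P = ennreal S"
    using wdens_finite_real[OF w(2) _ P E Epos] fin by blast
  obtain W n' We e' where 2: "ave lebesgue P w = ennreal (W / n')" "emeasure lebesgue P = ennreal n'" "emeasure (wdens w) E = ennreal We"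
     "emeasure lebesgue E = ennreal e'" "0 < W" "0 < n'" "0 < We" "0 < e'" "We \<le> W"
    using wdens_finite_real[OF w(1) _ P E Epos] fin by blast
  have [simp]: "n' = n" "e' = e" using 1 2 by auto
  have "ave lebesgue P w * epowr (ave lebesgue P (dual_weight p w)) (p - 1) \<le> ennreal A"
    using A P by (auto simp: Apd_def)
  then have a: "W / n * (S / n) powr (p - 1) \<le> A"
    using 1 2 A1 by (simp add: epowr_ennreal ennreal_le_iff flip: ennreal_mult)
  have "ennreal e \<le> ennreal (We powr (1 / p) * Se powr (1 - 1 / p))"
    using emeasure_le_weights[OF p w(1) E(1)] 1 2 by (simp add: epowr_ennreal ennreal_mult)
  then have h: "e \<le> We powr (1 / p) * Se powr (1 - 1 / p)" by (subst (asm) ennreal_le_iff) auto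
  have "\<eta> * n \<le> e" using \<eta> 1 by (simp add: ennreal_le_iff flip: ennreal_mult)
  also have "e \<le> W powr (1 / p) * Se powr (1 - 1 / p)"
    using 2 p by (intro order_trans[OF h] mult_right_mono powr_mono2) auto
  finally have "(\<eta> * n) powr p' \<le> (W powr (1 / p) * Se powr (1 - 1 / p)) powr p'"
    using p' 1 \<eta> by (intro powr_mono2) auto
  then have b: "\<eta> powr p' * n powr p' \<le> W powr (1 / (p - 1)) * Se"
    using 1 2 \<eta> p' by (simp add: powr_mult powr_powr)
  have "(W / n * (S / n) powr (p - 1)) powr (1 / (p - 1)) \<le> A powr (1 / (p - 1))"
    using a p 1 2 by (intro powr_mono2) auto
  moreover have "(W / n * (S / n) powr (p - 1)) powr (1 / (p - 1)) = (W / n) powr (1 / (p - 1)) * (S / n)"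
    using 1 2 p by (subst powr_mult) (auto simp: powr_powr)
  ultimately have c: "(W / n) powr (1 / (p - 1)) * (S / n) \<le> A powr (1 / (p - 1))" by simp
  have np: "n powr p' = n powr (1 / (p - 1)) * n"
  proof -
    have "p' = 1 / (p - 1) + 1" using p by (simp add: p'_def field_simps)
    then show ?thesis using 1 by (simp add: powr_add)
  qed
  have c': "W powr (1 / (p - 1)) * S \<le> A powr (1 / (p - 1)) * n powr p'"
    using c 1 2 by (simp add: powr_divide np field_simps)
  have "S * (\<eta> powr p' * n powr p') \<le> S * (W powr (1 / (p - 1)) * Se)"
    using b 1 by (intro mult_left_mono) auto
  also have "\<dots> = (W powr (1 / (p - 1)) * S) * Se" by simp
  also have "\<dots> \<le> (A powr (1 / (p - 1)) * n powr p') * Se"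
    using c' 1 by (intro mult_right_mono) auto
  finally have "n powr p' * (S * \<eta> powr p') \<le> n powr p' * (A powr (1 / (p - 1)) * Se)"
    by (simp add: mult_ac)
  then have "S * \<eta> powr p' \<le> A powr (1 / (p - 1)) * Se"
    using 1 by (subst (asm) mult_le_cancel_left_pos) auto
  then have "S \<le> \<eta> powr (- p') * A powr (1 / (p - 1)) * Se"
    using \<eta> by (simp add: powr_minus field_simps)
  then have "ennreal S \<le> ennreal (\<eta> powr (- p') * A powr (1 / (p - 1)) * Se)" by (rule ennreal_leI)
  then show ?thesis using 1 by (simp add: p'_def ennreal_mult)
qed

end

section \<open>Powers of sparse oscillation sums\<close>

text \<open>Turns the condition of \<open>rave_le_over\<close> on r = s / (s - 1) into a lower bound
  for s: for large s both r and r (q-1) / (q-r) are close to 1.\<close>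

lemma conj_exponent_bounds:
  fixes q \<epsilon> s :: real
  assumes q: "1 < q" and \<epsilon>: "0 < \<epsilon>" "\<epsilon> \<le> 1" and s: "2 * q / ((q - 1) * \<epsilon>) \<le> s"
  shows "2 < s" "1 < s / (s - 1)" "s / (s - 1) < q" "s / (s - 1) * (q - 1) / (q - s / (s - 1)) \<le> 1 + \<epsilon>"
proof -
  have a: "2 * q \<le> s * ((q - 1) * \<epsilon>)" using s q \<epsilon> by (simp add: pos_divide_le_eq)
  have "s * ((q - 1) * \<epsilon>) \<le> s * (q - 1)" if "0 \<le> s"
    using that q \<epsilon> by (intro mult_left_mono) auto
  moreover have "0 < 2 * q / ((q - 1) * \<epsilon>)" using q \<epsilon> by simp
  then have s0: "0 < s" using s by linarith
  ultimately have b: "2 * q \<le> s * (q - 1)" using a by linarith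
  have "2 * (q - 1) < s * (q - 1)" by (rule order_less_le_trans[OF _ b]) simp
  then show s2: "2 < s" using q by (subst (asm) mult_less_cancel_right_pos) auto
  then show "1 < s / (s - 1)" by simp
  have c: "s < q * (s - 1)" using b q by (simp add: algebra_simps)
  then show "s / (s - 1) < q" using s2 by (simp add: field_simps)
  have "s / (s - 1) * (q - 1) / (q - s / (s - 1)) = s * (q - 1) / (q * (s - 1) - s)"
  proof -
    have "q - s / (s - 1) = (q * (s - 1) - s) / (s - 1)" using s2 by (simp add: field_simps)
    then show ?thesis using s2 by simp
  qed
  also have "\<dots> \<le> 1 + \<epsilon>"
  proof -
    have "(1 + \<epsilon>) * q \<le> 2 * q" using q \<epsilon> by (intro mult_right_mono) auto
    then have "s * (q - 1) \<le> (1 + \<epsilon>) * (q * (s - 1) - s)"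
      using a by (simp add: algebra_simps)
    then show ?thesis using c by (simp add: pos_divide_le_eq)
  qed
  finally show "s / (s - 1) * (q - 1) / (q - s / (s - 1)) \<le> 1 + \<epsilon>" .
qed

lemma conj_conj: "1 < (s::real) \<Longrightarrow> s / (s - 1) / (s / (s - 1) - 1) = s"
  by (simp add: field_simps)

context dyadic
begin

text \<open>The reverse Hoelder gain of the dual weight, the weight on which
  \<open>rave_le_over\<close> relies.\<close>

definition rhd :: "real \<Rightarrow> real \<Rightarrow> real" where
  "rhd p A = rh_exp (p / (p - 1)) (A powr (1 / (p - 1)))"

lemma rhd_bounds: "1 < p \<Longrightarrow> 1 \<le> A \<Longrightarrow> 0 < rhd p A \<and> rhd p A \<le> 1"
proof -
  assume p: "1 < p" and A: "1 \<le> A"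
  have "1 \<le> A powr (1 / (p - 1))" using A p by (intro ge_one_powr_ge_zero) auto
  moreover have "1 \<le> (2::real) powr (p / (p - 1) - 1)" using p by (intro ge_one_powr_ge_zero) auto
  ultimately have X: "1 * 1 * 1 \<le> 4 * d * 2 powr (p / (p - 1) - 1) * A powr (1 / (p - 1))" (is "_ \<le> ?X")
    using d_ge_1 by (intro mult_mono) auto
  then have "0 < ?X" by linarith
  then show ?thesis using X unfolding rhd_def rh_exp_def by (simp only: zero_less_divide_iff divide_le_eq_1) simp
qed

lemma rave_le_reg_conj:
  assumes p: "1 < p" and A: "Apd p w A" and F: "finite F" "F \<subseteq> D" and f: "f \<in> borel_measurable lebesgue"
    and q: "1 < q" and s: "2 * q / ((q - 1) * rhd p A) \<le> s" and P: "P \<in> F"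
  shows "rave (s / (s - 1)) lebesgue P f \<le> 2 * ave lebesgue P (reg p q w F f)"
proof -
  have "1 \<le> A" using A by (simp add: Apd_def)
  note b = conj_exponent_bounds[OF q _ _ s] rhd_bounds[OF p this]
  show ?thesis
    by (rule rave_le_reg[OF p A F f _ _ _ P]) (use b in \<open>auto simp: rhd_def\<close>)
qed

lemma local_sum_measurable [measurable]: "F \<subseteq> D \<Longrightarrow> local_sum a F Q \<in> borel_measurable lebesgue"
  unfolding local_sum_def[abs_def] using D_sets by (intro borel_measurable_sum) auto

lemma local_sum_le: "finite F \<Longrightarrow> local_sum a F Q x \<le> (\<Sum>P\<in>F. a P)"
  unfolding local_sum_alt by (intro sum_mono2) auto

lemma bounded_Lr_finite:
  assumes Q: "Q \<in> D" and X: "\<And>x. X x \<le> c" "c < top" and r: "0 < r"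
  shows "(\<integral>\<^sup>+x\<in>Q. epowr (X x) r \<partial>lebesgue) < top"
proof -
  interpret finite_pos_set lebesgue Q by (rule D_pos[OF Q])
  have "(\<integral>\<^sup>+x\<in>Q. epowr (X x) r \<partial>lebesgue) \<le> (\<integral>\<^sup>+x\<in>Q. epowr c r \<partial>lebesgue)"
    using r by (intro nn_integral_set_mono epowr_mono X) auto
  also have "\<dots> < top" using X(2) fin by (simp add: nn_integral_set_const ennreal_mult_less_top)
  finally show ?thesis .
qed

text \<open>One step unfolds one factor by \<open>local_sum_power\<close>, tests against h and uses
  the induction hypothesis on the inner cell with the exponent v = s/2. The averages of h of
  exponent v are exactly those that \<open>mf_dual\<close> can remove, so s has to be halved j
  times: 2^j R \<le> s. The loss 4 (j + 1) per step is j + 1 from the unfolding, 2 from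
  \<open>rg\<close> and 2 from \<open>mf_dual\<close>.\<close>

lemma sparse_power_iterate:
  fixes \<nu> f :: "'a \<Rightarrow> ennreal" and fs rg :: "nat \<Rightarrow> 'a \<Rightarrow> ennreal"
  defines "a \<equiv> \<lambda>P. ave lebesgue P \<nu>"
  assumes F: "finite F" "F \<subseteq> D"
    and [measurable]: "\<nu> \<in> borel_measurable lebesgue" "f \<in> borel_measurable lebesgue"
      "\<And>i. fs i \<in> borel_measurable lebesgue" "\<And>i. rg i \<in> borel_measurable lebesgue"
    and a_fin: "\<And>P. P \<in> F \<Longrightarrow> a P < top" and f_bdd: "\<And>x. f x \<le> c" "c < top"
    and fs: "fs 0 = f" "\<And>i x. fs (Suc i) x = \<nu> x * sparse_op F (rg i) x"
    and R: "1 < R" and rg: "\<And>i s P. i \<le> m \<Longrightarrow> R \<le> s \<Longrightarrow> P \<in> F \<Longrightarrow> rave (s / (s - 1)) lebesgue P (fs i) \<le> 2 * ave lebesgue P (rg i)"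
    and "j \<le> m" "2 ^ j * R \<le> s" "Q \<in> F"
  shows "rave (s / (s - 1)) lebesgue Q (\<lambda>x. f x * local_sum a F Q x ^ j) \<le> of_nat (4 ^ j * fact j) * rave (s / (s - 1)) lebesgue Q (fs j)"
  using \<open>j \<le> m\<close> \<open>2 ^ j * R \<le> s\<close> \<open>Q \<in> F\<close>
proof (induction j arbitrary: s Q)
  case 0
  then show ?case by (simp add: fs)
next
  case (Suc j)
  have Fn: "nested F" using nested_subset[OF nested_D F(2)] .
  have QD: "Q \<in> D" using Suc.prems F by auto
  define v where "v = s / 2"
  have "1 * R \<le> 2 ^ j * R" using R by (intro mult_right_mono) auto
  moreover have "2 * (2 ^ j * R) \<le> s" using Suc.prems(2) by (simp add: mult.assoc)
  ultimately have v: "2 ^ j * R \<le> v" "R \<le> v" "1 < v" using R unfolding v_def by linarith+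
  have s: "2 < s" using v by (simp add: v_def)
  define r where "r = s / (s - 1)"
  have r: "1 < r" "r / (r - 1) = s" using s conj_conj[of s] by (auto simp: r_def)
  interpret Q: finite_pos_set lebesgue Q by (rule D_pos[OF QD])
  have [measurable]: "Q \<in> sets lebesgue" by (rule Q.sets_P)
  have [measurable]: "local_sum a F P \<in> borel_measurable lebesgue" for P by (rule local_sum_measurable[OF F(2)])
  define G where "G = {P\<in>F. P \<subseteq> Q}"
  have G: "finite G" "G \<subseteq> D" "G \<subseteq> F" using F by (auto simp: G_def)
  have GP: "P \<in> sets lebesgue" if "P \<in> G" for P using that G D_sets by auto
  define K :: ennreal where "K = of_nat (4 ^ j * fact j)"
  have c2: "(\<Sum>P\<in>F. a P) < top" using a_fin F by simp
  show ?case
    unfolding r_def[symmetric]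
  proof (rule rave_dual[OF D_pos[OF QD] r(1)])
    show "(\<integral>\<^sup>+x\<in>Q. epowr (f x * local_sum a F Q x ^ Suc j) r \<partial>lebesgue) < top"
    proof (rule bounded_Lr_finite[OF QD])
      show "f x * local_sum a F Q x ^ Suc j \<le> c * (\<Sum>P\<in>F. a P) ^ Suc j" for x
        by (intro mult_mono f_bdd power_mono local_sum_le F) auto
      show "c * (\<Sum>P\<in>F. a P) ^ Suc j < top"
        using f_bdd(2) c2 by (simp only: ennreal_mult_less_top power_less_top_ennreal) auto
    qed (use r in auto)
    fix h :: "'a \<Rightarrow> ennreal" assume [measurable]: "h \<in> borel_measurable lebesgue"
    define H where "H P = rave v lebesgue P h" for P
    have [measurable]: "mf H G \<in> borel_measurable lebesgue"
      using G GP by (intro measurable_mf countable_finite) auto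
    \<comment> \<open>Hoelder on P separates an average of f times the inner power from the average
      \<open>H P\<close> of h. The factor \<open>a P\<close> times |P| is then spread out again as
      the integral of \<nu> over P, where \<open>H P\<close> is at most the maximal
      function.\<close>
    have main: "a P * (\<integral>\<^sup>+x\<in>P. f x * local_sum a F P x ^ j * h x \<partial>lebesgue)
       \<le> K * 2 * (\<integral>\<^sup>+x\<in>Q. \<nu> x * (ave lebesgue P (rg j) * indicator P x) * mf H G x \<partial>lebesgue)" if P: "P \<in> G" for P
    proof -
      have PF: "P \<in> F" "P \<in> D" "P \<subseteq> Q" using P F by (auto simp: G_def)
      interpret P: finite_pos_set lebesgue P by (rule D_pos[OF PF(2)])
      have [measurable]: "P \<in> sets lebesgue" by (rule P.sets_P)
      have "(\<integral>\<^sup>+x\<in>P. f x * local_sum a F P x ^ j * h x \<partial>lebesgue) = ave lebesgue P (\<lambda>x. (f x * local_sum a F P x ^ j) * h x) * emeasure lebesgue P"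
        by (simp add: P.ave_mult_emeasure)
      also have "\<dots> \<le> (rave (v / (v - 1)) lebesgue P (\<lambda>x. f x * local_sum a F P x ^ j) * H P) * emeasure lebesgue P"
      proof (intro mult_right_mono)
        have "1 / (v / (v - 1)) + 1 / v = 1" "1 < v / (v - 1)" using v by (auto simp: field_simps)
        then show "ave lebesgue P (\<lambda>x. (f x * local_sum a F P x ^ j) * h x) \<le> rave (v / (v - 1)) lebesgue P (\<lambda>x. f x * local_sum a F P x ^ j) * H P"
          unfolding H_def by (intro P.ave_Holder_pq) (use v in auto)
      qed simp
      also have "\<dots> \<le> (K * (2 * ave lebesgue P (rg j)) * H P) * emeasure lebesgue P"
      proof (intro mult_right_mono)
        have "rave (v / (v - 1)) lebesgue P (\<lambda>x. f x * local_sum a F P x ^ j) \<le> K * rave (v / (v - 1)) lebesgue P (fs j)"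
          unfolding K_def using Suc.prems by (intro Suc.IH v PF) auto
        also have "\<dots> \<le> K * (2 * ave lebesgue P (rg j))"
          using Suc.prems by (intro mult_left_mono rg v PF) auto
        finally show "rave (v / (v - 1)) lebesgue P (\<lambda>x. f x * local_sum a F P x ^ j) \<le> K * (2 * ave lebesgue P (rg j))" .
      qed auto
      finally have "a P * (\<integral>\<^sup>+x\<in>P. f x * local_sum a F P x ^ j * h x \<partial>lebesgue)
        \<le> a P * ((K * (2 * ave lebesgue P (rg j)) * H P) * emeasure lebesgue P)"
        by (rule mult_left_mono) simp
      also have "\<dots> = K * 2 * (ave lebesgue P (rg j) * H P * (a P * emeasure lebesgue P))"
        by (simp add: mult_ac)
      also have "ave lebesgue P (rg j) * H P * (a P * emeasure lebesgue P) = (\<integral>\<^sup>+x. ave lebesgue P (rg j) * H P * (\<nu> x * indicator P x) \<partial>lebesgue)"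
        unfolding a_def P.ave_mult_emeasure by (rule nn_integral_cmult[symmetric]) measurable
      also have "\<dots> \<le> (\<integral>\<^sup>+x\<in>Q. \<nu> x * (ave lebesgue P (rg j) * indicator P x) * mf H G x \<partial>lebesgue)"
      proof (rule nn_integral_mono)
        fix x
        show "ave lebesgue P (rg j) * H P * (\<nu> x * indicator P x) \<le> \<nu> x * (ave lebesgue P (rg j) * indicator P x) * mf H G x * indicator Q x"
        proof (cases "x \<in> P")
          case True
          then have "\<nu> x * ave lebesgue P (rg j) * H P \<le> \<nu> x * ave lebesgue P (rg j) * mf H G x"
            by (intro mult_left_mono mf_upper P) auto
          then show ?thesis using True PF(3) by (auto simp: mult_ac)
        qed simp
      qed
      finally show ?thesis by (simp add: mult_left_mono)
    qed
    have "(\<integral>\<^sup>+x\<in>Q. f x * local_sum a F Q x ^ Suc j * h x \<partial>lebesgue)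
      \<le> (\<integral>\<^sup>+x. of_nat (Suc j) * (\<Sum>P\<in>G. a P * (f x * local_sum a F P x ^ j * h x * indicator P x)) \<partial>lebesgue)"
    proof (rule nn_integral_mono)
      fix x
      have "f x * local_sum a F Q x ^ Suc j * h x * indicator Q x \<le> f x * local_sum a F Q x ^ Suc j * h x"
        by (auto split: split_indicator)
      also have "\<dots> = f x * h x * local_sum a F Q x ^ Suc j" by (simp only: mult_ac)
      also have "\<dots> \<le> f x * h x * (of_nat (Suc j) * (\<Sum>P\<in>G. a P * indicator P x * local_sum a F P x ^ j))"
        unfolding G_def by (intro mult_left_mono local_sum_power F Fn) auto
      also have "\<dots> = of_nat (Suc j) * (\<Sum>P\<in>G. a P * (f x * local_sum a F P x ^ j * h x * indicator P x))"
        unfolding sum_distrib_left by (intro sum.cong) (auto simp only: mult_ac)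
      finally show "f x * local_sum a F Q x ^ Suc j * h x * indicator Q x \<le> of_nat (Suc j) * (\<Sum>P\<in>G. a P * (f x * local_sum a F P x ^ j * h x * indicator P x))" .
    qed
    also have "\<dots> = of_nat (Suc j) * (\<Sum>P\<in>G. a P * (\<integral>\<^sup>+x\<in>P. f x * local_sum a F P x ^ j * h x \<partial>lebesgue))"
      using GP by (simp add: nn_integral_cmult nn_integral_sum)
    also have "\<dots> \<le> of_nat (Suc j) * (\<Sum>P\<in>G. K * 2 * (\<integral>\<^sup>+x\<in>Q. \<nu> x * (ave lebesgue P (rg j) * indicator P x) * mf H G x \<partial>lebesgue))"
      by (intro mult_left_mono sum_mono main) auto
    also have "\<dots> = of_nat (Suc j) * (K * 2 * (\<integral>\<^sup>+x\<in>Q. (\<Sum>P\<in>G. \<nu> x * (ave lebesgue P (rg j) * indicator P x) * mf H G x) \<partial>lebesgue))"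
      using GP by (simp add: nn_integral_sum sum_distrib_right sum_distrib_left)
    also have "\<dots> \<le> of_nat (Suc j) * (K * 2 * (\<integral>\<^sup>+x\<in>Q. fs (Suc j) x * mf H G x \<partial>lebesgue))"
    proof (intro mult_left_mono nn_integral_set_mono)
      fix x
      have "(\<Sum>P\<in>G. ave lebesgue P (rg j) * indicator P x) \<le> sparse_op F (rg j) x"
        unfolding sparse_op_def using F G by (intro sum_mono2) auto
      then have "\<nu> x * (\<Sum>P\<in>G. ave lebesgue P (rg j) * indicator P x) * mf H G x \<le> \<nu> x * sparse_op F (rg j) x * mf H G x"
        by (intro mult_left_mono mult_right_mono) auto
      then show "(\<Sum>P\<in>G. \<nu> x * (ave lebesgue P (rg j) * indicator P x) * mf H G x) \<le> fs (Suc j) x * mf H G x"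
        by (simp add: fs sum_distrib_left sum_distrib_right)
    qed auto
    also have "\<dots> \<le> of_nat (Suc j) * (K * 2 * (2 * (epowr (\<integral>\<^sup>+x\<in>Q. epowr (fs (Suc j) x) r \<partial>lebesgue) (1 / r) *
        epowr (\<integral>\<^sup>+x. epowr (h x) (r / (r - 1)) \<partial>lebesgue) (1 - 1 / r))))"
      using mf_dual[OF G(1,2) QD r(1), of h "fs (Suc j)"] s unfolding H_def[abs_def] r(2) v_def
      by (intro mult_left_mono) auto
    also have "\<dots> = of_nat (4 ^ Suc j * fact (Suc j)) * (epowr (\<integral>\<^sup>+x\<in>Q. epowr (fs (Suc j) x) r \<partial>lebesgue) (1 / r) *
        epowr (\<integral>\<^sup>+x. epowr (h x) (r / (r - 1)) \<partial>lebesgue) (1 - 1 / r))"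
    proof -
      have "of_nat (Suc j) * (K * 2 * (2 * Z)) = of_nat (4 ^ Suc j * fact (Suc j)) * Z" for Z :: ennreal
      proof -
        have "of_nat (4 ^ Suc j * fact (Suc j)) = (of_nat (Suc j) * (of_nat (4 ^ j * fact j) * (2 * 2)) :: ennreal)"
          unfolding fact_Suc of_nat_mult[symmetric] of_nat_numeral[symmetric, where 'a=ennreal]
          by (rule arg_cong[where f=of_nat]) (simp add: algebra_simps)
        then show ?thesis unfolding K_def by (simp only: mult_ac)
      qed
      then show ?thesis .
    qed
    finally show "(\<integral>\<^sup>+x\<in>Q. f x * local_sum a F Q x ^ Suc j * h x \<partial>lebesgue)
      \<le> of_nat (4 ^ Suc j * fact (Suc j)) * (epowr (\<integral>\<^sup>+x\<in>Q. epowr (fs (Suc j) x) r \<partial>lebesgue) (1 / r) *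
        epowr (\<integral>\<^sup>+x. epowr (h x) (r / (r - 1)) \<partial>lebesgue) (1 - 1 / r))" .
  qed measurable
qed

end

section \<open>Powers of the local sum by means of maximal functions\<close>

definition cpow :: "real \<Rightarrow> nat \<Rightarrow> real \<Rightarrow> real \<Rightarrow> real" where
  "cpow p m q \<eta> = (let m' = real m / (real m - 1); y = m * q / (m * q - 1) in
     (2 * \<eta> powr (- (p / (p - 1))) * (m' / (m' - y)) powr (m' / y)) ^ (m - 1)) * (2 ^ (m + 3) / \<eta>)"

context dyadic
begin

text \<open>Hoelder with t = v/q and its conjugate separates h. What is left is an average, of
  exponent close to 1, of (f/\<sigma>)^q \<sigma>; \<open>rave_le_over\<close> turns it into a
  \<sigma>-average and raises the exponent on f/\<sigma> from q to q * q.\<close>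

lemma rave_over_mult:
  assumes p: "1 < p" and A: "Apd p w A" and P: "P \<in> D"
    and [measurable]: "f \<in> borel_measurable lebesgue" "h \<in> borel_measurable lebesgue"
    and q: "1 < q" and v: "2 * (q * q) / ((q - 1) * rhd p A) \<le> v"
  shows "rave q (wdens (dual_weight p w)) P (\<lambda>x. over f (dual_weight p w) x * h x)
    \<le> 2 * (rave v lebesgue P h * rave (q * q) (wdens (dual_weight p w)) P (over f (dual_weight p w)))"
proof -
  define \<sigma> where "\<sigma> = dual_weight p w"
  have w: "pos_weight w" "pos_weight \<sigma>" using Apd_pos[OF A] by (auto simp: \<sigma>_def intro: pos_weight_dual)
  have [measurable]: "w \<in> borel_measurable lebesgue" "\<sigma> \<in> borel_measurable lebesgue" using w by measurable
  interpret P: finite_pos_set lebesgue P by (rule D_pos[OF P])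
  note fin = Apd_ave(2)[OF A p P, folded \<sigma>_def]
  have A1: "1 \<le> A" using A by (simp add: Apd_def)
  note rhd = rhd_bounds[OF p A1]
  define t where "t = v / q"
  have t: "2 * q / ((q - 1) * rhd p A) \<le> t"
    using v q by (simp add: t_def pos_le_divide_eq mult_ac)
  note b = conj_exponent_bounds[OF q _ _ t]
  have b': "2 < t" "1 < t / (t - 1)" "t / (t - 1) < q" "t / (t - 1) * (q - 1) / (q - t / (t - 1)) \<le> 1 + rhd p A"
    using b rhd by auto
  have "v = q * t" using q by (simp add: t_def)
  moreover from this have "0 < v" using q b'(1) by simp
  ultimately have vt: "v = q * t" "0 < v" by auto
  define f0 where "f0 = over f \<sigma>"
  have [measurable]: "f0 \<in> borel_measurable lebesgue" unfolding f0_def by measurable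
  let ?Z = "rave q (wdens \<sigma>) P (\<lambda>x. f0 x * h x)" and ?H = "rave v lebesgue P h" and ?U = "rave (q * q) (wdens \<sigma>) P f0"
  have "epowr ?Z q * ave lebesgue P \<sigma> = ave (wdens \<sigma>) P (\<lambda>x. epowr (f0 x * h x) q) * ave lebesgue P \<sigma>"
    using q by (simp add: rave_def epowr_epowr)
  also have "\<dots> = ave lebesgue P (\<lambda>x. epowr (f0 x * h x) q * \<sigma> x)"
    by (rule ave_wdens[OF w(2) _ P]) (use fin in auto)
  also have "\<dots> = ave lebesgue P (\<lambda>x. epowr (h x) q * (epowr (f0 x) q * \<sigma> x))"
    by (simp add: epowr_mult mult_ac)
  also have "\<dots> \<le> rave t lebesgue P (\<lambda>x. epowr (h x) q) * rave (t / (t - 1)) lebesgue P (\<lambda>x. epowr (f0 x) q * \<sigma> x)"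
    by (rule P.ave_Holder_pq) (use b' in \<open>auto simp: field_simps\<close>)
  also have "rave t lebesgue P (\<lambda>x. epowr (h x) q) = epowr ?H q"
  proof -
    have "q \<noteq> 0" using q by simp
    then show ?thesis by (simp add: rave_def epowr_epowr vt)
  qed
  finally have Z1: "epowr ?Z q * ave lebesgue P \<sigma> \<le> epowr ?H q * rave (t / (t - 1)) lebesgue P (\<lambda>x. epowr (f0 x) q * \<sigma> x)" .
  have "rave (t / (t - 1)) lebesgue P (\<lambda>x. epowr (f0 x) q * \<sigma> x)
      \<le> 2 * (rave q (wdens \<sigma>) P (over (\<lambda>x. epowr (f0 x) q * \<sigma> x) \<sigma>) * ave lebesgue P \<sigma>)"
    unfolding \<sigma>_def
    by (rule rave_le_over[OF p A finite.emptyI empty_subsetI _ _ _ _ P])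
      (use b' in \<open>auto simp: rhd_def \<sigma>_def[symmetric]\<close>)
  also have "over (\<lambda>x. epowr (f0 x) q * \<sigma> x) \<sigma> = (\<lambda>x. epowr (f0 x) q)"
  proof
    fix x
    have "\<sigma> x * epowr (\<sigma> x) (-1) = 1"
      using pos_weight_epowr_add[OF w(2), of x 1 "-1"] pos_weight_epowr_0[OF w(2)] by simp
    then show "over (\<lambda>x. epowr (f0 x) q * \<sigma> x) \<sigma> x = epowr (f0 x) q" by (simp add: over_def mult.assoc)
  qed
  also have "rave q (wdens \<sigma>) P (\<lambda>x. epowr (f0 x) q) = epowr ?U q"
    using q by (simp add: rave_def epowr_epowr)
  finally have "epowr ?Z q * ave lebesgue P \<sigma> \<le> epowr ?H q * (2 * (epowr ?U q * ave lebesgue P \<sigma>))"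
    by (intro order_trans[OF Z1] mult_left_mono) auto
  then have "ave lebesgue P \<sigma> * epowr ?Z q \<le> ave lebesgue P \<sigma> * (2 * (epowr ?H q * epowr ?U q))"
    by (simp only: mult_ac)
  then have "epowr ?Z q \<le> 2 * (epowr ?H q * epowr ?U q)"
    using fin by (subst (asm) ennreal_mult_le_mult_iff) auto
  then have "epowr (epowr ?Z q) (1 / q) \<le> epowr (2 * (epowr ?H q * epowr ?U q)) (1 / q)"
    using q by (intro epowr_mono) auto
  then have "?Z \<le> epowr 2 (1 / q) * (?H * ?U)"
    using q by (simp add: epowr_mult epowr_epowr)
  also have "epowr 2 (1 / q) \<le> (2::ennreal)"
  proof -
    have "(2::real) powr (1 / q) \<le> 2 powr 1" using q by (intro powr_mono) auto
    then show ?thesis using epowr_ennreal[of 2 "1 / q"] ennreal_leI by fastforce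
  qed
  finally show ?thesis unfolding f0_def \<sigma>_def by (simp add: mult_right_mono)
qed

text \<open>Let I be the integral of f B^m h over Q, with B the local sum. Only one factor B is
  expanded; Hoelder on each cell and then for the sum over cells returns I^(1-1/m), next to
  X1^(1/m). Absorption leaves I \<le> X1 KK^(m-1), and each of the m - 1 factors KK contains
  A^(1/(p-1)) from comparing \<sigma>(P) with \<sigma>(E P).\<close>

lemma sparse_power_maximal:
  fixes w \<nu> f :: "'a \<Rightarrow> ennreal"
  defines "a \<equiv> \<lambda>P. ave lebesgue P \<nu>"
  assumes p: "1 < p" and A: "Apd p w A" and sp: "sparse_sets \<eta> F E" and m: "2 \<le> m"
    and [measurable]: "\<nu> \<in> borel_measurable lebesgue" "f \<in> borel_measurable lebesgue"
    and a_fin: "\<And>P. P \<in> F \<Longrightarrow> a P < top" and f_bdd: "\<And>x. f x \<le> c" "c < top"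
    and q: "1 < q" "q * q < p" and s: "2 * (2 * (q * q) / ((q - 1) * rhd p A)) \<le> s" and Q: "Q \<in> F"
  shows "rave (s / (s - 1)) lebesgue Q (\<lambda>x. f x * local_sum a F Q x ^ m)
    \<le> ennreal (cpow p m q \<eta> * (A powr (1 / (p - 1))) ^ (m - 1)) *
      rave (s / (s - 1)) lebesgue Q (\<lambda>x. \<nu> x ^ m * mf (\<lambda>P. ave lebesgue P (reg p (q * q) w F f)) F x)"
proof -
  define \<sigma> where "\<sigma> = dual_weight p w"
  have F: "finite F" "F \<subseteq> D" and \<eta>: "0 < \<eta>" "\<eta> \<le> 1" and E: "\<And>P. P \<in> F \<Longrightarrow> E P \<in> sets lebesgue"
    "\<And>P. P \<in> F \<Longrightarrow> E P \<subseteq> P" "\<And>P. P \<in> F \<Longrightarrow> ennreal \<eta> * emeasure lebesgue P \<le> emeasure lebesgue (E P)"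
    "\<And>x. (\<Sum>P\<in>F. indicator (E P) x) \<le> (2::ennreal)"
    using sp by (auto simp: sparse_sets_def)
  have w: "pos_weight w" "pos_weight \<sigma>" using Apd_pos[OF A] by (auto simp: \<sigma>_def intro: pos_weight_dual)
  have [measurable]: "w \<in> borel_measurable lebesgue" "\<sigma> \<in> borel_measurable lebesgue" using w by measurable
  have A1: "1 \<le> A" using A by (simp add: Apd_def)
  note fin = Apd_ave[OF A p, folded \<sigma>_def]
  have Fn: "nested F" using nested_subset[OF nested_D F(2)] .
  have QD: "Q \<in> D" using Q F by auto
  interpret Q: finite_pos_set lebesgue Q by (rule D_pos[OF QD])
  have [measurable]: "Q \<in> sets lebesgue" by (rule Q.sets_P)
  have Bm [measurable]: "local_sum a F Q \<in> borel_measurable lebesgue" by (rule local_sum_measurable[OF F(2)])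
  define v where "v = s / 2"
  have v: "2 * (q * q) / ((q - 1) * rhd p A) \<le> v" using s by (simp add: v_def)
  have "2 * q / ((q - 1) * rhd p A) \<le> 2 * (q * q) / ((q - 1) * rhd p A)"
    using q rhd_bounds[OF p A1] by (intro divide_right_mono) auto
  then have "2 < v"
    using conj_exponent_bounds(1)[OF q(1), of "rhd p A" v] rhd_bounds[OF p A1] v by auto
  then have s4: "2 < s" by (simp add: v_def)
  define r where "r = s / (s - 1)"
  have r: "1 < r" "r / (r - 1) = s" using s4 conj_conj[of s] by (auto simp: r_def)
  define G where "G = {P\<in>F. P \<subseteq> Q}"
  have G: "finite G" "G \<subseteq> D" "G \<subseteq> F" "nested G" using F nested_subset[OF Fn] by (auto simp: G_def)
  have GP: "P \<in> sets lebesgue" if "P \<in> G" for P using that G D_sets by auto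
  have GQ: "P \<subseteq> Q" if "P \<in> G" for P using that by (auto simp: G_def)
  have mfm [measurable]: "mf u G \<in> borel_measurable lebesgue" for u
    using G GP by (intro measurable_mf countable_finite) auto
  have ovG: "(\<Sum>P\<in>G. indicator (E P) x) \<le> (2::ennreal)" for x
    by (rule order_trans[OF sum_mono2 E(4)]) (use G F in auto)
  have EG: "E P \<in> sets lebesgue" "E P \<subseteq> P" if "P \<in> G" for P
    using E(1,2)[of P] G(3) that by auto
  define f0 where "f0 = over f \<sigma>"
  have [measurable]: "f0 \<in> borel_measurable lebesgue" unfolding f0_def by measurable
  define f' where "f' = reg p (q * q) w F f"
  have [measurable]: "f' \<in> borel_measurable lebesgue" unfolding f'_def by (rule reg_measurable[OF p A F])
  define Mf where "Mf = mf (\<lambda>P. ave lebesgue P f') F"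
  have [measurable]: "Mf \<in> borel_measurable lebesgue" unfolding Mf_def by (rule mf_measurable[OF p A F])
  define m1 where "m1 = real m"
  have m1: "2 \<le> m1" using m by (simp add: m1_def)
  define m' where "m' = m1 / (m1 - 1)"
  have m': "1 < m'" "1 / m1 + 1 / m' = 1" "1 / m' = 1 - 1 / m1" "1 < m1" "(1 - 1 / m1) * m' = 1" "(m1 - 1) * m' = m1"
    using m1 by (auto simp: m'_def field_simps)
  \<comment> \<open>The exponent conjugate to m q. As q > 1, it is strictly below m', and Doob's
    inequality on L^(m') applies to averages of exponent y.\<close>
  define y where "y = m1 * q / (m1 * q - 1)"
  have mq: "1 < m1 * q" using m1 q by (simp add: less_1_mult)
  have y: "1 < y" "1 / (m1 * q) + 1 / y = 1" "y < m'"
  proof -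
    show "1 < y" using mq by (simp add: y_def)
    show "1 / (m1 * q) + 1 / y = 1" using mq m1 q by (simp add: y_def diff_divide_distrib)
    show "y < m'" unfolding y_def m'_def using m1 q mq
      by (simp add: frac_less_eq divide_less_eq less_divide_eq) (simp add: field_simps)
  qed
  define Dm where "Dm = (m' / (m' - y)) powr (m' / y)"
  define Nc where "Nc = \<eta> powr (- (p / (p - 1))) * A powr (1 / (p - 1))"
  define KK where "KK = ennreal (2 * Nc * Dm)"
  have pos: "0 \<le> Dm" "0 \<le> Nc" by (auto simp: Dm_def Nc_def)
  have c2: "(\<Sum>P\<in>F. a P) < top" using a_fin F by simp
  have main: "(\<integral>\<^sup>+x\<in>Q. f x * local_sum a F Q x ^ m * h x \<partial>lebesgue) \<le> KK ^ (m - 1) * (ennreal (2 ^ (m + 3) / \<eta>) *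
     (epowr (\<integral>\<^sup>+x\<in>Q. epowr (\<nu> x ^ m * Mf x) r \<partial>lebesgue) (1 / r) * epowr (\<integral>\<^sup>+x. epowr (h x) s \<partial>lebesgue) (1 - 1 / r)))"
    if hm [measurable]: "h \<in> borel_measurable lebesgue" and h_fin: "(\<integral>\<^sup>+x. epowr (h x) s \<partial>lebesgue) < top" for h
  proof -
    define I where "I = (\<integral>\<^sup>+x\<in>Q. f x * local_sum a F Q x ^ m * h x \<partial>lebesgue)"
    define u where "u x = f0 x * h x" for x
    have [measurable]: "u \<in> borel_measurable lebesgue" unfolding u_def by measurable
    have u\<sigma>: "u x * \<sigma> x = f x * h x" for x
    proof -
      have "u x * \<sigma> x = over f \<sigma> x * \<sigma> x * h x" by (simp only: u_def f0_def mult_ac)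
      then show ?thesis by (simp add: over_mult[OF w(2)])
    qed
    have I_fin: "I < top"
    proof -
      have "ave lebesgue Q h \<le> rave s lebesgue Q h"
        using Q.rave_mono_exponent[of h 1 s] s4 by simp
      also have "rave s lebesgue Q h < top"
      proof -
        have "(\<integral>\<^sup>+x\<in>Q. epowr (h x) s \<partial>lebesgue) \<le> (\<integral>\<^sup>+x. epowr (h x) s \<partial>lebesgue)"
          by (intro nn_integral_mono) (auto split: split_indicator)
        then have "(\<integral>\<^sup>+x\<in>Q. epowr (h x) s \<partial>lebesgue) < top" using h_fin by (rule order_le_less_trans)
        then show ?thesis using Q.pos by (auto simp: rave_def ave_def less_top[symmetric] ennreal_divide_eq_top_iff)
      qed
      finally have "ave lebesgue Q h * emeasure lebesgue Q < top" using Q.fin by (simp add: ennreal_mult_less_top)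
      then have hQ: "(\<integral>\<^sup>+x\<in>Q. h x \<partial>lebesgue) < top" by (simp add: Q.ave_mult_emeasure)
      have "I \<le> (\<integral>\<^sup>+x\<in>Q. c * (\<Sum>P\<in>F. a P) ^ m * h x \<partial>lebesgue)"
        unfolding I_def by (intro nn_integral_set_mono mult_right_mono mult_mono f_bdd power_mono local_sum_le F) auto
      also have "\<dots> = c * (\<Sum>P\<in>F. a P) ^ m * (\<integral>\<^sup>+x\<in>Q. h x \<partial>lebesgue)"
        by (rule nn_integral_set_cmult) measurable
      also have "\<dots> < top"
        using f_bdd(2) c2 hQ by (simp only: ennreal_mult_less_top power_less_top_ennreal) auto
      finally show ?thesis .
    qed
    define Z where "Z P = rave q (wdens \<sigma>) P u" for P
    \<comment> \<open>Chosen so that u^(1/m) k equals u B^(m-1) on Q, while k^(m') has the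
      \<sigma>-integral I.\<close>
    define k where "k x = epowr (u x) (1 - 1 / m1) * epowr (local_sum a F Q x) (m1 - 1) * indicator Q x" for x
    have [measurable]: "k \<in> borel_measurable lebesgue" unfolding k_def by measurable
    define V where "V P = rave y (wdens \<sigma>) P k" for P
    have Bpow: "local_sum a F Q x ^ (m - 1) = epowr (local_sum a F Q x) (m1 - 1)" for x
      using epowr_nat[of "m - 1" "local_sum a F Q x"] m by (simp add: m1_def of_nat_diff)
    have Bpow': "local_sum a F Q x ^ m = epowr (local_sum a F Q x) m1" for x
      using epowr_nat[of m "local_sum a F Q x"] m by (simp add: m1_def)
    have local: "(\<integral>\<^sup>+x\<in>P. f x * h x * local_sum a F Q x ^ (m - 1) \<partial>lebesgue)
        \<le> epowr (Z P) (1 / m1) * V P * emeasure (wdens \<sigma>) P" if P: "P \<in> G" for P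
    proof -
      have PD: "P \<in> D" using P G by auto
      interpret N: finite_pos_set "wdens \<sigma>" P by (rule wdens_pos[OF w(2) _ PD]) (use fin PD in auto)
      have [measurable]: "P \<in> sets lebesgue" by (rule GP[OF P])
      have "(\<integral>\<^sup>+x\<in>P. f x * h x * local_sum a F Q x ^ (m - 1) \<partial>lebesgue) = (\<integral>\<^sup>+x. epowr (u x) (1 / m1) * k x * indicator P x * \<sigma> x \<partial>lebesgue)"
      proof (rule nn_integral_cong)
        fix x
        have "epowr (u x) (1 / m1) * epowr (u x) (1 - 1 / m1) = u x"
          unfolding epowr_add[symmetric] by simp
        moreover have "epowr (u x) (1 / m1) * (epowr (u x) (1 - 1 / m1) * epowr (local_sum a F Q x) (m1 - 1)) * \<sigma> x
          = (epowr (u x) (1 / m1) * epowr (u x) (1 - 1 / m1)) * \<sigma> x * epowr (local_sum a F Q x) (m1 - 1)"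
          by (simp only: mult_ac)
        ultimately have "epowr (u x) (1 / m1) * (epowr (u x) (1 - 1 / m1) * epowr (local_sum a F Q x) (m1 - 1)) * \<sigma> x
          = u x * \<sigma> x * epowr (local_sum a F Q x) (m1 - 1)" by simp
        then show "f x * h x * local_sum a F Q x ^ (m - 1) * indicator P x = epowr (u x) (1 / m1) * k x * indicator P x * \<sigma> x"
          using GQ[OF P] unfolding k_def Bpow by (auto simp: u\<sigma> split: split_indicator)
      qed
      also have "\<dots> = (\<integral>\<^sup>+x\<in>P. epowr (u x) (1 / m1) * k x \<partial>wdens \<sigma>)"
        by (rule nn_integral_wdens[OF w(2), symmetric]) measurable
      also have "\<dots> = ave (wdens \<sigma>) P (\<lambda>x. epowr (u x) (1 / m1) * k x) * emeasure (wdens \<sigma>) P"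
        by (simp add: N.ave_mult_emeasure)
      also have "\<dots> \<le> rave (m1 * q) (wdens \<sigma>) P (\<lambda>x. epowr (u x) (1 / m1)) * V P * emeasure (wdens \<sigma>) P"
        unfolding V_def by (intro mult_right_mono N.ave_Holder_pq) (use y mq in auto)
      also have "rave (m1 * q) (wdens \<sigma>) P (\<lambda>x. epowr (u x) (1 / m1)) = epowr (Z P) (1 / m1)"
        using m1 q by (simp add: Z_def rave_def epowr_epowr mult.commute)
      finally show ?thesis .
    qed
    define X1 where "X1 = (\<Sum>P\<in>G. a P ^ m * Z P * emeasure (wdens \<sigma>) P)"
    have k_int: "(\<integral>\<^sup>+x. epowr (k x) m' \<partial>wdens \<sigma>) = I"
    proof -
      have "(\<integral>\<^sup>+x. epowr (k x) m' \<partial>wdens \<sigma>) = (\<integral>\<^sup>+x. epowr (k x) m' * \<sigma> x \<partial>lebesgue)"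
        by (rule nn_integral_wdens[OF w(2)]) measurable
      also have "\<dots> = I"
        unfolding I_def
      proof (rule nn_integral_cong)
        fix x
        have "epowr (k x) m' = u x * epowr (local_sum a F Q x) m1 * indicator Q x"
          unfolding k_def epowr_mult epowr_epowr m'(5,6) by (simp split: split_indicator)
        then have "epowr (k x) m' * \<sigma> x = (u x * \<sigma> x) * epowr (local_sum a F Q x) m1 * indicator Q x"
          by (simp add: mult_ac)
        then show "epowr (k x) m' * \<sigma> x = f x * local_sum a F Q x ^ m * h x * indicator Q x"
          unfolding u\<sigma> Bpow' by (simp add: mult_ac)
      qed
      finally show ?thesis .
    qed
    have S2: "(\<Sum>P\<in>G. epowr (V P) m' * emeasure (wdens \<sigma>) P) \<le> KK * I"
    proof -
      have "(\<Sum>P\<in>G. epowr (V P) m' * emeasure (wdens \<sigma>) P) \<le> (\<Sum>P\<in>G. epowr (V P) m' * (ennreal Nc * emeasure (wdens \<sigma>) (E P)))"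
      proof (intro sum_mono mult_left_mono)
        fix P assume P: "P \<in> G"
        then have "P \<in> D" "P \<in> F" using G by auto
        then show "emeasure (wdens \<sigma>) P \<le> ennreal Nc * emeasure (wdens \<sigma>) (E P)"
          unfolding Nc_def \<sigma>_def using dual_measure_le[OF p A _ _ _ \<eta>(1), of P "E P"] E by auto
      qed simp
      also have "\<dots> = ennreal Nc * (\<Sum>P\<in>G. epowr (V P) m' * emeasure (wdens \<sigma>) (E P))"
        unfolding sum_distrib_left by (intro sum.cong) (auto simp: mult_ac)
      also have "\<dots> \<le> ennreal Nc * (2 * (\<integral>\<^sup>+x. mf (\<lambda>P. epowr (V P) m') G x \<partial>wdens \<sigma>))"
        using EG(1) by (intro mult_left_mono sum_sparse_le_mf G(1) EG(2) ovG) auto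
      also have "mf (\<lambda>P. epowr (V P) m') G = (\<lambda>x. epowr (mf V G x) m')"
        using m' by (intro ext epowr_mf[symmetric]) auto
      also have "(\<integral>\<^sup>+x. epowr (mf V G x) m' \<partial>wdens \<sigma>) \<le> ennreal Dm * (\<integral>\<^sup>+x. epowr (k x) m' \<partial>wdens \<sigma>)"
        unfolding V_def Dm_def
        by (rule Doob_rave[OF G(1,4)]) (use y G fin in \<open>auto intro!: wdens_pos w\<close>)
      finally have "(\<Sum>P\<in>G. epowr (V P) m' * emeasure (wdens \<sigma>) P) \<le> ennreal Nc * (2 * (ennreal Dm * I))"
        unfolding k_int by (simp add: mult_left_mono)
      also have "\<dots> = KK * I"
      proof -
        have "ennreal (2 * Nc * Dm) = ennreal 2 * ennreal Nc * ennreal Dm" using pos by (intro ennreal_mult3) auto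
        then show ?thesis unfolding KK_def by (simp add: mult_ac)
      qed
      finally show ?thesis .
    qed
    have "I = (\<integral>\<^sup>+x. (\<Sum>P\<in>G. a P * (f x * h x * local_sum a F Q x ^ (m - 1) * indicator P x)) \<partial>lebesgue)"
      unfolding I_def
    proof (rule nn_integral_cong)
      fix x
      have B0: "local_sum a F Q x * indicator Q x = local_sum a F Q x"
      proof (cases "x \<in> Q")
        case False
        then have "local_sum a F Q x = 0" unfolding local_sum_def by (intro sum.neutral) (auto simp: indicator_def)
        then show ?thesis by simp
      qed simp
      have "m = Suc (m - 1)" using m by simp
      then have "local_sum a F Q x ^ m = local_sum a F Q x ^ (m - 1) * local_sum a F Q x" by (metis power_Suc2)
      then have "f x * local_sum a F Q x ^ m * h x * indicator Q x = f x * h x * local_sum a F Q x ^ (m - 1) * (local_sum a F Q x * indicator Q x)"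
        by (simp add: mult_ac)
      also have "\<dots> = f x * h x * local_sum a F Q x ^ (m - 1) * (\<Sum>P\<in>G. a P * indicator P x)"
        unfolding B0 by (simp add: local_sum_def[of a F Q x] G_def)
      also have "\<dots> = (\<Sum>P\<in>G. a P * (f x * h x * local_sum a F Q x ^ (m - 1) * indicator P x))"
        unfolding sum_distrib_left by (intro sum.cong) (auto simp: mult_ac)
      finally show "f x * local_sum a F Q x ^ m * h x * indicator Q x = (\<Sum>P\<in>G. a P * (f x * h x * local_sum a F Q x ^ (m - 1) * indicator P x))" .
    qed
    also have "\<dots> = (\<Sum>P\<in>G. a P * (\<integral>\<^sup>+x\<in>P. f x * h x * local_sum a F Q x ^ (m - 1) \<partial>lebesgue))"
      using GP by (simp add: nn_integral_sum nn_integral_cmult)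
    also have "\<dots> \<le> (\<Sum>P\<in>G. a P * (epowr (Z P) (1 / m1) * V P * emeasure (wdens \<sigma>) P))"
      by (intro sum_mono mult_left_mono local) auto
    also have "\<dots> = (\<Sum>P\<in>G. (a P * epowr (Z P) (1 / m1) * epowr (emeasure (wdens \<sigma>) P) (1 / m1)) * (V P * epowr (emeasure (wdens \<sigma>) P) (1 / m')))"
    proof (rule sum.cong[OF refl])
      fix P assume "P \<in> G"
      have "epowr (emeasure (wdens \<sigma>) P) (1 / m1) * epowr (emeasure (wdens \<sigma>) P) (1 / m') = emeasure (wdens \<sigma>) P"
        unfolding epowr_add[symmetric] m'(2) by simp
      then show "a P * (epowr (Z P) (1 / m1) * V P * emeasure (wdens \<sigma>) P)
        = (a P * epowr (Z P) (1 / m1) * epowr (emeasure (wdens \<sigma>) P) (1 / m1)) * (V P * epowr (emeasure (wdens \<sigma>) P) (1 / m'))"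
        by (metis (no_types, opaque_lifting) mult.assoc mult.left_commute)
    qed
    also have "\<dots> \<le> epowr (\<Sum>P\<in>G. epowr (a P * epowr (Z P) (1 / m1) * epowr (emeasure (wdens \<sigma>) P) (1 / m1)) m1) (1 / m1) *
        epowr (\<Sum>P\<in>G. epowr (V P * epowr (emeasure (wdens \<sigma>) P) (1 / m')) m') (1 / m')"
      by (rule sum_Holder[OF G(1) m'(4,1,2)])
    also have "(\<Sum>P\<in>G. epowr (a P * epowr (Z P) (1 / m1) * epowr (emeasure (wdens \<sigma>) P) (1 / m1)) m1) = X1"
    proof -
      have "epowr x m1 = x ^ m" for x using epowr_nat[of m x] m by (simp add: m1_def)
      then show ?thesis unfolding X1_def epowr_mult epowr_epowr using m1 by simp
    qed
    also have "(\<Sum>P\<in>G. epowr (V P * epowr (emeasure (wdens \<sigma>) P) (1 / m')) m') = (\<Sum>P\<in>G. epowr (V P) m' * emeasure (wdens \<sigma>) P)"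
      unfolding epowr_mult epowr_epowr using m' by simp
    also have "epowr X1 (1 / m1) * epowr (\<Sum>P\<in>G. epowr (V P) m' * emeasure (wdens \<sigma>) P) (1 / m') \<le> epowr X1 (1 / m1) * epowr (KK * I) (1 / m')"
      using m' by (intro mult_left_mono epowr_mono S2) auto
    finally have "I \<le> (epowr X1 (1 / m1) * epowr KK (1 / m')) * epowr I (1 - 1 / m1)"
      by (simp add: epowr_mult mult.assoc m'(3))
    from ennreal_self_improve[OF I_fin this] have "epowr I (1 / m1) \<le> epowr X1 (1 / m1) * epowr KK (1 / m')"
      using m1 by simp
    then have "epowr (epowr I (1 / m1)) m1 \<le> epowr (epowr X1 (1 / m1) * epowr KK (1 / m')) m1"
      using m1 by (intro epowr_mono) auto
    moreover have "1 / m' * m1 = real (m - 1)"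
      using m m1 unfolding m'(3) by (simp add: m1_def of_nat_diff field_simps)
    ultimately have I1: "I \<le> X1 * KK ^ (m - 1)"
      using m1 m epowr_nat[of "m - 1" KK] by (simp add: epowr_mult epowr_epowr)
    define H where "H P = rave v lebesgue P h" for P
    define g where "g x = \<nu> x * epowr (Mf x) (1 / m1)" for x
    have [measurable]: "g \<in> borel_measurable lebesgue" unfolding g_def by measurable
    \<comment> \<open>\<open>a P\<close> times the m-th root of the average of f' over P is the
      average of \<nu> times a constant that is at most Mf^(1/m) on P. Hence \<open>T P ^ m\<close>
      dominates \<open>a P ^ m\<close> times the average of f'.\<close>
    define T where "T P = ave lebesgue P (\<lambda>x. g x * indicator Q x)" for P
    have X1_term: "a P ^ m * Z P * emeasure (wdens \<sigma>) P \<le> 2 * ennreal (1 / \<eta>) * (T P ^ m * H P * emeasure lebesgue (E P))"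
      if P: "P \<in> G" for P
    proof -
      have PD: "P \<in> D" "P \<in> F" using P G by auto
      interpret P: finite_pos_set lebesgue P by (rule D_pos[OF PD(1)])
      have N: "emeasure (wdens \<sigma>) P = ave lebesgue P \<sigma> * emeasure lebesgue P"
        by (simp add: emeasure_density P.ave_mult_emeasure)
      have ZP: "Z P \<le> 2 * (H P * rave (q * q) (wdens \<sigma>) P f0)"
        unfolding Z_def u_def H_def f0_def \<sigma>_def by (rule rave_over_mult[OF p A PD(1) _ hm q(1) v]) measurable
      have "Z P * emeasure (wdens \<sigma>) P \<le> 2 * (H P * rave (q * q) (wdens \<sigma>) P f0) * (ave lebesgue P \<sigma> * emeasure lebesgue P)"
        unfolding N by (intro mult_right_mono ZP) auto
      also have "\<dots> = 2 * H P * (rave (q * q) (wdens \<sigma>) P f0 * ave lebesgue P \<sigma>) * emeasure lebesgue P"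
        by (simp add: mult_ac)
      also have "\<dots> \<le> 2 * H P * ave lebesgue P f' * emeasure lebesgue P"
        unfolding f0_def f'_def \<sigma>_def by (intro mult_right_mono mult_left_mono reg_ave[OF p A F PD(2)]) auto
      also have "\<dots> \<le> 2 * H P * ave lebesgue P f' * (ennreal (1 / \<eta>) * emeasure lebesgue (E P))"
      proof (intro mult_left_mono)
        have "ennreal (1 / \<eta>) * (ennreal \<eta> * emeasure lebesgue P) \<le> ennreal (1 / \<eta>) * emeasure lebesgue (E P)"
          by (intro mult_left_mono E PD) auto
        then show "emeasure lebesgue P \<le> ennreal (1 / \<eta>) * emeasure lebesgue (E P)"
          using \<eta> by (simp add: mult.assoc[symmetric] ennreal_mult[symmetric])
      qed auto
      finally have 1: "Z P * emeasure (wdens \<sigma>) P \<le> 2 * H P * ave lebesgue P f' * (ennreal (1 / \<eta>) * emeasure lebesgue (E P))" .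
      have "a P * epowr (ave lebesgue P f') (1 / m1) = ave lebesgue P (\<lambda>x. epowr (ave lebesgue P f') (1 / m1) * \<nu> x)"
        unfolding a_def by (subst ave_cmult) (auto simp: mult.commute)
      also have "\<dots> \<le> T P"
        unfolding T_def
      proof (rule ave_mono)
        fix x assume x: "x \<in> P"
        then have "x \<in> Q" using GQ[OF P] by auto
        moreover have "epowr (ave lebesgue P f') (1 / m1) \<le> epowr (Mf x) (1 / m1)"
          unfolding Mf_def using m1 mf_upper[OF PD(2) x, of "\<lambda>P. ave lebesgue P f'"] by (intro epowr_mono) auto
        ultimately show "epowr (ave lebesgue P f') (1 / m1) * \<nu> x \<le> g x * indicator Q x"
          by (simp add: g_def mult.commute mult_left_mono)
      qed
      finally have "(a P * epowr (ave lebesgue P f') (1 / m1)) ^ m \<le> T P ^ m" by (rule power_mono) simp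
      moreover have "epowr (ave lebesgue P f') (1 / m1) ^ m = ave lebesgue P f'"
      proof -
        have "epowr (ave lebesgue P f') (1 / m1) ^ m = epowr (epowr (ave lebesgue P f') (1 / m1)) (real m)"
          using m by (intro epowr_nat[symmetric]) auto
        then show ?thesis using m1 by (simp add: epowr_epowr m1_def)
      qed
      ultimately have 2: "a P ^ m * ave lebesgue P f' \<le> T P ^ m" by (simp add: power_mult_distrib)
      have "a P ^ m * Z P * emeasure (wdens \<sigma>) P \<le> a P ^ m * (2 * H P * ave lebesgue P f' * (ennreal (1 / \<eta>) * emeasure lebesgue (E P)))"
        unfolding mult.assoc[of "a P ^ m"] by (intro mult_left_mono 1) auto
      also have "\<dots> = (a P ^ m * ave lebesgue P f') * (2 * H P * (ennreal (1 / \<eta>) * emeasure lebesgue (E P)))"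
        by (simp only: mult_ac)
      also have "\<dots> \<le> T P ^ m * (2 * H P * (ennreal (1 / \<eta>) * emeasure lebesgue (E P)))"
        by (intro mult_right_mono 2) auto
      finally show ?thesis by (simp only: mult_ac)
    qed
    have "X1 \<le> (\<Sum>P\<in>G. 2 * ennreal (1 / \<eta>) * (T P ^ m * H P * emeasure lebesgue (E P)))"
      unfolding X1_def by (intro sum_mono X1_term)
    also have "\<dots> = 2 * ennreal (1 / \<eta>) * (\<Sum>P\<in>G. T P ^ m * H P * emeasure lebesgue (E P))"
      by (rule sum_distrib_left[symmetric])
    also have "\<dots> \<le> 2 * ennreal (1 / \<eta>) * (2 * (\<integral>\<^sup>+x. mf (\<lambda>P. T P ^ m * H P) G x \<partial>lebesgue))"
      using EG(1) by (intro mult_left_mono sum_sparse_le_mf G(1) EG(2) ovG) auto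
    also have "\<dots> \<le> 2 * ennreal (1 / \<eta>) * (2 * (\<integral>\<^sup>+x\<in>Q. mf T G x ^ m * mf H G x \<partial>lebesgue))"
    proof (intro mult_left_mono nn_integral_mono)
      fix x
      show "mf (\<lambda>P. T P ^ m * H P) G x \<le> mf T G x ^ m * mf H G x * indicator Q x"
      proof (rule mf_least)
        fix P assume P: "P \<in> G" "x \<in> P"
        have "T P ^ m * H P \<le> mf T G x ^ m * mf H G x"
          by (intro mult_mono power_mono mf_upper P) auto
        then show "T P ^ m * H P \<le> mf T G x ^ m * mf H G x * indicator Q x" using GQ[OF P(1)] P by auto
      qed
    qed auto
    also have "(\<integral>\<^sup>+x\<in>Q. mf T G x ^ m * mf H G x \<partial>lebesgue) \<le> 2 * (epowr (\<integral>\<^sup>+x\<in>Q. epowr (mf T G x ^ m) r \<partial>lebesgue) (1 / r) *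
        epowr (\<integral>\<^sup>+x. epowr (h x) s \<partial>lebesgue) (1 - 1 / r))"
      using mf_dual[OF G(1,2) QD r(1), of h "\<lambda>x. mf T G x ^ m"] s4 unfolding H_def[abs_def] r(2) v_def by simp
    also have "epowr (\<integral>\<^sup>+x\<in>Q. epowr (mf T G x ^ m) r \<partial>lebesgue) (1 / r) \<le> ennreal (2 ^ m) * epowr (\<integral>\<^sup>+x\<in>Q. epowr (\<nu> x ^ m * Mf x) r \<partial>lebesgue) (1 / r)"
    proof -
      \<comment> \<open>The m-th power turns L^r into L^(m r) with m r > 2, so Doob's factor kk /
        (kk - 1) is below 2 and its m-th power below 2^m.\<close>
      define kk where "kk = m1 * r"
      have "2 * 1 < m1 * r" using m1 r by (intro mult_le_less_imp_less) auto
      then have kk: "2 < kk" by (simp add: kk_def)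
      have pw: "epowr (x ^ m) r = epowr x kk" for x
        using epowr_nat[of m x, symmetric] m by (simp add: epowr_epowr kk_def m1_def)
      have "(\<integral>\<^sup>+x\<in>Q. epowr (mf T G x ^ m) r \<partial>lebesgue) \<le> (\<integral>\<^sup>+x. epowr (mf T G x) kk \<partial>lebesgue)"
        unfolding pw by (intro nn_integral_mono) (auto split: split_indicator)
      also have "\<dots> \<le> ennreal ((kk / (kk - 1)) powr kk) * (\<integral>\<^sup>+x. epowr (g x * indicator Q x) kk \<partial>lebesgue)"
        unfolding T_def by (rule Doob[OF G(1,4)]) (use G D_pos kk in auto)
      also have "(\<integral>\<^sup>+x. epowr (g x * indicator Q x) kk \<partial>lebesgue) = (\<integral>\<^sup>+x\<in>Q. epowr (\<nu> x ^ m * Mf x) r \<partial>lebesgue)"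
      proof (rule nn_integral_cong)
        fix x
        have "epowr (g x) kk = epowr (\<nu> x) kk * epowr (Mf x) r"
          using m1 by (simp add: g_def epowr_mult epowr_epowr kk_def)
        then have "epowr (g x) kk = epowr (\<nu> x ^ m * Mf x) r" by (simp add: epowr_mult pw)
        then show "epowr (g x * indicator Q x) kk = epowr (\<nu> x ^ m * Mf x) r * indicator Q x"
          by (simp add: epowr_mult_indicator)
      qed
      finally have "epowr (\<integral>\<^sup>+x\<in>Q. epowr (mf T G x ^ m) r \<partial>lebesgue) (1 / r)
        \<le> epowr (ennreal ((kk / (kk - 1)) powr kk) * (\<integral>\<^sup>+x\<in>Q. epowr (\<nu> x ^ m * Mf x) r \<partial>lebesgue)) (1 / r)"
        using r by (intro epowr_mono) auto
      also have "\<dots> = ennreal ((kk / (kk - 1)) powr m1) * epowr (\<integral>\<^sup>+x\<in>Q. epowr (\<nu> x ^ m * Mf x) r \<partial>lebesgue) (1 / r)"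
        using r by (simp add: epowr_mult epowr_ennreal powr_powr kk_def)
      also have "\<dots> \<le> ennreal (2 ^ m) * epowr (\<integral>\<^sup>+x\<in>Q. epowr (\<nu> x ^ m * Mf x) r \<partial>lebesgue) (1 / r)"
      proof (intro mult_right_mono ennreal_leI)
        have "(kk / (kk - 1)) powr m1 \<le> 2 powr m1" using kk m1 by (intro powr_mono2) (auto simp: field_simps)
        then show "(kk / (kk - 1)) powr m1 \<le> 2 ^ m" by (simp add: m1_def powr_realpow)
      qed auto
      finally show ?thesis .
    qed
    finally have "X1 \<le> 2 * ennreal (1 / \<eta>) * (2 * (2 * (ennreal (2 ^ m) * epowr (\<integral>\<^sup>+x\<in>Q. epowr (\<nu> x ^ m * Mf x) r \<partial>lebesgue) (1 / r) *
        epowr (\<integral>\<^sup>+x. epowr (h x) s \<partial>lebesgue) (1 - 1 / r))))"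
      by (simp add: mult_left_mono mult_right_mono)
    also have "\<dots> = (2 * ennreal (1 / \<eta>) * 2 * 2 * ennreal (2 ^ m)) * (epowr (\<integral>\<^sup>+x\<in>Q. epowr (\<nu> x ^ m * Mf x) r \<partial>lebesgue) (1 / r) *
        epowr (\<integral>\<^sup>+x. epowr (h x) s \<partial>lebesgue) (1 - 1 / r))"
      by (simp only: mult_ac)
    also have "2 * ennreal (1 / \<eta>) * 2 * 2 * ennreal (2 ^ m) = ennreal (2 ^ (m + 3) / \<eta>)"
    proof -
      have "2 * ennreal (1 / \<eta>) * 2 * 2 * ennreal (2 ^ m) = (2 * 2 * 2) * ennreal (1 / \<eta>) * ennreal (2 ^ m)"
        by (simp only: mult_ac)
      also have "(2 * 2 * 2 :: ennreal) = ennreal 8" by simp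
      also have "ennreal 8 * ennreal (1 / \<eta>) * ennreal (2 ^ m) = ennreal (8 * (1 / \<eta>) * 2 ^ m)" using \<eta> by (intro ennreal_mult3[symmetric]) auto
      also have "8 * (1 / \<eta>) * 2 ^ m = 2 ^ (m + 3) / \<eta>" by (simp add: power_add)
      finally show ?thesis .
    qed
    finally have X1: "X1 \<le> ennreal (2 ^ (m + 3) / \<eta>) * (epowr (\<integral>\<^sup>+x\<in>Q. epowr (\<nu> x ^ m * Mf x) r \<partial>lebesgue) (1 / r) *
        epowr (\<integral>\<^sup>+x. epowr (h x) s \<partial>lebesgue) (1 - 1 / r))" .
    have "I \<le> KK ^ (m - 1) * X1" using I1 by (simp add: mult.commute)
    also have "\<dots> \<le> KK ^ (m - 1) * (ennreal (2 ^ (m + 3) / \<eta>) * (epowr (\<integral>\<^sup>+x\<in>Q. epowr (\<nu> x ^ m * Mf x) r \<partial>lebesgue) (1 / r) *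
        epowr (\<integral>\<^sup>+x. epowr (h x) s \<partial>lebesgue) (1 - 1 / r)))"
      by (intro mult_left_mono X1) auto
    finally show ?thesis unfolding I_def .
  qed
  have K: "ennreal (cpow p m q \<eta> * (A powr (1 / (p - 1))) ^ (m - 1)) = KK ^ (m - 1) * ennreal (2 ^ (m + 3) / \<eta>)"
  proof -
    have "cpow p m q \<eta> = (2 * \<eta> powr (- (p / (p - 1))) * Dm) ^ (m - 1) * (2 ^ (m + 3) / \<eta>)"
      by (simp add: cpow_def Let_def Dm_def m'_def y_def m1_def)
    then have "cpow p m q \<eta> * (A powr (1 / (p - 1))) ^ (m - 1) = (2 * Nc * Dm) ^ (m - 1) * (2 ^ (m + 3) / \<eta>)"
      by (simp add: Nc_def power_mult_distrib)
    moreover have nn: "0 \<le> 2 * Nc * Dm" using pos by simp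
    moreover have "ennreal ((2 * Nc * Dm) ^ (m - 1) * (2 ^ (m + 3) / \<eta>)) = ennreal ((2 * Nc * Dm) ^ (m - 1)) * ennreal (2 ^ (m + 3) / \<eta>)"
      using nn \<eta> by (intro ennreal_mult) auto
    ultimately show ?thesis by (simp only: KK_def ennreal_power)
  qed
  show ?thesis
    unfolding r_def[symmetric] f'_def[symmetric] Mf_def[symmetric] K
  proof (rule rave_dual[OF D_pos[OF QD] r(1)])
    show "(\<integral>\<^sup>+x\<in>Q. epowr (f x * local_sum a F Q x ^ m) r \<partial>lebesgue) < top"
    proof (rule bounded_Lr_finite[OF QD])
      show "f x * local_sum a F Q x ^ m \<le> c * (\<Sum>P\<in>F. a P) ^ m" for x
        by (intro mult_mono f_bdd power_mono local_sum_le F) auto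
      show "c * (\<Sum>P\<in>F. a P) ^ m < top"
        using f_bdd(2) c2 by (simp only: ennreal_mult_less_top power_less_top_ennreal) auto
    qed (use r in auto)
    fix h :: "'a \<Rightarrow> ennreal" assume "h \<in> borel_measurable lebesgue" "(\<integral>\<^sup>+x. epowr (h x) (r / (r - 1)) \<partial>lebesgue) < top"
    then show "(\<integral>\<^sup>+x\<in>Q. f x * local_sum a F Q x ^ m * h x \<partial>lebesgue) \<le> KK ^ (m - 1) * ennreal (2 ^ (m + 3) / \<eta>) *
     (epowr (\<integral>\<^sup>+x\<in>Q. epowr (\<nu> x ^ m * Mf x) r \<partial>lebesgue) (1 / r) * epowr (\<integral>\<^sup>+x. epowr (h x) (r / (r - 1)) \<partial>lebesgue) (1 - 1 / r))"
      using main[of h] by (simp add: r(2) mult.assoc)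
  qed measurable
qed

end

section \<open>Bloom estimates for dyadic sparse forms\<close>

text \<open>The square, (1 + p) / 2, is halfway between 1 and p; hence both q = \<open>qp p\<close>
  and q * q, the exponent used in \<open>reg\<close>, lie strictly between 1 and p.\<close>

definition qp :: "real \<Rightarrow> real" where "qp p = sqrt ((1 + p) / 2)"

lemma qp: "1 < p \<Longrightarrow> 1 < qp p" "1 < p \<Longrightarrow> qp p * qp p < p" "1 < p \<Longrightarrow> 1 < qp p * qp p"
  by (simp_all add: qp_def)

text \<open>The constant of \<open>reg_norm\<close> for the exponent
  \<open>qp p * qp p\<close>.\<close>

definition creg :: "real \<Rightarrow> real" where
  "creg p = (p / (p - qp p * qp p)) powr (1 / (qp p * qp p))"

text \<open>
  \<open>cR d p\<close> times the \<open>1 / (p - 1)\<close>-th power of the \<open>A\<^sub>p\<close> constant is the threshold for \<open>s\<close> above which the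
  reverse Hoelder inequality allows averages with exponent \<open>s / (s - 1)\<close>.
\<close>

definition cR :: "real \<Rightarrow> real \<Rightarrow> real" where
  "cR d p = 2 * (qp p * qp p) / (qp p - 1) * (4 * d * 2 powr (p / (p - 1) - 1))"

definition geo :: "('a \<Rightarrow> ennreal) \<Rightarrow> ('a \<Rightarrow> ennreal) \<Rightarrow> real \<Rightarrow> 'a \<Rightarrow> ennreal" where
  "geo \<mu> lam \<theta> = (\<lambda>x. epowr (\<mu> x) (1 - \<theta>) * epowr (lam x) \<theta>)"

definition bloom :: "real \<Rightarrow> nat \<Rightarrow> ('a \<Rightarrow> ennreal) \<Rightarrow> ('a \<Rightarrow> ennreal) \<Rightarrow> 'a \<Rightarrow> ennreal" where
  "bloom p m \<mu> lam = (\<lambda>x. epowr (\<mu> x) (1 / (p * m)) * epowr (lam x) (- (1 / (p * m))))"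

lemma pos_weight_mult: "pos_weight u \<Longrightarrow> pos_weight v \<Longrightarrow> pos_weight (\<lambda>x. u x * v x)"
  by (auto simp: pos_weight_def ennreal_zero_less_mult_iff ennreal_mult_less_top)

lemma pos_weight_geo: "pos_weight \<mu> \<Longrightarrow> pos_weight lam \<Longrightarrow> pos_weight (geo \<mu> lam \<theta>)"
  unfolding geo_def by (intro pos_weight_mult pos_weight_epowr)

lemma pos_weight_bloom: "pos_weight \<mu> \<Longrightarrow> pos_weight lam \<Longrightarrow> pos_weight (bloom p m \<mu> lam)"
  unfolding bloom_def by (intro pos_weight_mult pos_weight_epowr)

lemma geo_0: "pos_weight lam \<Longrightarrow> geo \<mu> lam 0 = \<mu>"
  by (simp add: geo_def fun_eq_iff pos_weight_epowr_0)

lemma geo_1: "pos_weight \<mu> \<Longrightarrow> geo \<mu> lam 1 = lam"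
  by (simp add: geo_def fun_eq_iff pos_weight_epowr_0)

lemma dual_geo: "dual_weight p (geo \<mu> lam \<theta>) = geo (dual_weight p \<mu>) (dual_weight p lam) \<theta>"
  by (simp add: dual_weight_def geo_def epowr_mult epowr_epowr fun_eq_iff mult.commute)

text \<open>
  The weights \<open>geo \<mu> lam (i / m)\<close> interpolate between \<open>\<mu>\<close> and \<open>lam\<close>; a multiplication by the Bloom
  weight passes from one to the next.
\<close>

lemma bloom_geo:
  assumes "1 < p" "1 \<le> m"
  shows "epowr (bloom p m \<mu> lam x) p * geo \<mu> lam (real (Suc i) / m) x = geo \<mu> lam (real i / m) x"
proof -
  have e: "1 / (p * m) * p = 1 / m" "- (1 / (p * m)) * p = - (1 / m)" using assms by auto
  have "epowr (bloom p m \<mu> lam x) p * geo \<mu> lam (real (Suc i) / m) x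
     = (epowr (\<mu> x) (1 / m) * epowr (\<mu> x) (1 - real (Suc i) / m)) * (epowr (lam x) (- (1 / m)) * epowr (lam x) (real (Suc i) / m))"
    unfolding bloom_def geo_def epowr_mult epowr_epowr e by (simp add: mult_ac)
  also have "\<dots> = geo \<mu> lam (real i / m) x"
  proof -
    have "1 / m + (1 - real (Suc i) / m) = 1 - real i / m" "- (1 / m) + real (Suc i) / m = real i / m"
      using assms by (auto simp: field_simps)
    then show ?thesis by (simp only: geo_def flip: epowr_add)
  qed
  finally show ?thesis .
qed

text \<open>All m multiplications by the Bloom weight at once.\<close>

lemma bloom_power:
  assumes "1 < p" "1 \<le> m" "pos_weight lam"
  shows "epowr (bloom p m \<mu> lam x ^ m) p * lam x = \<mu> x"
proof -
  have e: "1 / (p * m) * m * p = 1" "- (1 / (p * m)) * m * p = - 1" using assms by auto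
  have "epowr (bloom p m \<mu> lam x ^ m) p * lam x = \<mu> x * (epowr (lam x) (-1) * epowr (lam x) 1)"
    using assms(2) unfolding epowr_nat[symmetric, OF assms(2)] bloom_def epowr_mult epowr_epowr e by (simp add: mult.assoc)
  also have "\<dots> = \<mu> x" unfolding epowr_add[symmetric] using pos_weight_epowr_0[OF assms(3)] by simp
  finally show ?thesis .
qed

lemma creg_nonneg: "0 \<le> creg p" by (simp add: creg_def)

text \<open>4^m m! is the loss of the iteration, 4 and the \<open>creg\<close> of the conjugate
  exponent come from the final bilinear bound, and each of the m + 1 sparse bounds contributes
  \<open>cform p \<eta> * creg p\<close>.\<close>

definition cK1 :: "real \<Rightarrow> nat \<Rightarrow> real \<Rightarrow> real" where
  "cK1 p m \<eta> = real (4 ^ m * fact m) * 4 * creg (p / (p - 1)) * (cform p \<eta> * creg p) ^ Suc m"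

definition cK2 :: "real \<Rightarrow> nat \<Rightarrow> real \<Rightarrow> real" where
  "cK2 p m \<eta> = cpow p m (qp p) \<eta> * 4 * cform p \<eta> * creg p * creg (p / (p - 1)) *
     (p powr (1 / (p - 1)) * (p / (p - 1)) * creg p)"

section \<open>Both estimates of the first half of the form in one lattice\<close>

context dyadic
begin

text \<open>Hoelder with the same \<theta> for the weights and for their duals, so that the A_p
  products interpolate.\<close>

lemma Apd_geo:
  assumes p: "1 < p" and A: "Apd p \<mu> A" and B: "Apd p lam B" and \<theta>: "0 \<le> \<theta>" "\<theta> \<le> 1"
  shows "Apd p (geo \<mu> lam \<theta>) (A powr (1 - \<theta>) * B powr \<theta>)"
proof -
  have w: "pos_weight \<mu>" "pos_weight lam" using Apd_pos A B by auto
  have AB: "1 \<le> A" "1 \<le> B" using A B by (auto simp: Apd_def)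
  have ge: "1 \<le> A powr (1 - \<theta>)" "1 \<le> B powr \<theta>" using AB \<theta> by (auto intro: ge_one_powr_ge_zero)
  show ?thesis
  proof (cases "\<theta> = 0 \<or> \<theta> = 1")
    case True
    then show ?thesis using A B AB w by (auto simp: geo_0 geo_1)
  next
    case False
    then have \<theta>': "0 < 1 - \<theta>" "1 - \<theta> < 1" using \<theta> by auto
    have [measurable]: "\<mu> \<in> borel_measurable lebesgue" "lam \<in> borel_measurable lebesgue"
      "dual_weight p \<mu> \<in> borel_measurable lebesgue" "dual_weight p lam \<in> borel_measurable lebesgue"
      using w pos_weight_dual by measurable
    show ?thesis
      unfolding Apd_def dual_geo
    proof (intro conjI ballI)
      show "pos_weight (geo \<mu> lam \<theta>)" by (rule pos_weight_geo[OF w])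
      show "1 \<le> A powr (1 - \<theta>) * B powr \<theta>" using mult_mono[OF ge] AB by simp
      fix P assume P: "P \<in> D"
      interpret P: finite_pos_set lebesgue P by (rule D_pos[OF P])
      have 1: "ave lebesgue P (geo \<mu> lam \<theta>) \<le> epowr (ave lebesgue P \<mu>) (1 - \<theta>) * epowr (ave lebesgue P lam) \<theta>"
        using P.ave_Holder[of \<mu> lam "1 - \<theta>"] \<theta>' by (simp add: geo_def)
      have 2: "ave lebesgue P (geo (dual_weight p \<mu>) (dual_weight p lam) \<theta>)
          \<le> epowr (ave lebesgue P (dual_weight p \<mu>)) (1 - \<theta>) * epowr (ave lebesgue P (dual_weight p lam)) \<theta>"
        using P.ave_Holder[of "dual_weight p \<mu>" "dual_weight p lam" "1 - \<theta>"] \<theta>' by (simp add: geo_def)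
      have "ave lebesgue P (geo \<mu> lam \<theta>) * epowr (ave lebesgue P (geo (dual_weight p \<mu>) (dual_weight p lam) \<theta>)) (p - 1)
        \<le> (epowr (ave lebesgue P \<mu>) (1 - \<theta>) * epowr (ave lebesgue P lam) \<theta>) *
          epowr (epowr (ave lebesgue P (dual_weight p \<mu>)) (1 - \<theta>) * epowr (ave lebesgue P (dual_weight p lam)) \<theta>) (p - 1)"
        using p by (intro mult_mono epowr_mono 1 2) auto
      also have "\<dots> = epowr (ave lebesgue P \<mu> * epowr (ave lebesgue P (dual_weight p \<mu>)) (p - 1)) (1 - \<theta>) *
          epowr (ave lebesgue P lam * epowr (ave lebesgue P (dual_weight p lam)) (p - 1)) \<theta>"
        unfolding epowr_mult epowr_epowr by (simp only: mult_ac)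
      also have "\<dots> \<le> epowr (ennreal A) (1 - \<theta>) * epowr (ennreal B) \<theta>"
        using A B P \<theta> by (intro mult_mono epowr_mono) (auto simp: Apd_def)
      finally show "ave lebesgue P (geo \<mu> lam \<theta>) * epowr (ave lebesgue P (geo (dual_weight p \<mu>) (dual_weight p lam) \<theta>)) (p - 1)
        \<le> ennreal (A powr (1 - \<theta>) * B powr \<theta>)"
        using AB by (simp add: epowr_ennreal ennreal_mult)
    qed
  qed
qed

text \<open>The Bloom weight is a product of powers of \<mu> and of the dual of lam, with the
  exponents 1/(p m) and 1/(p' m); Hoelder and Jensen bound its average by averages of the two
  weights.\<close>

lemma ave_bloom_fin:
  assumes p: "1 < p" and m: "1 \<le> m" and A: "Apd p \<mu> A" and B: "Apd p lam B" and P: "P \<in> D"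
  shows "ave lebesgue P (bloom p m \<mu> lam) < top"
proof -
  have w: "pos_weight \<mu>" "pos_weight lam" using Apd_pos A B by auto
  have [measurable]: "\<mu> \<in> borel_measurable lebesgue" "lam \<in> borel_measurable lebesgue" "dual_weight p lam \<in> borel_measurable lebesgue"
    using w pos_weight_dual by measurable
  interpret P: finite_pos_set lebesgue P by (rule D_pos[OF P])
  have "- (1 / (p - 1)) * (1 / m) * (1 - 1 / p) = - (1 / (p * m))"
    using p m by (simp add: field_simps)
  then have e: "bloom p m \<mu> lam = (\<lambda>x. epowr (epowr (\<mu> x) (1 / m)) (1 / p) * epowr (epowr (dual_weight p lam x) (1 / m)) (1 - 1 / p))"
    unfolding bloom_def dual_weight_def epowr_epowr by (simp add: mult.commute)
  have "ave lebesgue P (bloom p m \<mu> lam) \<le> epowr (ave lebesgue P (\<lambda>x. epowr (\<mu> x) (1 / m))) (1 / p) *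
      epowr (ave lebesgue P (\<lambda>x. epowr (dual_weight p lam x) (1 / m))) (1 - 1 / p)"
    unfolding e using p by (intro P.ave_Holder) auto
  also have "\<dots> \<le> epowr (epowr (ave lebesgue P \<mu>) (1 / m)) (1 / p) * epowr (epowr (ave lebesgue P (dual_weight p lam)) (1 / m)) (1 - 1 / p)"
    using p m by (intro mult_mono epowr_mono P.ave_Jensen) auto
  also have "\<dots> < top"
    using Apd_ave[OF A p P] Apd_ave[OF B p P] by (simp add: ennreal_mult_less_top)
  finally show ?thesis .
qed

lemma sparse_op_measurable: "F \<subseteq> D \<Longrightarrow> sparse_op F f \<in> borel_measurable lebesgue"
  unfolding sparse_op_def[abs_def] using D_sets by (intro borel_measurable_sum) auto

text \<open>With q = \<open>qp p\<close>, the threshold with q - 1 in the denominator is the one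
  that \<open>sparse_power_maximal\<close> asks for. As q * q exceeds q, it also implies the
  threshold with q * q - 1 of \<open>rave_le_reg_conj\<close>.\<close>

lemma rave_le_reg_qp:
  assumes p: "1 < p" and A: "Apd p w A" and F: "finite F" "F \<subseteq> D" and f: "f \<in> borel_measurable lebesgue"
    and s: "cR d p * A powr (1 / (p - 1)) \<le> s" and P: "P \<in> F"
  shows "rave (s / (s - 1)) lebesgue P f \<le> 2 * ave lebesgue P (reg p (qp p * qp p) w F f)"
    "2 * (qp p * qp p) / ((qp p - 1) * rhd p A) \<le> s"
proof -
  have A1: "1 \<le> A" using A by (simp add: Apd_def)
  have e: "2 * (qp p * qp p) / ((qp p - 1) * rhd p A) = cR d p * A powr (1 / (p - 1))"
    by (simp add: cR_def rhd_def rh_exp_def)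
  then show s': "2 * (qp p * qp p) / ((qp p - 1) * rhd p A) \<le> s" using s by simp
  have "qp p * 1 \<le> qp p * qp p" using qp(1)[OF p] by (intro mult_left_mono) auto
  then have "2 * (qp p * qp p) / ((qp p * qp p - 1) * rhd p A) \<le> 2 * (qp p * qp p) / ((qp p - 1) * rhd p A)"
    using qp[OF p] rhd_bounds[OF p A1] by (intro divide_left_mono mult_right_mono) auto
  then show "rave (s / (s - 1)) lebesgue P f \<le> 2 * ave lebesgue P (reg p (qp p * qp p) w F f)"
    using s' by (intro rave_le_reg_conj[OF p A F f qp(3)[OF p] _ P]) auto
qed

lemma reg_norm_qp:
  assumes p: "1 < p" and A: "Apd p w A" and F: "finite F" "F \<subseteq> D" and f: "f \<in> borel_measurable lebesgue"
  shows "wnorm p w (reg p (qp p * qp p) w F f) \<le> ennreal (creg p) * wnorm p w f"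
  unfolding creg_def by (rule reg_norm[OF p A F f]) (use qp[OF p] in auto)

context
  fixes p A B \<eta> s t :: real and \<mu> lam f g :: "'a \<Rightarrow> ennreal" and m :: nat and F E c
  assumes p: "1 < p" and m: "1 \<le> m" and A: "Apd p \<mu> A" and B: "Apd p lam B" and sp: "sparse_sets \<eta> F E"
    and f [measurable]: "f \<in> borel_measurable lebesgue" and g [measurable]: "g \<in> borel_measurable lebesgue"
    and f_bdd: "\<And>x. f x \<le> c" "c < top"
    and s: "2 ^ m * (cR d p * max A B powr (1 / (p - 1))) \<le> s"
    and t: "cR d (p / (p - 1)) * B \<le> t"
begin

text \<open>The common end of both estimates: X is regularised on L^p(lam), g on the dual side, and
  a single bilinear sparse bound contributes the power \<open>Ap_exp p\<close> of B.\<close>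

lemma form_end:
  assumes [measurable]: "X \<in> borel_measurable lebesgue"
    and dom: "\<And>Q. Q \<in> F \<Longrightarrow> rave (s / (s - 1)) lebesgue Q (\<lambda>x. f x * local_sum (\<lambda>P. ave lebesgue P (bloom p m \<mu> lam)) F Q x ^ m) \<le> K * rave (s / (s - 1)) lebesgue Q X"
  shows "(\<Sum>Q\<in>F. rave (s / (s - 1)) lebesgue Q (\<lambda>x. f x * local_sum (\<lambda>P. ave lebesgue P (bloom p m \<mu> lam)) F Q x ^ m) *
      rave (t / (t - 1)) lebesgue Q g * emeasure lebesgue Q)
    \<le> K * ennreal (4 * cform p \<eta> * creg p * creg (p / (p - 1)) * B powr Ap_exp p) * (wnorm p lam X * wnorm (p / (p - 1)) (dual_weight p lam) g)"
proof -
  define p' where "p' = p / (p - 1)"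
  have p': "1 < p'" "p' - 1 = 1 / (p - 1)" using p by (auto simp: p'_def field_simps)
  have F: "finite F" "F \<subseteq> D" using sp by (auto simp: sparse_sets_def)
  have AB: "1 \<le> A" "1 \<le> B" using A B by (auto simp: Apd_def)
  have B': "Apd p' (dual_weight p lam) (B powr (1 / (p - 1)))" unfolding p'_def by (rule Apd_dual[OF B p])
  define X' where "X' = reg p (qp p * qp p) lam F X"
  define g' where "g' = reg p' (qp p' * qp p') (dual_weight p lam) F g"
  have [measurable]: "X' \<in> borel_measurable lebesgue" "g' \<in> borel_measurable lebesgue"
    unfolding X'_def g'_def by (rule reg_measurable[OF p B F], rule reg_measurable[OF p'(1) B' F])
  have cR0: "0 \<le> cR d p" using d_ge_1 qp[OF p] by (simp add: cR_def)
  have s': "cR d p * B powr (1 / (p - 1)) \<le> s"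
  proof -
    have "B powr (1 / (p - 1)) \<le> max A B powr (1 / (p - 1))" using AB p by (intro powr_mono2) auto
    then have "1 * (cR d p * B powr (1 / (p - 1))) \<le> 2 ^ m * (cR d p * max A B powr (1 / (p - 1)))"
      using cR0 by (intro mult_mono) auto
    then show ?thesis using s by simp
  qed
  have t': "cR d p' * (B powr (1 / (p - 1))) powr (1 / (p' - 1)) \<le> t"
    using t p AB unfolding p'(2) by (simp add: powr_powr p'_def)
  have "(\<Sum>Q\<in>F. rave (s / (s - 1)) lebesgue Q (\<lambda>x. f x * local_sum (\<lambda>P. ave lebesgue P (bloom p m \<mu> lam)) F Q x ^ m) *
      rave (t / (t - 1)) lebesgue Q g * emeasure lebesgue Q)
    \<le> (\<Sum>Q\<in>F. K * (2 * ave lebesgue Q X') * (2 * ave lebesgue Q g') * emeasure lebesgue Q)"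
  proof (intro sum_mono mult_right_mono mult_mono)
    fix Q assume Q: "Q \<in> F"
    have "rave (s / (s - 1)) lebesgue Q X \<le> 2 * ave lebesgue Q X'"
      unfolding X'_def by (rule rave_le_reg_qp(1)[OF p B F _ s' Q]) measurable
    then have "K * rave (s / (s - 1)) lebesgue Q X \<le> K * (2 * ave lebesgue Q X')" by (rule mult_left_mono) simp
    then show "rave (s / (s - 1)) lebesgue Q (\<lambda>x. f x * local_sum (\<lambda>P. ave lebesgue P (bloom p m \<mu> lam)) F Q x ^ m) \<le> K * (2 * ave lebesgue Q X')"
      by (rule order_trans[OF dom[OF Q]])
    show "rave (t / (t - 1)) lebesgue Q g \<le> 2 * ave lebesgue Q g'"
      unfolding g'_def by (rule rave_le_reg_qp(1)[OF p'(1) B' F _ t' Q]) measurable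
  qed auto
  also have "\<dots> = K * 4 * (\<Sum>Q\<in>F. ave lebesgue Q X' * ave lebesgue Q g' * emeasure lebesgue Q)"
  proof -
    have "K * (2 * x) * (2 * y) * z = K * 4 * (x * y * z)" for x y z :: ennreal
    proof -
      have "(2::ennreal) * 2 = 4" by simp
      then have "K * (2 * x) * (2 * y) * z = K * (2 * 2) * (x * y * z)" by (simp only: mult_ac)
      then show ?thesis by simp
    qed
    then show ?thesis by (simp only: sum_distrib_left)
  qed
  also have "\<dots> \<le> K * 4 * (ennreal (cform p \<eta> * B powr Ap_exp p) * (wnorm p lam X' * wnorm p' (dual_weight p lam) g'))"
    unfolding p'_def by (intro mult_left_mono sparse_bilinear[OF p B sp]) auto
  also have "\<dots> \<le> K * 4 * (ennreal (cform p \<eta> * B powr Ap_exp p) * ((ennreal (creg p) * wnorm p lam X) * (ennreal (creg p') * wnorm p' (dual_weight p lam) g)))"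
    unfolding X'_def g'_def by (intro mult_left_mono mult_mono reg_norm_qp[OF p B F] reg_norm_qp[OF p'(1) B' F]) auto
  also have "\<dots> = K * (4 * ennreal (cform p \<eta> * B powr Ap_exp p) * ennreal (creg p) * ennreal (creg p')) * (wnorm p lam X * wnorm p' (dual_weight p lam) g)"
    by (simp only: mult_ac)
  also have "4 * ennreal (cform p \<eta> * B powr Ap_exp p) * ennreal (creg p) * ennreal (creg p') = ennreal (4 * cform p \<eta> * creg p * creg p' * B powr Ap_exp p)"
  proof -
    have "4 * ennreal (cform p \<eta> * B powr Ap_exp p) = ennreal (4 * (cform p \<eta> * B powr Ap_exp p))"
      using cform_nonneg[OF p] by (simp add: ennreal_mult)
    then have "4 * ennreal (cform p \<eta> * B powr Ap_exp p) * ennreal (creg p) * ennreal (creg p')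
       = ennreal (4 * (cform p \<eta> * B powr Ap_exp p) * creg p * creg p')"
      using cform_nonneg[OF p] creg_nonneg by (simp only:) (intro ennreal_mult3[symmetric], auto)
    then show ?thesis by (simp only: mult_ac)
  qed
  finally show ?thesis by (simp only: p'_def)
qed

text \<open>As \<nu>^(m p) lam = \<mu>, the norm of X in L^p(lam) is that of the maximal function in
  L^p(\<mu>). Buckley's inequality adds one factor A^(1/(p-1)) to the m - 1 factors of
  \<open>sparse_power_maximal\<close>.\<close>

lemma form_maximal:
  assumes m2: "2 \<le> m"
  shows "(\<Sum>Q\<in>F. rave (s / (s - 1)) lebesgue Q (\<lambda>x. f x * local_sum (\<lambda>P. ave lebesgue P (bloom p m \<mu> lam)) F Q x ^ m) *
      rave (t / (t - 1)) lebesgue Q g * emeasure lebesgue Q)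
    \<le> ennreal (cK2 p m \<eta> * (A powr (real m / (p - 1)) * B powr Ap_exp p)) * (wnorm p \<mu> f * wnorm (p / (p - 1)) (dual_weight p lam) g)"
proof -
  have F: "finite F" "F \<subseteq> D" using sp by (auto simp: sparse_sets_def)
  have w: "pos_weight \<mu>" "pos_weight lam" using Apd_pos A B by auto
  have AB: "1 \<le> A" "1 \<le> B" using A B by (auto simp: Apd_def)
  have [measurable]: "bloom p m \<mu> lam \<in> borel_measurable lebesgue" using pos_weight_bloom[OF w] by measurable
  have cR0: "0 \<le> cR d p" using d_ge_1 qp[OF p] by (simp add: cR_def)
  have s': "cR d p * A powr (1 / (p - 1)) \<le> s / 2"
  proof -
    have "A powr (1 / (p - 1)) \<le> max A B powr (1 / (p - 1))" using AB p by (intro powr_mono2) auto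
    moreover have "(2::real) ^ 1 \<le> 2 ^ m" using m by (intro power_increasing) auto
    ultimately have "2 * (cR d p * A powr (1 / (p - 1))) \<le> 2 ^ m * (cR d p * max A B powr (1 / (p - 1)))"
      using cR0 by (intro mult_mono) auto
    then show ?thesis using s by simp
  qed
  define f' where "f' = reg p (qp p * qp p) \<mu> F f"
  have [measurable]: "f' \<in> borel_measurable lebesgue" unfolding f'_def by (rule reg_measurable[OF p A F])
  define Mf where "Mf = mf (\<lambda>P. ave lebesgue P f') F"
  have [measurable]: "Mf \<in> borel_measurable lebesgue" unfolding Mf_def by (rule mf_measurable[OF p A F])
  define X where "X x = bloom p m \<mu> lam x ^ m * Mf x" for x
  define cB where "cB = p powr (1 / (p - 1)) * (p / (p - 1))"
  have cB: "0 \<le> cB" using p by (simp add: cB_def)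
  have X: "wnorm p lam X \<le> ennreal (cB * creg p * A powr (1 / (p - 1))) * wnorm p \<mu> f"
  proof -
    have "wnorm p lam X = wnorm p \<mu> Mf"
    proof -
      have "epowr (X x) p * lam x = epowr (Mf x) p * \<mu> x" for x
        using bloom_power[OF p m w(2), of \<mu> x] unfolding X_def epowr_mult by (metis (no_types, opaque_lifting) mult.assoc mult.commute)
      then show ?thesis by (simp add: wnorm_def)
    qed
    also have "\<dots> \<le> ennreal (cB * A powr (1 / (p - 1))) * wnorm p \<mu> f'"
      unfolding Mf_def cB_def by (rule Buckley[OF p A F]) measurable
    also have "\<dots> \<le> ennreal (cB * A powr (1 / (p - 1))) * (ennreal (creg p) * wnorm p \<mu> f)"
      unfolding f'_def by (intro mult_left_mono reg_norm_qp[OF p A F]) auto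
    also have "\<dots> = ennreal (cB * A powr (1 / (p - 1)) * creg p) * wnorm p \<mu> f"
      using cB creg_nonneg by (simp add: ennreal_mult mult.assoc)
    finally show ?thesis by (simp add: mult_ac)
  qed
  let ?K = "cpow p m (qp p) \<eta> * (A powr (1 / (p - 1))) ^ (m - 1)"
  have \<eta>: "0 < \<eta>" using sp by (simp add: sparse_sets_def)
  have cp: "0 \<le> cpow p m (qp p) \<eta>" using \<eta> by (simp add: cpow_def Let_def)
  have "(\<Sum>Q\<in>F. rave (s / (s - 1)) lebesgue Q (\<lambda>x. f x * local_sum (\<lambda>P. ave lebesgue P (bloom p m \<mu> lam)) F Q x ^ m) *
      rave (t / (t - 1)) lebesgue Q g * emeasure lebesgue Q)
    \<le> ennreal ?K * ennreal (4 * cform p \<eta> * creg p * creg (p / (p - 1)) * B powr Ap_exp p) * (wnorm p lam X * wnorm (p / (p - 1)) (dual_weight p lam) g)"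
  proof (rule form_end)
    show "X \<in> borel_measurable lebesgue" unfolding X_def by measurable
    fix Q assume Q: "Q \<in> F"
    have "2 * (2 * (qp p * qp p) / ((qp p - 1) * rhd p A)) \<le> s"
      using rave_le_reg_qp(2)[OF p A F f s' Q] by simp
    then show "rave (s / (s - 1)) lebesgue Q (\<lambda>x. f x * local_sum (\<lambda>P. ave lebesgue P (bloom p m \<mu> lam)) F Q x ^ m) \<le> ennreal ?K * rave (s / (s - 1)) lebesgue Q X"
      unfolding X_def[abs_def] Mf_def f'_def
      by (rule sparse_power_maximal[OF p A sp m2 _ f _ f_bdd qp(1)[OF p] qp(2)[OF p] _ Q, rotated 2])
        (use F in \<open>auto intro!: ave_bloom_fin[OF p m A B]\<close>)
  qed
  also have "\<dots> \<le> ennreal ?K * ennreal (4 * cform p \<eta> * creg p * creg (p / (p - 1)) * B powr Ap_exp p) *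
      (ennreal (cB * creg p * A powr (1 / (p - 1))) * wnorm p \<mu> f * wnorm (p / (p - 1)) (dual_weight p lam) g)"
    by (intro mult_left_mono mult_right_mono X) auto
  also have "\<dots> = (ennreal ?K * ennreal (4 * cform p \<eta> * creg p * creg (p / (p - 1)) * B powr Ap_exp p) * ennreal (cB * creg p * A powr (1 / (p - 1)))) *
     (wnorm p \<mu> f * wnorm (p / (p - 1)) (dual_weight p lam) g)"
    by (simp only: mult_ac)
  also have "ennreal ?K * ennreal (4 * cform p \<eta> * creg p * creg (p / (p - 1)) * B powr Ap_exp p) * ennreal (cB * creg p * A powr (1 / (p - 1)))
     = ennreal (?K * (4 * cform p \<eta> * creg p * creg (p / (p - 1)) * B powr Ap_exp p) * (cB * creg p * A powr (1 / (p - 1))))"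
    by (intro ennreal_mult3[symmetric] mult_nonneg_nonneg zero_le_power cp cform_nonneg[OF p] creg_nonneg cB powr_ge_zero zero_le_numeral)
  also have "?K * (4 * cform p \<eta> * creg p * creg (p / (p - 1)) * B powr Ap_exp p) * (cB * creg p * A powr (1 / (p - 1)))
     = cK2 p m \<eta> * (A powr (real m / (p - 1)) * B powr Ap_exp p)"
  proof -
    have "(A powr (1 / (p - 1))) ^ (m - 1) * A powr (1 / (p - 1)) = (A powr (1 / (p - 1))) ^ m"
      using m by (cases m) (auto simp: mult.commute)
    also have "\<dots> = A powr (real m / (p - 1))"
      using AB by (simp add: powr_powr mult.commute flip: powr_realpow)
    finally have e: "A powr (real m / (p - 1)) = (A powr (1 / (p - 1))) ^ (m - 1) * A powr (1 / (p - 1))" ..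
    show ?thesis unfolding e cK2_def cB_def by (simp only: mult_ac)
  qed
  finally show ?thesis .
qed

text \<open>Multiplication by \<nu> is an isometry from L^p(W i) to L^p(W (i + 1)), so the i-th
  sparse operator is estimated on W i, and the final bilinear bound on W m = lam.\<close>

lemma form_iterate:
  assumes fin_f: "wnorm p \<mu> f < top"
  shows "(\<Sum>Q\<in>F. rave (s / (s - 1)) lebesgue Q (\<lambda>x. f x * local_sum (\<lambda>P. ave lebesgue P (bloom p m \<mu> lam)) F Q x ^ m) *
      rave (t / (t - 1)) lebesgue Q g * emeasure lebesgue Q)
    \<le> ennreal (cK1 p m \<eta> * (A * B) powr ((real m + 1) / 2 * Ap_exp p)) * (wnorm p \<mu> f * wnorm (p / (p - 1)) (dual_weight p lam) g)"
proof -
  have F: "finite F" "F \<subseteq> D" using sp by (auto simp: sparse_sets_def)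
  have w: "pos_weight \<mu>" "pos_weight lam" using Apd_pos A B by auto
  have AB: "1 \<le> A" "1 \<le> B" using A B by (auto simp: Apd_def)
  have bm [measurable]: "bloom p m \<mu> lam \<in> borel_measurable lebesgue" using pos_weight_bloom[OF w] by measurable
  have cR0: "0 \<le> cR d p" using d_ge_1 qp[OF p] by (simp add: cR_def)
  \<comment> \<open>The index is cut off at m, so that every natural number gives an A_p weight and
    no side conditions arise in the recursion.\<close>
  define W where "W i = geo \<mu> lam (real (min i m) / m)" for i
  define AA where "AA i = A powr (1 - real (min i m) / m) * B powr (real (min i m) / m)" for i
  have WA: "Apd p (W i) (AA i)" for i
    unfolding W_def AA_def using m by (intro Apd_geo[OF p A B]) (auto simp: divide_le_eq_1)
  have Wm: "W m = lam" "W 0 = \<mu>" using m by (auto simp: W_def geo_0 geo_1 w)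
  have Wstep: "epowr (bloom p m \<mu> lam x) p * W (Suc i) x = W i x" if "i < m" for i x
    using bloom_geo[OF p m, of \<mu> lam x i] that by (simp add: W_def)
  define rgo where "rgo i h = reg p (qp p * qp p) (W i) F h" for i h
  define fs where "fs = rec_nat f (\<lambda>i h x. bloom p m \<mu> lam x * sparse_op F (rgo i h) x)"
  have fs: "fs 0 = f" "fs (Suc i) = (\<lambda>x. bloom p m \<mu> lam x * sparse_op F (rgo i (fs i)) x)" for i
    by (simp_all add: fs_def)
  have rm: "rgo i h \<in> borel_measurable lebesgue" for i h
    unfolding rgo_def by (rule reg_measurable[OF p WA F])
  have fm: "fs i \<in> borel_measurable lebesgue" for i
    by (cases i) (auto simp: fs intro!: borel_measurable_times_ennreal bm sparse_op_measurable F)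
  define R where "R = cR d p * max A B powr (1 / (p - 1))"
  have AAle: "AA i \<le> max A B" for i
  proof -
    let ?\<theta> = "real (min i m) / m"
    have \<theta>: "0 \<le> ?\<theta>" "?\<theta> \<le> 1" using m by (auto simp: divide_le_eq_1)
    have "AA i \<le> max A B powr (1 - ?\<theta>) * max A B powr ?\<theta>"
      unfolding AA_def using AB \<theta> by (intro mult_mono powr_mono2) auto
    also have "\<dots> = max A B" using AB by (simp flip: powr_add)
    finally show ?thesis .
  qed
  have AA1: "1 \<le> AA i" for i using WA[of i] by (simp add: Apd_def)
  have rg: "rave (s' / (s' - 1)) lebesgue P (fs i) \<le> 2 * ave lebesgue P (rgo i (fs i))" if "R \<le> s'" "P \<in> F" for i s' P
  proof -
    have "cR d p * AA i powr (1 / (p - 1)) \<le> R"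
      unfolding R_def using cR0 AAle[of i] AA1[of i] p by (intro mult_left_mono powr_mono2) auto
    then show ?thesis
      unfolding rgo_def using that by (intro rave_le_reg_qp(1)[OF p WA F fm]) auto
  qed
  have R1: "1 < R"
  proof -
    have "qp p * 1 \<le> qp p * qp p" using qp(1)[OF p] by (intro mult_left_mono) auto
    then have "qp p - 1 < qp p * qp p" by linarith
    then have "1 < qp p * qp p / (qp p - 1)" using qp[OF p] by simp
    then have "1 < 2 * (qp p * qp p) / (qp p - 1)" by simp
    moreover have "1 \<le> 4 * d * 2 powr (p / (p - 1) - 1)"
    proof -
      have "1 \<le> (2::real) powr (p / (p - 1) - 1)" using p by (intro ge_one_powr_ge_zero) auto
      then have "1 * 1 \<le> 4 * d * 2 powr (p / (p - 1) - 1)" using d_ge_1 by (intro mult_mono) auto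
      then show ?thesis by simp
    qed
    ultimately have "1 * 1 < 2 * (qp p * qp p) / (qp p - 1) * (4 * d * 2 powr (p / (p - 1) - 1))"
      by (intro mult_less_le_imp_less) auto
    then have c1: "1 < cR d p" by (simp only: cR_def mult_1)
    have "1 \<le> max A B powr (1 / (p - 1))" using AB p by (intro ge_one_powr_ge_zero) auto
    then have "cR d p * 1 \<le> R" unfolding R_def using cR0 by (intro mult_left_mono) auto
    then show ?thesis using c1 by simp
  qed
  define cc where "cc = cform p \<eta> * creg p"
  have cc: "0 \<le> cc" using cform_nonneg[OF p] creg_nonneg by (simp add: cc_def)
  have norm: "wnorm p (W i) (fs i) \<le> ennreal (cc ^ i * (\<Prod>j<i. AA j) powr Ap_exp p) * wnorm p \<mu> f" if "i \<le> m" for i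
    using that
  proof (induction i)
    case 0
    then show ?case by (simp add: fs Wm)
  next
    case (Suc i)
    have pr: "0 \<le> (\<Prod>j<i. AA j)" "0 \<le> AA i" using AA1 by (auto intro!: prod_nonneg intro: order_trans[of 0 1])
    have IH: "wnorm p (W i) (fs i) \<le> ennreal (cc ^ i * (\<Prod>j<i. AA j) powr Ap_exp p) * wnorm p \<mu> f" using Suc by simp
    have 1: "wnorm p (W i) (rgo i (fs i)) \<le> ennreal (creg p) * wnorm p (W i) (fs i)"
      unfolding rgo_def by (rule reg_norm_qp[OF p WA F fm])
    have fin: "wnorm p (W i) (rgo i (fs i)) < top"
      using fin_f by (intro order_le_less_trans[OF order_trans[OF 1 mult_left_mono[OF IH]]]) (auto simp: ennreal_mult_less_top)
    have "wnorm p (W (Suc i)) (fs (Suc i)) = wnorm p (W i) (sparse_op F (rgo i (fs i)))"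
    proof -
      have "epowr (fs (Suc i) x) p * W (Suc i) x = epowr (sparse_op F (rgo i (fs i)) x) p * W i x" for x
        using Wstep[of i x] Suc.prems unfolding fs epowr_mult by (metis (no_types, opaque_lifting) Suc_le_lessD mult.assoc mult.commute)
      then show ?thesis by (simp add: wnorm_def)
    qed
    also have "\<dots> \<le> ennreal (cform p \<eta> * AA i powr Ap_exp p) * wnorm p (W i) (rgo i (fs i))"
      by (rule sparse_op_bound[OF p WA sp rm fin])
    also have "\<dots> \<le> ennreal (cform p \<eta> * AA i powr Ap_exp p) * (ennreal (creg p) * (ennreal (cc ^ i * (\<Prod>j<i. AA j) powr Ap_exp p) * wnorm p \<mu> f))"
      by (intro mult_left_mono order_trans[OF 1] IH) auto
    also have "\<dots> = (ennreal (cform p \<eta> * AA i powr Ap_exp p) * ennreal (creg p) * ennreal (cc ^ i * (\<Prod>j<i. AA j) powr Ap_exp p)) * wnorm p \<mu> f"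
      by (simp only: mult_ac)
    also have "ennreal (cform p \<eta> * AA i powr Ap_exp p) * ennreal (creg p) * ennreal (cc ^ i * (\<Prod>j<i. AA j) powr Ap_exp p)
      = ennreal (cform p \<eta> * AA i powr Ap_exp p * creg p * (cc ^ i * (\<Prod>j<i. AA j) powr Ap_exp p))"
      by (intro ennreal_mult3[symmetric] mult_nonneg_nonneg zero_le_power cform_nonneg[OF p] creg_nonneg cc powr_ge_zero zero_le_numeral)
    also have "cform p \<eta> * AA i powr Ap_exp p * creg p * (cc ^ i * (\<Prod>j<i. AA j) powr Ap_exp p) = cc ^ Suc i * (\<Prod>j<Suc i. AA j) powr Ap_exp p"
      using pr by (simp add: powr_mult cc_def mult_ac)
    finally show ?case .
  qed
  have "(\<Sum>j<Suc m. real j) = real m * (real m + 1) / 2"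
    by (induction m) (auto simp: field_simps)
  then have S1: "(\<Sum>j<Suc m. real j / m) = (real m + 1) / 2"
    using m unfolding sum_divide_distrib[symmetric] by simp
  have S2: "(\<Sum>j<Suc m. 1 - real j / m) = (real m + 1) / 2"
    unfolding sum_subtractf S1 by (simp add: field_simps)
  have prod: "(\<Prod>j<Suc m. AA j) = (A * B) powr ((real m + 1) / 2)"
  proof -
    have "(\<Prod>j<Suc m. AA j) = (\<Prod>j<Suc m. A powr (1 - real j / m) * B powr (real j / m))"
      by (intro prod.cong) (auto simp: AA_def min_def)
    also have "\<dots> = A powr (\<Sum>j<Suc m. 1 - real j / m) * B powr (\<Sum>j<Suc m. real j / m)"
      unfolding prod.distrib using AB by (subst (1 2) powr_sum) auto
    also have "\<dots> = (A * B) powr ((real m + 1) / 2)"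
      unfolding S1 S2 using AB by (simp add: powr_mult)
    finally show ?thesis .
  qed
  have AAm: "AA m = B" using m AB by (simp add: AA_def)
  let ?K = "of_nat (4 ^ m * fact m) :: ennreal"
  have "(\<Sum>Q\<in>F. rave (s / (s - 1)) lebesgue Q (\<lambda>x. f x * local_sum (\<lambda>P. ave lebesgue P (bloom p m \<mu> lam)) F Q x ^ m) *
      rave (t / (t - 1)) lebesgue Q g * emeasure lebesgue Q)
    \<le> ?K * ennreal (4 * cform p \<eta> * creg p * creg (p / (p - 1)) * B powr Ap_exp p) * (wnorm p lam (fs m) * wnorm (p / (p - 1)) (dual_weight p lam) g)"
  proof (rule form_end[OF fm])
    fix Q assume Q: "Q \<in> F"
    show "rave (s / (s - 1)) lebesgue Q (\<lambda>x. f x * local_sum (\<lambda>P. ave lebesgue P (bloom p m \<mu> lam)) F Q x ^ m) \<le> ?K * rave (s / (s - 1)) lebesgue Q (fs m)"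
      by (rule sparse_power_iterate[where rg="\<lambda>i. rgo i (fs i)" and R=R and m=m, OF F bm f fm rm _ f_bdd fs(1) _ R1 rg])
        (use F Q s in \<open>auto simp: fs R_def intro!: ave_bloom_fin[OF p m A B]\<close>)
  qed
  also have "\<dots> \<le> ?K * ennreal (4 * cform p \<eta> * creg p * creg (p / (p - 1)) * B powr Ap_exp p) *
      (ennreal (cc ^ m * (\<Prod>j<m. AA j) powr Ap_exp p) * wnorm p \<mu> f * wnorm (p / (p - 1)) (dual_weight p lam) g)"
    using norm[of m] unfolding Wm by (intro mult_left_mono mult_right_mono) auto
  also have "\<dots> = (?K * ennreal (4 * cform p \<eta> * creg p * creg (p / (p - 1)) * B powr Ap_exp p) * ennreal (cc ^ m * (\<Prod>j<m. AA j) powr Ap_exp p)) *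
      (wnorm p \<mu> f * wnorm (p / (p - 1)) (dual_weight p lam) g)"
    by (simp only: mult_ac)
  also have "?K = ennreal (real (4 ^ m * fact m))" by (rule ennreal_of_nat_eq_real_of_nat)
  also have "ennreal (real (4 ^ m * fact m)) * ennreal (4 * cform p \<eta> * creg p * creg (p / (p - 1)) * B powr Ap_exp p) * ennreal (cc ^ m * (\<Prod>j<m. AA j) powr Ap_exp p)
     = ennreal (real (4 ^ m * fact m) * (4 * cform p \<eta> * creg p * creg (p / (p - 1)) * B powr Ap_exp p) * (cc ^ m * (\<Prod>j<m. AA j) powr Ap_exp p))"
    by (intro ennreal_mult3[symmetric] mult_nonneg_nonneg zero_le_power cform_nonneg[OF p] creg_nonneg cc powr_ge_zero zero_le_numeral of_nat_0_le_iff)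
  also have "real (4 ^ m * fact m) * (4 * cform p \<eta> * creg p * creg (p / (p - 1)) * B powr Ap_exp p) * (cc ^ m * (\<Prod>j<m. AA j) powr Ap_exp p)
     = cK1 p m \<eta> * (A * B) powr ((real m + 1) / 2 * Ap_exp p)"
  proof -
    have "0 \<le> (\<Prod>j<m. AA j)" using AA1 by (auto intro!: prod_nonneg intro: order_trans[of 0 1])
    then have "(A * B) powr ((real m + 1) / 2 * Ap_exp p) = (\<Prod>j<m. AA j) powr Ap_exp p * B powr Ap_exp p"
      using AB unfolding powr_powr[symmetric] prod[symmetric] by (simp add: AAm powr_mult)
    then show ?thesis unfolding cK1_def cc_def power_Suc by (simp only: mult_ac)
  qed
  finally show ?thesis .
qed

end

end

section \<open>Shifted dyadic lattices in \<open>\<real>\<^sup>n\<close>\<close>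

text \<open>Half-open cubes of side 2^(-k), so a larger k is finer. Integer parts of coordinates
  reduce questions of inclusion to integer division.\<close>

definition cell :: "real^'n \<Rightarrow> int \<Rightarrow> ('n \<Rightarrow> int) \<Rightarrow> (real^'n) set" where
  "cell v k z = {x. \<forall>i. \<lfloor>(x $ i - v $ i) * 2 powr of_int k\<rfloor> = z i}"

definition lattice :: "real^'n \<Rightarrow> (real^'n) set set" where
  "lattice v = {cell v k z | k z. cell v k z \<noteq> {}}"

definition addr :: "real^'n \<Rightarrow> int \<Rightarrow> real^'n \<Rightarrow> 'n \<Rightarrow> int" where
  "addr v k x = (\<lambda>i. \<lfloor>(x $ i - v $ i) * 2 powr of_int k\<rfloor>)"

lemma mem_cell: "x \<in> cell v k z \<longleftrightarrow> addr v k x = z"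
  by (auto simp: cell_def addr_def fun_eq_iff)

definition lo :: "real^'n \<Rightarrow> int \<Rightarrow> ('n \<Rightarrow> int) \<Rightarrow> real^'n" where
  "lo v k z = (\<chi> i. v $ i + of_int (z i) * 2 powr (- of_int k))"

definition hi :: "real^'n \<Rightarrow> int \<Rightarrow> ('n \<Rightarrow> int) \<Rightarrow> real^'n" where
  "hi v k z = (\<chi> i. v $ i + (of_int (z i) + 1) * 2 powr (- of_int k))"

lemma mem_cell_iff: "x \<in> cell v k z \<longleftrightarrow> (\<forall>i. lo v k z $ i \<le> x $ i \<and> x $ i < hi v k z $ i)"
proof -
  have "\<lfloor>(x $ i - v $ i) * 2 powr of_int k\<rfloor> = z i \<longleftrightarrow> lo v k z $ i \<le> x $ i \<and> x $ i < hi v k z $ i" for i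
  proof -
    have h: "(2::real) powr (- of_int k) = 1 / 2 powr of_int k" by (simp add: powr_minus_divide)
    have p: "0 < (2::real) powr of_int k" by simp
    have "\<lfloor>(x $ i - v $ i) * 2 powr of_int k\<rfloor> = z i \<longleftrightarrow>
       of_int (z i) \<le> (x $ i - v $ i) * 2 powr of_int k \<and> (x $ i - v $ i) * 2 powr of_int k < of_int (z i) + 1"
      by (rule floor_eq_iff)
    also have "of_int (z i) \<le> (x $ i - v $ i) * 2 powr of_int k \<longleftrightarrow> of_int (z i) / 2 powr of_int k \<le> x $ i - v $ i"
      using p by (simp add: pos_divide_le_eq)
    also have "(x $ i - v $ i) * 2 powr of_int k < of_int (z i) + 1 \<longleftrightarrow> x $ i - v $ i < (of_int (z i) + 1) / 2 powr of_int k"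
      using p by (simp add: pos_less_divide_eq)
    finally show ?thesis by (auto simp: lo_def hi_def h)
  qed
  then show ?thesis by (simp add: cell_def)
qed

lemma hi_lo: "hi v k z $ i - lo v k z $ i = 2 powr (- of_int k)"
  by (simp add: hi_def lo_def algebra_simps)

lemma lo_less_hi: "lo v k z $ i < hi v k z $ i"
  using hi_lo[of v k z i] by (smt (verit) powr_gt_zero)

lemma lo_mem_cell: "lo v k z \<in> cell v k z"
  by (simp add: mem_cell_iff lo_less_hi)

lemma lattice_alt: "lattice v = range (\<lambda>(k, z). cell v k z)"
  using lo_mem_cell unfolding lattice_def by fastforce

lemma cell_eq_cube: "cbox (lo v k z) (hi v k z) = cube ((1 / 2) *\<^sub>R (lo v k z + hi v k z)) (2 powr (- of_int k))"
proof -
  have "lo v k z = (1 / 2) *\<^sub>R (lo v k z + hi v k z) - vec (2 powr (- of_int k) / 2)"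
    "hi v k z = (1 / 2) *\<^sub>R (lo v k z + hi v k z) + vec (2 powr (- of_int k) / 2)"
    using hi_lo[of v k z] by (auto simp: vec_eq_iff field_simps)
  then show ?thesis unfolding cube_def by metis
qed

lemma box_subset_cell: "box (lo v k z) (hi v k z) \<subseteq> cell v k z" "cell v k z \<subseteq> cbox (lo v k z) (hi v k z)"
  by (auto simp: mem_cell_iff mem_box_cart less_imp_le)

text \<open>The reason why information on closed cubes, namely A_p constants and mean oscillations,
  passes to half-open cells without loss.\<close>

lemma cell_null_diff: "cbox (lo v k z) (hi v k z) - cell v k z \<in> null_sets lebesgue"
proof -
  have "negligible (cbox (lo v k z) (hi v k z) - box (lo v k z) (hi v k z))"
    by (rule negligible_frontier_interval)
  then have "negligible (cbox (lo v k z) (hi v k z) - cell v k z)"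
    by (rule negligible_subset) (use box_subset_cell in blast)
  then show ?thesis by (simp add: negligible_iff_null_sets)
qed

lemma cell_sets [measurable]: "cell v k z \<in> sets lebesgue"
proof -
  have "cell v k z = cbox (lo v k z) (hi v k z) - (cbox (lo v k z) (hi v k z) - cell v k z)"
    using box_subset_cell by blast
  also have "\<dots> \<in> sets lebesgue"
    by (rule sets.Diff[OF _ null_setsD2[OF cell_null_diff]]) simp
  finally show ?thesis .
qed

lemma emeasure_cbox_cube: "0 \<le> a \<Longrightarrow> emeasure lebesgue (cube (c :: real^'n) a) = ennreal (a ^ CARD('n))"
proof -
  assume a: "0 \<le> a"
  have "emeasure lborel (cbox (c - vec (a / 2)) (c + vec (a / 2))) = ennreal (\<Prod>b\<in>Basis. (c + vec (a / 2) - (c - vec (a / 2))) \<bullet> b)"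
    using a by (intro emeasure_lborel_cbox) (auto simp: Basis_vec_def inner_axis algebra_simps)
  also have "(\<Prod>b\<in>Basis. (c + vec (a / 2) - (c - vec (a / 2))) \<bullet> b) = (\<Prod>b\<in>(Basis :: (real^'n) set). a)"
    by (intro prod.cong) (auto simp: Basis_vec_def inner_axis algebra_simps)
  also have "\<dots> = a ^ CARD('n)" by simp
  finally show ?thesis by (simp add: cube_def emeasure_completion)
qed

lemma emeasure_cell: "emeasure lebesgue (cell v k z :: (real^'n) set) = ennreal ((2 powr (- of_int k)) ^ CARD('n))"
proof -
  let ?C = "cbox (lo v k z) (hi v k z)"
  have "?C = cell v k z \<union> (?C - cell v k z)" using box_subset_cell by blast
  then have "emeasure lebesgue ?C = emeasure lebesgue (cell v k z)"
    using emeasure_Un_null_set[OF cell_sets cell_null_diff[of v k z]] by metis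
  then show ?thesis
    using emeasure_cbox_cube[of "2 powr (- of_int k)" "(1 / 2) *\<^sub>R (lo v k z + hi v k z)"] unfolding cell_eq_cube by simp
qed

text \<open>The coarser address is the finer one divided by a power of two and rounded down.\<close>

lemma addr_coarser:
  assumes "k \<le> k'" "addr v k' x = addr v k' y"
  shows "addr v k x = addr v k y"
proof
  fix i
  have n: "real_of_int (2 ^ nat (k' - k)) = 2 powr of_int (k' - k)"
    using assms(1) by (simp add: powr_realpow[symmetric])
  have e: "(t - v $ i) * 2 powr of_int k = ((t - v $ i) * 2 powr of_int k') / real_of_int (2 ^ nat (k' - k))" for t
    unfolding n by (simp add: powr_diff)
  have "addr v k x i = addr v k' x i div 2 ^ nat (k' - k)" for x
    unfolding addr_def e by (rule floor_divide_real_eq_div) simp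
  then show "addr v k x i = addr v k y i" using assms(2) by simp
qed

lemma cell_nested: "k \<le> k' \<Longrightarrow> x \<in> cell v k z \<Longrightarrow> x \<in> cell v k' z' \<Longrightarrow> cell v k' z' \<subseteq> cell v k z"
  using addr_coarser unfolding mem_cell subset_iff by metis

lemma lattice_nested: "nested (lattice v)"
  unfolding nested_def
proof (intro ballI)
  fix P Q assume "P \<in> lattice v" "Q \<in> lattice v"
  then obtain k z k' z' where kz: "P = cell v k z" "Q = cell v k' z'" unfolding lattice_alt by auto
  show "P \<inter> Q = {} \<or> P \<subseteq> Q \<or> Q \<subseteq> P"
    using cell_nested[of k k' _ v z z'] cell_nested[of k' k _ v z' z] unfolding kz by (cases "k \<le> k'") auto
qed

lemma powr2_mono_cell: "(2 powr (- of_int k)) ^ CARD('n::finite) \<le> ((2::real) powr (- of_int k')) ^ CARD('n) \<longleftrightarrow> k' \<le> k"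
  by (simp add: power_mono_iff)

lemma lattice_pos: "P \<in> lattice v \<Longrightarrow> finite_pos_set lebesgue P"
  by (auto simp: lattice_alt finite_pos_set_def emeasure_cell)

lemma dist_cell: "x \<in> cell v k z \<Longrightarrow> y \<in> cell v k z \<Longrightarrow> dist x (y :: real^'n) \<le> CARD('n) * 2 powr (- of_int k)"
proof -
  assume xy: "x \<in> cell v k z" "y \<in> cell v k z"
  have "dist x y \<le> (\<Sum>i\<in>UNIV. \<bar>(x - y) $ i\<bar>)" unfolding dist_norm by (rule norm_le_l1_cart)
  also have "\<dots> \<le> (\<Sum>i\<in>(UNIV::'n set). 2 powr (- of_int k))"
  proof (rule sum_mono)
    fix i
    show "\<bar>(x - y) $ i\<bar> \<le> 2 powr (- of_int k)"
      using xy hi_lo[of v k z i] unfolding mem_cell_iff by (smt (verit) vector_minus_component)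
  qed
  finally show ?thesis by simp
qed

text \<open>The next larger cell is the one of the previous generation through the same point. A
  cell between P and Q is determined by its generation, which its measure confines to a finite
  range.\<close>

theorem dyadic_lattice: "dyadic (lattice (v :: real^'n)) (2 ^ CARD('n))"
proof (rule dyadic.intro)
  show "(1::real) \<le> 2 ^ CARD('n)" by simp
  show "countable (lattice v)" unfolding lattice_alt by simp
  show "nested (lattice v)" by (rule lattice_nested)
  show "finite_pos_set lebesgue P" if "P \<in> lattice v" for P by (rule lattice_pos[OF that])
next
  fix P Q assume P: "P \<in> lattice v" and Q: "Q \<in> lattice v" and PQ: "P \<subset> Q"
  obtain k z k0 z0 where kz: "P = cell v k z" "Q = cell v k0 z0" using P Q unfolding lattice_alt by auto
  obtain x where x: "x \<in> P" using lo_mem_cell kz by blast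
  then have xQ: "x \<in> Q" using PQ by auto
  have kk: "k0 < k"
    using cell_nested[of k k0 x v z z0] x xQ PQ kz by (meson linorder_not_le psubsetE)
  define P' where "P' = cell v (k - 1) (addr v (k - 1) x)"
  have x': "x \<in> P'" by (simp add: P'_def mem_cell)
  have sub: "P \<subseteq> P'" "P' \<subseteq> Q"
    using cell_nested[of "k - 1" k x v] cell_nested[of k0 "k - 1" x v] x x' xQ kk unfolding kz P'_def by auto
  have "2 powr (- of_int (k - 1)) = 2 * (2::real) powr (- of_int k)"
    by (simp add: powr_diff powr_minus field_simps)
  then have m: "emeasure lebesgue P' = ennreal (2 ^ CARD('n)) * emeasure lebesgue P"
    unfolding kz P'_def emeasure_cell by (simp only: power_mult_distrib) (rule ennreal_mult, auto)
  have "(2 powr (- of_int k)) ^ CARD('n) < ((2::real) powr (- of_int (k - 1))) ^ CARD('n)"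
    by (intro power_strict_mono) auto
  then have "emeasure lebesgue P' \<noteq> emeasure lebesgue P"
    unfolding kz P'_def emeasure_cell by (subst ennreal_inj) auto
  then have "P \<subset> P'" using sub by auto
  then show "\<exists>P'\<in>lattice v. P \<subset> P' \<and> P' \<subseteq> Q \<and> emeasure lebesgue P' \<le> ennreal (2 ^ CARD('n)) * emeasure lebesgue P"
    using sub m unfolding lattice_alt by (intro bexI[of _ P']) (auto simp: P'_def)
next
  fix P Q assume P: "P \<in> lattice v" and Q: "Q \<in> lattice v"
  obtain k z k0 z0 where kz: "P = cell v k z" "Q = cell v k0 z0" using P Q unfolding lattice_alt by auto
  obtain x where x: "x \<in> P" using lo_mem_cell kz by blast
  have "{R\<in>lattice v. P \<subseteq> R \<and> R \<subseteq> Q} \<subseteq> (\<lambda>k'. cell v k' (addr v k' x)) ` {k0..k}"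
  proof
    fix R assume R: "R \<in> {R\<in>lattice v. P \<subseteq> R \<and> R \<subseteq> Q}"
    then obtain k' z' where k': "R = cell v k' z'" unfolding lattice_alt by auto
    have "x \<in> R" using x R by auto
    then have z': "z' = addr v k' x" by (simp add: k' mem_cell)
    have "emeasure lebesgue P \<le> emeasure lebesgue R" "emeasure lebesgue R \<le> emeasure lebesgue Q"
      using R kz k' by (auto intro!: emeasure_mono)
    then have "k' \<le> k" "k0 \<le> k'"
      unfolding kz k' emeasure_cell
      using powr2_mono_cell[where 'n='n, of k k'] powr2_mono_cell[where 'n='n, of k' k0] by (auto simp: ennreal_le_iff)
    then show "R \<in> (\<lambda>k'. cell v k' (addr v k' x)) ` {k0..k}" using k' z' by auto
  qed
  then show "finite {R\<in>lattice v. P \<subseteq> R \<and> R \<subseteq> Q}" by (rule finite_subset) simp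
next
  fix U Q and x :: "real^'n" assume U: "open U" "x \<in> U" and Q: "Q \<in> lattice v" "x \<in> Q"
  obtain k0 z0 where k0: "Q = cell v k0 z0" using Q unfolding lattice_alt by auto
  obtain e where e: "0 < e" "ball x e \<subseteq> U" using U open_contains_ball by blast
  define c where "c = real CARD('n) / e"
  have c: "0 < c" using e by (simp add: c_def)
  define k where "k = max k0 (\<lfloor>log 2 c\<rfloor> + 1)"
  have "log 2 c < of_int k" unfolding k_def by linarith
  then have "c < 2 powr of_int k" using c by (simp add: log_less_iff)
  then have "real CARD('n) * 2 powr (- of_int k) < e"
    using e c by (simp add: c_def powr_minus field_simps)
  then have "cell v k (addr v k x) \<subseteq> ball x e"
    using dist_cell[of x v k "addr v k x"] by (force simp: mem_cell)
  moreover have "cell v k (addr v k x) \<subseteq> Q"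
    unfolding k0 using Q(2) k0 by (intro cell_nested[of k0 k x]) (auto simp: k_def mem_cell)
  ultimately show "\<exists>P\<in>lattice v. x \<in> P \<and> P \<subseteq> U \<and> P \<subseteq> Q"
    using e(2) unfolding lattice_alt by (intro bexI[of _ "cell v k (addr v k x)"]) (auto simp: mem_cell)
qed

section \<open>Every cube lies in a comparable cell of one of finitely many lattices\<close>

lemma floor_same_or_separated:
  assumes "l \<le> (u::real)" "\<lfloor>l\<rfloor> \<noteq> \<lfloor>u\<rfloor>"
  shows "\<exists>j::int. l < of_int j \<and> of_int j \<le> u"
proof -
  have "\<lfloor>l\<rfloor> < \<lfloor>u\<rfloor>" using assms floor_mono[OF assms(1)] by linarith
  then show ?thesis by (intro exI[of _ "\<lfloor>u\<rfloor>"]) linarith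
qed

text \<open>
  The one-third trick.  The two grids of mesh \<open>h = 2\<^bsup>-k\<^esup>\<close>, one shifted by \<open>2\<^bsup>K\<^esup> / 3\<close>, have all their
  grid points at distance at least \<open>h / 3\<close> from each other, because \<open>2\<^bsup>K + k\<^esup>\<close> is not divisible by 3.
\<close>

lemma one_third_trick:
  fixes l a :: real and k :: int and K :: int
  assumes a: "0 \<le> a" "3 * a \<le> 2 powr (- of_int k)" and K: "- k \<le> K"
  shows "\<exists>s\<in>{0, 2 powr of_int K / 3}. \<lfloor>(l - s) * 2 powr of_int k\<rfloor> = \<lfloor>(l + a - s) * 2 powr of_int k\<rfloor>"
proof (rule ccontr)
  assume "\<not> ?thesis"
  then have n: "\<lfloor>l * 2 powr of_int k\<rfloor> \<noteq> \<lfloor>(l + a) * 2 powr of_int k\<rfloor>"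
    "\<lfloor>(l - 2 powr of_int K / 3) * 2 powr of_int k\<rfloor> \<noteq> \<lfloor>(l + a - 2 powr of_int K / 3) * 2 powr of_int k\<rfloor>" by auto
  have p: "0 < (2::real) powr of_int k" by simp
  obtain i :: int where i: "l * 2 powr of_int k < of_int i" "of_int i \<le> (l + a) * 2 powr of_int k"
    using floor_same_or_separated[OF _ n(1)] a p by (auto intro!: mult_right_mono)
  obtain j :: int where j: "(l - 2 powr of_int K / 3) * 2 powr of_int k < of_int j" "of_int j \<le> (l + a - 2 powr of_int K / 3) * 2 powr of_int k"
    using floor_same_or_separated[OF _ n(2)] a p by (auto intro!: mult_right_mono)
  define N :: int where "N = 2 ^ nat (K + k)"
  have N: "real_of_int N = 2 powr of_int K * 2 powr of_int k"
    unfolding N_def powr_add[symmetric] using K by (simp add: powr_realpow[symmetric])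
  have aN: "3 * (a * 2 powr of_int k) \<le> 1"
  proof -
    have "(3 * a) * 2 powr of_int k \<le> 2 powr (- of_int k) * 2 powr of_int k" using a by (intro mult_right_mono) auto
    also have "\<dots> = 1" by (simp flip: powr_add)
    finally show ?thesis by simp
  qed
  define L where "L = l * 2 powr of_int k"
  have "L < of_int i" "of_int i \<le> L + a * 2 powr of_int k" "L - of_int N / 3 < of_int j" "of_int j \<le> L + a * 2 powr of_int k - of_int N / 3"
    using i j by (auto simp: L_def N algebra_simps)
  \<comment> \<open>In units of the mesh, i and j + N/3 lie in one half-open interval of length at
    most 1/3. So the integer 3 i - 3 j - N has modulus below 1.\<close>
  then have "\<bar>3 * real_of_int i - 3 * real_of_int j - real_of_int N\<bar> < 1" using aN by linarith
  then have "\<bar>3 * i - 3 * j - N\<bar> < 1" by linarith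
  then have "3 * i - 3 * j - N = 0" by simp
  then have "N = 3 * (i - j)" by (simp add: algebra_simps)
  then have "3 dvd N" by simp
  then have "(3::int) dvd 2"
    unfolding N_def by (rule prime_dvd_power[rotated]) (simp add: prime_int_numeral_eq)
  then show False by simp
qed

text \<open>Each coordinate is shifted or not. The shift depends on the scale K, so the lattices can
  be fixed only for cubes of bounded size.\<close>

definition shifts :: "int \<Rightarrow> (real^'n) set" where
  "shifts K = {v. \<forall>i. v $ i \<in> {0, 2 powr of_int K / 3}}"

lemma finite_shifts: "finite (shifts K :: (real^'n) set)" "card (shifts K :: (real^'n) set) \<le> 2 ^ CARD('n)"
proof -
  let ?S = "{0, 2 powr of_int K / 3} :: real set"
  have sub: "(shifts K :: (real^'n) set) \<subseteq> (\<lambda>f. \<chi> i. f i) ` (UNIV \<rightarrow>\<^sub>E ?S)"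
  proof
    fix v :: "real^'n" assume "v \<in> shifts K"
    then have "(\<lambda>i. v $ i) \<in> UNIV \<rightarrow>\<^sub>E ?S" by (auto simp: shifts_def PiE_def)
    then show "v \<in> (\<lambda>f. \<chi> i. f i) ` (UNIV \<rightarrow>\<^sub>E ?S)" by (intro image_eqI[of _ _ "\<lambda>i. v $ i"]) auto
  qed
  have fin: "finite (UNIV \<rightarrow>\<^sub>E ?S :: ('n \<Rightarrow> real) set)" by (intro finite_PiE) auto
  then show f: "finite (shifts K :: (real^'n) set)" using finite_subset[OF sub] by auto
  have "card (shifts K :: (real^'n) set) \<le> card ((\<lambda>f. (\<chi> i. f i) :: real^'n) ` (UNIV \<rightarrow>\<^sub>E ?S))"
    by (intro card_mono sub finite_imageI fin)
  also have "\<dots> \<le> card (UNIV \<rightarrow>\<^sub>E ?S :: ('n \<Rightarrow> real) set)" by (intro card_image_le fin)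
  also have "\<dots> = 2 ^ CARD('n)" by (subst card_PiE) (auto simp: numeral_2_eq_2)
  finally show "card (shifts K :: (real^'n) set) \<le> 2 ^ CARD('n)" .
qed

text \<open>The mesh is at least 3 a, as the one-third trick needs, and below 6 a, which gives the
  ratio of measures. The shift is chosen separately for each coordinate.\<close>

theorem cube_in_lattice:
  fixes c :: "real^'n"
  assumes a: "0 < a" and K: "6 * a \<le> 2 powr of_int K"
  shows "\<exists>v\<in>shifts K. \<exists>P\<in>lattice v. cube c a \<subseteq> P \<and> emeasure lebesgue P \<le> ennreal (6 ^ CARD('n)) * emeasure lebesgue (cube c a)"
proof -
  define k where "k = - \<lceil>log 2 (3 * a)\<rceil>"
  have "2 powr log 2 (3 * a) = 3 * a" using a by simp
  moreover have "log 2 (3 * a) \<le> - of_int k" "- of_int k < log 2 (3 * a) + 1" unfolding k_def by linarith+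
  then have "2 powr log 2 (3 * a) \<le> 2 powr (- of_int k)" "2 powr (- of_int k) < 2 powr (log 2 (3 * a) + 1)" by auto
  ultimately have k: "3 * a \<le> 2 powr (- of_int k)" "2 powr (- of_int k) < 6 * a" using a by (auto simp: powr_add)
  have "2 powr (- real_of_int k) < 2 powr of_int K" using k(2) K by linarith
  then have kK: "- k \<le> K" by simp
  define l where "l i = c $ i - a / 2" for i
  have "\<exists>s. s \<in> {0, 2 powr of_int K / 3} \<and> \<lfloor>(l i - s) * 2 powr of_int k\<rfloor> = \<lfloor>(l i + a - s) * 2 powr of_int k\<rfloor>" for i
    using one_third_trick[of a k K "l i"] less_imp_le[OF a] k(1) kK unfolding Bex_def by blast
  then obtain s where s: "\<And>i. s i \<in> {0, 2 powr of_int K / 3}"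
     "\<And>i. \<lfloor>(l i - s i) * 2 powr of_int k\<rfloor> = \<lfloor>(l i + a - s i) * 2 powr of_int k\<rfloor>" by metis
  define v :: "real^'n" where "v = (\<chi> i. s i)"
  define P where "P = cell v k (\<lambda>i. \<lfloor>(l i - s i) * 2 powr of_int k\<rfloor>)"
  have v: "v \<in> shifts K" using s(1) by (simp add: shifts_def v_def)
  have sub: "cube c a \<subseteq> P"
  proof
    fix x assume "x \<in> cube c a"
    then have x: "l i \<le> x $ i" "x $ i \<le> l i + a" for i
      unfolding cube_def mem_box_cart by (auto simp: l_def dest!: spec[of _ i])
    have "\<lfloor>(x $ i - v $ i) * 2 powr of_int k\<rfloor> = \<lfloor>(l i - s i) * 2 powr of_int k\<rfloor>" for i
    proof (rule antisym)
      have "\<lfloor>(x $ i - v $ i) * 2 powr of_int k\<rfloor> \<le> \<lfloor>(l i + a - s i) * 2 powr of_int k\<rfloor>"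
        using x[of i] by (intro floor_mono mult_right_mono) (auto simp: v_def)
      then show "\<lfloor>(x $ i - v $ i) * 2 powr of_int k\<rfloor> \<le> \<lfloor>(l i - s i) * 2 powr of_int k\<rfloor>" using s(2) by simp
      show "\<lfloor>(l i - s i) * 2 powr of_int k\<rfloor> \<le> \<lfloor>(x $ i - v $ i) * 2 powr of_int k\<rfloor>"
        using x[of i] by (intro floor_mono mult_right_mono) (auto simp: v_def)
    qed
    then show "x \<in> P" by (simp add: P_def cell_def)
  qed
  have "(2 powr (- of_int k)) ^ CARD('n) \<le> (6 * a) ^ CARD('n)" using k by (intro power_mono) auto
  then have "emeasure lebesgue P \<le> ennreal ((6 * a) ^ CARD('n))" unfolding P_def emeasure_cell by (rule ennreal_leI)
  also have "\<dots> = ennreal (6 ^ CARD('n)) * emeasure lebesgue (cube c a)"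
    using a by (simp add: emeasure_cbox_cube power_mult_distrib ennreal_mult)
  finally show ?thesis using v sub unfolding lattice_alt by (intro bexI[of _ v] bexI[of _ P]) (auto simp: P_def)
qed

section \<open>From cubes to dyadic lattices\<close>

lemma cubes_pos: "Q \<in> cubes \<Longrightarrow> finite_pos_set lebesgue Q"
proof -
  assume "Q \<in> cubes"
  then obtain c a where Q: "Q = cube c a" "0 < a" by (auto simp: cubes_def)
  have "Q \<in> sets lebesgue" unfolding Q cube_def by simp
  then show ?thesis using Q by (auto simp: finite_pos_set_def emeasure_cbox_cube)
qed

lemma lattice_cube:
  assumes "P \<in> lattice v"
  obtains C where "C \<in> cubes" "P \<subseteq> C" "C - P \<in> null_sets lebesgue"
proof -
  obtain k z where P: "P = cell v k z" using assms unfolding lattice_alt by auto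
  have "cbox (lo v k z) (hi v k z) \<in> cubes" 
  proof -
    have "(0::real) < 2 powr (- of_int k)" by simp
    then show ?thesis unfolding cell_eq_cube cubes_def by blast
  qed
  then show ?thesis using that box_subset_cell(2)[of v k z] cell_null_diff[of v k z] P by blast
qed

lemma AE_indicator_eq:
  assumes "P \<subseteq> C" "C - P \<in> null_sets M"
  shows "AE x in M. indicator P x = (indicator C x :: 'b::zero_neq_one)"
  by (rule AE_I'[OF assms(2)]) (use assms(1) in \<open>auto simp: indicator_def\<close>)

lemma ave_null_diff:
  assumes P: "P \<in> sets M" "P \<subseteq> C" "C - P \<in> null_sets M"
  shows "ave M P h = ave M C h"
proof -
  have "C = P \<union> (C - P)" using P by blast
  then have e: "emeasure M C = emeasure M P" using emeasure_Un_null_set[OF P(1,3)] by metis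
  have "(\<integral>\<^sup>+x\<in>P. h x \<partial>M) = (\<integral>\<^sup>+x\<in>C. h x \<partial>M)"
    using AE_indicator_eq[OF P(2,3), where 'b=ennreal] by (intro nn_integral_cong_AE) auto
  then show ?thesis by (simp add: ave_def e)
qed

lemma mean_null_diff:
  fixes b :: "(real^'n) \<Rightarrow> 'k::euclidean_space"
  assumes P: "P \<in> sets lebesgue" "P \<subseteq> C" "C - P \<in> null_sets lebesgue" and C: "C \<in> sets lebesgue"
    and [measurable]: "b \<in> borel_measurable lebesgue"
  shows "mean P b = mean C b"
proof -
  have "C = P \<union> (C - P)" using P by blast
  then have "emeasure lebesgue C = emeasure lebesgue P" using emeasure_Un_null_set[OF P(1,3)] by metis
  then have e: "measure lebesgue C = measure lebesgue P" by (simp only: measure_def)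
  have "(LINT x:P|lebesgue. b x) = (LINT x:C|lebesgue. b x)"
    unfolding set_lebesgue_integral_def
    using AE_indicator_eq[OF P(2,3), where 'b=real] P(1) C by (intro integral_cong_AE) auto
  then show ?thesis by (simp only: mean_def e)
qed

text \<open>The counterpart of \<open>Apd\<close> over all cubes; it implies \<open>Apd\<close> in
  every shifted lattice with the same A.\<close>

definition cube_Ap :: "real \<Rightarrow> (real^'n \<Rightarrow> ennreal) \<Rightarrow> real \<Rightarrow> bool" where
  "cube_Ap p w A \<longleftrightarrow> pos_weight w \<and> 1 \<le> A \<and>
     (\<forall>Q\<in>cubes. ave lebesgue Q w * epowr (ave lebesgue Q (dual_weight p w)) (p - 1) \<le> ennreal A)"

lemma cube_Ap_lattice: "cube_Ap p w A \<Longrightarrow> dyadic.Apd (lattice v) p w A"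
proof -
  assume A: "cube_Ap p w A"
  interpret dyadic "lattice v" "2 ^ CARD('a)" by (rule dyadic_lattice)
  show ?thesis
    unfolding Apd_def
  proof (intro conjI ballI)
    fix P assume P: "P \<in> lattice v"
    obtain C where C: "C \<in> cubes" "P \<subseteq> C" "C - P \<in> null_sets lebesgue" using lattice_cube[OF P] .
    show "ave lebesgue P w * epowr (ave lebesgue P (dual_weight p w)) (p - 1) \<le> ennreal A"
      using A C(1) unfolding ave_null_diff[OF D_sets[OF P] C(2,3)] by (simp add: cube_Ap_def)
  qed (use A in \<open>auto simp: cube_Ap_def\<close>)
qed

lemma cube_Ap_dual:
  assumes A: "cube_Ap p w A" and p: "1 < p"
  shows "cube_Ap (p / (p - 1)) (dual_weight p w) (A powr (1 / (p - 1)))"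
  unfolding cube_Ap_def
proof (intro conjI ballI)
  show "pos_weight (dual_weight p w)" using A by (simp add: cube_Ap_def pos_weight_dual)
  show "1 \<le> A powr (1 / (p - 1))" using A p by (intro ge_one_powr_ge_zero) (auto simp: cube_Ap_def)
  fix P :: "(real^'a) set" assume P: "P \<in> cubes"
  have e: "p / (p - 1) - 1 = 1 / (p - 1)" using p by (simp add: field_simps)
  have "epowr (ave lebesgue P w * epowr (ave lebesgue P (dual_weight p w)) (p - 1)) (1 / (p - 1)) \<le> epowr (ennreal A) (1 / (p - 1))"
    using A P p by (intro epowr_mono) (auto simp: cube_Ap_def)
  then show "ave lebesgue P (dual_weight p w) *
      epowr (ave lebesgue P (dual_weight (p / (p - 1)) (dual_weight p w))) (p / (p - 1) - 1) \<le> ennreal (A powr (1 / (p - 1)))"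
    using A p by (simp add: dual_dual_weight e epowr_mult epowr_epowr epowr_ennreal cube_Ap_def mult.commute)
qed

lemma ave_subset:
  assumes Q: "finite_pos_set N Q" and P: "finite_pos_set N P" and sub: "Q \<subseteq> P" and K: "emeasure N P \<le> K * emeasure N Q"
  shows "ave N Q h \<le> K * ave N P h"
proof -
  interpret Q: finite_pos_set N Q by (rule Q)
  interpret P: finite_pos_set N P by (rule P)
  have "emeasure N Q * ave N Q h = (\<integral>\<^sup>+x\<in>Q. h x \<partial>N)" by (metis Q.ave_mult_emeasure mult.commute)
  also have "\<dots> \<le> (\<integral>\<^sup>+x\<in>P. h x \<partial>N)" using sub by (intro nn_integral_mono) (auto split: split_indicator)
  also have "\<dots> = ave N P h * emeasure N P" by (simp add: P.ave_mult_emeasure)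
  also have "\<dots> \<le> ave N P h * (K * emeasure N Q)" by (intro mult_left_mono K) auto
  finally have "emeasure N Q * ave N Q h \<le> emeasure N Q * (K * ave N P h)" by (simp add: mult_ac)
  then show ?thesis using Q.pos Q.fin by (subst (asm) ennreal_mult_le_mult_iff) auto
qed

lemma rave_subset:
  assumes Q: "finite_pos_set N Q" and P: "finite_pos_set N P" and sub: "Q \<subseteq> P"
    and K: "emeasure N P \<le> ennreal K * emeasure N Q" "1 \<le> K" and r: "1 \<le> r"
  shows "rave r N Q h \<le> ennreal K * rave r N P h"
proof -
  have "rave r N Q h \<le> epowr (ennreal K * ave N P (\<lambda>x. epowr (h x) r)) (1 / r)"
    unfolding rave_def using r by (intro epowr_mono ave_subset[OF Q P sub K(1)]) auto
  also have "\<dots> = ennreal (K powr (1 / r)) * rave r N P h"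
    using K by (simp add: epowr_mult epowr_ennreal rave_def)
  also have "\<dots> \<le> ennreal K * rave r N P h"
  proof (intro mult_right_mono ennreal_leI)
    have "K powr (1 / r) \<le> K powr 1" using K r by (intro powr_mono) auto
    then show "K powr (1 / r) \<le> K" using K by simp
  qed auto
  finally show ?thesis .
qed

lemma ennreal_SUP_power:
  fixes f :: "nat \<Rightarrow> ennreal"
  assumes "1 \<le> m" shows "(SUP i. f i) ^ m = (SUP i. f i ^ m)"
  using epowr_SUP[of "real m" UNIV f] assms by (simp add: epowr_nat)

lemma rave_SUP:
  assumes r: "0 < r" and [measurable]: "\<And>i::nat. h i \<in> borel_measurable N" "P \<in> sets N" and inc: "\<And>x. incseq (\<lambda>i. h i x)"
  shows "rave r N P (\<lambda>x. SUP i. h i x) = (SUP i. rave r N P (h i))"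
proof -
  have "(\<integral>\<^sup>+x\<in>P. epowr (SUP i. h i x) r \<partial>N) = (\<integral>\<^sup>+x. (SUP i. epowr (h i x) r * indicator P x) \<partial>N)"
    using r by (intro nn_integral_cong) (auto simp: epowr_SUP split: split_indicator)
  also have "\<dots> = (SUP i. \<integral>\<^sup>+x\<in>P. epowr (h i x) r \<partial>N)"
    using inc r by (intro nn_integral_monotone_convergence_SUP incseq_SucI le_funI mult_right_mono epowr_mono)
      (auto simp: incseq_def)
  finally show ?thesis
    using r by (simp add: rave_def ave_def epowr_SUP[symmetric] SUP_divide_ennreal[symmetric])
qed

text \<open>Passing from Q to the cell \<open>PP Q\<close> costs a factor 6^n in each average. The
  stopping family is built around these cells; as it may be infinite while \<open>bound\<close>
  speaks of finite families, the complete local sum \<open>BS\<close> is reached as a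
  supremum.\<close>

lemma lattice_form:
  fixes b :: "real^'n \<Rightarrow> 'k::euclidean_space" and f g \<nu> :: "real^'n \<Rightarrow> ennreal" and v :: "real^'n"
  defines "a \<equiv> \<lambda>P. ave lebesgue P \<nu>"
  assumes S: "finite S" "S \<subseteq> cubes"
    and E: "\<And>Q. Q \<in> S \<Longrightarrow> E Q \<in> sets lebesgue" "\<And>Q. Q \<in> S \<Longrightarrow> E Q \<subseteq> Q"
      "\<And>Q. Q \<in> S \<Longrightarrow> ennreal \<eta> * emeasure lebesgue Q \<le> emeasure lebesgue (E Q)" "disjoint_family_on E S"
    and \<eta>: "0 < \<eta>" "\<eta> \<le> 1"
    and PP: "\<And>Q. Q \<in> S \<Longrightarrow> PP Q \<in> lattice v" "\<And>Q. Q \<in> S \<Longrightarrow> Q \<subseteq> PP Q"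
      "\<And>Q. Q \<in> S \<Longrightarrow> emeasure lebesgue (PP Q) \<le> ennreal (6 ^ CARD('n)) * emeasure lebesgue Q"
    and b [measurable]: "b \<in> borel_measurable lebesgue" and b_int: "\<And>Q. Q \<in> cubes \<Longrightarrow> set_integrable lebesgue Q b"
    and \<beta>: "0 \<le> \<beta>" "\<And>Q. Q \<in> cubes \<Longrightarrow> ave lebesgue Q (\<lambda>x. ennreal (norm (b x - mean Q b))) \<le> ennreal \<beta> * a Q"
    and f [measurable]: "f \<in> borel_measurable lebesgue" and g [measurable]: "g \<in> borel_measurable lebesgue"
    and r: "1 \<le> r" and t: "1 \<le> t" and m: "1 \<le> m"
    and bound: "\<And>F ES. dyadic.sparse_sets (lattice v) (3 / 4 * (\<eta> / 6 ^ CARD('n))) F ES \<Longrightarrow>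
      (\<Sum>P\<in>F. rave r lebesgue P (\<lambda>x. f x * local_sum a F P x ^ m) * rave t lebesgue P g * emeasure lebesgue P) \<le> W"
  shows "(\<Sum>Q\<in>S. rave r lebesgue Q (\<lambda>x. ennreal (norm (b x - mean Q b)) ^ m * f x) * rave t lebesgue Q g * emeasure lebesgue Q)
    \<le> ennreal (((4 * 2 ^ CARD('n) + 6 ^ CARD('n)) * \<beta>) ^ m * (6 ^ CARD('n) * 6 ^ CARD('n)) * (1 / \<eta>)) * W"
proof -
  define d :: real where "d = 2 ^ CARD('n)"
  define K6 :: real where "K6 = 6 ^ CARD('n)"
  have K6: "1 \<le> K6" by (simp add: K6_def)
  interpret dyadic "lattice v" d unfolding d_def by (rule dyadic_lattice)
  define S' where "S' = PP ` S"
  have S': "finite S'" "S' \<subseteq> lattice v" using S PP by (auto simp: S'_def)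
  have latC: "\<exists>C\<in>cubes. P \<subseteq> C \<and> C \<in> sets lebesgue \<and> ave lebesgue P h = ave lebesgue C h \<and> mean P b = mean C b" if P: "P \<in> lattice v" for P h
  proof -
    obtain C where C: "C \<in> cubes" "P \<subseteq> C" "C - P \<in> null_sets lebesgue" using lattice_cube[OF P] .
    have Cs: "C \<in> sets lebesgue" using finite_pos_set.sets_P[OF cubes_pos[OF C(1)]] .
    then show ?thesis
      using C ave_null_diff[OF D_sets[OF P] C(2,3)] mean_null_diff[OF D_sets[OF P] C(2,3) Cs b] by auto
  qed
  interpret O: dyadic_osc "lattice v" d S' b
  proof
    show "set_integrable lebesgue P b" if P: "P \<in> lattice v" for P
    proof -
      obtain C where C: "C \<in> cubes" "P \<subseteq> C" using latC[OF P] by blast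
      show ?thesis by (rule set_integrable_subset[OF b_int[OF C(1)] D_sets[OF P] C(2)])
    qed
  qed (use S' in auto)
  define \<eta>' where "\<eta>' = \<eta> / K6"
  have \<eta>': "0 < \<eta>'" "\<eta>' \<le> 1" using \<eta> K6 by (auto simp: \<eta>'_def divide_le_eq)
  \<comment> \<open>Several Q may share a cell; the union of their disjoint parts serves as the part
    of that cell.\<close>
  define E' where "E' P = (\<Union>Q\<in>{Q\<in>S. PP Q = P}. E Q)" for P
  have E'1: "E' P \<in> sets lebesgue" "E' P \<subseteq> P" for P
  proof -
    show "E' P \<in> sets lebesgue" unfolding E'_def using S(1) E(1) by (intro sets.finite_UN) auto
    show "E' P \<subseteq> P" unfolding E'_def using E(2) PP(2) by blast
  qed
  have E'2: "ennreal \<eta>' * emeasure lebesgue P \<le> emeasure lebesgue (E' P)" if P: "P \<in> S'" for P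
  proof -
    obtain Q where Q: "Q \<in> S" "PP Q = P" using P by (auto simp: S'_def)
    have "ennreal \<eta>' * emeasure lebesgue P \<le> ennreal \<eta>' * (ennreal K6 * emeasure lebesgue Q)"
      using PP(3)[OF Q(1)] Q(2) by (intro mult_left_mono) (auto simp: K6_def)
    also have "\<dots> = ennreal \<eta> * emeasure lebesgue Q"
    proof -
      have "ennreal \<eta>' * ennreal K6 = ennreal \<eta>" using K6 \<eta> \<eta>' by (subst ennreal_mult[symmetric]) (auto simp: \<eta>'_def)
      then show ?thesis by (simp add: mult.assoc[symmetric])
    qed
    also have "\<dots> \<le> emeasure lebesgue (E Q)" by (rule E(3)[OF Q(1)])
    also have "\<dots> \<le> emeasure lebesgue (E' P)"
      using E'1 Q by (intro emeasure_mono) (auto simp: E'_def)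
    finally show ?thesis .
  qed
  have E'3: "disjoint_family_on E' S'"
    unfolding disjoint_family_on_def E'_def using E(4) by (fastforce simp: disjoint_family_on_def)
  note sparse = O.sparse_St[OF \<eta>' E'1 E'2 E'3]
  note AE_osc = O.oscillation_sparse[OF \<eta>' E'1 E'2 E'3]
  have St: "O.St \<subseteq> lattice v" "countable O.St" "S' \<subseteq> O.St"
    using O.St_D countable_subset[OF _ countable_D, of O.St] O.St.base by auto
  have osc_le: "O.osc R \<le> ennreal \<beta> * a R" if R: "R \<in> lattice v" for R
  proof -
    obtain C where C: "C \<in> cubes" "ave lebesgue R (O.dev R) = ave lebesgue C (O.dev R)" "mean R b = mean C b"
      using latC[OF R] by blast
    obtain C' where C': "C' \<in> cubes" "R \<subseteq> C'" "C' - R \<in> null_sets lebesgue" using lattice_cube[OF R] .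
    have "O.osc R = ave lebesgue C' (O.dev R)" unfolding O.osc_def by (rule ave_null_diff[OF D_sets[OF R] C'(2,3)])
    also have "O.dev R = (\<lambda>x. ennreal (norm (b x - mean C' b)))"
      unfolding O.dev_def[abs_def] using mean_null_diff[OF D_sets[OF R] C'(2,3) _ b] finite_pos_set.sets_P[OF cubes_pos[OF C'(1)]] by simp
    also have "ave lebesgue C' \<dots> \<le> ennreal \<beta> * a C'" by (rule \<beta>(2)[OF C'(1)])
    also have "a C' = a R" unfolding a_def by (rule ave_null_diff[OF D_sets[OF R] C'(2,3), symmetric])
    finally show ?thesis .
  qed
  \<comment> \<open>An increasing exhaustion of the countable family \<open>O.St\<close> by finite
    families, all of which contain S'.\<close>
  define F where "F i = S' \<union> {R\<in>O.St. to_nat_on O.St R < i}" for i :: nat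
  have F: "finite (F i)" "F i \<subseteq> O.St" "S' \<subseteq> F i" for i
  proof -
    have "{R\<in>O.St. to_nat_on O.St R < i} = to_nat_on O.St -` {..<i} \<inter> O.St" by auto
    then have "finite {R\<in>O.St. to_nat_on O.St R < i}"
      using inj_on_to_nat_on[OF St(2)] by (simp add: finite_vimage_IntI)
    then show "finite (F i)" "F i \<subseteq> O.St" "S' \<subseteq> F i" using S' St by (auto simp: F_def)
  qed
  have F_inc: "F i \<subseteq> F j" if "i \<le> j" for i j using that by (auto simp: F_def)
  have F_lat: "F i \<subseteq> lattice v" for i using F(2) St by blast
  have F_ex: "\<exists>i. X \<subseteq> F i" if "finite X" "X \<subseteq> O.St" for X
  proof -
    define i where "i = Suc (Max (to_nat_on O.St ` X \<union> {0}))"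
    have "to_nat_on O.St R < i" if "R \<in> X" for R
      unfolding i_def using that \<open>finite X\<close> by (intro le_imp_less_Suc Max_ge) auto
    then show ?thesis using that by (intro exI[of _ i]) (auto simp: F_def)
  qed
  have local_sum_mono: "local_sum a (F i) P x \<le> local_sum a (F j) P x" if "i \<le> j" for i j P x
    unfolding local_sum_def using F_inc[OF that] F(1)[of j] by (intro sum_mono2) auto
  have local_sum_meas [measurable]: "local_sum a (F i) P \<in> borel_measurable lebesgue" for i P
    by (rule local_sum_measurable[OF F_lat])
  define BS where "BS P x = (SUP i. local_sum a (F i) P x)" for P x
  have [measurable]: "BS P \<in> borel_measurable lebesgue" for P unfolding BS_def by measurable
  \<comment> \<open>4 d comes from the deviation on the cell, K6 from replacing the mean over Q by
    the mean over its cell.\<close>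
  define c0 where "c0 = (4 * d + K6) * \<beta>"
  have d1: "1 \<le> d" by (simp add: d_def)
  have c0: "0 \<le> c0" using \<beta>(1) K6 d1 by (simp add: c0_def)
  have pt: "AE x in lebesgue. \<forall>Q\<in>S. x \<in> Q \<longrightarrow> ennreal (norm (b x - mean Q b)) \<le> ennreal c0 * BS (PP Q) x"
  proof (rule eventually_mono[OF AE_osc], assumption, intro ballI impI)
    fix x Q assume x: "\<forall>P\<in>S'. x \<in> P \<longrightarrow> finite {R\<in>O.St. x \<in> R} \<and>
        O.dev P x \<le> ennreal (4 * d) * (\<Sum>R\<in>{R\<in>O.St. R \<subseteq> P \<and> x \<in> R}. O.osc R)" and Q: "Q \<in> S" "x \<in> Q"
    define P where "P = PP Q"
    have P: "P \<in> S'" "P \<in> lattice v" "x \<in> P" "Q \<subseteq> P" using Q PP by (auto simp: P_def S'_def)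
    have Qc: "Q \<in> cubes" using Q S by auto
    let ?X = "{R\<in>O.St. R \<subseteq> P \<and> x \<in> R}"
    have finX: "finite ?X" using x P finite_subset[of ?X "{R\<in>O.St. x \<in> R}"] by auto
    have PX: "P \<in> ?X" using P St by auto
    have s1: "(\<Sum>R\<in>?X. O.osc R) \<le> ennreal \<beta> * (\<Sum>R\<in>?X. a R)"
      unfolding sum_distrib_left using St by (intro sum_mono osc_le) auto
    have "O.osc P \<le> (\<Sum>R\<in>?X. O.osc R)" by (rule member_le_sum[OF PX _ finX]) simp
    then have s2: "O.osc P \<le> ennreal \<beta> * (\<Sum>R\<in>?X. a R)" using s1 by (rule order_trans)
    have "(\<Sum>R\<in>?X. a R) \<le> BS P x"
    proof -
      obtain i where i: "?X \<subseteq> F i" using F_ex[OF finX] by auto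
      have "(\<Sum>R\<in>?X. a R) \<le> local_sum a (F i) P x"
        unfolding local_sum_alt[OF F(1)] using i F(1)[of i] by (intro sum_mono2) auto
      also have "\<dots> \<le> BS P x" unfolding BS_def by (rule SUP_upper) simp
      finally show ?thesis .
    qed
    then have s3: "ennreal \<beta> * (\<Sum>R\<in>?X. a R) \<le> ennreal \<beta> * BS P x" by (rule mult_left_mono) simp
    have "ennreal (norm (mean Q b - mean P b)) \<le> ave lebesgue Q (O.dev P)"
      unfolding O.dev_def[abs_def] by (rule norm_mean_diff_le[OF cubes_pos[OF Qc] b_int[OF Qc]])
    also have "\<dots> \<le> ennreal K6 * O.osc P"
      unfolding O.osc_def using PP(3)[OF Q(1)] by (intro ave_subset cubes_pos Qc D_pos P) (auto simp: K6_def P_def)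
    also have "\<dots> \<le> ennreal K6 * (ennreal \<beta> * BS P x)"
      by (intro mult_left_mono order_trans[OF s2 s3]) auto
    finally have 1: "ennreal (norm (mean Q b - mean P b)) \<le> ennreal K6 * (ennreal \<beta> * BS P x)" .
    have "O.dev P x \<le> ennreal (4 * d) * (\<Sum>R\<in>?X. O.osc R)" using x P by auto
    also have "\<dots> \<le> ennreal (4 * d) * (ennreal \<beta> * BS P x)"
      by (intro mult_left_mono order_trans[OF s1 s3]) auto
    finally have 2: "O.dev P x \<le> ennreal (4 * d) * (ennreal \<beta> * BS P x)" .
    have "norm (b x - mean Q b) \<le> norm (b x - mean P b) + norm (mean Q b - mean P b)"
      using norm_triangle_ineq4[of "b x - mean P b" "mean Q b - mean P b"] by simp
    then have "ennreal (norm (b x - mean Q b)) \<le> O.dev P x + ennreal (norm (mean Q b - mean P b))"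
      unfolding O.dev_def by (simp add: ennreal_leI flip: ennreal_plus)
    also have "\<dots> \<le> ennreal (4 * d) * (ennreal \<beta> * BS P x) + ennreal K6 * (ennreal \<beta> * BS P x)"
      by (intro add_mono 1 2)
    also have "\<dots> = (ennreal (4 * d) + ennreal K6) * ennreal \<beta> * BS P x"
      by (simp only: distrib_right mult.assoc)
    also have "\<dots> = ennreal c0 * BS P x"
    proof -
      have "ennreal c0 = ennreal (4 * d + K6) * ennreal \<beta>"
        unfolding c0_def using d1 K6 \<beta>(1) by (intro ennreal_mult) auto
      also have "ennreal (4 * d + K6) = ennreal (4 * d) + ennreal K6" using d1 K6 by (intro ennreal_plus) auto
      finally show ?thesis by simp
    qed
    finally show "ennreal (norm (b x - mean Q b)) \<le> ennreal c0 * BS (PP Q) x" by (simp add: P_def)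
  qed
  define X where "X P = rave r lebesgue P (\<lambda>x. f x * BS P x ^ m)" for P
  have term_le: "rave r lebesgue Q (\<lambda>x. ennreal (norm (b x - mean Q b)) ^ m * f x) * rave t lebesgue Q g * emeasure lebesgue Q
    \<le> ennreal (c0 ^ m * (K6 * K6)) * (X (PP Q) * rave t lebesgue (PP Q) g * emeasure lebesgue Q)" if Q: "Q \<in> S" for Q
  proof -
    have Qc: "Q \<in> cubes" using Q S by auto
    have [measurable]: "Q \<in> sets lebesgue" using finite_pos_set.sets_P[OF cubes_pos[OF Qc]] .
    have sub: "rave \<rho> lebesgue Q h \<le> ennreal K6 * rave \<rho> lebesgue (PP Q) h" if "1 \<le> \<rho>" for \<rho> h
      using that K6 PP[OF Q] by (intro rave_subset cubes_pos Qc D_pos) (auto simp: K6_def)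
    have "rave r lebesgue Q (\<lambda>x. ennreal (norm (b x - mean Q b)) ^ m * f x)
       \<le> rave r lebesgue Q (\<lambda>x. ennreal c0 ^ m * (f x * BS (PP Q) x ^ m))"
    proof (rule rave_mono_AE)
      show "AE x in lebesgue. x \<in> Q \<longrightarrow> ennreal (norm (b x - mean Q b)) ^ m * f x \<le> ennreal c0 ^ m * (f x * BS (PP Q) x ^ m)"
        using pt
      proof (rule eventually_mono, intro impI)
        fix x assume x: "\<forall>Q\<in>S. x \<in> Q \<longrightarrow> ennreal (norm (b x - mean Q b)) \<le> ennreal c0 * BS (PP Q) x" "x \<in> Q"
        then have "ennreal (norm (b x - mean Q b)) ^ m \<le> (ennreal c0 * BS (PP Q) x) ^ m" using Q by (intro power_mono) auto
        then have "ennreal (norm (b x - mean Q b)) ^ m * f x \<le> (ennreal c0 * BS (PP Q) x) ^ m * f x" by (rule mult_right_mono) simp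
        then show "ennreal (norm (b x - mean Q b)) ^ m * f x \<le> ennreal c0 ^ m * (f x * BS (PP Q) x ^ m)"
          by (simp only: power_mult_distrib mult_ac)
      qed
    qed (use r in auto)
    also have "\<dots> = ennreal c0 ^ m * rave r lebesgue Q (\<lambda>x. f x * BS (PP Q) x ^ m)"
      using r by (intro rave_cmult) auto
    also have "\<dots> \<le> ennreal c0 ^ m * (ennreal K6 * X (PP Q))"
      unfolding X_def using sub[OF r] by (intro mult_left_mono) auto
    finally have "rave r lebesgue Q (\<lambda>x. ennreal (norm (b x - mean Q b)) ^ m * f x) * rave t lebesgue Q g * emeasure lebesgue Q
       \<le> (ennreal c0 ^ m * (ennreal K6 * X (PP Q))) * (ennreal K6 * rave t lebesgue (PP Q) g) * emeasure lebesgue Q"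
      using sub[OF t] by (intro mult_right_mono mult_mono) auto
    also have "\<dots> = (ennreal c0 ^ m * (ennreal K6 * ennreal K6)) * (X (PP Q) * rave t lebesgue (PP Q) g * emeasure lebesgue Q)"
      by (simp only: mult_ac)
    also have "ennreal c0 ^ m * (ennreal K6 * ennreal K6) = ennreal (c0 ^ m * (K6 * K6))"
      using c0 K6 by (simp add: ennreal_mult ennreal_power)
    finally show ?thesis .
  qed
  have "(\<Sum>Q\<in>S. rave r lebesgue Q (\<lambda>x. ennreal (norm (b x - mean Q b)) ^ m * f x) * rave t lebesgue Q g * emeasure lebesgue Q)
    \<le> (\<Sum>Q\<in>S. ennreal (c0 ^ m * (K6 * K6)) * (X (PP Q) * rave t lebesgue (PP Q) g * emeasure lebesgue Q))"
    by (intro sum_mono term_le)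
  also have "\<dots> = ennreal (c0 ^ m * (K6 * K6)) * (\<Sum>Q\<in>S. X (PP Q) * rave t lebesgue (PP Q) g * emeasure lebesgue Q)"
    by (rule sum_distrib_left[symmetric])
  also have "(\<Sum>Q\<in>S. X (PP Q) * rave t lebesgue (PP Q) g * emeasure lebesgue Q)
     = (\<Sum>P\<in>S'. \<Sum>Q\<in>{Q\<in>S. PP Q = P}. X (PP Q) * rave t lebesgue (PP Q) g * emeasure lebesgue Q)"
    unfolding S'_def by (rule sum.image_gen[OF S(1)])
  also have "\<dots> = (\<Sum>P\<in>S'. X P * rave t lebesgue P g * (\<Sum>Q\<in>{Q\<in>S. PP Q = P}. emeasure lebesgue Q))"
    by (intro sum.cong refl) (simp add: sum_distrib_left)
  also have "\<dots> \<le> (\<Sum>P\<in>S'. X P * rave t lebesgue P g * (ennreal (1 / \<eta>) * emeasure lebesgue P))"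
  proof (intro sum_mono mult_left_mono)
    fix P assume P: "P \<in> S'"
    have [measurable]: "P \<in> sets lebesgue" using P S' D_sets by auto
    \<comment> \<open>The terms have been grouped by cell. The parts \<open>E Q\<close> are disjoint
      subsets of P, so the cubes sharing P have total measure at most |P| / \<eta>.\<close>
    have "ennreal \<eta> * (\<Sum>Q\<in>{Q\<in>S. PP Q = P}. emeasure lebesgue Q) \<le> (\<Sum>Q\<in>{Q\<in>S. PP Q = P}. emeasure lebesgue (E Q))"
      unfolding sum_distrib_left by (intro sum_mono E(3)) auto
    also have "\<dots> = emeasure lebesgue (E' P)"
      unfolding E'_def using S(1) E(1) disjoint_family_on_mono[OF _ E(4), of "{Q\<in>S. PP Q = P}"]
      by (intro sum_emeasure) auto
    also have "\<dots> \<le> emeasure lebesgue P" using E'1 by (intro emeasure_mono) auto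
    finally have "ennreal (1 / \<eta>) * (ennreal \<eta> * (\<Sum>Q\<in>{Q\<in>S. PP Q = P}. emeasure lebesgue Q)) \<le> ennreal (1 / \<eta>) * emeasure lebesgue P"
      by (rule mult_left_mono) simp
    then show "(\<Sum>Q\<in>{Q\<in>S. PP Q = P}. emeasure lebesgue Q) \<le> ennreal (1 / \<eta>) * emeasure lebesgue P"
      using \<eta> by (simp add: mult.assoc[symmetric] ennreal_mult[symmetric])
  qed auto
  also have "\<dots> = ennreal (1 / \<eta>) * (\<Sum>P\<in>S'. X P * rave t lebesgue P g * emeasure lebesgue P)"
    unfolding sum_distrib_left by (intro sum.cong refl) (simp only: mult_ac)
  also have "(\<Sum>P\<in>S'. X P * rave t lebesgue P g * emeasure lebesgue P) \<le> W"
  proof -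
    let ?Y = "\<lambda>i P. rave r lebesgue P (\<lambda>x. f x * local_sum a (F i) P x ^ m)"
    have inc: "incseq (\<lambda>i. f x * local_sum a (F i) P x ^ m)" for P x
      using local_sum_mono by (intro incseq_SucI mult_left_mono power_mono) auto
    have X: "X P = (SUP i. ?Y i P)" if P: "P \<in> S'" for P
    proof -
      have [measurable]: "P \<in> sets lebesgue" using P S' D_sets by auto
      have "X P = rave r lebesgue P (\<lambda>x. SUP i. f x * local_sum a (F i) P x ^ m)"
        unfolding X_def BS_def using m by (simp add: ennreal_SUP_power SUP_mult_left_ennreal)
      also have "\<dots> = (SUP i. ?Y i P)"
        using r by (intro rave_SUP inc) auto
      finally show ?thesis .
    qed
    have incY: "incseq (\<lambda>i. ?Y i P)" for P
      using r local_sum_mono by (intro incseq_SucI rave_mono mult_left_mono power_mono) auto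
    have "(\<Sum>P\<in>S'. X P * rave t lebesgue P g * emeasure lebesgue P) = (\<Sum>P\<in>S'. SUP i. ?Y i P * (rave t lebesgue P g * emeasure lebesgue P))"
      by (intro sum.cong refl) (simp add: X SUP_mult_right_ennreal mult.assoc)
    also have "\<dots> = (SUP i. \<Sum>P\<in>S'. ?Y i P * (rave t lebesgue P g * emeasure lebesgue P))"
      using incY by (intro ennreal_SUP_sum[symmetric]) (auto simp: incseq_def intro!: mult_right_mono)
    also have "\<dots> \<le> W"
    proof (rule SUP_least)
      fix i
      have "(\<Sum>P\<in>S'. ?Y i P * (rave t lebesgue P g * emeasure lebesgue P)) \<le> (\<Sum>P\<in>F i. ?Y i P * (rave t lebesgue P g * emeasure lebesgue P))"
        using F by (intro sum_mono2) auto
      also have "\<dots> \<le> W"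
        using bound[OF sparse[OF _ F(1,2)[of i], unfolded \<eta>'_def K6_def]] by (simp add: mult.assoc)
      finally show "(\<Sum>P\<in>S'. ?Y i P * (rave t lebesgue P g * emeasure lebesgue P)) \<le> W" .
    qed
    finally show ?thesis .
  qed
  finally have "(\<Sum>Q\<in>S. rave r lebesgue Q (\<lambda>x. ennreal (norm (b x - mean Q b)) ^ m * f x) * rave t lebesgue Q g * emeasure lebesgue Q)
     \<le> ennreal (c0 ^ m * (K6 * K6)) * (ennreal (1 / \<eta>) * W)" by (simp add: mult_left_mono)
  also have "\<dots> = ennreal (c0 ^ m * (K6 * K6) * (1 / \<eta>)) * W"
    using c0 K6 \<eta> by (simp only: mult.assoc[symmetric]) (subst ennreal_mult, auto)
  finally show ?thesis by (simp only: c0_def K6_def d_def)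
qed

section \<open>The sparse form on cubes\<close>

text \<open>For finite K only finitely many terms exceed 1/(n+1), so only countably many are
  nonzero. This admits index sets, such as arbitrary sets of cubes, for which countability is not
  given.\<close>

lemma nn_integral_count_space_le:
  fixes f :: "'a \<Rightarrow> ennreal"
  assumes le: "\<And>F. finite F \<Longrightarrow> F \<subseteq> A \<Longrightarrow> (\<Sum>x\<in>F. f x) \<le> K"
  shows "(\<integral>\<^sup>+x. f x \<partial>count_space A) \<le> K"
proof (cases "K = top")
  case False
  define B where "B = {x\<in>A. f x \<noteq> 0}"
  have fin: "finite {x\<in>A. inverse (of_nat (Suc n)) < f x}" (is "finite ?X") for n
  proof (rule ccontr)
    assume inf: "infinite ?X"
    obtain k where k: "K * of_nat (Suc n) < of_nat k"
      using False by (metis ennreal_Ex_less_of_nat ennreal_mult_eq_top_iff ennreal_of_nat_neq_top infinity_ennreal_def less_top)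
    obtain F where F: "F \<subseteq> ?X" "finite F" "card F = k" using infinite_arbitrarily_large[OF inf] by blast
    have "of_nat k * inverse (of_nat (Suc n)) \<le> (\<Sum>x\<in>F. f x)"
      using F sum_mono[of F "\<lambda>_. inverse (of_nat (Suc n))" f] by (auto simp: less_imp_le subset_iff)
    also have "\<dots> \<le> K" using F by (intro le) auto
    finally have "of_nat k * inverse (of_nat (Suc n)) * of_nat (Suc n) \<le> K * of_nat (Suc n)" by (rule mult_right_mono) simp
    moreover have "inverse (of_nat (Suc n)) * (of_nat (Suc n) :: ennreal) = 1"
      by (metis ennreal_mult_divide_eq divide_ennreal_def mult.commute mult_1 of_nat_neq_0 ennreal_of_nat_neq_top of_nat_eq_0_iff infinity_ennreal_def nat.distinct(1))
    ultimately show False using k by (simp only: mult.assoc mult_1_right)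
  qed
  have "B = (\<Union>n. {x\<in>A. inverse (of_nat (Suc n)) < f x})"
  proof (intro equalityI subsetI)
    fix x assume x: "x \<in> B"
    have inv: "inverse (of_nat (Suc n)) = ennreal (inverse (real (Suc n)))" for n
      using inverse_ennreal[of "real (Suc n)"] by (simp add: ennreal_of_nat_eq_real_of_nat del: of_nat_Suc)
    have "\<exists>n. inverse (of_nat (Suc n)) < f x"
    proof (cases "f x")
      case (real r)
      then have "0 < r" using x by (simp add: B_def order.strict_iff_order)
      then obtain n where "inverse (real (Suc n)) < r" using reals_Archimedean by blast
      then have "inverse (of_nat (Suc n)) < f x" unfolding inv real(2) by (intro ennreal_lessI \<open>0 < r\<close>)
      then show ?thesis by blast
    next
      case top
      have "inverse (of_nat (Suc 0)) < f x" unfolding inv top by simp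
      then show ?thesis by blast
    qed
    then show "x \<in> (\<Union>n. {x\<in>A. inverse (of_nat (Suc n)) < f x})" using x by (auto simp: B_def)
  qed (auto simp: B_def)
  then have "countable B" using fin by (simp only:) (intro countable_UN, auto intro: countable_finite)
  then have "(\<integral>\<^sup>+x. f x \<partial>count_space B) \<le> K"
    by (rule nn_integral_count_space_le_countable) (auto simp: B_def intro!: le)
  also have "(\<integral>\<^sup>+x. f x \<partial>count_space B) = (\<integral>\<^sup>+x. f x \<partial>count_space A)"
    by (rule nn_integral_count_space_eq) (auto simp: B_def)
  finally show ?thesis .
qed simp

lemma cK1_nonneg: "1 < p \<Longrightarrow> 0 \<le> cK1 p m \<eta>"
  unfolding cK1_def using cform_nonneg creg_nonneg by (intro mult_nonneg_nonneg zero_le_power) auto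

text \<open>The leading 2^n bounds the number of lattices; the rest is the constant of
  \<open>lattice_form\<close> without \<beta>.\<close>

definition cT :: "nat \<Rightarrow> nat \<Rightarrow> real \<Rightarrow> real" where
  "cT n m \<eta> = 2 ^ n * ((4 * 2 ^ n + 6 ^ n) ^ m * (6 ^ n * 6 ^ n) * (1 / \<eta>))"

lemma cT_nonneg: "0 < \<eta> \<Longrightarrow> 0 \<le> cT n m \<eta>"
  by (simp add: cT_def)

section \<open>Summation over the shifted lattices, and both halves of the form\<close>

context
  fixes b :: "real^'n \<Rightarrow> 'k::euclidean_space" and \<nu> :: "real^'n \<Rightarrow> ennreal" and S :: "(real^'n) set set" and E :: "(real^'n) set \<Rightarrow> (real^'n) set" and \<eta> \<beta> :: real and m :: nat
  assumes S: "finite S" "S \<subseteq> cubes"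
    and E: "\<And>Q. Q \<in> S \<Longrightarrow> E Q \<in> sets lebesgue" "\<And>Q. Q \<in> S \<Longrightarrow> E Q \<subseteq> Q"
      "\<And>Q. Q \<in> S \<Longrightarrow> ennreal \<eta> * emeasure lebesgue Q \<le> emeasure lebesgue (E Q)" "disjoint_family_on E S"
    and \<eta>: "0 < \<eta>" "\<eta> \<le> 1"
    and b: "b \<in> borel_measurable lebesgue" and b_int: "\<And>Q. Q \<in> cubes \<Longrightarrow> set_integrable lebesgue Q b"
    and \<beta>: "0 \<le> \<beta>" "\<And>Q. Q \<in> cubes \<Longrightarrow> ave lebesgue Q (\<lambda>x. ennreal (norm (b x - mean Q b))) \<le> ennreal \<beta> * ave lebesgue Q \<nu>"
    and m: "1 \<le> m"
begin

text \<open>A finite S has cubes of bounded size, so one scale K serves all of them, and S is split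
  according to the lattice that receives each cube.\<close>

lemma cubes_form:
  assumes f: "f \<in> borel_measurable lebesgue" and g: "g \<in> borel_measurable lebesgue"
    and r: "1 \<le> r" and t: "1 \<le> t"
    and bound: "\<And>(v::real^'n) F ES. dyadic.sparse_sets (lattice v) (3 / 4 * (\<eta> / 6 ^ CARD('n))) F ES \<Longrightarrow>
      (\<Sum>P\<in>F. rave r lebesgue P (\<lambda>x. f x * local_sum (\<lambda>P. ave lebesgue P \<nu>) F P x ^ m) * rave t lebesgue P g * emeasure lebesgue P) \<le> W"
  shows "(\<Sum>Q\<in>S. rave r lebesgue Q (\<lambda>x. ennreal (norm (b x - mean Q b)) ^ m * f x) * rave t lebesgue Q g * emeasure lebesgue Q)
    \<le> ennreal (cT CARD('n) m \<eta> * \<beta> ^ m) * W"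
proof -
  define c1 :: real where "c1 = ((4 * 2 ^ CARD('n) + 6 ^ CARD('n)) * \<beta>) ^ m * (6 ^ CARD('n) * 6 ^ CARD('n)) * (1 / \<eta>)"
  have c1: "0 \<le> c1" using \<eta> \<beta>(1) by (simp add: c1_def)
  let ?h = "\<lambda>Q. rave r lebesgue Q (\<lambda>x. ennreal (norm (b x - mean Q b)) ^ m * f x) * rave t lebesgue Q g * emeasure lebesgue Q"
  have "\<forall>Q\<in>S. \<exists>ca. Q = cube (fst ca) (snd ca) \<and> 0 < snd ca"
    using S(2) by (auto simp: cubes_def subset_iff)
  then obtain ca where ca: "\<And>Q. Q \<in> S \<Longrightarrow> Q = cube (fst (ca Q)) (snd (ca Q))" "\<And>Q. Q \<in> S \<Longrightarrow> 0 < snd (ca Q)"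
    by metis
  define M where "M = 1 + (\<Sum>Q\<in>S. 6 * snd (ca Q))"
  have "0 \<le> (\<Sum>Q\<in>S. 6 * snd (ca Q))" using ca(2) by (intro sum_nonneg) (auto simp: less_imp_le)
  then have M: "0 < M" by (simp add: M_def)
  define K where "K = \<lceil>log 2 M\<rceil>"
  have MK: "M \<le> 2 powr of_int K"
  proof -
    have "M = 2 powr log 2 M" using M by simp
    also have "\<dots> \<le> 2 powr of_int K" unfolding K_def by (intro powr_mono) auto
    finally show ?thesis .
  qed
  have "6 * snd (ca Q) \<le> 2 powr of_int K" if "Q \<in> S" for Q
  proof -
    have "6 * snd (ca Q) \<le> (\<Sum>Q\<in>S. 6 * snd (ca Q))"
      using that S(1) ca(2) by (intro member_le_sum) (auto simp: less_imp_le)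
    then show ?thesis using MK by (simp add: M_def)
  qed
  then have "\<exists>v\<in>shifts K. \<exists>P\<in>lattice v. Q \<subseteq> P \<and> emeasure lebesgue P \<le> ennreal (6 ^ CARD('n)) * emeasure lebesgue Q" if "Q \<in> S" for Q
    using cube_in_lattice[OF ca(2)[OF that], of K "fst (ca Q)"] that ca(1)[OF that] by simp
  then obtain V PP where VP: "\<And>Q. Q \<in> S \<Longrightarrow> V Q \<in> shifts K" "\<And>Q. Q \<in> S \<Longrightarrow> PP Q \<in> lattice (V Q)" "\<And>Q. Q \<in> S \<Longrightarrow> Q \<subseteq> PP Q"
      "\<And>Q. Q \<in> S \<Longrightarrow> emeasure lebesgue (PP Q) \<le> ennreal (6 ^ CARD('n)) * emeasure lebesgue Q" by metis
  have "(\<Sum>Q\<in>S. ?h Q) = (\<Sum>v\<in>shifts K. \<Sum>Q\<in>{Q\<in>S. V Q = v}. ?h Q)"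
    using S(1) finite_shifts(1) VP(1) by (intro sum.group[symmetric]) auto
  also have "\<dots> \<le> (\<Sum>v\<in>(shifts K :: (real^'n) set). ennreal c1 * W)"
  proof (rule sum_mono)
    fix v :: "real^'n"
    show "(\<Sum>Q\<in>{Q\<in>S. V Q = v}. ?h Q) \<le> ennreal c1 * W"
      unfolding c1_def
    proof (rule lattice_form[where E=E and PP=PP and v=v and \<nu>=\<nu>])
      show "disjoint_family_on E {Q\<in>S. V Q = v}" by (rule disjoint_family_on_mono[OF _ E(4)]) auto
    qed (use S E \<eta> VP b b_int \<beta> f g r t m bound in auto)
  qed
  also have "\<dots> = of_nat (card (shifts K :: (real^'n) set)) * (ennreal c1 * W)" by simp
  also have "\<dots> \<le> of_nat (2 ^ CARD('n)) * (ennreal c1 * W)"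
    by (intro mult_right_mono of_nat_mono finite_shifts(2)) auto
  also have "\<dots> = ennreal (2 ^ CARD('n) * c1) * W"
    using c1 by (simp add: ennreal_mult mult.assoc ennreal_power[symmetric])
  also have "2 ^ CARD('n) * c1 = cT CARD('n) m \<eta> * \<beta> ^ m"
    by (simp add: cT_def c1_def power_mult_distrib)
  finally show ?thesis .
qed

lemma cubes_form_bloom:
  assumes \<nu>: "\<nu> = bloom p m \<mu> lam" and p: "1 < p" and A: "cube_Ap p \<mu> A" and B: "cube_Ap p lam B"
    and f: "f \<in> borel_measurable lebesgue" and g: "g \<in> borel_measurable lebesgue"
    and f_bdd: "\<And>x. f x \<le> c" "c < top" and fin_f: "wnorm p \<mu> f < top"
    and s: "1 < s" "2 ^ m * (cR (2 ^ CARD('n)) p * max A B powr (1 / (p - 1))) \<le> s"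
    and t: "1 < t" "cR (2 ^ CARD('n)) (p / (p - 1)) * B \<le> t"
  defines "\<eta>' \<equiv> 3 / 4 * (\<eta> / 6 ^ CARD('n))" and "W \<equiv> wnorm p \<mu> f * wnorm (p / (p - 1)) (dual_weight p lam) g"
    and "L \<equiv> (\<Sum>Q\<in>S. rave (s / (s - 1)) lebesgue Q (\<lambda>x. ennreal (norm (b x - mean Q b)) ^ m * f x) * rave (t / (t - 1)) lebesgue Q g * emeasure lebesgue Q)"
  shows "L \<le> ennreal (cT CARD('n) m \<eta> * \<beta> ^ m) * (ennreal (cK1 p m \<eta>' * (A * B) powr ((real m + 1) / 2 * Ap_exp p)) * W)"
    and "2 \<le> m \<Longrightarrow> L \<le> ennreal (cT CARD('n) m \<eta> * \<beta> ^ m) * (ennreal (cK2 p m \<eta>' * (A powr (real m / (p - 1)) * B powr Ap_exp p)) * W)"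
proof -
  have st: "1 \<le> s / (s - 1)" "1 \<le> t / (t - 1)" using s(1) t(1) by auto
  note A' = cube_Ap_lattice[OF A] and B' = cube_Ap_lattice[OF B]
  show "L \<le> ennreal (cT CARD('n) m \<eta> * \<beta> ^ m) * (ennreal (cK1 p m \<eta>' * (A * B) powr ((real m + 1) / 2 * Ap_exp p)) * W)"
    unfolding L_def W_def \<eta>'_def
    by (rule cubes_form[OF f g st], unfold \<nu>, rule dyadic.form_iterate[OF dyadic_lattice p m A' B' _ f g f_bdd s(2) t(2) fin_f])
  show "L \<le> ennreal (cT CARD('n) m \<eta> * \<beta> ^ m) * (ennreal (cK2 p m \<eta>' * (A powr (real m / (p - 1)) * B powr Ap_exp p)) * W)" if "2 \<le> m"
    unfolding L_def W_def \<eta>'_def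
    by (rule cubes_form[OF f g st], unfold \<nu>, rule dyadic.form_maximal[OF dyadic_lattice p m A' B' _ f g f_bdd s(2) t(2) that])
qed

end

text \<open>The exponents match because (p - 1) p' = p for p' = p / (p - 1). Hence the hypothesis on
  the oscillation of b is literally the same for the dual problem.\<close>

lemma bloom_dual:
  assumes p: "1 < p" and m: "1 \<le> m"
  shows "bloom (p / (p - 1)) m (dual_weight p lam) (dual_weight p \<mu>) = bloom p m \<mu> lam"
proof -
  have e: "- (1 / (p - 1)) * (1 / (p / (p - 1) * m)) = - (1 / (p * m))"
       "- (1 / (p - 1)) * - (1 / (p / (p - 1) * m)) = 1 / (p * m)" using p m by (auto simp: field_simps)
  show ?thesis unfolding bloom_def dual_weight_def epowr_epowr e by (simp add: mult.commute)
qed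

lemma Ap_exp_dual: "1 < p \<Longrightarrow> 1 / (p - 1) * Ap_exp (p / (p - 1)) = Ap_exp p"
proof -
  assume p: "1 < p"
  have "p / (p - 1) - 1 = 1 / (p - 1)" using p by (simp add: field_simps)
  then have "1 / (p / (p - 1) - 1) = p - 1" by simp
  then show ?thesis unfolding Ap_exp_def using p by (auto simp: max_def field_simps)
qed

lemma cK2_nonneg: "1 < p \<Longrightarrow> 0 < \<eta> \<Longrightarrow> 0 \<le> cK2 p m \<eta>"
proof -
  assume p: "1 < p" and \<eta>: "0 < \<eta>"
  have "0 \<le> cpow p m (qp p) \<eta>" using \<eta> by (simp add: cpow_def Let_def)
  then show ?thesis unfolding cK2_def using p cform_nonneg[OF p] creg_nonneg by (intro mult_nonneg_nonneg) auto
qed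

text \<open>Duality also exchanges s and t. The dual constants are A and B to the power 1/(p-1), and
  the dual threshold raises their maximum to the power p - 1 (\<open>maxp\<close>); this is why t is
  compared with max A B and s with its power 1/(p-1).\<close>

lemma cubes_full_form:
  fixes b :: "real^'n \<Rightarrow> 'k::euclidean_space" and \<mu> lam f g :: "real^'n \<Rightarrow> ennreal"
  assumes S: "finite S" "S \<subseteq> cubes"
    and E: "\<And>Q. Q \<in> S \<Longrightarrow> E Q \<in> sets lebesgue" "\<And>Q. Q \<in> S \<Longrightarrow> E Q \<subseteq> Q"
      "\<And>Q. Q \<in> S \<Longrightarrow> ennreal \<eta> * emeasure lebesgue Q \<le> emeasure lebesgue (E Q)" "disjoint_family_on E S"
    and \<eta>: "0 < \<eta>" "\<eta> \<le> 1"
    and b: "b \<in> borel_measurable lebesgue" and b_int: "\<And>Q. Q \<in> cubes \<Longrightarrow> set_integrable lebesgue Q b"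
    and \<beta>: "0 \<le> \<beta>" "\<And>Q. Q \<in> cubes \<Longrightarrow> ave lebesgue Q (\<lambda>x. ennreal (norm (b x - mean Q b))) \<le> ennreal \<beta> * ave lebesgue Q (bloom p m \<mu> lam)"
    and p: "1 < p" and m: "1 \<le> m" and A: "cube_Ap p \<mu> A" and B: "cube_Ap p lam B"
    and f: "f \<in> borel_measurable lebesgue" and g: "g \<in> borel_measurable lebesgue"
    and bdd: "\<And>x. f x \<le> c" "\<And>x. g x \<le> c" "c < top"
    and fin: "wnorm p \<mu> f < top" "wnorm (p / (p - 1)) (dual_weight p lam) g < top"
    and s: "1 < s" "2 ^ m * (cR (2 ^ CARD('n)) p * max A B powr (1 / (p - 1))) \<le> s"
    and t: "1 < t" "2 ^ m * (cR (2 ^ CARD('n)) (p / (p - 1)) * max A B) \<le> t"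
  defines "\<eta>' \<equiv> 3 / 4 * (\<eta> / 6 ^ CARD('n))" and "W \<equiv> wnorm p \<mu> f * wnorm (p / (p - 1)) (dual_weight p lam) g"
    and "L \<equiv> (\<Sum>Q\<in>S. (rave (s / (s - 1)) lebesgue Q (\<lambda>x. ennreal (norm (b x - mean Q b)) ^ m * f x) * rave (t / (t - 1)) lebesgue Q g
       + rave (s / (s - 1)) lebesgue Q f * rave (t / (t - 1)) lebesgue Q (\<lambda>x. ennreal (norm (b x - mean Q b)) ^ m * g x)) * emeasure lebesgue Q)"
    and "p' \<equiv> p / (p - 1)"
  shows "L \<le> ennreal (cT CARD('n) m \<eta> * (cK1 p m \<eta>' + cK1 p' m \<eta>') * (A * B) powr ((real m + 1) / 2 * Ap_exp p) * \<beta> ^ m) * W"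
    and "2 \<le> m \<Longrightarrow> L \<le> ennreal (cT CARD('n) m \<eta> * (cK2 p m \<eta>' + cK2 p' m \<eta>') * (A powr (real m / (p - 1)) * B powr Ap_exp p + A powr Ap_exp p * B ^ m) * \<beta> ^ m) * W"
proof -
  have AB: "1 \<le> A" "1 \<le> B" using A B by (auto simp: cube_Ap_def)
  have p': "1 < p'" "p' - 1 = 1 / (p - 1)" "p' / (p' - 1) = p" using p by (auto simp: p'_def field_simps)
  have \<eta>': "0 < \<eta>'" using \<eta> by (simp add: \<eta>'_def)
  let ?d = "2 ^ CARD('n) :: real"
  have cR0: "0 \<le> cR ?d p" "0 \<le> cR ?d p'" using qp[OF p] qp[OF p'(1)] by (auto simp: cR_def)
  define lam' where "lam' = dual_weight p lam"
  define \<mu>' where "\<mu>' = dual_weight p \<mu>"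
  define A' where "A' = A powr (1 / (p - 1))"
  define B' where "B' = B powr (1 / (p - 1))"
  have \<mu>A': "cube_Ap p' \<mu>' A'" and lB': "cube_Ap p' lam' B'"
    unfolding p'_def A'_def B'_def \<mu>'_def lam'_def by (rule cube_Ap_dual[OF A p], rule cube_Ap_dual[OF B p])
  have le2m: "X \<le> 2 ^ m * X" if "0 \<le> X" for X :: real
    using mult_right_mono[of 1 "2 ^ m" X] that by simp
  have t1: "cR ?d p' * B \<le> t"
  proof -
    have "cR ?d p' * B \<le> cR ?d p' * max A B" using cR0 by (intro mult_left_mono) auto
    also have "\<dots> \<le> t" using le2m[of "cR ?d p' * max A B"] cR0 AB t(2) by (simp add: p'_def)
    finally show ?thesis .
  qed
  have s1: "cR ?d p * A' \<le> s"
  proof -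
    have "A' \<le> max A B powr (1 / (p - 1))" unfolding A'_def using AB p by (intro powr_mono2) auto
    then have "cR ?d p * A' \<le> cR ?d p * max A B powr (1 / (p - 1))" using cR0 by (intro mult_left_mono) auto
    also have "\<dots> \<le> s" using le2m[of "cR ?d p * max A B powr (1 / (p - 1))"] cR0 AB s(2) by simp
    finally show ?thesis .
  qed
  have maxp: "max B' A' powr (1 / (p' - 1)) = max A B"
  proof -
    have "max B' A' = max A B powr (1 / (p - 1))"
    proof (cases "A \<le> B")
      case True
      then have "A' \<le> B'" unfolding A'_def B'_def using AB p by (intro powr_mono2) auto
      then show ?thesis using True by (simp add: B'_def)
    next
      case False
      then have "B' \<le> A'" unfolding A'_def B'_def using AB p by (intro powr_mono2) auto
      then show ?thesis using False by (simp add: A'_def)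
    qed
    then show ?thesis using AB p by (simp add: p'(2) powr_powr)
  qed
  have pw1: "(B' * A') powr ((real m + 1) / 2 * Ap_exp p') = (A * B) powr ((real m + 1) / 2 * Ap_exp p)"
  proof -
    have "B' * A' = (A * B) powr (1 / (p - 1))" using AB by (simp add: A'_def B'_def powr_mult mult.commute)
    moreover have "1 / (p - 1) * ((real m + 1) / 2 * Ap_exp p') = (real m + 1) / 2 * Ap_exp p"
      using Ap_exp_dual[OF p] unfolding p'_def by (metis mult.left_commute)
    ultimately show ?thesis by (simp only: powr_powr)
  qed
  have pw2: "B' powr (real m / (p' - 1)) * A' powr Ap_exp p' = A powr Ap_exp p * B ^ m"
  proof -
    have "A' powr Ap_exp p' = A powr Ap_exp p" unfolding A'_def powr_powr using Ap_exp_dual[OF p] by (simp add: p'_def)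
    moreover have "B' powr (real m / (p' - 1)) = B ^ m" using AB p by (simp add: B'_def p'(2) powr_powr powr_realpow)
    ultimately show ?thesis by simp
  qed
  define L1 where "L1 = (\<Sum>Q\<in>S. rave (s / (s - 1)) lebesgue Q (\<lambda>x. ennreal (norm (b x - mean Q b)) ^ m * f x) * rave (t / (t - 1)) lebesgue Q g * emeasure lebesgue Q)"
  define L2 where "L2 = (\<Sum>Q\<in>S. rave (t / (t - 1)) lebesgue Q (\<lambda>x. ennreal (norm (b x - mean Q b)) ^ m * g x) * rave (s / (s - 1)) lebesgue Q f * emeasure lebesgue Q)"
  have L: "L = L1 + L2"
    unfolding L_def L1_def L2_def sum.distrib[symmetric] by (intro sum.cong refl) (simp only: distrib_right mult.commute[of "rave (s / (s - 1)) lebesgue _ f"])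
  have t2: "2 ^ m * (cR (2 ^ CARD('n)) p' * max B' A' powr (1 / (p' - 1))) \<le> t" unfolding maxp using t(2) by (simp add: p'_def)
  have s2: "cR (2 ^ CARD('n)) (p' / (p' - 1)) * A' \<le> s" unfolding p'(3) by (rule s1)
  have dd: "dual_weight p' \<mu>' = \<mu>" unfolding p'_def \<mu>'_def by (rule dual_dual_weight[OF p])
  have bd: "bloom p' m lam' \<mu>' = bloom p m \<mu> lam" unfolding p'_def \<mu>'_def lam'_def by (rule bloom_dual[OF p m])
  have W': "W = wnorm p' lam' g * wnorm p \<mu> f" by (simp add: W_def p'_def lam'_def mult.commute)
  let ?T = "cT CARD('n) m \<eta> * \<beta> ^ m"
  have T0: "0 \<le> ?T" using cT_nonneg[OF \<eta>(1)] \<beta>(1) by simp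
  note form1 = cubes_form_bloom[OF S E \<eta> b b_int \<beta> m refl p A B f g bdd(1,3) fin(1) s t(1) t1[unfolded p'_def], folded \<eta>'_def W_def L1_def]
  note form2 = cubes_form_bloom[OF S E \<eta> b b_int \<beta> m bd[symmetric] p'(1) lB' \<mu>A' g f bdd(2,3) fin(2)[folded p'_def lam'_def] t(1) t2 s(1) s2,
      folded \<eta>'_def L2_def, unfolded p'(3) dd pw1 pw2, folded W']
  have comb: "ennreal ?T * (ennreal (k1 * x1) * W) + ennreal ?T * (ennreal (k2 * x2) * W) \<le> ennreal (cT CARD('n) m \<eta> * (k1 + k2) * y * \<beta> ^ m) * W"
    if "0 \<le> k1" "0 \<le> k2" "0 \<le> x1" "0 \<le> x2" "x1 \<le> y" "x2 \<le> y" for k1 k2 x1 x2 y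
  proof -
    have "ennreal ?T * (ennreal (k1 * x1) * W) + ennreal ?T * (ennreal (k2 * x2) * W)
        = ennreal ?T * (ennreal (k1 * x1) + ennreal (k2 * x2)) * W" by (simp only: distrib_left distrib_right mult.assoc)
    also have "ennreal (k1 * x1) + ennreal (k2 * x2) = ennreal (k1 * x1 + k2 * x2)" using that by simp
    also have "ennreal ?T * \<dots> = ennreal (?T * (k1 * x1 + k2 * x2))" using T0 that by (intro ennreal_mult[symmetric]) auto
    also have "\<dots> \<le> ennreal (?T * (k1 * y + k2 * y))"
      using T0 that by (intro ennreal_leI mult_left_mono add_mono) auto
    also have "?T * (k1 * y + k2 * y) = cT CARD('n) m \<eta> * (k1 + k2) * y * \<beta> ^ m" by (simp add: algebra_simps)
    finally show ?thesis by (simp add: mult_right_mono)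
  qed
  have k: "0 \<le> cK1 p m \<eta>'" "0 \<le> cK1 p' m \<eta>'" "0 \<le> cK2 p m \<eta>'" "0 \<le> cK2 p' m \<eta>'"
    using cK1_nonneg cK2_nonneg p p'(1) \<eta>' by auto
  show "L \<le> ennreal (cT CARD('n) m \<eta> * (cK1 p m \<eta>' + cK1 p' m \<eta>') * (A * B) powr ((real m + 1) / 2 * Ap_exp p) * \<beta> ^ m) * W"
    unfolding L by (rule order_trans[OF add_mono[OF form1(1) form2(1)] comb]) (use k in auto)
  show "L \<le> ennreal (cT CARD('n) m \<eta> * (cK2 p m \<eta>' + cK2 p' m \<eta>') * (A powr (real m / (p - 1)) * B powr Ap_exp p + A powr Ap_exp p * B ^ m) * \<beta> ^ m) * W" if "2 \<le> m"
    unfolding L by (rule order_trans[OF add_mono[OF form1(2)[OF _ _ _ _ _ that] form2(2)[OF _ _ _ _ _ that]] comb]) (use k AB in auto)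
qed

section \<open>Weights, mean oscillation and the commutator\<close>

lemma locally_integrable_measurable:
  fixes f :: "real^'n \<Rightarrow> 'k::euclidean_space"
  assumes "locally_integrable f" shows "f \<in> borel_measurable lebesgue"
proof (rule borel_measurable_LIMSEQ_metric)
  fix i :: nat
  show "(\<lambda>x. indicator (cball 0 (real i)) x *\<^sub>R f x) \<in> borel_measurable lebesgue"
    using assms unfolding locally_integrable_def set_integrable_def by (auto intro: borel_measurable_integrable)
next
  fix x :: "real^'n"
  have "\<forall>\<^sub>F i in sequentially. indicator (cball 0 (real i)) x *\<^sub>R f x = f x"
    unfolding eventually_sequentially
  proof (intro exI allI impI)
    fix i assume "nat \<lceil>norm x\<rceil> \<le> i"
    then have "norm x \<le> real i" by linarith
    then show "indicator (cball 0 (real i)) x *\<^sub>R f x = f x" by simp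
  qed
  then show "(\<lambda>i. indicator (cball 0 (real i)) x *\<^sub>R f x) \<longlonglongrightarrow> f x" by (rule tendsto_eventually)
qed

lemma locally_integrable_cubes: "locally_integrable f \<Longrightarrow> Q \<in> cubes \<Longrightarrow> set_integrable lebesgue Q f"
  by (auto simp: locally_integrable_def cubes_def cube_def)

lemma cube_in_cubes: "0 < a \<Longrightarrow> cube c a \<in> cubes"
  unfolding cubes_def by blast

lemma avg_rave: "(\<And>x. 0 \<le> h x) \<Longrightarrow> avg r Q h = rave r lebesgue Q (\<lambda>x. ennreal (h x))"
  by (simp add: avg_def rave_def ave_def epowr_ennreal)

lemma cube_subset_cell:
  fixes Q :: "(real^'n) set"
  assumes "Q \<in> cubes"
  obtains v P where "P \<in> lattice v" "Q \<subseteq> P"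
proof -
  obtain c a where Q: "Q = cube c a" "0 < a" using assms by (auto simp: cubes_def)
  have "6 * a = 2 powr log 2 (6 * a)" using Q by simp
  also have "\<dots> \<le> 2 powr of_int \<lceil>log 2 (6 * a)\<rceil>" by (intro powr_mono) auto
  finally show ?thesis using cube_in_lattice[OF Q(2), of "\<lceil>log 2 (6 * a)\<rceil>" c] that unfolding Q(1) by blast
qed

lemma cube_Ap_finite:
  assumes p: "1 < p" and A: "cube_Ap p w A" and Q: "Q \<in> cubes"
  shows "(\<integral>\<^sup>+x\<in>Q. w x \<partial>lebesgue) < top"
proof -
  obtain v P where P: "P \<in> lattice v" "Q \<subseteq> P" using cube_subset_cell[OF Q] .
  interpret L: dyadic "lattice v" "2 ^ CARD('a)" by (rule dyadic_lattice)
  interpret P: finite_pos_set lebesgue P by (rule L.D_pos[OF P(1)])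
  have "(\<integral>\<^sup>+x\<in>Q. w x \<partial>lebesgue) \<le> (\<integral>\<^sup>+x\<in>P. w x \<partial>lebesgue)"
    using P(2) by (intro nn_integral_mono) (auto split: split_indicator)
  also have "\<dots> = ave lebesgue P w * emeasure lebesgue P" by (rule P.ave_mult_emeasure[symmetric])
  also have "\<dots> < top" using L.Apd_ave(1)[OF cube_Ap_lattice[OF A] p P(1)] P.fin by (simp add: ennreal_mult_less_top)
  finally show ?thesis .
qed

lemma cube_Ap_wnorm_finite:
  assumes p: "1 < p" and A: "cube_Ap p w A" and Q: "Q \<in> cubes" and q: "0 < q"
    and h: "\<And>x. h x \<le> c" "c < top" "\<And>x. x \<notin> Q \<Longrightarrow> h x = 0"
  shows "wnorm q w h < top"
proof -
  have [measurable]: "Q \<in> sets lebesgue" "w \<in> borel_measurable lebesgue"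
    using finite_pos_set.sets_P[OF cubes_pos[OF Q]] A by (auto simp: cube_Ap_def)
  have "(\<integral>\<^sup>+x. epowr (h x) q * w x \<partial>lebesgue) \<le> (\<integral>\<^sup>+x. epowr c q * (w x * indicator Q x) \<partial>lebesgue)"
  proof (rule nn_integral_mono)
    fix x
    show "epowr (h x) q * w x \<le> epowr c q * (w x * indicator Q x)"
      using epowr_mono[OF h(1)[of x], of q] q h(3)[of x] by (cases "x \<in> Q") (auto intro: mult_right_mono)
  qed
  also have "\<dots> = epowr c q * (\<integral>\<^sup>+x\<in>Q. w x \<partial>lebesgue)" by (rule nn_integral_cmult) measurable
  also have "\<dots> < top" using h(2) cube_Ap_finite[OF p A Q] by (simp add: ennreal_mult_less_top)
  finally show ?thesis by (simp add: wnorm_def)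
qed

text \<open>
  A weight may vanish on a null set.  The value 1 there makes every power, negative ones
  included, positive and finite.
\<close>

definition enn_weight :: "('a \<Rightarrow> real) \<Rightarrow> 'a \<Rightarrow> ennreal" where
  "enn_weight w x = (if 0 < w x then ennreal (w x) else 1)"

lemma pos_weight_enn_weight: "w \<in> borel_measurable lebesgue \<Longrightarrow> pos_weight (enn_weight w)"
  unfolding pos_weight_def enn_weight_def by (auto intro!: measurable_If)

lemma weight_measurable: "weight w \<Longrightarrow> w \<in> borel_measurable lebesgue"
  by (simp add: weight_def locally_integrable_measurable)

lemma avg_enn_weight:
  assumes w: "weight w" and p: "1 < p"
  shows "avg 1 Q w = ave lebesgue Q (enn_weight w)"
    "avg (1 / (p - 1)) Q (\<lambda>x. inverse (w x)) = epowr (ave lebesgue Q (dual_weight p (enn_weight w))) (p - 1)"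
proof -
  have pos: "AE x in lebesgue. 0 < w x" and nn: "\<And>x. 0 \<le> w x" using w by (auto simp: weight_def)
  show "avg 1 Q w = ave lebesgue Q (enn_weight w)"
    unfolding avg_rave[OF nn] rave_1 ave_def using pos
    by (intro arg_cong2[where f="(/)"] nn_integral_cong_AE refl) (auto simp: enn_weight_def elim!: eventually_mono)
  have "(\<integral>\<^sup>+x\<in>Q. ennreal (inverse (w x) powr (1 / (p - 1))) \<partial>lebesgue) = (\<integral>\<^sup>+x\<in>Q. dual_weight p (enn_weight w) x \<partial>lebesgue)"
  proof (intro nn_integral_cong_AE eventually_mono[OF pos])
    fix x assume "0 < w x"
    then show "ennreal (inverse (w x) powr (1 / (p - 1))) * indicator Q x = dual_weight p (enn_weight w) x * indicator Q x"
      by (simp add: dual_weight_def enn_weight_def epowr_ennreal powr_minus inverse_powr)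
  qed
  then show "avg (1 / (p - 1)) Q (\<lambda>x. inverse (w x)) = epowr (ave lebesgue Q (dual_weight p (enn_weight w))) (p - 1)"
    by (simp add: avg_def ave_def)
qed

text \<open>Hoelder for 1 = w^(1/p) \<sigma>^(1-1/p), with \<sigma> the dual weight.\<close>

lemma one_le_Ap_product:
  assumes w: "pos_weight w" and p: "1 < p" and Q: "finite_pos_set lebesgue Q"
  shows "1 \<le> ave lebesgue Q w * epowr (ave lebesgue Q (dual_weight p w)) (p - 1)"
proof -
  interpret finite_pos_set lebesgue Q by (rule Q)
  have [measurable]: "w \<in> borel_measurable lebesgue" "dual_weight p w \<in> borel_measurable lebesgue"
    using w pos_weight_dual[OF w] by measurable
  have e: "- (1 / (p - 1)) * (1 - 1 / p) = - (1 / p)" "1 / p + - (1 / p) = 0" using p by (auto simp: field_simps)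
  have "epowr (w x) (1 / p) * epowr (dual_weight p w x) (1 - 1 / p) = 1" for x
    unfolding dual_weight_def epowr_epowr e(1) pos_weight_epowr_add[OF w] e(2) by (rule pos_weight_epowr_0[OF w])
  then have "1 \<le> epowr (ave lebesgue Q w) (1 / p) * epowr (ave lebesgue Q (dual_weight p w)) (1 - 1 / p)"
    using ave_Holder[of w "dual_weight p w" "1 / p"] p ave_const[of 1] by simp
  then have "epowr 1 p \<le> epowr (epowr (ave lebesgue Q w) (1 / p) * epowr (ave lebesgue Q (dual_weight p w)) (1 - 1 / p)) p"
    using p by (intro epowr_mono) auto
  moreover have "(1 - 1 / p) * p = p - 1" "1 / p * p = 1" using p by (auto simp: field_simps)
  ultimately show ?thesis unfolding epowr_mult epowr_epowr by simp
qed

text \<open>The characteristic itself serves as the bound: it is finite by membership and at least 1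
  because the product over a single cube is.\<close>

lemma Ap_cube_Ap:
  assumes w: "w \<in> Ap p" and p: "1 < p"
  shows "cube_Ap p (enn_weight w) (enn2real (Ap_char p w))" "1 \<le> enn2real (Ap_char p w)"
proof -
  have wt: "weight w" and fin: "Ap_char p w < top" using w by (auto simp: Ap_def)
  have pw: "pos_weight (enn_weight w)" by (rule pos_weight_enn_weight[OF weight_measurable[OF wt]])
  have A: "Ap_char p w = ennreal (enn2real (Ap_char p w))" using fin by simp
  have le: "ave lebesgue Q (enn_weight w) * epowr (ave lebesgue Q (dual_weight p (enn_weight w))) (p - 1) \<le> Ap_char p w" if "Q \<in> cubes" for Q
    unfolding avg_enn_weight[OF wt p, symmetric] Ap_char_def by (rule SUP_upper[OF that])
  have "cube 0 1 \<in> (cubes :: (real^'a) set set)" by (rule cube_in_cubes) simp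
  then have "1 \<le> Ap_char p w" using le one_le_Ap_product[OF pw p cubes_pos] order_trans by blast
  then show ge: "1 \<le> enn2real (Ap_char p w)" using A by (metis ennreal_ge_1)
  show "cube_Ap p (enn_weight w) (enn2real (Ap_char p w))"
    unfolding cube_Ap_def using pw ge le A by auto
qed

lemma weighted_norm_wnorm:
  assumes "weight w" "0 < p"
  shows "weighted_norm p w f = wnorm p (enn_weight w) (\<lambda>x. ennreal (norm (f x)))"
proof -
  have "(\<integral>\<^sup>+x. ennreal (norm (f x) powr p * w x) \<partial>lebesgue) = (\<integral>\<^sup>+x. epowr (ennreal (norm (f x))) p * enn_weight w x \<partial>lebesgue)"
  proof (rule nn_integral_cong_AE)
    have "AE x in lebesgue. 0 < w x" using assms by (simp add: weight_def)
    then show "AE x in lebesgue. ennreal (norm (f x) powr p * w x) = epowr (ennreal (norm (f x))) p * enn_weight w x"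
      by (rule eventually_mono) (simp add: enn_weight_def epowr_ennreal ennreal_mult)
  qed
  then show ?thesis by (simp add: weighted_norm_def wnorm_def)
qed

lemma bloom_enn_weight:
  assumes "weight \<mu>" "weight lam"
  shows "AE x in lebesgue. ennreal ((\<mu> x / lam x) powr (1 / (p * real m))) = bloom p m (enn_weight \<mu>) (enn_weight lam) x"
proof -
  have "AE x in lebesgue. 0 < \<mu> x \<and> 0 < lam x" using assms by (auto simp: weight_def)
  then show ?thesis
  proof (rule eventually_mono)
    fix x assume "0 < \<mu> x \<and> 0 < lam x"
    then show "ennreal ((\<mu> x / lam x) powr (1 / (p * real m))) = bloom p m (enn_weight \<mu>) (enn_weight lam) x"
      by (simp add: bloom_def enn_weight_def epowr_ennreal powr_divide powr_minus_divide flip: ennreal_mult)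
  qed
qed

text \<open>Clearing the denominator in the norm needs a finite \<nu>-measure of Q. This comes from
  a lattice cell containing Q, on which \<open>ave_bloom_fin\<close> applies.\<close>

lemma bmo_ave:
  assumes p: "1 < p" and m: "1 \<le> m" and \<mu>: "\<mu> \<in> Ap p" and lam: "lam \<in> Ap p"
    and \<beta>: "bmo_norm (\<lambda>x. (\<mu> x / lam x) powr (1 / (p * real m))) b = ennreal \<beta>" and Q: "Q \<in> cubes"
  shows "ave lebesgue Q (\<lambda>x. ennreal (norm (b x - mean Q b))) \<le> ennreal \<beta> * ave lebesgue Q (bloom p m (enn_weight \<mu>) (enn_weight lam))"
proof -
  let ?\<nu> = "bloom p m (enn_weight \<mu>) (enn_weight lam)"
  have w: "weight \<mu>" "weight lam" using \<mu> lam by (auto simp: Ap_def)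
  note A = Ap_cube_Ap(1)[OF \<mu> p] and B = Ap_cube_Ap(1)[OF lam p]
  obtain v P where P: "P \<in> lattice v" "Q \<subseteq> P" using cube_subset_cell[OF Q] .
  interpret L: dyadic "lattice v" "2 ^ CARD('a)" by (rule dyadic_lattice)
  interpret P: finite_pos_set lebesgue P by (rule L.D_pos[OF P(1)])
  have "(\<integral>\<^sup>+x\<in>Q. ?\<nu> x \<partial>lebesgue) \<le> (\<integral>\<^sup>+x\<in>P. ?\<nu> x \<partial>lebesgue)"
    using P(2) by (intro nn_integral_mono) (auto split: split_indicator)
  also have "\<dots> = ave lebesgue P ?\<nu> * emeasure lebesgue P" by (rule P.ave_mult_emeasure[symmetric])
  also have "\<dots> < top"
    using L.ave_bloom_fin[OF p m cube_Ap_lattice[OF A] cube_Ap_lattice[OF B] P(1)] P.fin by (simp add: ennreal_mult_less_top)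
  finally have fin: "(\<integral>\<^sup>+x\<in>Q. ?\<nu> x \<partial>lebesgue) < top" .
  have e: "(\<integral>\<^sup>+x\<in>Q. ennreal ((\<mu> x / lam x) powr (1 / (p * real m))) \<partial>lebesgue) = (\<integral>\<^sup>+x\<in>Q. ?\<nu> x \<partial>lebesgue)"
    using bloom_enn_weight[OF w, of p m] by (intro nn_integral_cong_AE) auto
  have le: "(\<integral>\<^sup>+x\<in>Q. ennreal (norm (b x - mean Q b)) \<partial>lebesgue) / (\<integral>\<^sup>+x\<in>Q. ?\<nu> x \<partial>lebesgue) \<le> ennreal \<beta>"
    unfolding \<beta>[symmetric] bmo_norm_def e[symmetric] by (rule SUP_upper[OF Q])
  \<comment> \<open>A quotient x / 0 is infinite unless x = 0, so a vanishing denominator does no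
    harm.\<close>
  have div: "x \<le> ennreal \<beta> * y" if "x / y \<le> ennreal \<beta>" "y < top" for x y
  proof (cases "y = 0")
    case True
    then show ?thesis using that(1) by (cases "x = 0") (auto simp: ennreal_divide_zero top_unique)
  next
    case False
    then have "x / y * y = x" using that(2) by (simp add: ennreal_divide_times ennreal_times_divide ennreal_mult_divide_eq flip: mult_divide_eq_ennreal)
    then show ?thesis using mult_right_mono[OF that(1), of y] by simp
  qed
  have "(\<integral>\<^sup>+x\<in>Q. ennreal (norm (b x - mean Q b)) \<partial>lebesgue) / emeasure lebesgue Q \<le> ennreal \<beta> * (\<integral>\<^sup>+x\<in>Q. ?\<nu> x \<partial>lebesgue) / emeasure lebesgue Q"
    by (intro divide_right_mono_ennreal div[OF le fin])
  then show ?thesis unfolding ave_def by (simp add: ennreal_times_divide)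
qed

lemma bounded_compact_supportE:
  fixes f :: "real^'n \<Rightarrow> 'k::euclidean_space"
  assumes "bounded_compact_support f"
  obtains Q c where "Q \<in> cubes" "\<And>x. x \<notin> Q \<Longrightarrow> f x = 0" "\<And>x. ennreal (norm (f x)) \<le> ennreal c"
proof -
  obtain c where c: "\<And>x. norm (f x) \<le> c" using assms by (auto simp: bounded_compact_support_def bounded_iff)
  have "bounded (closure {x. f x \<noteq> 0})" using assms by (auto simp: bounded_compact_support_def compact_imp_bounded)
  then obtain R :: real where R0: "0 < R" and R: "\<forall>x\<in>closure {x. f x \<noteq> 0}. norm x \<le> R" unfolding bounded_pos by blast
  have "cube 0 (2 * R) \<in> (cubes :: (real^'n) set set)" using R0 by (intro cube_in_cubes) simp
  moreover have "f x = 0" if "x \<notin> cube 0 (2 * R)" for x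
  proof (rule ccontr)
    assume "f x \<noteq> 0"
    then have "x \<in> closure {x. f x \<noteq> 0}" using closure_subset by fast
    then have x: "norm x \<le> R" using R by blast
    have "- R \<le> x $ i \<and> x $ i \<le> R" for i using component_le_norm_cart[of x i] x by linarith
    then have "x \<in> cube 0 (2 * R)" by (simp add: cube_def mem_box_cart)
    then show False using that by simp
  qed
  moreover have "ennreal (norm (f x)) \<le> ennreal c" for x by (intro ennreal_leI c)
  ultimately show ?thesis using that by blast
qed

section \<open>The sparse form for the original weights, and duality for the commutator\<close>

definition comm_const :: "nat \<Rightarrow> real \<Rightarrow> nat \<Rightarrow> real" where
  "comm_const n p m = (let \<eta> = 1 / (2 * 3 ^ n); \<eta>' = 3 / 4 * (\<eta> / 6 ^ n); p' = p / (p - 1) in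
     cT n m \<eta> * (cK1 p m \<eta>' + cK1 p' m \<eta>' + cK2 p m \<eta>' + cK2 p' m \<eta>'))"

text \<open>\<eta> is the sparseness in the domination principle, and \<eta>' the sparseness left
  after passing to cells and to the stopping family. One constant is made to cover both forms of
  K_p.\<close>

lemma comm_const_bounds:
  fixes n m :: nat and p :: real
  assumes p: "1 < p"
  defines "\<eta> \<equiv> 1 / (2 * 3 ^ n)" and "\<eta>' \<equiv> 3 / 4 * (1 / (2 * 3 ^ n) / 6 ^ n)" and "p' \<equiv> p / (p - 1)"
  shows "0 \<le> comm_const n p m" "cT n m \<eta> * (cK1 p m \<eta>' + cK1 p' m \<eta>') \<le> comm_const n p m" "cT n m \<eta> * (cK2 p m \<eta>' + cK2 p' m \<eta>') \<le> comm_const n p m"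
proof -
  have p': "1 < p'" using p by (simp add: p'_def)
  have \<eta>: "0 < \<eta>" "0 < \<eta>'" by (simp_all add: \<eta>_def \<eta>'_def)
  have k: "0 \<le> cK1 p m \<eta>'" "0 \<le> cK1 p' m \<eta>'" "0 \<le> cK2 p m \<eta>'" "0 \<le> cK2 p' m \<eta>'" "0 \<le> cT n m \<eta>"
    using cK1_nonneg cK2_nonneg p p' \<eta> cT_nonneg by auto
  have e: "comm_const n p m = cT n m \<eta> * (cK1 p m \<eta>' + cK1 p' m \<eta>' + cK2 p m \<eta>' + cK2 p' m \<eta>')"
    by (simp only: comm_const_def Let_def \<eta>_def \<eta>'_def p'_def)
  show "0 \<le> comm_const n p m" unfolding e using k by (intro mult_nonneg_nonneg add_nonneg_nonneg)
  show "cT n m \<eta> * (cK1 p m \<eta>' + cK1 p' m \<eta>') \<le> comm_const n p m" "cT n m \<eta> * (cK2 p m \<eta>' + cK2 p' m \<eta>') \<le> comm_const n p m"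
    unfolding e using k by (intro mult_left_mono; linarith)+
qed

text \<open>\<open>cubes_full_form\<close> on finite subfamilies, with a bound that does not depend
  on them. The norms it requires to be finite are so because f and g are bounded and supported in
  cubes.\<close>

lemma sparse_form_le:
  fixes b :: "real^'n \<Rightarrow> 'k::euclidean_space"
  assumes p: "1 < p" and m: "1 \<le> m" and \<mu>: "\<mu> \<in> Ap p" and lam: "lam \<in> Ap p" and b: "locally_integrable b"
    and \<beta>: "bmo_norm (\<lambda>x. (\<mu> x / lam x) powr (1 / (p * real m))) b = ennreal \<beta>" "0 \<le> \<beta>"
    and f: "bounded_compact_support f" and g: "bounded_compact_support g"
    and sp: "sparse (1 / (2 * 3 ^ CARD('n))) \<S>"
    and AB: "A = enn2real (Ap_char p \<mu>)" "B = enn2real (Ap_char p lam)"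
    and s: "1 < s" "2 ^ m * (cR (2 ^ CARD('n)) p * max A B powr (1 / (p - 1))) \<le> s"
    and t: "1 < t" "2 ^ m * (cR (2 ^ CARD('n)) (p / (p - 1)) * max A B) \<le> t"
    and Kp: "Kp = (A * B) powr ((real m + 1) / 2 * Ap_exp p) \<or>
       2 \<le> m \<and> Kp = A powr (real m / (p - 1)) * B powr Ap_exp p + A powr Ap_exp p * B ^ m"
  shows "sparse_form (s / (s - 1)) (ereal t) b m f g \<S>
    \<le> ennreal (comm_const CARD('n) p m * Kp * \<beta> ^ m) *
      (weighted_norm p \<mu> f * wnorm (p / (p - 1)) (dual_weight p (enn_weight lam)) (\<lambda>x. ennreal (norm (g x))))"
  unfolding sparse_form_def
proof (rule nn_integral_count_space_le)
  fix F assume F: "finite F" "F \<subseteq> \<S>"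
  define \<eta> :: real where "\<eta> = 1 / (2 * 3 ^ CARD('n))"
  have "(1::real) \<le> 3 ^ CARD('n)" by simp
  then have "(1::real) \<le> 2 * 3 ^ CARD('n)" by linarith
  then have \<eta>: "0 < \<eta>" "\<eta> \<le> 1" by (auto simp: \<eta>_def)
  obtain E where cub: "\<S> \<subseteq> cubes" and E: "\<And>Q. Q \<in> \<S> \<Longrightarrow> E Q \<subseteq> Q" "\<And>Q. Q \<in> \<S> \<Longrightarrow> E Q \<in> sets lebesgue"
      "\<And>Q. Q \<in> \<S> \<Longrightarrow> ennreal \<eta> * emeasure lebesgue Q \<le> emeasure lebesgue (E Q)" "disjoint_family_on E \<S>"
    using sp unfolding sparse_def \<eta>_def by blast
  have w: "weight \<mu>" "weight lam" using \<mu> lam by (auto simp: Ap_def)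
  note A = Ap_cube_Ap[OF \<mu> p, folded AB] and B = Ap_cube_Ap[OF lam p, folded AB]
  obtain Q1 c1 where f1: "Q1 \<in> cubes" "\<And>x. x \<notin> Q1 \<Longrightarrow> f x = 0" "\<And>x. ennreal (norm (f x)) \<le> ennreal c1"
    using bounded_compact_supportE[OF f] by blast
  obtain Q2 c2 where g1: "Q2 \<in> cubes" "\<And>x. x \<notin> Q2 \<Longrightarrow> g x = 0" "\<And>x. ennreal (norm (g x)) \<le> ennreal c2"
    using bounded_compact_supportE[OF g] by blast
  define c where "c = ennreal (max c1 c2)"
  have c: "ennreal (norm (f x)) \<le> c" "ennreal (norm (g x)) \<le> c" for x
    unfolding c_def by (rule order_trans[OF f1(3)], simp add: ennreal_leI) (rule order_trans[OF g1(3)], simp add: ennreal_leI)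
  have p': "1 < p / (p - 1)" using p by simp
  let ?f = "\<lambda>x. ennreal (norm (f x))" and ?g = "\<lambda>x. ennreal (norm (g x))"
  have fg: "?f \<in> borel_measurable lebesgue" "?g \<in> borel_measurable lebesgue"
    using f g by (auto simp: bounded_compact_support_def)
  have fin_f: "wnorm p (enn_weight \<mu>) ?f < top"
    using p f1(2) by (intro cube_Ap_wnorm_finite[OF p A(1) f1(1) _ f1(3)]) auto
  have fin_g: "wnorm (p / (p - 1)) (dual_weight p (enn_weight lam)) ?g < top"
    using p' g1(2) by (intro cube_Ap_wnorm_finite[OF p' cube_Ap_dual[OF B(1) p] g1(1) _ g1(3)]) auto
  have a1: "avg r Q (\<lambda>x. norm (b x - mean Q b) ^ m * norm (h x)) = rave r lebesgue Q (\<lambda>x. ennreal (norm (b x - mean Q b)) ^ m * ennreal (norm (h x)))"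
    and a2: "avg r Q (\<lambda>x. norm (h x)) = rave r lebesgue Q (\<lambda>x. ennreal (norm (h x)))"
    for r Q and h :: "real^'n \<Rightarrow> 'k"
    by (subst avg_rave; simp add: ennreal_mult ennreal_power)+
  have hc: "holder_conj (ereal t) = t / (t - 1)" by (simp add: holder_conj_def)
  define \<eta>' where "\<eta>' = 3 / 4 * (\<eta> / 6 ^ CARD('n))"
  define W where "W = wnorm p (enn_weight \<mu>) ?f * wnorm (p / (p - 1)) (dual_weight p (enn_weight lam)) ?g"
  define L where "L = (\<Sum>Q\<in>F. (rave (s / (s - 1)) lebesgue Q (\<lambda>x. ennreal (norm (b x - mean Q b)) ^ m * ?f x) * rave (t / (t - 1)) lebesgue Q ?g
       + rave (s / (s - 1)) lebesgue Q ?f * rave (t / (t - 1)) lebesgue Q (\<lambda>x. ennreal (norm (b x - mean Q b)) ^ m * ?g x)) * emeasure lebesgue Q)"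
  have E': "\<And>Q. Q \<in> F \<Longrightarrow> E Q \<in> sets lebesgue" "\<And>Q. Q \<in> F \<Longrightarrow> E Q \<subseteq> Q"
      "\<And>Q. Q \<in> F \<Longrightarrow> ennreal \<eta> * emeasure lebesgue Q \<le> emeasure lebesgue (E Q)" "disjoint_family_on E F" "F \<subseteq> cubes"
    using E(2)[OF subsetD[OF F(2)]] E(1)[OF subsetD[OF F(2)]] E(3)[OF subsetD[OF F(2)]] cub F(2) disjoint_family_on_mono[OF F(2) E(4)] by simp_all
  note full = cubes_full_form[OF F(1) E'(5) E'(1,2,3,4) \<eta> locally_integrable_measurable[OF b] locally_integrable_cubes[OF b] \<beta>(2)
      bmo_ave[OF p m \<mu> lam \<beta>(1)] p m A(1) B(1) fg c _ fin_f fin_g s t, folded \<eta>'_def W_def L_def]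
  have ctop: "c < top" by (simp add: c_def)
  have Kp0: "0 \<le> Kp" using Kp A(2) B(2) by auto
  have mono: "ennreal (X * Kp * \<beta> ^ m) * W \<le> ennreal (comm_const CARD('n) p m * Kp * \<beta> ^ m) * W" if "X \<le> comm_const CARD('n) p m" for X
    using that Kp0 \<beta>(2) by (intro mult_right_mono ennreal_leI) auto
  have "L \<le> ennreal (comm_const CARD('n) p m * Kp * \<beta> ^ m) * W"
    using Kp
  proof
    assume K: "Kp = (A * B) powr ((real m + 1) / 2 * Ap_exp p)"
    have "L \<le> ennreal (cT CARD('n) m \<eta> * (cK1 p m \<eta>' + cK1 (p / (p - 1)) m \<eta>') * Kp * \<beta> ^ m) * W"
      unfolding K by (rule full(1)) (use ctop in auto)
    also have "\<dots> \<le> ennreal (comm_const CARD('n) p m * Kp * \<beta> ^ m) * W"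
      unfolding \<eta>'_def \<eta>_def by (rule mono[OF comm_const_bounds(2)[OF p]])
    finally show ?thesis .
  next
    assume K: "2 \<le> m \<and> Kp = A powr (real m / (p - 1)) * B powr Ap_exp p + A powr Ap_exp p * B ^ m"
    have "L \<le> ennreal (cT CARD('n) m \<eta> * (cK2 p m \<eta>' + cK2 (p / (p - 1)) m \<eta>') * Kp * \<beta> ^ m) * W"
      unfolding K[THEN conjunct2] by (rule full(2)) (use ctop K in auto)
    also have "\<dots> \<le> ennreal (comm_const CARD('n) p m * Kp * \<beta> ^ m) * W"
      unfolding \<eta>'_def \<eta>_def by (rule mono[OF comm_const_bounds(3)[OF p]])
    finally show ?thesis .
  qed
  then show "(\<Sum>Q\<in>F. (avg (s / (s - 1)) Q (\<lambda>x. norm (b x - mean Q b) ^ m * norm (f x)) * avg (holder_conj (ereal t)) Q (\<lambda>x. norm (g x)) +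
           avg (s / (s - 1)) Q (\<lambda>x. norm (f x)) * avg (holder_conj (ereal t)) Q (\<lambda>x. norm (b x - mean Q b) ^ m * norm (g x))) * emeasure lebesgue Q)
     \<le> ennreal (comm_const CARD('n) p m * Kp * \<beta> ^ m) * (weighted_norm p \<mu> f * wnorm (p / (p - 1)) (dual_weight p (enn_weight lam)) ?g)"
    using p w unfolding a1 a2 hc L_def W_def by (simp only: weighted_norm_wnorm)
qed

text \<open>
  \<open>H\<close> is not assumed to be measurable, since the commutator need not be.  Its norm is a supremum
  over simple functions below, and the test functions are built from those.
\<close>

lemma wnorm_dual:
  fixes H :: "real^'n \<Rightarrow> 'k::{real_normed_field, euclidean_space}"
  assumes p: "1 < p" and w: "pos_weight w"
    and dual: "\<And>g::real^'n \<Rightarrow> 'k. bounded_compact_support g \<Longrightarrow>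
      (\<integral>\<^sup>+x. ennreal (norm (H x) * norm (g x)) \<partial>lebesgue) \<le> K * wnorm (p / (p - 1)) (dual_weight p w) (\<lambda>x. ennreal (norm (g x)))"
  shows "wnorm p w (\<lambda>x. ennreal (norm (H x))) \<le> K"
proof -
  have wm [measurable]: "w \<in> borel_measurable lebesgue" and w0: "\<And>x. 0 < w x \<and> w x < top" using w by (auto simp: pos_weight_def)
  define p' where "p' = p / (p - 1)"
  have p': "1 < p'" "(p - 1) * p' = p" "p' + - (1 / (p - 1)) = 1" "1 - 1 / p' = 1 / p"
  proof -
    show "1 < p'" "(p - 1) * p' = p" using p by (auto simp: p'_def)
    show "p' + - (1 / (p - 1)) = 1" using p by (simp add: p'_def flip: diff_divide_distrib)
    have "1 / p' = (p - 1) / p" by (simp add: p'_def)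
    then show "1 - 1 / p' = 1 / p" using p by (simp add: field_simps)
  qed
  have key: "(\<integral>\<^sup>+x. epowr (u x) p * w x \<partial>lebesgue) \<le> epowr K p"
    if u [measurable]: "u \<in> borel_measurable lebesgue" and uH: "\<And>x. u x \<le> ennreal (norm (H x))" for u
  proof -
    \<comment> \<open>Truncation in space, in the size of u and in the size of w makes the integral
      finite and the test function bounded with compact support.\<close>
    define S where "S N = {x \<in> cball 0 (real N). u x \<le> of_nat N \<and> w x \<le> of_nat N}" for N
    have S [measurable]: "S N \<in> sets lebesgue" for N
    proof -
      have e: "S N = cball 0 (real N) \<inter> {x\<in>space lebesgue. u x \<le> of_nat N} \<inter> {x\<in>space lebesgue. w x \<le> of_nat N}" by (auto simp: S_def)
      have "{x\<in>space lebesgue. u x \<le> of_nat N} \<in> sets lebesgue" "{x\<in>space lebesgue. w x \<le> of_nat N} \<in> sets lebesgue" by measurable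
      moreover have "cball 0 (real N) \<in> sets (lebesgue :: (real^'n) measure)" by simp
      ultimately show ?thesis unfolding e by (intro sets.Int)
    qed
    have S_inc: "S N \<subseteq> S M" if "N \<le> M" for N M
    proof
      fix x assume "x \<in> S N"
      moreover have "(of_nat N :: ennreal) \<le> of_nat M" using that by (rule of_nat_mono)
      ultimately show "x \<in> S M" using that unfolding S_def by (auto intro: order_trans)
    qed
    have S_ex: "\<exists>N. x \<in> S N" for x
    proof -
      have "u x < top" using uH[of x] by (rule order_le_less_trans) simp
      then obtain N1 where N1: "u x < of_nat N1" by (metis ennreal_Ex_less_of_nat infinity_ennreal_def less_top)
      obtain N2 where N2: "w x < of_nat N2" using w0[of x] by (metis ennreal_Ex_less_of_nat infinity_ennreal_def less_top)
      obtain N3 where N3: "norm x \<le> real N3" using real_arch_simple by blast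
      define N where "N = max N1 (max N2 N3)"
      have "(of_nat N1 :: ennreal) \<le> of_nat N" "(of_nat N2 :: ennreal) \<le> of_nat N" "real N3 \<le> real N"
        by (auto simp: N_def intro!: of_nat_mono)
      then have "x \<in> S N" unfolding S_def using N1 N2 N3 by (auto intro: order_trans less_imp_le)
      then show ?thesis ..
    qed
    define un where "un N x = u x * indicator (S N) x" for N x
    have [measurable]: "un N \<in> borel_measurable lebesgue" for N unfolding un_def by measurable
    have un_le: "un N x \<le> of_nat N" for N x by (auto simp: un_def S_def split: split_indicator)
    have un_w: "epowr (un N x) a * w x \<le> epowr (of_nat N) a * of_nat N" if "0 \<le> a" for N x a
      using epowr_mono[OF un_le that, of N x] by (cases "x \<in> S N") (auto simp: un_def S_def intro!: mult_mono)
    have bound: "(\<integral>\<^sup>+x. epowr (un N x) p * w x \<partial>lebesgue) \<le> epowr K p" for N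
    proof -
      let ?I = "\<integral>\<^sup>+x. epowr (un N x) p * w x \<partial>lebesgue"
      have "?I \<le> (\<integral>\<^sup>+x. epowr (of_nat N) p * of_nat N * indicator (cball 0 (real N) :: (real^'n) set) x \<partial>lebesgue)"
      proof (rule nn_integral_mono)
        fix x
        show "epowr (un N x) p * w x \<le> epowr (of_nat N) p * of_nat N * indicator (cball 0 (real N)) x"
        proof (cases "x \<in> S N")
          case True
          then have "x \<in> cball 0 (real N)" by (simp add: S_def)
          then show ?thesis using un_w[of p N x] p by simp
        qed (simp add: un_def)
      qed
      also have "\<dots> = epowr (of_nat N) p * of_nat N * emeasure lebesgue (cball 0 (real N) :: (real^'n) set)"
        by (rule nn_integral_cmult_indicator) simp
      also have "\<dots> < top"
      proof (intro ennreal_mult_less_top[THEN iffD2] disjI2 conjI)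
        show "emeasure lebesgue (cball 0 (real N) :: (real^'n) set) < top"
          using emeasure_bounded_finite[OF bounded_cball, of "0 :: real^'n" "real N"]
          by (simp add: emeasure_completion less_top)
      qed (auto simp: ennreal_mult_less_top less_top[symmetric])
      finally have fin: "?I < top" .
      define G where "G x = epowr (un N x) (p - 1) * w x" for x
      have [measurable]: "G \<in> borel_measurable lebesgue" unfolding G_def by measurable
      have Gt: "G x \<le> epowr (of_nat N) (p - 1) * of_nat N" for x unfolding G_def by (rule un_w) (use p in simp)
      have Nt: "epowr (of_nat N) (p - 1) * of_nat N < (top::ennreal)" by (simp add: ennreal_mult_eq_top_iff less_top[symmetric])
      have Gfin: "ennreal (enn2real (G x)) = G x" for x using order_le_less_trans[OF Gt Nt] by (intro ennreal_enn2real)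
      \<comment> \<open>The extremal function un^(p-1) w, embedded into the scalars; only its
        modulus enters the pairing.\<close>
      define g :: "real^'n \<Rightarrow> 'k" where "g x = of_real (enn2real (G x))" for x
      have ng: "ennreal (norm (g x)) = G x" for x by (simp add: g_def Gfin)
      have "bounded_compact_support g"
        unfolding bounded_compact_support_def
      proof (intro conjI)
        show "g \<in> borel_measurable lebesgue"
          unfolding g_def by measurable
        have "norm (g x) \<le> enn2real (epowr (of_nat N) (p - 1) * of_nat N)" for x
          using enn2real_mono[OF Gt Nt, of x] by (simp add: g_def)
        then show "bounded (range g)" unfolding bounded_iff by blast
        have "{x. g x \<noteq> 0} \<subseteq> cball 0 (real N)" by (auto simp: g_def G_def un_def S_def split: split_indicator)
        then show "compact (closure {x. g x \<noteq> 0})" unfolding compact_closure by (rule bounded_subset[OF bounded_cball])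
      qed
      from dual[OF this] have d: "(\<integral>\<^sup>+x. ennreal (norm (H x) * norm (g x)) \<partial>lebesgue) \<le> K * wnorm p' (dual_weight p w) G"
        unfolding ng p'_def by simp
      have "?I \<le> (\<integral>\<^sup>+x. ennreal (norm (H x) * norm (g x)) \<partial>lebesgue)"
      proof (rule nn_integral_mono)
        fix x
        have "epowr (un N x) p = un N x * epowr (un N x) (p - 1)" using epowr_add1[of "un N x" "p - 1"] by simp
        then have "epowr (un N x) p * w x = un N x * G x" by (simp add: G_def mult.assoc)
        also have "\<dots> \<le> ennreal (norm (H x)) * G x"
        proof (rule mult_right_mono)
          show "un N x \<le> ennreal (norm (H x))" using uH[of x] by (auto simp: un_def split: split_indicator)
        qed simp
        also have "\<dots> = ennreal (norm (H x) * norm (g x))" unfolding ng[symmetric] by (rule ennreal_mult[symmetric]) auto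
        finally show "epowr (un N x) p * w x \<le> ennreal (norm (H x) * norm (g x))" .
      qed
      also note d
      also have "wnorm p' (dual_weight p w) G = epowr ?I (1 / p')"
      proof -
        have "epowr (G x) p' * dual_weight p w x = epowr (un N x) p * w x" for x
        proof -
          have "epowr (G x) p' * dual_weight p w x = epowr (un N x) p * (epowr (w x) p' * epowr (w x) (- (1 / (p - 1))))"
            by (simp add: G_def epowr_mult epowr_epowr p'(2) dual_weight_def mult.assoc)
          then show ?thesis unfolding pos_weight_epowr_add[OF w] p'(3) by simp
        qed
        then show ?thesis by (simp add: wnorm_def)
      qed
      finally have "epowr ?I (1 - 1 / p') \<le> K" using p'(1) by (intro ennreal_self_improve[OF fin]) auto
      then have "?I \<le> epowr K (1 / (1 / p))" unfolding p'(4) using p by (intro epowr_le_cancel) auto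
      then show ?thesis by simp
    qed
    have inc: "incseq (\<lambda>N x. epowr (un N x) p * w x)"
    proof (intro incseq_SucI le_funI mult_right_mono epowr_mono)
      fix N x show "un N x \<le> un (Suc N) x" using S_inc[of N "Suc N"] by (auto simp: un_def split: split_indicator)
    qed (use p in auto)
    have sup: "epowr (u x) p * w x = (SUP N. epowr (un N x) p * w x)" for x
    proof (rule antisym)
      obtain N where "x \<in> S N" using S_ex by blast
      then show "epowr (u x) p * w x \<le> (SUP N. epowr (un N x) p * w x)" by (intro SUP_upper2[of N]) (auto simp: un_def)
      show "(SUP N. epowr (un N x) p * w x) \<le> epowr (u x) p * w x"
        using p by (intro SUP_least mult_right_mono epowr_mono) (auto simp: un_def split: split_indicator)
    qed
    have "(\<integral>\<^sup>+x. epowr (u x) p * w x \<partial>lebesgue) = (SUP N. \<integral>\<^sup>+x. epowr (un N x) p * w x \<partial>lebesgue)"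
      unfolding sup using inc by (rule nn_integral_monotone_convergence_SUP) measurable
    also have "\<dots> \<le> epowr K p" by (rule SUP_least) (rule bound)
    finally show ?thesis .
  qed
  have "(\<integral>\<^sup>+x. epowr (ennreal (norm (H x))) p * w x \<partial>lebesgue) \<le> epowr K p"
    unfolding nn_integral_def
  proof (rule SUP_least)
    fix k assume "k \<in> {g. simple_function lebesgue g \<and> g \<le> (\<lambda>x. epowr (ennreal (norm (H x))) p * w x)}"
    then have k: "simple_function lebesgue k" "\<And>x. k x \<le> epowr (ennreal (norm (H x))) p * w x" by (auto simp: le_fun_def)
    have km [measurable]: "k \<in> borel_measurable lebesgue" by (rule borel_measurable_simple_function[OF k(1)])
    have ww: "epowr (w x) (-1) * w x = 1" for x
      using pos_weight_epowr_add[OF w, of x "-1" 1] pos_weight_epowr_0[OF w, of x] by simp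
    \<comment> \<open>Removes the weight and the power, so that a simple function below the
      integrand yields a measurable minorant of |H|, to which \<open>key\<close> applies.\<close>
    define u where "u x = epowr (k x * epowr (w x) (-1)) (1 / p)" for x
    have "epowr (u x) p * w x = k x" for x
      using p ww[of x] by (simp add: u_def epowr_epowr mult.assoc)
    moreover have "u x \<le> ennreal (norm (H x))" for x
    proof -
      have "k x * epowr (w x) (-1) \<le> epowr (ennreal (norm (H x))) p * w x * epowr (w x) (-1)"
        using k(2)[of x] by (rule mult_right_mono) simp
      also have "\<dots> = epowr (ennreal (norm (H x))) p" by (simp only: mult.assoc mult.commute[of "w x"] ww mult_1_right)
      finally have "u x \<le> epowr (epowr (ennreal (norm (H x))) p) (1 / p)" unfolding u_def using p by (intro epowr_mono) auto
      then show ?thesis using p by (simp add: epowr_epowr)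
    qed
    moreover have "u \<in> borel_measurable lebesgue" unfolding u_def by measurable
    ultimately have "(\<integral>\<^sup>+x. k x \<partial>lebesgue) \<le> epowr K p" using key[of u] by simp
    then show "integral\<^sup>S lebesgue k \<le> epowr K p" by (simp only: nn_integral_eq_simple_integral[OF k(1)])
  qed
  then have "wnorm p w (\<lambda>x. ennreal (norm (H x))) \<le> epowr (epowr K p) (1 / p)"
    unfolding wnorm_def using p by (intro epowr_mono) auto
  then show ?thesis using p by (simp add: epowr_epowr)
qed

text \<open>The domination principle is applied with r = s / (s - 1) and the upper exponent t, where
  s and t are exactly the arguments of \<psi> in the bound. The summand 3 in c gives s, t \<ge> 3,
  hence 1 < r < 2 < t; the other summands of c meet the thresholds of
  \<open>sparse_form_le\<close>.\<close>

lemma commutator_op_norm: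
  fixes T :: "(real^'n \<Rightarrow> 'k::{real_normed_field, euclidean_space}) \<Rightarrow> real^'n \<Rightarrow> 'k" and \<psi> :: "real \<Rightarrow> real \<Rightarrow> real"
  assumes p: "1 < p" and m: "1 \<le> m"
    and dom: "sparse_domination_constants TYPE('n) TYPE('k) m C l"
    and T: "sublinear_operator D T" and D: "\<And>r. 1 < r \<Longrightarrow> r < 2 \<Longrightarrow> local_Lr r \<subseteq> D" "commutator_args b m \<subseteq> D"
    and b: "locally_integrable b"
    and \<psi>1: "\<And>x y. 1 \<le> x \<Longrightarrow> 1 \<le> y \<Longrightarrow> 1 \<le> \<psi> x y"
    and weak: "\<And>r s. 1 < r \<Longrightarrow> r < 2 \<Longrightarrow> 2 < s \<Longrightarrow>
         locally_weak_bounded r (\<phi>T r) (abs_op T) \<and>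
         locally_weak_bounded r (\<phi>M s r) (sharp_maximal T (ereal s)) \<and>
         \<phi>T r l + \<phi>M s r l \<le> \<psi> (holder_conj (ereal r)) s"
    and \<mu>: "\<mu> \<in> Ap p" and lam: "lam \<in> Ap p"
    and AB: "A = enn2real (Ap_char p \<mu>)" "B = enn2real (Ap_char p lam)"
    and Kp: "Kp = (A * B) powr ((real m + 1) / 2 * Ap_exp p) \<or>
       2 \<le> m \<and> Kp = A powr (real m / (p - 1)) * B powr Ap_exp p + A powr Ap_exp p * B ^ m"
  defines "c \<equiv> 3 + 2 ^ m * (cR (2 ^ CARD('n)) p + cR (2 ^ CARD('n)) (p / (p - 1)))"
  shows "op_norm p \<mu> lam (commutator T b m)
    \<le> ennreal ((C * comm_const CARD('n) p m + 1) * Kp * \<psi> (c * max A B powr (1 / (p - 1))) (c * max A B)) *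
       bmo_norm (\<lambda>x. (\<mu> x / lam x) powr (1 / (p * real m))) b ^ m"
proof -
  let ?bmo = "bmo_norm (\<lambda>x. (\<mu> x / lam x) powr (1 / (p * real m))) b"
  have p': "1 < p / (p - 1)" using p by simp
  have w: "weight \<mu>" "weight lam" using \<mu> lam by (auto simp: Ap_def)
  have A1: "1 \<le> A" "1 \<le> B" using Ap_cube_Ap(2)[OF \<mu> p] Ap_cube_Ap(2)[OF lam p] by (simp_all add: AB)
  define s where "s = c * max A B powr (1 / (p - 1))"
  define t where "t = c * max A B"
  define r where "r = s / (s - 1)"
  have C: "1 < C" using dom by (simp add: sparse_domination_constants_def)
  have cR0: "0 \<le> cR (2 ^ CARD('n)) p" "0 \<le> cR (2 ^ CARD('n)) (p / (p - 1))" using qp[OF p] qp[OF p'] p p' by (auto simp: cR_def)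
  have c: "3 \<le> c" "2 ^ m * cR (2 ^ CARD('n)) p \<le> c" "2 ^ m * cR (2 ^ CARD('n)) (p / (p - 1)) \<le> c"
    using cR0 by (auto simp: c_def distrib_left)
  have mx: "1 \<le> max A B" "1 \<le> max A B powr (1 / (p - 1))" using A1 p by (auto intro!: ge_one_powr_ge_zero)
  have s: "3 \<le> s" "2 ^ m * (cR (2 ^ CARD('n)) p * max A B powr (1 / (p - 1))) \<le> s"
    using mult_mono[OF c(1) mx(2)] c mx(2) mult_right_mono[OF c(2), of "max A B powr (1 / (p - 1))"] by (auto simp: s_def mult.assoc)
  have t: "3 \<le> t" "2 ^ m * (cR (2 ^ CARD('n)) (p / (p - 1)) * max A B) \<le> t"
    using mult_mono[OF c(1) mx(1)] c mx(1) mult_right_mono[OF c(3), of "max A B"] by (auto simp: t_def mult.assoc)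
  have r: "1 < r" "r < 2" using s(1) by (auto simp: r_def divide_less_eq)
  have "s / (s - 1) - 1 = 1 / (s - 1)" using s(1) by (simp add: field_simps)
  then have hr: "holder_conj (ereal r) = s" using s(1) by (simp add: holder_conj_def r_def)
  define \<Psi> where "\<Psi> = \<psi> s t"
  have \<Psi>: "1 \<le> \<Psi>" unfolding \<Psi>_def using s(1) t(1) by (intro \<psi>1) auto
  have Kp1: "0 < Kp"
    using Kp
  proof
    assume "2 \<le> m \<and> Kp = A powr (real m / (p - 1)) * B powr Ap_exp p + A powr Ap_exp p * B ^ m"
    then show ?thesis using A1 by (auto intro!: add_pos_pos mult_pos_pos)
  qed (use A1 in simp)
  define c0 where "c0 = comm_const CARD('n) p m"
  have c0: "0 \<le> c0" unfolding c0_def by (rule comm_const_bounds(1)[OF p])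
  \<comment> \<open>The summand 1 keeps the constant positive. An infinite BMO norm then makes the
    right side infinite, and not 0 through a product of 0 and \<open>top\<close>.\<close>
  have K0: "0 < (C * c0 + 1) * Kp * \<Psi>" using C c0 Kp1 \<Psi> by (intro mult_pos_pos add_nonneg_pos) auto
  show ?thesis
  proof (cases "?bmo = top")
    case True
    then have "?bmo ^ m = top" using m by (simp add: power_eq_top_ennreal)
    moreover have "ennreal ((C * c0 + 1) * Kp * \<Psi>) \<noteq> 0" using K0 by (simp only: ennreal_eq_0_iff not_le)
    ultimately have "ennreal ((C * c0 + 1) * Kp * \<Psi>) * ?bmo ^ m = top" by (simp only: ennreal_mult_top if_False)
    then show ?thesis unfolding s_def t_def \<Psi>_def c0_def by (simp only: top_greatest)
  next
    case False
    define \<beta> where "\<beta> = enn2real ?bmo"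
    have \<beta>: "?bmo = ennreal \<beta>" "0 \<le> \<beta>" using False by (auto simp: \<beta>_def less_top)
    have main: "weighted_norm p lam (commutator T b m f) \<le> ennreal ((C * c0 + 1) * Kp * \<Psi> * \<beta> ^ m) * weighted_norm p \<mu> f"
      if f: "bounded_compact_support f" for f
      unfolding weighted_norm_wnorm[OF w(2) order.strict_trans[OF zero_less_one p]]
    proof (rule wnorm_dual[OF p pos_weight_enn_weight[OF weight_measurable[OF w(2)]]])
      fix g :: "real^'n \<Rightarrow> 'k" assume g: "bounded_compact_support g"
      let ?ng = "wnorm (p / (p - 1)) (dual_weight p (enn_weight lam)) (\<lambda>x. ennreal (norm (g x)))"
      have wk: "locally_weak_bounded r (\<phi>T r) (abs_op T)" "locally_weak_bounded r (\<phi>M t r) (sharp_maximal T (ereal t))"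
        "\<phi>T r l + \<phi>M t r l \<le> \<Psi>"
        using weak[OF r, of t] t(1) unfolding hr \<Psi>_def by auto
      have rt: "1 \<le> r" "ereal r < ereal t" using r t(1) by auto
      obtain \<S> where sp: "sparse (1 / (2 * 3 ^ CARD('n))) \<S>"
        and or: "sparse_form r (ereal t) b m f g \<S> = \<infinity> \<or>
            (\<integral>\<^sup>+x. ennreal (norm (commutator T b m f x) * norm (g x)) \<partial>lebesgue)
              \<le> ennreal (C * (\<phi>T r l + \<phi>M t r l)) * sparse_form r (ereal t) b m f g \<S>"
        using dom[unfolded sparse_domination_constants_def, THEN conjunct2, THEN conjunct2, THEN conjunct2, rule_format,
            of r "ereal t" D T b "\<phi>T r" "\<phi>M t r" f g] rt T D(1)[OF r] D(2) wk b f g by blast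
      have sf: "sparse_form r (ereal t) b m f g \<S> \<le> ennreal (c0 * Kp * \<beta> ^ m) * (weighted_norm p \<mu> f * ?ng)"
        unfolding r_def c0_def using s t
        by (intro sparse_form_le[OF p m \<mu> lam b \<beta> f g sp AB _ s(2) _ t(2) Kp]) auto
      have "weighted_norm p \<mu> f < top"
      proof -
        obtain Q c1 where f1: "Q \<in> cubes" "\<And>x. x \<notin> Q \<Longrightarrow> f x = 0" "\<And>x. ennreal (norm (f x)) \<le> ennreal c1"
          using bounded_compact_supportE[OF f] by blast
        show ?thesis unfolding weighted_norm_wnorm[OF w(1) order.strict_trans[OF zero_less_one p]]
          using p f1(2) by (intro cube_Ap_wnorm_finite[OF p Ap_cube_Ap(1)[OF \<mu> p] f1(1) _ f1(3)]) auto
      qed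
      moreover have "?ng < top"
      proof -
        obtain Q c1 where g1: "Q \<in> cubes" "\<And>x. x \<notin> Q \<Longrightarrow> g x = 0" "\<And>x. ennreal (norm (g x)) \<le> ennreal c1"
          using bounded_compact_supportE[OF g] by blast
        show ?thesis
          using p' g1(2) by (intro cube_Ap_wnorm_finite[OF p' cube_Ap_dual[OF Ap_cube_Ap(1)[OF lam p] p] g1(1) _ g1(3)]) auto
      qed
      ultimately have "ennreal (c0 * Kp * \<beta> ^ m) * (weighted_norm p \<mu> f * ?ng) < top" by (simp add: ennreal_mult_less_top)
      \<comment> \<open>The finite weighted norms of f and g exclude the alternative in which the
        domination principle says nothing.\<close>
      then have "sparse_form r (ereal t) b m f g \<S> \<noteq> \<infinity>" using sf by auto
      then have "(\<integral>\<^sup>+x. ennreal (norm (commutator T b m f x) * norm (g x)) \<partial>lebesgue)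
          \<le> ennreal (C * (\<phi>T r l + \<phi>M t r l)) * sparse_form r (ereal t) b m f g \<S>" using or by blast
      also have "\<dots> \<le> ennreal (C * \<Psi>) * (ennreal (c0 * Kp * \<beta> ^ m) * (weighted_norm p \<mu> f * ?ng))"
        using wk(3) C by (intro mult_mono ennreal_leI mult_left_mono sf) auto
      also have "\<dots> = ennreal (C * \<Psi> * (c0 * Kp * \<beta> ^ m)) * (weighted_norm p \<mu> f * ?ng)"
        using C \<Psi> c0 Kp1 \<beta>(2) by (subst ennreal_mult) (auto simp: mult.assoc)
      also have "\<dots> \<le> ennreal ((C * c0 + 1) * Kp * \<Psi> * \<beta> ^ m) * (weighted_norm p \<mu> f * ?ng)"
      proof (intro mult_right_mono ennreal_leI)
        have "C * \<Psi> * (c0 * Kp * \<beta> ^ m) = C * c0 * (Kp * \<Psi> * \<beta> ^ m)" by (simp only: mult_ac)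
        also have "\<dots> \<le> (C * c0 + 1) * (Kp * \<Psi> * \<beta> ^ m)"
          using Kp1 \<Psi> \<beta>(2) by (intro mult_right_mono mult_nonneg_nonneg zero_le_power) auto
        finally show "C * \<Psi> * (c0 * Kp * \<beta> ^ m) \<le> (C * c0 + 1) * Kp * \<Psi> * \<beta> ^ m" by (simp only: mult.assoc)
      qed simp
      finally show "(\<integral>\<^sup>+x. ennreal (norm (commutator T b m f x) * norm (g x)) \<partial>lebesgue)
         \<le> ennreal ((C * c0 + 1) * Kp * \<Psi> * \<beta> ^ m) * weighted_norm p \<mu> f * ?ng" by (simp only: mult.assoc)
    qed
    have nn: "0 \<le> (C * c0 + 1) * Kp * \<Psi> * \<beta> ^ m" by (intro mult_nonneg_nonneg zero_le_power less_imp_le[OF K0] \<beta>(2))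
    have "op_norm p \<mu> lam (commutator T b m) \<le> ennreal ((C * c0 + 1) * Kp * \<Psi> * \<beta> ^ m)"
      unfolding op_norm_def using main nn by (intro Inf_lower) blast
    also have "\<dots> = ennreal ((C * c0 + 1) * Kp * \<Psi>) * ?bmo ^ m"
      unfolding \<beta>(1) using K0 \<beta>(2) by (simp only: ennreal_power) (rule ennreal_mult, auto)
    finally show ?thesis by (simp only: s_def t_def \<Psi>_def c0_def)
  qed
qed

theorem theorem6p2:
  fixes p C l :: real and m :: nat
  assumes "1 < p" and "1 \<le> m"
    and "sparse_domination_constants TYPE('n::finite) TYPE('k::{real_normed_field, euclidean_space}) m C l"
  shows "\<exists>K > 0. \<exists>c \<ge> 1.
    \<forall>(D :: (real^'n \<Rightarrow> 'k) set) (T :: (real^'n \<Rightarrow> 'k) \<Rightarrow> real^'n \<Rightarrow> 'k) (b :: real^'n \<Rightarrow> 'k)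
      (\<psi> :: real \<Rightarrow> real \<Rightarrow> real) (\<phi>T :: real \<Rightarrow> real \<Rightarrow> real) (\<phi>M :: real \<Rightarrow> real \<Rightarrow> real \<Rightarrow> real)
      (\<mu> :: real^'n \<Rightarrow> real) (lam :: real^'n \<Rightarrow> real).
      sublinear_operator D T \<and>
      (\<forall>r. 1 < r \<and> r < 2 \<longrightarrow> local_Lr r \<subseteq> D) \<and> commutator_args b m \<subseteq> D \<and>
      locally_integrable b \<and>
      (\<forall>x\<ge>1. \<forall>y\<ge>1. 1 \<le> \<psi> x y) \<and>
      (\<forall>x x' y y'. 1 \<le> x \<and> x \<le> x' \<and> 1 \<le> y \<and> y \<le> y' \<longrightarrow> \<psi> x y \<le> \<psi> x' y') \<and>
      (\<forall>r s. 1 < r \<and> r < 2 \<and> 2 < s \<longrightarrow>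
         locally_weak_bounded r (\<phi>T r) (abs_op T) \<and>
         locally_weak_bounded r (\<phi>M s r) (sharp_maximal T (ereal s)) \<and>
         \<phi>T r l + \<phi>M s r l \<le> \<psi> (holder_conj (ereal r)) s) \<and>
      \<mu> \<in> Ap p \<and> lam \<in> Ap p \<longrightarrow>
      (let \<nu> = (\<lambda>x. (\<mu> x / lam x) powr (1 / (p * real m)));
           A = enn2real (Ap_char p \<mu>);
           B = enn2real (Ap_char p lam);
           e = max 1 (1 / (p - 1));
           C\<psi> = \<psi> (c * max A B powr (1 / (p - 1))) (c * max A B);
           bound = (\<lambda>Kp. op_norm p \<mu> lam (commutator T b m)
                           \<le> ennreal (K * Kp * C\<psi>) * bmo_norm \<nu> b ^ m)
       in bound ((A * B) powr ((real m + 1) / 2 * e)) \<and>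
          (2 \<le> m \<longrightarrow>
             bound (A powr (real m / (p - 1)) * B powr e + A powr e * B ^ m)))"
proof -
  \<comment> \<open>K and c involve only p, n, m and the constant C of the domination principle, so
    they can be fixed before the operator, b, \<psi> and the weights.\<close>
  define K where "K = C * comm_const CARD('n) p m + 1"
  define c where "c = 3 + 2 ^ m * (cR (2 ^ CARD('n)) p + cR (2 ^ CARD('n)) (p / (p - 1)))"
  have p': "1 < p / (p - 1)" using assms(1) by simp
  have "0 \<le> cR (2 ^ CARD('n)) p" "0 \<le> cR (2 ^ CARD('n)) (p / (p - 1))"
    using qp[OF assms(1)] qp[OF p'] assms(1) p' by (auto simp: cR_def)
  then have "0 \<le> 2 ^ m * (cR (2 ^ CARD('n)) p + cR (2 ^ CARD('n)) (p / (p - 1)))" by (intro mult_nonneg_nonneg) auto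
  then have c: "1 \<le> c" by (simp add: c_def)
  have "1 < C" using assms(3) by (simp add: sparse_domination_constants_def)
  then have K: "0 < K" unfolding K_def using comm_const_bounds(1)[OF assms(1)] by (intro add_nonneg_pos mult_nonneg_nonneg) auto
  show ?thesis
  proof (rule exI[of _ K], rule conjI[OF K], rule exI[of _ c], rule conjI[OF c], intro allI impI)
    fix D :: "(real^'n \<Rightarrow> 'k) set" and T :: "(real^'n \<Rightarrow> 'k) \<Rightarrow> real^'n \<Rightarrow> 'k" and b :: "real^'n \<Rightarrow> 'k"
      and \<psi> :: "real \<Rightarrow> real \<Rightarrow> real" and \<phi>T :: "real \<Rightarrow> real \<Rightarrow> real" and \<phi>M :: "real \<Rightarrow> real \<Rightarrow> real \<Rightarrow> real"
      and \<mu> lam :: "real^'n \<Rightarrow> real"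
    assume H: "sublinear_operator D T \<and>
      (\<forall>r. 1 < r \<and> r < 2 \<longrightarrow> local_Lr r \<subseteq> D) \<and> commutator_args b m \<subseteq> D \<and>
      locally_integrable b \<and>
      (\<forall>x\<ge>1. \<forall>y\<ge>1. 1 \<le> \<psi> x y) \<and>
      (\<forall>x x' y y'. 1 \<le> x \<and> x \<le> x' \<and> 1 \<le> y \<and> y \<le> y' \<longrightarrow> \<psi> x y \<le> \<psi> x' y') \<and>
      (\<forall>r s. 1 < r \<and> r < 2 \<and> 2 < s \<longrightarrow>
         locally_weak_bounded r (\<phi>T r) (abs_op T) \<and>
         locally_weak_bounded r (\<phi>M s r) (sharp_maximal T (ereal s)) \<and>
         \<phi>T r l + \<phi>M s r l \<le> \<psi> (holder_conj (ereal r)) s) \<and>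
      \<mu> \<in> Ap p \<and> lam \<in> Ap p"
    have "op_norm p \<mu> lam (commutator T b m)
      \<le> ennreal (K * Kp * \<psi> (c * max (enn2real (Ap_char p \<mu>)) (enn2real (Ap_char p lam)) powr (1 / (p - 1)))
          (c * max (enn2real (Ap_char p \<mu>)) (enn2real (Ap_char p lam)))) *
        bmo_norm (\<lambda>x. (\<mu> x / lam x) powr (1 / (p * real m))) b ^ m"
      if "Kp = (enn2real (Ap_char p \<mu>) * enn2real (Ap_char p lam)) powr ((real m + 1) / 2 * Ap_exp p) \<or>
        2 \<le> m \<and> Kp = enn2real (Ap_char p \<mu>) powr (real m / (p - 1)) * enn2real (Ap_char p lam) powr Ap_exp p
          + enn2real (Ap_char p \<mu>) powr Ap_exp p * enn2real (Ap_char p lam) ^ m" for Kp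
      unfolding K_def c_def
      by (rule commutator_op_norm[OF assms, where D=D and \<phi>T=\<phi>T and \<phi>M=\<phi>M]) (use H that in blast)+
    then show "let \<nu> = (\<lambda>x. (\<mu> x / lam x) powr (1 / (p * real m)));
           A = enn2real (Ap_char p \<mu>);
           B = enn2real (Ap_char p lam);
           e = max 1 (1 / (p - 1));
           C\<psi> = \<psi> (c * max A B powr (1 / (p - 1))) (c * max A B);
           bound = (\<lambda>Kp. op_norm p \<mu> lam (commutator T b m)
                           \<le> ennreal (K * Kp * C\<psi>) * bmo_norm \<nu> b ^ m)
       in bound ((A * B) powr ((real m + 1) / 2 * e)) \<and>
          (2 \<le> m \<longrightarrow>
             bound (A powr (real m / (p - 1)) * B powr e + A powr e * B ^ m))"
      unfolding Let_def Ap_exp_def[symmetric] by blast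
  qed
qed

end
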